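(* Let $\mathcal T=(T,E)$ be a $d$-regular tree (every vertex has exactly $d$ neighbours) with $d\ge3$ and root $\phi$, endowed with constant conductances $W>0$ such that, under $\nu_T^W(d\beta)$, $\mathbb P[\forall i\in T,\ \psi(i)>0]=1$. Then for all integers $m,m'\ge0$ with $m\ne m'$ and all $i_0\in T$, the distribution of the jump rates $\big(\frac12W_{i,j}\frac{G_m(i_0,j)}{G_m(i_0,i)}\big)_{i\sim j}$ under $\nu_{T,B_m}^W(d\beta,d\rho_m)$ and the distribution of the jump rates $\big(\frac12W_{i,j}\frac{G_{m'}(i_0,j)}{G_{m'}(i_0,i)}\big)_{i\sim j}$ under $\nu_{T,B_{m'}}^W(d\beta,d\rho_{m'})$ are different.
   Context: Potential: $i\sim j$ means $\{i,j\}\in E$; $W_{i,j}=W$ if $i\sim j$, $0$ otherwise. For $\beta\in\mathbb R^T$, $H_\beta=2\beta-W$, i.e. $(H_\beta f)(i)=2\beta_if(i)-\sum_{j\sim i}W_{i,j}f(j)$. For finite $U$, a symmetric nonnegative matrix $W$ on $U$ with zero diagonal and $\eta\in\mathbb R_+^U$, $\nu_U^{W,\eta}$ is the probability measure on $\mathcal D_U^W=\{\beta\in\mathbb R^U: H_\beta=2\beta-W\text{ positive definite}\}$ $$\nu_U^{W,\eta}(d\beta)=\Big(\tfrac2\pi\Big)^{|U|/2}e^{-\frac12(\langle\mathbf 1,H_\beta\mathbf 1\rangle+\langle\eta,H_\beta^{-1}\eta\rangle)}e^{\langle\eta,\mathbf 1\rangle}\frac{\prod_{i\in U}d\beta_i}{\sqrt{\det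 H_\beta}},\qquad \nu_U^W=\nu_U^{W,0}.$$ $\mathcal D_T^W=\{\beta\in\mathbb R^T:(H_\beta)_{U,U}>0\text{ for all finite }U\}$ and $\nu_T^W$ is the unique probability on $\mathcal D_T^W$ such that $\beta_U\sim\nu_U^{W_{U,U},\eta}$, $\eta=W_{U,U^c}\mathbf 1_{U^c}$, for each finite $U\subset T$. Tree notation: $|x|$ is the distance from $\phi$ to $x$; $x\wedge y$ is the closest common ancestor; $D^{(n)}=\{x:|x|=n\}$, $T^{(n)}=\{x:|x|\le n\}$. $\Omega$ is the set of ends (infinite self-avoiding paths from $\phi$) with the end topology, $\Omega_x$ the set of rays passing through $x$. $B_m=\{\delta_x:x\in D^{(m)}\}$ is a set of $|D^{(m)}|$ abstract boundary points. Functions of $\beta$: $\hat G^{(n)}=((H_\beta)_{T^{(n)},T^{(n)}})^{-1}$; $\psi^{(n)}$ is defined by $(H_\beta\psi^{(n)})_{T^{(n)}}=0$, $\psi^{(n)}=1$ off $T^{(n)}$. Under $\nu_T^W$, a.s. $\hat G^{(n)}(i,j)\to\hat G(i,j)<\infty$ and $\psi^{(n)}(i)\to\psi(i)$ for all $i,j\in T$. When $\psi>0$, the reversible random walk with conductances $W_{i,j}\psi(i)\psi(j)$ is a.s. transient and $\mu^\psi_y$ denotes the law on $\Omega$ of the end to which it converges when started at $y$. Set $\chi(y,\cdot)=\psi(y)\mu^\psi_y(\cdot)$. Representations: for $m\ge0$, $\check C_m$ is the matrix indexed by $B_m$ with $(\check C_m)_{\delta_x,\delta_x}=0$ and $(\check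 C_m)_{\delta_x,\delta_{x'}}=\frac{\chi(x\wedge x',\Omega_x)\chi(x\wedge x',\Omega_{x'})}{\hat G(x\wedge x',x\wedge x')}$ for $x\ne x'$; $\nu_{T,B_m}^W(d\beta,d\rho_m)=\nu_T^W(d\beta)\nu_{B_m}^{\check C_m}(d\rho_m)$; $\check G_m=(2\rho_m-\check C_m)^{-1}$; $\check g_m(\omega,\tau)=\check G_m(\delta_x,\delta_{x'})$ for $\omega\in\Omega_x,\tau\in\Omega_{x'}$, $x,x'\in D^{(m)}$; and $G_m(i,j)=\hat G(i,j)+\int_{\Omega^2}\chi(i,d\omega)\chi(j,d\tau)\check g_m(\omega,\tau)$ for $i,j\in T$. *)

theory Defs
  imports "HOL-Probability.Probability" "HOL-Combinatorics.Permutations"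
begin

section \<open>Matrices indexed by a finite subset of a type\<close>

definition posdef_on :: "'a set \<Rightarrow> ('a \<Rightarrow> 'a \<Rightarrow> real) \<Rightarrow> bool" where
  "posdef_on U A \<longleftrightarrow>
     (\<forall>f. (\<exists>i\<in>U. f i \<noteq> 0) \<longrightarrow> 0 < (\<Sum>i\<in>U. \<Sum>j\<in>U. f i * A i j * f j))"

definition det_on :: "'a set \<Rightarrow> ('a \<Rightarrow> 'a \<Rightarrow> real) \<Rightarrow> real" where
  "det_on U A = (\<Sum>p | p permutes U. of_int (sign p) * (\<Prod>i\<in>U. A i (p i)))"

text \<open>The inverse of the \<open>U \<times> U\<close> block of \<open>A\<close>, extended by zero.\<close>

definition inv_on :: "'a set \<Rightarrow> ('a \<Rightarrow> 'a \<Rightarrow> real) \<Rightarrow> 'a \<Rightarrow> 'a \<Rightarrow> real" where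
  "inv_on U A = (THE B.
     (\<forall>i\<in>U. \<forall>j\<in>U. (\<Sum>k\<in>U. A i k * B k j) = (if i = j then 1 else 0) \<and>
                   (\<Sum>k\<in>U. B i k * A k j) = (if i = j then 1 else 0)) \<and>
     (\<forall>i j. i \<notin> U \<or> j \<notin> U \<longrightarrow> B i j = 0))"


section \<open>The random Schroedinger potential\<close>

definition Hmat :: "('a \<Rightarrow> 'a \<Rightarrow> real) \<Rightarrow> ('a \<Rightarrow> real) \<Rightarrow> 'a \<Rightarrow> 'a \<Rightarrow> real" where
  "Hmat W \<beta> i j = (if i = j then 2 * \<beta> i else 0) - W i j"

definition dom_fin :: "'a set \<Rightarrow> ('a \<Rightarrow> 'a \<Rightarrow> real) \<Rightarrow> ('a \<Rightarrow> real) set" where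
  "dom_fin U W = {\<beta>. posdef_on U (Hmat W \<beta>)}"

definition nu_fin :: "'a set \<Rightarrow> ('a \<Rightarrow> 'a \<Rightarrow> real) \<Rightarrow> ('a \<Rightarrow> real) \<Rightarrow> ('a \<Rightarrow> real) measure" where
  "nu_fin U W \<eta> = density (PiM U (\<lambda>_. lborel)) (\<lambda>\<beta>. ennreal
     (indicator (dom_fin U W) \<beta> * (2 / pi) powr (real (card U) / 2)
      * exp (- (1/2) * ((\<Sum>i\<in>U. \<Sum>j\<in>U. Hmat W \<beta> i j)
                        + (\<Sum>i\<in>U. \<Sum>j\<in>U. \<eta> i * inv_on U (Hmat W \<beta>) i j * \<eta> j)))
      * exp (\<Sum>i\<in>U. \<eta> i) / sqrt (det_on U (Hmat W \<beta>))))"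

definition dom_inf :: "'a set \<Rightarrow> ('a \<Rightarrow> 'a \<Rightarrow> real) \<Rightarrow> ('a \<Rightarrow> real) set" where
  "dom_inf T W = {\<beta>. \<forall>U. finite U \<longrightarrow> U \<subseteq> T \<longrightarrow> posdef_on U (Hmat W \<beta>)}"

definition nu_inf :: "'a set \<Rightarrow> ('a \<Rightarrow> 'a \<Rightarrow> real) \<Rightarrow> ('a \<Rightarrow> real) measure" where
  "nu_inf T W = (THE M. prob_space M \<and> sets M = sets (PiM T (\<lambda>_. borel)) \<and>
     (AE \<beta> in M. \<beta> \<in> dom_inf T W) \<and>
     (\<forall>U. finite U \<longrightarrow> U \<subseteq> T \<longrightarrow>
        distr M (PiM U (\<lambda>_. borel)) (\<lambda>\<beta>. restrict \<beta> U)
          = nu_fin U W (\<lambda>i. \<Sum>\<^sub>\<infinity>j\<in>T - U. W i j)))"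


section \<open>Trees\<close>

definition is_tree :: "'v set \<Rightarrow> 'v set set \<Rightarrow> bool" where
  "is_tree T E \<longleftrightarrow>
     E \<subseteq> {{x, y} | x y. x \<in> T \<and> y \<in> T \<and> x \<noteq> y} \<and>
     (\<forall>x\<in>T. \<forall>y\<in>T. (x, y) \<in> {(u, v). {u, v} \<in> E}\<^sup>*) \<and>
     (\<nexists>xs. 3 \<le> length xs \<and> distinct xs \<and> successively (\<lambda>u v. {u, v} \<in> E) xs \<and>
           {last xs, hd xs} \<in> E)"

definition regular :: "'v set \<Rightarrow> 'v set set \<Rightarrow> nat \<Rightarrow> bool" where
  "regular T E d \<longleftrightarrow> (\<forall>x\<in>T. finite {y. {x, y} \<in> E} \<and> card {y. {x, y} \<in> E} = d)"

definition gdist :: "'v set set \<Rightarrow> 'v \<Rightarrow> 'v \<Rightarrow> nat" where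
  "gdist E x y = (LEAST n. (x, y) \<in> {(u, v). {u, v} \<in> E} ^^ n)"

definition level :: "'v set \<Rightarrow> 'v set set \<Rightarrow> 'v \<Rightarrow> nat \<Rightarrow> 'v set" where
  "level T E r n = {x \<in> T. gdist E r x = n}"

definition tball :: "'v set \<Rightarrow> 'v set set \<Rightarrow> 'v \<Rightarrow> nat \<Rightarrow> 'v set" where
  "tball T E r n = {x \<in> T. gdist E r x \<le> n}"

text \<open>\<open>z\<close> is an ancestor of \<open>x\<close> (possibly \<open>x\<close> itself) with respect to the root \<open>r\<close>.\<close>

definition ancestor :: "'v set set \<Rightarrow> 'v \<Rightarrow> 'v \<Rightarrow> 'v \<Rightarrow> bool" where
  "ancestor E r z x \<longleftrightarrow>
     (\<exists>xs. xs \<noteq> [] \<and> distinct xs \<and> successively (\<lambda>u v. {u, v} \<in> E) xs \<and>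
           hd xs = r \<and> last xs = x \<and> z \<in> set xs)"

definition meet :: "'v set set \<Rightarrow> 'v \<Rightarrow> 'v \<Rightarrow> 'v \<Rightarrow> 'v" where
  "meet E r x y = arg_max (gdist E r) (\<lambda>z. ancestor E r z x \<and> ancestor E r z y)"

definition ends :: "'v set set \<Rightarrow> 'v \<Rightarrow> (nat \<Rightarrow> 'v) set" where
  "ends E r = {\<omega>. \<omega> 0 = r \<and> inj \<omega> \<and> (\<forall>n. {\<omega> n, \<omega> (Suc n)} \<in> E)}"

definition ends_through :: "'v set set \<Rightarrow> 'v \<Rightarrow> 'v \<Rightarrow> (nat \<Rightarrow> 'v) set" where
  "ends_through E r x = {\<omega> \<in> ends E r. x \<in> range \<omega>}"

definition end_topology :: "'v set \<Rightarrow> 'v set set \<Rightarrow> 'v \<Rightarrow> (nat \<Rightarrow> 'v) topology" where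
  "end_topology T E r = topology_generated_by (ends_through E r ` T)"

definition end_borel :: "'v set \<Rightarrow> 'v set set \<Rightarrow> 'v \<Rightarrow> (nat \<Rightarrow> 'v) measure" where
  "end_borel T E r = sigma (ends E r) {A. openin (end_topology T E r) A}"

text \<open>Convergence of a sequence of vertices to the end \<open>\<omega>\<close>: the sequence is eventually in the
  subtree of descendants of each vertex of the ray \<open>\<omega>\<close>.\<close>

definition tends_to_end :: "'v set set \<Rightarrow> 'v \<Rightarrow> (nat \<Rightarrow> 'v) \<Rightarrow> (nat \<Rightarrow> 'v) \<Rightarrow> bool" where
  "tends_to_end E r X \<omega> \<longleftrightarrow>
     \<omega> \<in> ends E r \<and> (\<forall>n. \<forall>\<^sub>F k in sequentially. ancestor E r (\<omega> n) (X k))"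


section \<open>Functions of the potential on a tree with constant conductances\<close>

definition edge_weight :: "'v set set \<Rightarrow> real \<Rightarrow> 'v \<Rightarrow> 'v \<Rightarrow> real" where
  "edge_weight E w i j = (if {i, j} \<in> E then w else 0)"

definition Hop :: "'v set set \<Rightarrow> real \<Rightarrow> ('v \<Rightarrow> real) \<Rightarrow> ('v \<Rightarrow> real) \<Rightarrow> 'v \<Rightarrow> real" where
  "Hop E w \<beta> f i = 2 * \<beta> i * f i - (\<Sum>j | {i, j} \<in> E. edge_weight E w i j * f j)"

definition Ghat_n ::
    "'v set \<Rightarrow> 'v set set \<Rightarrow> 'v \<Rightarrow> real \<Rightarrow> nat \<Rightarrow> ('v \<Rightarrow> real) \<Rightarrow> 'v \<Rightarrow> 'v \<Rightarrow> real" where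
  "Ghat_n T E r w n \<beta> = inv_on (tball T E r n) (Hmat (edge_weight E w) \<beta>)"

definition psi_n ::
    "'v set \<Rightarrow> 'v set set \<Rightarrow> 'v \<Rightarrow> real \<Rightarrow> nat \<Rightarrow> ('v \<Rightarrow> real) \<Rightarrow> 'v \<Rightarrow> real" where
  "psi_n T E r w n \<beta> = (THE f. (\<forall>i\<in>tball T E r n. Hop E w \<beta> f i = 0) \<and>
                                (\<forall>i. i \<notin> tball T E r n \<longrightarrow> f i = 1))"

definition Ghat ::
    "'v set \<Rightarrow> 'v set set \<Rightarrow> 'v \<Rightarrow> real \<Rightarrow> ('v \<Rightarrow> real) \<Rightarrow> 'v \<Rightarrow> 'v \<Rightarrow> real" where
  "Ghat T E r w \<beta> i j = lim (\<lambda>n. Ghat_n T E r w n \<beta> i j)"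

definition psi :: "'v set \<Rightarrow> 'v set set \<Rightarrow> 'v \<Rightarrow> real \<Rightarrow> ('v \<Rightarrow> real) \<Rightarrow> 'v \<Rightarrow> real" where
  "psi T E r w \<beta> i = lim (\<lambda>n. psi_n T E r w n \<beta> i)"

text \<open>The law of the discrete-time Markov chain on \<open>T\<close> with transition matrix \<open>p\<close> started at \<open>y\<close>.\<close>

definition chain_law :: "'v set \<Rightarrow> ('v \<Rightarrow> 'v \<Rightarrow> real) \<Rightarrow> 'v \<Rightarrow> (nat \<Rightarrow> 'v) measure" where
  "chain_law T p y = (THE M. prob_space M \<and>
     sets M = sets (PiM UNIV (\<lambda>_::nat. count_space T)) \<and>
     (\<forall>n x. (\<forall>k\<le>n. x k \<in> T) \<longrightarrow>
        measure M {X \<in> space M. \<forall>k\<le>n. X k = x k}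
          = (if x 0 = y then \<Prod>k<n. p (x k) (x (Suc k)) else 0)))"

definition walk_conductance ::
    "'v set set \<Rightarrow> real \<Rightarrow> ('v \<Rightarrow> real) \<Rightarrow> 'v \<Rightarrow> 'v \<Rightarrow> real" where
  "walk_conductance E w f i j = edge_weight E w i j * f i * f j"

definition walk_step :: "'v set set \<Rightarrow> real \<Rightarrow> ('v \<Rightarrow> real) \<Rightarrow> 'v \<Rightarrow> 'v \<Rightarrow> real" where
  "walk_step E w f i j =
     walk_conductance E w f i j / (\<Sum>k | {i, k} \<in> E. walk_conductance E w f i k)"

definition exit_law ::
    "'v set \<Rightarrow> 'v set set \<Rightarrow> 'v \<Rightarrow> real \<Rightarrow> ('v \<Rightarrow> real) \<Rightarrow> 'v \<Rightarrow> (nat \<Rightarrow> 'v) measure" where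
  "exit_law T E r w f y = distr (chain_law T (walk_step E w f) y) (end_borel T E r)
     (\<lambda>X. THE \<omega>. tends_to_end E r X \<omega>)"

definition chi ::
    "'v set \<Rightarrow> 'v set set \<Rightarrow> 'v \<Rightarrow> real \<Rightarrow> ('v \<Rightarrow> real) \<Rightarrow> 'v \<Rightarrow> (nat \<Rightarrow> 'v) measure" where
  "chi T E r w \<beta> y =
     scale_measure (ennreal (psi T E r w \<beta> y)) (exit_law T E r w (psi T E r w \<beta>) y)"


section \<open>The representations with boundary at a finite level\<close>

text \<open>The abstract boundary point attached to \<open>x\<close> in level \<open>m\<close> is represented by \<open>x\<close> itself.
  The boundary potential \<open>\<rho>\<close> is a separate component of the state, so it does not
  interfere with the value of \<open>\<beta>\<close> at \<open>x\<close>.\<close>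

definition Ccheck ::
    "'v set \<Rightarrow> 'v set set \<Rightarrow> 'v \<Rightarrow> real \<Rightarrow> ('v \<Rightarrow> real) \<Rightarrow> 'v \<Rightarrow> 'v \<Rightarrow> real" where
  "Ccheck T E r w \<beta> x x' = (if x = x' then 0 else
     (let z = meet E r x x' in
      measure (chi T E r w \<beta> z) (ends_through E r x)
      * measure (chi T E r w \<beta> z) (ends_through E r x') / Ghat T E r w \<beta> z z))"

text \<open>The measure \<open>\<nu>(d\<beta>) \<nu>'\<^sub>\<beta>(d\<rho>)\<close>. The kernel is only determined for almost every \<open>\<beta>\<close>; the
  integral formula below does not depend on its values on a null set, whereas
  \<^const>\<open>bind\<close> would require measurability everywhere.\<close>

definition nu_joint ::
    "'v set \<Rightarrow> 'v set set \<Rightarrow> 'v \<Rightarrow> real \<Rightarrow> nat \<Rightarrow> (('v \<Rightarrow> real) \<times> ('v \<Rightarrow> real)) measure" where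
  "nu_joint T E r w m =
     (let \<nu> = nu_inf T (edge_weight E w);
          P = \<nu> \<Otimes>\<^sub>M PiM (level T E r m) (\<lambda>_. borel)
      in measure_of (space P) (sets P)
           (\<lambda>A. \<integral>\<^sup>+ \<beta>. emeasure (nu_fin (level T E r m) (Ccheck T E r w \<beta>) (\<lambda>_. 0))
                          {\<rho>. (\<beta>, \<rho>) \<in> A} \<partial>\<nu>))"

definition Gcheck ::
    "'v set \<Rightarrow> 'v set set \<Rightarrow> 'v \<Rightarrow> real \<Rightarrow> nat \<Rightarrow> ('v \<Rightarrow> real) \<Rightarrow> ('v \<Rightarrow> real)
      \<Rightarrow> 'v \<Rightarrow> 'v \<Rightarrow> real" where
  "Gcheck T E r w m \<beta> \<rho> = inv_on (level T E r m) (Hmat (Ccheck T E r w \<beta>) \<rho>)"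

text \<open>The vertex at level \<open>m\<close> through which the end \<open>\<omega>\<close> passes is \<open>\<omega> m\<close>.\<close>

definition gcheck ::
    "'v set \<Rightarrow> 'v set set \<Rightarrow> 'v \<Rightarrow> real \<Rightarrow> nat \<Rightarrow> ('v \<Rightarrow> real) \<Rightarrow> ('v \<Rightarrow> real)
      \<Rightarrow> (nat \<Rightarrow> 'v) \<Rightarrow> (nat \<Rightarrow> 'v) \<Rightarrow> real" where
  "gcheck T E r w m \<beta> \<rho> \<omega> \<tau> = Gcheck T E r w m \<beta> \<rho> (\<omega> m) (\<tau> m)"

definition Gm ::
    "'v set \<Rightarrow> 'v set set \<Rightarrow> 'v \<Rightarrow> real \<Rightarrow> nat \<Rightarrow> ('v \<Rightarrow> real) \<Rightarrow> ('v \<Rightarrow> real)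
      \<Rightarrow> 'v \<Rightarrow> 'v \<Rightarrow> real" where
  "Gm T E r w m \<beta> \<rho> i j = Ghat T E r w \<beta> i j
     + (\<integral>(\<omega>, \<tau>). gcheck T E r w m \<beta> \<rho> \<omega> \<tau> \<partial>(chi T E r w \<beta> i \<Otimes>\<^sub>M chi T E r w \<beta> j))"

definition dir_edges :: "'v set set \<Rightarrow> ('v \<times> 'v) set" where
  "dir_edges E = {(i, j). {i, j} \<in> E}"

definition jump_rates ::
    "'v set \<Rightarrow> 'v set set \<Rightarrow> 'v \<Rightarrow> real \<Rightarrow> nat \<Rightarrow> 'v
      \<Rightarrow> ('v \<Rightarrow> real) \<times> ('v \<Rightarrow> real) \<Rightarrow> 'v \<times> 'v \<Rightarrow> real" where
  "jump_rates T E r w m i0 = (\<lambda>(\<beta>, \<rho>). \<lambda>(i, j)\<in>dir_edges E.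
     1/2 * edge_weight E w i j * (Gm T E r w m \<beta> \<rho> i0 j / Gm T E r w m \<beta> \<rho> i0 i))"

text \<open>The jump rates are defined almost surely only, hence the completion: modifying them
  on a null set does not change this law.\<close>

definition jump_rates_law ::
    "'v set \<Rightarrow> 'v set set \<Rightarrow> 'v \<Rightarrow> real \<Rightarrow> nat \<Rightarrow> 'v \<Rightarrow> ('v \<times> 'v \<Rightarrow> real) measure" where
  "jump_rates_law T E r w m i0 =
     distr (completion (nu_joint T E r w m)) (PiM (dir_edges E) (\<lambda>_. borel))
       (jump_rates T E r w m i0)"

end

theory Submission
  imports Defs "HOL-Real_Asymp.Real_Asymp"
begin

text \<open>
  Let \<open>h\<close> be the function \<open>G\<^sub>m(i\<^sub>0, \<sqdot>)\<close>. It solves \<open>H\<^sub>\<beta> h = 0\<close> off \<open>i\<^sub>0\<close>, so the jump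
  rates out of a vertex \<open>i \<noteq> i\<^sub>0\<close> add up to \<open>\<beta>\<^sub>i\<close>. The rates therefore determine, for every
  vertex \<open>y\<close> whose subtree does not contain \<open>i\<^sub>0\<close>, the two numbers that describe how this
  subtree acts on a solution: its Green's function \<open>a\<^sub>y\<close> at \<open>y\<close> (\<open>green\<close>), and the
  contribution \<open>b\<^sub>y\<close> (\<open>inflow\<close>) of its ends to \<open>\<psi>\<close>, given by
  \<open>\<psi>(y) = w a\<^sub>y \<psi>(x) + b\<^sub>y\<close> with \<open>x\<close> the parent of \<open>y\<close>.

  Take two children \<open>y1\<close>, \<open>y2\<close> of a vertex \<open>x\<close> of level \<open>m\<close> whose subtrees avoid \<open>i\<^sub>0\<close>.
  With boundary level \<open>m\<close> all ends below \<open>x\<close> are attached to the same boundary point, hence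
  \<open>h(y) - w a\<^sub>y h(x) = b\<^sub>y k\<close> for both children with the same \<open>k\<close> (\<open>level_identity\<close>), and
  \<open>b\<^sub>y\<^sub>2 (h(y1) - w a\<^sub>y\<^sub>1 h(x)) = b\<^sub>y\<^sub>1 (h(y2) - w a\<^sub>y\<^sub>2 h(x))\<close>. Divided by \<open>h(x)\<close> this is an
  equation between functions of the jump rates; \<open>mismatch\<close> is the event that it fails, and it
  has probability \<open>0\<close> for level \<open>m\<close>.

  With a boundary level \<open>m' > m\<close> the ends below \<open>y1\<close> and below \<open>y2\<close> are attached to different
  boundary points. If the equation held almost surely, then for almost every \<open>\<beta>\<close> a bilinear
  form of \<open>(2\<rho> - C)\<^sup>-\<^sup>1\<close> would vanish for almost every boundary potential \<open>\<rho>\<close>, so its diagonal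
  coefficients would vanish (\<open>bilinear_inverse_vanishes\<close>), which means \<open>b\<^sub>y\<^sub>1 b\<^sub>y\<^sub>2 = 0\<close>. But
  \<open>b\<^sub>y\<^sub>1\<close> and \<open>b\<^sub>y\<^sub>2\<close> are independent, as no edge joins the two subtrees, and the law of
  \<open>b\<^sub>y\<close> is the same for all \<open>y\<close> other than the root, as the subtrees are isomorphic. So all
  \<open>b\<^sub>y\<close> would vanish almost surely. This is impossible for \<open>\<psi> > 0\<close>: \<open>\<psi>\<close> would then be a
  multiple of \<open>G(\<sqdot>, r)\<close> near the root \<open>r\<close>, but \<open>H\<^sub>\<beta> \<psi> = 0\<close> at \<open>r\<close>
  (\<open>not_AE_one_branch\<close>).

  The objects in this argument have to be constructed first. Integrating out one vertex is an
  inverse Gaussian integral in the Schur complement; this shows that the finite-volume measures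
  are consistent probability measures, and Kolmogorov's theorem yields \<open>\<nu>\<close>. An additional
  boundary weight \<open>l\<close> at \<open>i\<close> tilts the finite-volume density by
  \<open>exp (- l \<psi>\<^sup>(\<^sup>n\<^sup>)(i) - l\<^sup>2 G\<^sup>(\<^sup>n\<^sup>)(i, i) / 2)\<close>, which by consistency is a bounded martingale; its
  convergence gives the limits \<open>\<psi>\<close> and \<open>G\<close>. The random walk with conductances
  \<open>w \<psi>(i) \<psi>(j)\<close> visits a vertex a number of times whose expectation is bounded through
  \<open>G\<close>, so it is transient and has an exit law on the ends. The exit mass of the ends
  through a vertex \<open>u\<close>, as a function of the starting point, is dominated by a multiple of \<open>G\<close>
  in every subtree disjoint from that of \<open>u\<close>, and so has no inflow there
  (\<open>potential_subtree\<close>, \<open>exit_mass_subtree\<close>).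
\<close>

section \<open>Positive definite matrices on finite sets\<close>

definition symm_on :: "'a set \<Rightarrow> ('a \<Rightarrow> 'a \<Rightarrow> real) \<Rightarrow> bool" where
  "symm_on U A \<longleftrightarrow> (\<forall>i\<in>U. \<forall>j\<in>U. A i j = A j i)"

definition is_inv_on :: "'a set \<Rightarrow> ('a \<Rightarrow> 'a \<Rightarrow> real) \<Rightarrow> ('a \<Rightarrow> 'a \<Rightarrow> real) \<Rightarrow> bool" where
  "is_inv_on U A B \<longleftrightarrow>
     (\<forall>i\<in>U. \<forall>j\<in>U. (\<Sum>k\<in>U. A i k * B k j) = (if i = j then 1 else 0) \<and>
                   (\<Sum>k\<in>U. B i k * A k j) = (if i = j then 1 else 0)) \<and>
     (\<forall>i j. i \<notin> U \<or> j \<notin> U \<longrightarrow> B i j = 0)"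

lemma is_inv_on_unique:
  assumes fin: "finite U" and B: "is_inv_on U A B" and C: "is_inv_on U A C"
  shows "B = C"
proof (intro ext)
  fix i j
  show "B i j = C i j"
  proof (cases "i \<in> U \<and> j \<in> U")
    case True
    have "B i j = (\<Sum>l\<in>U. B i l * (if l = j then 1 else 0))"
      using True fin by (simp add: sum.delta if_distrib cong: if_cong)
    also have "\<dots> = (\<Sum>l\<in>U. B i l * (\<Sum>k\<in>U. A l k * C k j))"
      using C True by (intro sum.cong refl) (simp add: is_inv_on_def)
    also have "\<dots> = (\<Sum>k\<in>U. (\<Sum>l\<in>U. B i l * A l k) * C k j)"
      by (simp add: sum_distrib_left sum_distrib_right mult.assoc) (rule sum.swap)
    also have "\<dots> = (\<Sum>k\<in>U. (if i = k then 1 else 0) * C k j)"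
      using B True by (intro sum.cong refl) (simp add: is_inv_on_def)
    also have "\<dots> = C i j" using True fin
      by (simp add: if_distrib[of "\<lambda>x. x * _"] cong: if_cong)
    finally show ?thesis .
  next
    case False
    then show ?thesis using B C by (auto simp: is_inv_on_def)
  qed
qed

lemma inv_on_eqI:
  assumes "finite U" "is_inv_on U A B"
  shows "inv_on U A = B"
proof -
  have "inv_on U A = (THE B. is_inv_on U A B)"
    unfolding inv_on_def is_inv_on_def ..
  also have "\<dots> = B"
    using assms is_inv_on_unique by (intro the_equality) blast+
  finally show ?thesis .
qed

lemma posdef_onD:
  "posdef_on U A \<Longrightarrow> i \<in> U \<Longrightarrow> f i \<noteq> 0 \<Longrightarrow> 0 < (\<Sum>i\<in>U. \<Sum>j\<in>U. f i * A i j * f j)"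
  unfolding posdef_on_def by (erule allE[of _ f]) auto

text \<open>The pivot vector \<open>e\<close> spans the \<open>A\<close>-orthogonal complement of the functions on \<open>V\<close>
  inside the functions on \<open>insert k V\<close>. Every fact about a bordered matrix comes from
  \<open>A e = schur \<sqdot> \<delta>\<^sub>k\<close>.\<close>

definition pivot :: "'a set \<Rightarrow> ('a \<Rightarrow> 'a \<Rightarrow> real) \<Rightarrow> 'a \<Rightarrow> 'a \<Rightarrow> real" where
  "pivot V A k i = (if i = k then 1 else 0) - (\<Sum>j\<in>V. inv_on V A i j * A j k)"

definition schur :: "'a set \<Rightarrow> ('a \<Rightarrow> 'a \<Rightarrow> real) \<Rightarrow> 'a \<Rightarrow> real" where
  "schur V A k = A k k - (\<Sum>i\<in>V. \<Sum>j\<in>V. A k i * inv_on V A i j * A j k)"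

locale bordered =
  fixes V :: "'a set" and A :: "'a \<Rightarrow> 'a \<Rightarrow> real" and k :: 'a
  assumes fin: "finite V" and k: "k \<notin> V" and sym: "symm_on (insert k V) A"
    and inv: "is_inv_on V A (inv_on V A)"
    and inv_sym: "\<And>i j. inv_on V A i j = inv_on V A j i"
begin

abbreviation "e \<equiv> pivot V A k"
abbreviation "s \<equiv> schur V A k"

lemma e_k: "e k = 1"
  using inv k by (simp add: pivot_def is_inv_on_def)

lemma e_out: "i \<notin> insert k V \<Longrightarrow> e i = 0"
  using inv by (simp add: pivot_def is_inv_on_def)

lemma e_V: "i \<in> V \<Longrightarrow> e i = - (\<Sum>j\<in>V. inv_on V A i j * A j k)"
  using k by (auto simp: pivot_def)

lemma A_e:
  assumes i: "i \<in> insert k V"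
  shows "(\<Sum>j\<in>insert k V. A i j * e j) = (if i = k then s else 0)"
proof -
  have "(\<Sum>j\<in>insert k V. A i j * e j) = A i k - (\<Sum>j\<in>V. \<Sum>l\<in>V. A i j * inv_on V A j l * A l k)"
    using fin k by (simp add: e_k e_V sum_negf sum_distrib_left mult.assoc)
  also have "\<dots> = (if i = k then s else 0)"
  proof (cases "i = k")
    case False
    with i have iV: "i \<in> V" by auto
    have "(\<Sum>j\<in>V. \<Sum>l\<in>V. A i j * inv_on V A j l * A l k)
        = (\<Sum>l\<in>V. (\<Sum>j\<in>V. A i j * inv_on V A j l) * A l k)"
      by (simp add: sum_distrib_right) (rule sum.swap)
    also have "\<dots> = (\<Sum>l\<in>V. (if i = l then 1 else 0) * A l k)"
      using inv iV by (intro sum.cong refl) (simp add: is_inv_on_def)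
    also have "\<dots> = A i k" using iV fin by (simp add: if_distrib[of "\<lambda>x. x * _"] cong: if_cong)
    finally show ?thesis using False by simp
  qed (simp add: schur_def)
  finally show ?thesis .
qed

lemma e_A:
  assumes i: "i \<in> insert k V"
  shows "(\<Sum>j\<in>insert k V. e j * A j i) = (if i = k then s else 0)"
proof -
  have "(\<Sum>j\<in>insert k V. e j * A j i) = (\<Sum>j\<in>insert k V. A i j * e j)"
    using sym i by (intro sum.cong refl) (auto simp: symm_on_def)
  then show ?thesis using A_e[OF i] by simp
qed

text \<open>Inverting \<open>A\<close> on \<open>V\<close> first leaves an error in the direction of \<open>e\<close> only, and
  \<open>A e = s \<delta>\<^sub>k\<close> shows that the rank-one term \<open>e e\<^sup>T / s\<close> corrects it.\<close>

lemma inv_bordered: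
  assumes s: "s \<noteq> 0"
  shows "is_inv_on (insert k V) A (\<lambda>i j. inv_on V A i j + e i * e j / s)" (is "is_inv_on ?U A ?B")
proof -
  have AB: "(\<Sum>l\<in>?U. A i l * ?B l j) = (if i = j then 1 else 0)" if i: "i \<in> ?U" and j: "j \<in> ?U" for i j
  proof -
    have "(\<Sum>l\<in>?U. A i l * ?B l j) = (\<Sum>l\<in>?U. A i l * inv_on V A l j) + (\<Sum>l\<in>?U. A i l * e l) * e j / s"
      by (simp add: distrib_left sum.distrib sum_distrib_right sum_divide_distrib mult.assoc)
    also have "(\<Sum>l\<in>?U. A i l * inv_on V A l j) = (\<Sum>l\<in>V. A i l * inv_on V A l j)"
      using fin k inv by (simp add: is_inv_on_def)
    also have "(\<Sum>l\<in>?U. A i l * e l) * e j / s = (if i = k then e j else 0)"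
      using A_e[OF i] s by simp
    also have "(\<Sum>l\<in>V. A i l * inv_on V A l j) = (if i = k then (if j = k then 0 else - e j) else if i = j then 1 else 0)"
    proof (cases "i = k")
      case True
      show ?thesis
      proof (cases "j = k")
        case True then show ?thesis using k inv \<open>i = k\<close> by (simp add: is_inv_on_def)
      next
        case False
        with j have "j \<in> V" by auto
        have "(\<Sum>l\<in>V. A k l * inv_on V A l j) = (\<Sum>l\<in>V. inv_on V A j l * A l k)"
        proof (rule sum.cong[OF refl])
          fix l assume "l \<in> V"
          then have "A k l = A l k" using sym unfolding symm_on_def by blast
          moreover have "inv_on V A l j = inv_on V A j l" by (rule inv_sym)
          ultimately show "A k l * inv_on V A l j = inv_on V A j l * A l k" by simp
        qed
        then show ?thesis using True False e_V[OF \<open>j \<in> V\<close>] by simp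
      qed
    next
      case False
      with i have "i \<in> V" by auto
      then show ?thesis using False inv j k by (auto simp: is_inv_on_def)
    qed
    finally show ?thesis using e_k by auto
  qed
  have sB: "?B i j = ?B j i" for i j using inv_sym[of i j] by simp
  have BA: "(\<Sum>l\<in>?U. ?B i l * A l j) = (if i = j then 1 else 0)" if i: "i \<in> ?U" and j: "j \<in> ?U" for i j
  proof -
    have "(\<Sum>l\<in>?U. ?B i l * A l j) = (\<Sum>l\<in>?U. A j l * ?B l i)"
    proof (rule sum.cong[OF refl])
      fix l assume "l \<in> ?U"
      then have "A l j = A j l" using sym j unfolding symm_on_def by blast
      then show "?B i l * A l j = A j l * ?B l i" by (simp only: sB[of i] mult.commute)
    qed
    then show ?thesis using AB[OF j i] by auto
  qed
  show ?thesis using AB BA e_out inv unfolding is_inv_on_def by auto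
qed

definition Q :: "('a \<Rightarrow> real) \<Rightarrow> real" where
  "Q f = (\<Sum>i\<in>insert k V. \<Sum>j\<in>insert k V. f i * A i j * f j)"

text \<open>Completing the square: \<open>e\<close> is \<open>A\<close>-orthogonal to the functions on \<open>V\<close> and has
  \<open>\<langle>e, A e\<rangle> = s\<close>.\<close>

lemma Q_split: "Q (\<lambda>i. f i + c * e i) = Q f + 2 * c * f k * s + c\<^sup>2 * s"
proof -
  have 1: "(\<Sum>i\<in>insert k V. \<Sum>j\<in>insert k V. x i * A i j * e j) = x k * s" for x :: "'a \<Rightarrow> real"
  proof -
    have "(\<Sum>i\<in>insert k V. \<Sum>j\<in>insert k V. x i * A i j * e j)
      = (\<Sum>i\<in>insert k V. x i * (\<Sum>j\<in>insert k V. A i j * e j))"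
      by (simp only: sum_distrib_left mult.assoc)
    also have "\<dots> = (\<Sum>i\<in>insert k V. x i * (if i = k then s else 0))"
      by (intro sum.cong refl) (simp only: A_e)
    also have "\<dots> = x k * s" using fin by (simp add: if_distrib[of "\<lambda>y. _ * y"] cong: if_cong)
    finally show ?thesis .
  qed
  have 2: "(\<Sum>i\<in>insert k V. \<Sum>j\<in>insert k V. e i * A i j * x j) = x k * s" for x :: "'a \<Rightarrow> real"
    unfolding 1[symmetric]
  proof (subst sum.swap, intro sum.cong refl)
    fix i j assume "i \<in> insert k V" "j \<in> insert k V"
    then have "A j i = A i j" using sym unfolding symm_on_def by blast
    then show "e j * A j i * x i = x i * A i j * e j" by simp
  qed
  have "Q (\<lambda>i. f i + c * e i) = Q f
     + c * (\<Sum>i\<in>insert k V. \<Sum>j\<in>insert k V. f i * A i j * e j)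
     + c * (\<Sum>i\<in>insert k V. \<Sum>j\<in>insert k V. e i * A i j * f j)
     + c\<^sup>2 * (\<Sum>i\<in>insert k V. \<Sum>j\<in>insert k V. e i * A i j * e j)"
    unfolding Q_def sum_distrib_left sum.distrib[symmetric]
    by (intro sum.cong refl) (simp add: algebra_simps power2_eq_square)
  then show ?thesis unfolding 1 2 by (simp add: e_k)
qed

lemma Q_zero: "f k = 0 \<Longrightarrow> Q f = (\<Sum>i\<in>V. \<Sum>j\<in>V. f i * A i j * f j)"
  using fin k by (simp add: Q_def)

lemma posdef_iff: "posdef_on (insert k V) A \<longleftrightarrow> posdef_on V A \<and> 0 < s"
proof safe
  assume pd: "posdef_on (insert k V) A"
  show "posdef_on V A"
    unfolding posdef_on_def
  proof (intro allI impI)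
    fix f :: "'a \<Rightarrow> real" assume "\<exists>i\<in>V. f i \<noteq> 0"
    then obtain i where i: "i \<in> V" "f i \<noteq> 0" by auto
    let ?f = "f(k := 0)"
    have "0 < Q ?f" unfolding Q_def
      using i k by (intro posdef_onD[OF pd, of i]) auto
    also have "\<dots> = (\<Sum>i\<in>V. \<Sum>j\<in>V. f i * A i j * f j)"
      unfolding Q_zero[of ?f, simplified] using k by (intro sum.cong refl) auto
    finally show "0 < (\<Sum>i\<in>V. \<Sum>j\<in>V. f i * A i j * f j)" .
  qed
  have "0 < Q e" unfolding Q_def
    using e_k by (intro posdef_onD[OF pd, of k]) auto
  moreover have "Q e = s" using Q_split[of "\<lambda>_. 0" 1] by (simp add: Q_def)
  ultimately show "0 < s" by simp
next
  assume pd: "posdef_on V A" and s: "0 < s"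
  show "posdef_on (insert k V) A"
    unfolding posdef_on_def
  proof (intro allI impI)
    fix f :: "'a \<Rightarrow> real" assume f: "\<exists>i\<in>insert k V. f i \<noteq> 0"
    define h where "h i = f i - f k * e i" for i
    have hk: "h k = 0" by (simp add: h_def e_k)
    have "Q f = Q (\<lambda>i. h i + f k * e i)" by (simp add: h_def)
    also have "\<dots> = Q h + (f k)\<^sup>2 * s" using Q_split[of h "f k"] hk by simp
    finally have eq: "Q f = Q h + (f k)\<^sup>2 * s" .
    have "0 < Q f"
    proof (cases "\<exists>i\<in>V. h i \<noteq> 0")
      case True
      then have "0 < Q h" using pd hk by (simp add: Q_zero posdef_on_def)
      moreover have "0 \<le> (f k)\<^sup>2 * s" using s by simp
      ultimately show ?thesis using eq by linarith
    next
      case False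
      then have Qh: "Q h = 0" using hk by (simp add: Q_zero)
      have "f k \<noteq> 0" using f False by (auto simp: h_def)
      then show ?thesis using Qh eq s by simp
    qed
    then show "0 < (\<Sum>i\<in>insert k V. \<Sum>j\<in>insert k V. f i * A i j * f j)" by (simp add: Q_def)
  qed
qed

end

lemma symm_on_subset: "symm_on U A \<Longrightarrow> V \<subseteq> U \<Longrightarrow> symm_on V A"
  by (auto simp: symm_on_def)

lemma posdef_on_subset:
  assumes "posdef_on U A" "V \<subseteq> U" "finite U"
  shows "posdef_on V A"
  unfolding posdef_on_def
proof (intro allI impI)
  fix f :: "'a \<Rightarrow> real" assume "\<exists>i\<in>V. f i \<noteq> 0"
  then obtain i where i: "i \<in> V" "f i \<noteq> 0" by auto
  let ?f = "\<lambda>i. if i \<in> V then f i else 0"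
  have "0 < (\<Sum>i\<in>U. \<Sum>j\<in>U. ?f i * A i j * ?f j)"
    using i assms(2) by (intro posdef_onD[OF assms(1), of i]) auto
  also have "\<dots> = (\<Sum>i\<in>V. \<Sum>j\<in>U. ?f i * A i j * ?f j)"
    using assms by (intro sum.mono_neutral_right) auto
  also have "\<dots> = (\<Sum>i\<in>V. \<Sum>j\<in>V. ?f i * A i j * ?f j)"
    using assms by (intro sum.cong refl sum.mono_neutral_right) auto
  also have "\<dots> = (\<Sum>i\<in>V. \<Sum>j\<in>V. f i * A i j * f j)"
    by (intro sum.cong refl) auto
  finally show "0 < (\<Sum>i\<in>V. \<Sum>j\<in>V. f i * A i j * f j)" .
qed

lemma posdef_inv:
  assumes "finite U" "symm_on U A" "posdef_on U A"
  shows "is_inv_on U A (inv_on U A) \<and> (\<forall>i j. inv_on U A i j = inv_on U A j i)"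
  using assms
proof (induction U rule: finite_induct)
  case empty
  have "is_inv_on {} A (\<lambda>_ _. 0)" by (simp add: is_inv_on_def)
  from inv_on_eqI[OF _ this] this show ?case by simp
next
  case (insert k V)
  have "posdef_on V A" using insert.prems insert.hyps by (auto intro: posdef_on_subset)
  then have IH: "is_inv_on V A (inv_on V A)" "\<And>i j. inv_on V A i j = inv_on V A j i"
    using insert by (auto intro: symm_on_subset)
  interpret bordered V A k using insert IH by unfold_locales auto
  have "s \<noteq> 0" using insert.prems posdef_iff by simp
  note B = inv_bordered[OF this]
  from inv_on_eqI[OF _ B] have eq: "inv_on (insert k V) A = (\<lambda>i j. inv_on V A i j + e i * e j / s)"
    using insert.hyps by simp
  show ?case unfolding eq using B IH(2) by (simp add: mult.commute)
qed

lemma bordered_posdef: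
  assumes "finite V" "k \<notin> V" "symm_on (insert k V) A" "posdef_on V A"
  shows "bordered V A k"
  using assms posdef_inv[of V A] symm_on_subset[of "insert k V" A V] by unfold_locales auto

lemma posdef_insert:
  assumes "finite V" "k \<notin> V" "symm_on (insert k V) A"
  shows "posdef_on (insert k V) A \<longleftrightarrow> posdef_on V A \<and> 0 < schur V A k"
  using bordered.posdef_iff[OF bordered_posdef[OF assms]] posdef_on_subset[of "insert k V" A V] assms(1)
  by blast

lemma inv_insert:
  assumes "finite V" "k \<notin> V" "symm_on (insert k V) A" "posdef_on (insert k V) A"
  shows "inv_on (insert k V) A i j = inv_on V A i j + pivot V A k i * pivot V A k j / schur V A k"
proof -
  have pd: "posdef_on V A" and s: "0 < schur V A k"
    using assms(4) unfolding posdef_insert[OF assms(1-3)] by auto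
  interpret bordered V A k by (rule bordered_posdef) (use assms pd in auto)
  show ?thesis using inv_on_eqI[OF _ inv_bordered] s assms(1) by simp
qed

lemma inv_sym:
  "finite U \<Longrightarrow> symm_on U A \<Longrightarrow> posdef_on U A \<Longrightarrow> inv_on U A i j = inv_on U A j i"
  using posdef_inv by blast

lemma inv_outside:
  "finite U \<Longrightarrow> symm_on U A \<Longrightarrow> posdef_on U A \<Longrightarrow> i \<notin> U \<or> j \<notin> U \<Longrightarrow> inv_on U A i j = 0"
  using posdef_inv[of U A] by (simp add: is_inv_on_def)

lemma inv_right:
  "finite U \<Longrightarrow> symm_on U A \<Longrightarrow> posdef_on U A \<Longrightarrow> i \<in> U \<Longrightarrow> j \<in> U \<Longrightarrow>
    (\<Sum>k\<in>U. A i k * inv_on U A k j) = (if i = j then 1 else 0)"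
  using posdef_inv[of U A] by (simp add: is_inv_on_def)

lemma inv_left:
  "finite U \<Longrightarrow> symm_on U A \<Longrightarrow> posdef_on U A \<Longrightarrow> i \<in> U \<Longrightarrow> j \<in> U \<Longrightarrow>
    (\<Sum>k\<in>U. inv_on U A i k * A k j) = (if i = j then 1 else 0)"
  using conjunct1[OF posdef_inv, of U A] unfolding is_inv_on_def by blast

text \<open>The left inverse property turns a linear system on \<open>U\<close> into a formula for its
  solution.\<close>

lemma inv_solve:
  assumes "finite U" "symm_on U A" "posdef_on U A" and i: "i \<in> U"
    and y: "\<And>j. j \<in> U \<Longrightarrow> (\<Sum>k\<in>U. A j k * x k) = y j"
  shows "x i = (\<Sum>j\<in>U. inv_on U A i j * y j)"
proof -
  have "(\<Sum>j\<in>U. inv_on U A i j * y j) = (\<Sum>j\<in>U. inv_on U A i j * (\<Sum>k\<in>U. A j k * x k))"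
    using y by simp
  also have "\<dots> = (\<Sum>k\<in>U. (\<Sum>j\<in>U. inv_on U A i j * A j k) * x k)"
    by (simp add: sum_distrib_left sum_distrib_right mult.assoc) (rule sum.swap)
  also have "\<dots> = (\<Sum>k\<in>U. (if i = k then 1 else 0) * x k)"
    using inv_left[OF assms(1-3) i] by (intro sum.cong refl) simp
  also have "\<dots> = x i" using i assms(1) by (simp add: if_distrib[of "\<lambda>x. x * _"] cong: if_cong)
  finally show ?thesis by simp
qed

lemma inv_psd:
  assumes "finite U" "symm_on U A" "posdef_on U A"
  shows "0 \<le> (\<Sum>i\<in>U. \<Sum>j\<in>U. x i * inv_on U A i j * x j)"
proof -
  let ?y = "\<lambda>i. \<Sum>j\<in>U. inv_on U A i j * x j"
  have Ay: "(\<Sum>k\<in>U. A i k * ?y k) = x i" if "i \<in> U" for i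
  proof -
    have "(\<Sum>k\<in>U. A i k * ?y k) = (\<Sum>j\<in>U. (\<Sum>k\<in>U. A i k * inv_on U A k j) * x j)"
      by (simp add: sum_distrib_left sum_distrib_right mult.assoc) (rule sum.swap)
    also have "\<dots> = (\<Sum>j\<in>U. (if i = j then 1 else 0) * x j)"
      using inv_right[OF assms] that by (intro sum.cong refl) simp
    also have "\<dots> = x i" using that assms(1) by (simp add: if_distrib[of "\<lambda>x. x * _"] cong: if_cong)
    finally show ?thesis .
  qed
  have "(\<Sum>i\<in>U. \<Sum>j\<in>U. x i * inv_on U A i j * x j) = (\<Sum>i\<in>U. ?y i * x i)"
    by (simp add: sum_distrib_left sum_distrib_right mult_ac)
  also have "\<dots> = (\<Sum>i\<in>U. ?y i * (\<Sum>k\<in>U. A i k * ?y k))"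
    using Ay by (intro sum.cong refl) simp
  also have "\<dots> = (\<Sum>i\<in>U. \<Sum>k\<in>U. ?y i * A i k * ?y k)"
    by (simp add: sum_distrib_left mult.assoc)
  also have "0 \<le> \<dots>"
  proof (cases "\<exists>i\<in>U. ?y i \<noteq> 0")
    case True
    from assms(3)[unfolded posdef_on_def, rule_format, OF True] show ?thesis by (rule less_imp_le)
  qed simp
  finally show ?thesis .
qed

text \<open>Entries of the inverse of a positive definite matrix with nonpositive off-diagonal
  entries are nonnegative and grow with the index set.\<close>

definition Zmat :: "'a set \<Rightarrow> ('a \<Rightarrow> 'a \<Rightarrow> real) \<Rightarrow> bool" where
  "Zmat U A \<longleftrightarrow> (\<forall>i\<in>U. \<forall>j\<in>U. i \<noteq> j \<longrightarrow> A i j \<le> 0)"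

lemma pivot_nonneg:
  assumes "Zmat (insert k V) A" "k \<notin> V" "\<And>i j. 0 \<le> inv_on V A i j"
  shows "0 \<le> pivot V A k i"
proof -
  have "inv_on V A i j * A j k \<le> 0" if "j \<in> V" for j
    using assms that by (auto simp: Zmat_def mult_nonneg_nonpos)
  then have "(\<Sum>j\<in>V. inv_on V A i j * A j k) \<le> 0" by (rule sum_nonpos)
  then show ?thesis unfolding pivot_def by (auto intro: order.trans[of _ 0])
qed

lemma inv_nonneg:
  assumes "finite U" "symm_on U A" "posdef_on U A" "Zmat U A"
  shows "0 \<le> inv_on U A i j"
  using assms
proof (induction U arbitrary: i j rule: finite_induct)
  case empty
  then show ?case using inv_outside[of "{}" A i j] by simp
next
  case (insert k V)
  have pd: "posdef_on V A" "0 < schur V A k"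
    using insert.prems(2) unfolding posdef_insert[OF insert.hyps insert.prems(1)] by auto
  have IH: "0 \<le> inv_on V A i j" for i j
    using insert.IH[OF symm_on_subset[OF insert.prems(1)] pd(1)] insert.prems(3)
    by (auto simp: Zmat_def)
  show ?case using inv_insert[OF insert.hyps insert.prems(1,2), of i j] IH[of i j] pd
      pivot_nonneg[OF insert.prems(3) insert.hyps(2) IH] by simp
qed

text \<open>Each added vertex changes the inverse by \<open>e e\<^sup>T / s\<close>, and \<open>e \<ge> 0\<close> by the sign condition.\<close>

lemma inv_mono:
  assumes "finite U" "V \<subseteq> U" "symm_on U A" "posdef_on U A" "Zmat U A"
  shows "inv_on V A i j \<le> inv_on U A i j"
proof -
  have "finite V" using assms finite_subset by blast
  have "inv_on V A i j \<le> inv_on (V \<union> D) A i j" if "finite D" "V \<union> D \<subseteq> U" for D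
    using that
  proof (induction D rule: finite_induct)
    case (insert k D)
    show ?case
    proof (cases "k \<in> V")
      case True then show ?thesis using insert by (simp add: insert_absorb)
    next
      case False
      let ?W = "V \<union> D"
      have k: "k \<notin> ?W" and W: "finite ?W" using False insert \<open>finite V\<close> by auto
      have pd: "posdef_on (insert k ?W) A" and sy: "symm_on (insert k ?W) A" and Z: "Zmat (insert k ?W) A"
        using insert.prems assms(2,5) posdef_on_subset[OF assms(4) _ assms(1)] symm_on_subset[OF assms(3)]
        by (auto simp: Zmat_def subset_iff)
      have pd': "posdef_on ?W A" "0 < schur ?W A k" using posdef_insert[OF W k sy] pd by auto
      have "0 \<le> inv_on ?W A i j" for i j
        using inv_nonneg[OF W symm_on_subset[OF sy] pd'(1)] Z by (auto simp: Zmat_def)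
      then have "inv_on ?W A i j \<le> inv_on (insert k ?W) A i j"
        using inv_insert[OF W k sy pd] pivot_nonneg[OF Z k] pd' by simp
      then show ?thesis using insert by simp
    qed
  qed simp
  from this[of "U - V"] assms show ?thesis by (simp add: Un_absorb1)
qed

subsection \<open>Determinants\<close>

lemma det_row_split:
  assumes "finite U" "k \<in> U"
  shows "det_on U (A(k := R))
    = (\<Sum>p | p permutes U. of_int (sign p) * (R (p k) * (\<Prod>i\<in>U - {k}. A i (p i))))"
  unfolding det_on_def
  using assms by (intro sum.cong refl) (auto simp: prod.remove[of U k] intro!: prod.cong)

lemma det_row_sum:
  assumes "finite U" "k \<in> U"
  shows "det_on U (A(k := (\<lambda>j. \<Sum>m\<in>M. c m * R m j))) = (\<Sum>m\<in>M. c m * det_on U (A(k := R m)))"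
  unfolding det_row_split[OF assms]
  by (simp add: sum_distrib_left sum_distrib_right) (subst sum.swap, simp add: mult_ac)

lemma det_equal_rows:
  assumes fin: "finite U" and U: "k \<in> U" "v \<in> U" "k \<noteq> v" and eq: "A k = A v"
  shows "det_on U A = 0"
proof -
  let ?t = "Transposition.transpose k v"
  let ?F = "\<lambda>p. real_of_int (sign p) * (\<Prod>i\<in>U. A i (p i))"
  have t: "?t permutes U" using U by (intro permutes_swap_id)
  have "det_on U A = (\<Sum>p | p permutes U. ?F (p \<circ> ?t))"
    unfolding det_on_def
    by (rule sum.reindex_bij_witness[where i="\<lambda>p. p \<circ> ?t" and j="\<lambda>p. p \<circ> ?t"])
       (auto simp: comp_assoc intro: permutes_compose[OF t])
  also have "\<dots> = (\<Sum>p | p permutes U. - ?F p)"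
  proof (intro sum.cong refl, clarsimp)
    fix p assume p: "p permutes U"
    have s: "sign (p \<circ> ?t) = - sign p"
      using permutes_imp_permutation[OF fin p] permutes_imp_permutation[OF fin t] U
      by (simp add: sign_compose sign_swap_id)
    have "(\<Prod>i\<in>U. A i ((p \<circ> ?t) i)) = (\<Prod>i\<in>U. A (?t i) (p i))"
      using permutes_in_image[OF t]
      by (intro prod.reindex_bij_witness[where i="?t" and j="?t"]) auto
    also have "\<dots> = (\<Prod>i\<in>U. A i (p i))"
      using eq by (intro prod.cong refl) (metis transpose_apply_first transpose_apply_other transpose_apply_second)
    finally show "real_of_int (sign (p \<circ> ?t)) * (\<Prod>i\<in>U. A i (p (?t i))) = - ?F p"
      using s by (simp add: comp_def)
  qed
  also have "\<dots> = - det_on U A" by (simp add: det_on_def sum_negf)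
  finally show ?thesis by simp
qed

lemma det_unit_row:
  assumes "finite V" "k \<notin> V"
  shows "det_on (insert k V) (A(k := (\<lambda>j. if j = k then 1 else 0))) = det_on V A"
proof -
  have S: "{p. p permutes V} \<subseteq> {p. p permutes insert k V}"
    using permutes_subset by blast
  have "det_on (insert k V) (A(k := (\<lambda>j. if j = k then 1 else 0)))
    = (\<Sum>p | p permutes insert k V. of_int (sign p) * ((if p k = k then 1 else 0) * (\<Prod>i\<in>V. A i (p i))))"
    using assms by (subst det_row_split) auto
  also have "\<dots> = (\<Sum>p | p permutes V. of_int (sign p) * ((if p k = k then 1 else 0) * (\<Prod>i\<in>V. A i (p i))))"
  proof (rule sum.mono_neutral_right)
    show "finite {p. p permutes insert k V}" using assms by (simp add: finite_permutations)
    show "\<forall>p\<in>{p. p permutes insert k V} - {p. p permutes V}.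
        real_of_int (sign p) * ((if p k = k then 1 else 0) * (\<Prod>i\<in>V. A i (p i))) = 0"
      using permutes_superset[of _ "insert k V" V] by auto
  qed (rule S)
  also have "\<dots> = det_on V A" unfolding det_on_def
    using assms permutes_not_in by (intro sum.cong refl) fastforce
  finally show ?thesis .
qed

text \<open>Since \<open>e\<^sup>T A = s \<delta>\<^sub>k\<^sup>T\<close>, row \<open>k\<close> is a combination of the other rows and of \<open>s \<delta>\<^sub>k\<^sup>T\<close>; only
  the latter contributes to the determinant.\<close>

lemma det_insert:
  assumes "finite V" "k \<notin> V" "symm_on (insert k V) A" "posdef_on V A"
  shows "det_on (insert k V) A = det_on V A * schur V A k"
proof -
  interpret bordered V A k by (rule bordered_posdef[OF assms])
  let ?U = "insert k V"
  let ?R = "\<lambda>m. if m = k then (\<lambda>j. if j = k then 1 else 0) else A m"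
  let ?c = "\<lambda>m. if m = k then s else - e m"
  have row: "A k j = (\<Sum>m\<in>?U. ?c m * ?R m j)" if j: "j \<in> ?U" for j
  proof -
    have "(\<Sum>m\<in>?U. ?c m * ?R m j) = s * (if j = k then 1 else 0) - (\<Sum>m\<in>V. e m * A m j)"
    proof -
      have "(\<Sum>m\<in>V. ?c m * ?R m j) = (\<Sum>m\<in>V. - (e m * A m j))"
        using k by (intro sum.cong refl) auto
      then show ?thesis using fin k by (simp add: sum_negf)
    qed
    also have "\<dots> = A k j"
    proof -
      have "A k j + (\<Sum>m\<in>V. e m * A m j) = (if j = k then s else 0)"
        using e_A[OF j] fin k e_k by simp
      then show ?thesis by (cases "j = k") auto
    qed
    finally show ?thesis by simp
  qed
  have "det_on ?U A = det_on ?U (A(k := (\<lambda>j. \<Sum>m\<in>?U. ?c m * ?R m j)))"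
    unfolding det_on_def
  proof (intro sum.cong refl arg_cong2[where f="(*)"] prod.cong)
    fix p i assume "p \<in> {p. p permutes insert k V}" "i \<in> insert k V"
    then have "p i \<in> ?U" using permutes_in_image[of p "insert k V" i] by blast
    then show "A i (p i) = (A(k := (\<lambda>j. \<Sum>m\<in>?U. ?c m * ?R m j))) i (p i)"
      using row[of "p i"] by (cases "i = k") (simp_all only: fun_upd_same fun_upd_other not_False_eq_True)
  qed
  also have "\<dots> = (\<Sum>m\<in>?U. ?c m * det_on ?U (A(k := ?R m)))"
    using fin by (subst det_row_sum) auto
  also have "\<dots> = s * det_on ?U (A(k := ?R k)) + (\<Sum>m\<in>V. ?c m * det_on ?U (A(k := ?R m)))"
    using fin k by simp
  also have "(\<Sum>m\<in>V. ?c m * det_on ?U (A(k := ?R m))) = 0"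
  proof (intro sum.neutral ballI)
    fix m assume "m \<in> V"
    then show "?c m * det_on ?U (A(k := ?R m)) = 0"
      using k fin det_equal_rows[of ?U k m "A(k := A m)"] by auto
  qed
  also have "det_on ?U (A(k := ?R k)) = det_on V A" using det_unit_row[OF fin k] by simp
  finally show ?thesis by simp
qed

lemma det_pos:
  assumes "finite U" "symm_on U A" "posdef_on U A"
  shows "0 < det_on U A"
  using assms
proof (induction U rule: finite_induct)
  case (insert k V)
  then show ?case
    using posdef_insert[of V k A] det_insert[of V k A] symm_on_subset[of "insert k V" A V] zero_less_mult_iff
    by auto
qed (simp add: det_on_def)

subsection \<open>Measurability\<close>

text \<open>Measurability of the inverse is proved along the recursion over the vertices, where the
  pivot and the Schur complement are rational expressions; the domain of positive definite
  matrices is the set where all Schur complements are positive. Off the domain the inverse is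
  replaced by \<open>0\<close>, because \<^const>\<open>inv_on\<close> is unspecified for singular matrices.\<close>

lemma posdef_inv_measurable:
  assumes "finite U" "\<And>i j. i \<in> U \<Longrightarrow> j \<in> U \<Longrightarrow> (\<lambda>x. A x i j) \<in> borel_measurable N"
    and "\<And>x. x \<in> space N \<Longrightarrow> symm_on U (A x)"
  shows "{x \<in> space N. posdef_on U (A x)} \<in> sets N \<and>
    (\<forall>i j. (\<lambda>x. if posdef_on U (A x) then inv_on U (A x) i j else 0) \<in> borel_measurable N)"
  using assms
proof (induction U rule: finite_induct)
  case empty
  have "posdef_on {} (A x)" for x by (simp add: posdef_on_def)
  moreover have "inv_on {} (A x) i j = 0" for x i j
    by (rule inv_outside) (auto simp: symm_on_def posdef_on_def)
  ultimately show ?case by simp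
next
  case (insert k V)
  have sV: "\<And>x. x \<in> space N \<Longrightarrow> symm_on V (A x)"
    using insert.prems(2) symm_on_subset by (metis subset_insertI)
  define I where "I = (\<lambda>x i j. if posdef_on V (A x) then inv_on V (A x) i j else 0)"
  have IH: "{x \<in> space N. posdef_on V (A x)} \<in> sets N" "\<And>i j. (\<lambda>x. I x i j) \<in> borel_measurable N"
    using insert.IH insert.prems(1) sV unfolding I_def by auto
  define S where "S = (\<lambda>x. A x k k - (\<Sum>i\<in>V. \<Sum>j\<in>V. A x k i * I x i j * A x j k))"
  define P where "P = (\<lambda>x i. (if i = k then 1 else 0) - (\<Sum>j\<in>V. I x i j * A x j k))"
  have [measurable]: "\<And>i j. (\<lambda>x. I x i j) \<in> borel_measurable N" by fact
  have [measurable]: "S \<in> borel_measurable N" unfolding S_def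
    using insert.prems(1) by (intro borel_measurable_diff borel_measurable_sum borel_measurable_times) auto
  have [measurable]: "(\<lambda>x. P x i) \<in> borel_measurable N" for i unfolding P_def
    using insert.prems(1) by (intro borel_measurable_diff borel_measurable_sum borel_measurable_times) auto
  have "{x \<in> space N. posdef_on (insert k V) (A x)}
      = {x \<in> space N. posdef_on V (A x)} \<inter> {x \<in> space N. 0 < S x}"
    using posdef_insert[OF insert.hyps insert.prems(2)] by (auto simp: S_def I_def schur_def)
  also have "\<dots> \<in> sets N" by (rule sets.Int[OF IH(1)]) measurable
  finally have 1: "{x \<in> space N. posdef_on (insert k V) (A x)} \<in> sets N" .
  have "(\<lambda>x. if posdef_on (insert k V) (A x) then inv_on (insert k V) (A x) i j else 0) \<in> borel_measurable N" for i j
  proof -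
    have "(\<lambda>x. if x \<in> {x \<in> space N. posdef_on (insert k V) (A x)} then I x i j + P x i * P x j / S x else 0)
        \<in> borel_measurable N"
      using 1 by measurable
    then show ?thesis
      apply (rule measurable_cong[THEN iffD1, rotated])
      using posdef_insert[OF insert.hyps insert.prems(2)] inv_insert[OF insert.hyps insert.prems(2)]
      by (auto simp: S_def I_def schur_def P_def pivot_def)
  qed
  with 1 show ?case by blast
qed

lemma det_measurable:
  assumes "\<And>i j. i \<in> U \<Longrightarrow> j \<in> U \<Longrightarrow> (\<lambda>x. A x i j) \<in> borel_measurable N"
  shows "(\<lambda>x. det_on U (A x)) \<in> borel_measurable N"
  unfolding det_on_def
proof (intro borel_measurable_sum borel_measurable_times borel_measurable_const borel_measurable_prod)
  fix p i assume "p \<in> {p. p permutes U}" "i \<in> U"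
  then show "(\<lambda>x. A x i (p i)) \<in> borel_measurable N"
    using assms by (simp add: permutes_in_image)
qed

section \<open>An inverse Gaussian integral\<close>

text \<open>The error function without its normalisation. As an interval integral it is defined,
  and differentiable, on the whole line, with \<open>gauss 0 = 0\<close>.\<close>

definition gauss :: "real \<Rightarrow> real" where
  "gauss x = (LBINT y=0..ereal x. exp (- y\<^sup>2))"

lemma gauss_deriv: "(gauss has_real_derivative exp (- x\<^sup>2)) (at x)"
proof -
  let ?a = "- (\<bar>x\<bar> + 1)" and ?b = "\<bar>x\<bar> + 1"
  have "((\<lambda>u. LBINT y=ereal 0..ereal u. exp (- y\<^sup>2)) has_vector_derivative exp (- x\<^sup>2)) (at x within {?a..?b})"
    by (rule interval_integral_FTC2) (auto intro!: continuous_intros)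
  then have "(gauss has_vector_derivative exp (- x\<^sup>2)) (at x within {?a..?b})"
    unfolding gauss_def[abs_def] by (simp add: zero_ereal_def)
  then have "(gauss has_vector_derivative exp (- x\<^sup>2)) (at x)"
    by (simp add: at_within_Icc_at abs_le_iff)
  then show ?thesis by (simp add: has_real_derivative_iff_has_vector_derivative)
qed

lemma gauss_top: "(gauss \<longlongrightarrow> sqrt pi / 2) at_top"
proof -
  let ?f = "\<lambda>x. indicator {0..} x *\<^sub>R exp (- x\<^sup>2) :: real"
  have hb: "has_bochner_integral lborel ?f (sqrt pi / 2)" by (rule gaussian_moment_0)
  have 1: "((\<lambda>y. \<integral>x. indicator {..y} x *\<^sub>R ?f x \<partial>lborel) \<longlongrightarrow> (\<integral>x. ?f x \<partial>lborel)) at_top"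
    using hb by (intro tendsto_integral_at_top) (auto simp: has_bochner_integral_iff)
  have 2: "(\<integral>x. ?f x \<partial>lborel) = sqrt pi / 2" using hb by (simp add: has_bochner_integral_iff)
  have 3: "\<forall>\<^sub>F y in at_top. (\<integral>x. indicator {..y} x *\<^sub>R ?f x \<partial>lborel) = gauss y"
    using eventually_ge_at_top[of 0]
  proof eventually_elim
    case (elim y)
    have "gauss y = (LBINT x:{0..y}. exp (- x\<^sup>2))"
      unfolding gauss_def zero_ereal_def using elim by (subst interval_integral_Icc) auto
    also have "\<dots> = (\<integral>x. indicator {..y} x *\<^sub>R ?f x \<partial>lborel)"
      unfolding set_lebesgue_integral_def by (intro Bochner_Integration.integral_cong) (auto simp: indicator_def)
    finally show ?case by simp
  qed
  show ?thesis using 1 unfolding tendsto_cong[OF 3] 2 .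
qed

lemma gauss_bot: "(gauss \<longlongrightarrow> - (sqrt pi / 2)) at_bot"
proof -
  have odd: "gauss (- x) = - gauss x" for x
  proof -
    have "((\<lambda>x. gauss (- x) + gauss x) has_real_derivative 0) (at y)" for y
      by (rule derivative_eq_intros DERIV_chain2[OF gauss_deriv] gauss_deriv refl | simp)+
    then have "gauss (- x) + gauss x = gauss (- 0) + gauss 0" by (intro DERIV_isconst_all allI)
    moreover have "gauss 0 = 0" by (simp add: gauss_def zero_ereal_def[symmetric])
    ultimately show ?thesis by simp
  qed
  have "((\<lambda>x. - gauss (- x)) \<longlongrightarrow> - (sqrt pi / 2)) at_bot"
    by (intro tendsto_minus filterlim_compose[OF gauss_top] filterlim_uminus_at_top_at_bot)
  then show ?thesis by (simp add: odd)
qed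

text \<open>The function \<open>e\<^sup>-\<^sup>t gauss (x - y) + e\<^sup>t gauss (x + y)\<close> with \<open>x\<^sup>2 = s / 2\<close> and \<open>x y = t / 2\<close>
  is an antiderivative of the integrand: both Gaussian factors equal
  \<open>exp (- (s + t\<^sup>2 / s) / 2)\<close>, and the two chain-rule terms containing \<open>t\<close> cancel.\<close>

lemma inverse_gaussian_integral:
  assumes t: "0 \<le> t"
  shows "(\<integral>\<^sup>+ s. ennreal (indicator {0<..} s * (exp (- (1/2) * (s + t\<^sup>2 / s)) / sqrt s)) \<partial>lborel)
     = ennreal (sqrt (2 * pi) * exp (- t))"
proof -
  let ?u = "\<lambda>s. (sqrt s - t / sqrt s) / sqrt 2" and ?v = "\<lambda>s. (sqrt s + t / sqrt s) / sqrt 2"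
  define F where "F s = exp (- t) * gauss (?u s) + exp t * gauss (?v s)" for s
  \<comment> \<open>The substitution adds a factor \<open>1 / \<surd>2\<close> to the integrand, which is taken out at the end.\<close>
  define f where "f s = exp (- (1/2) * (s + t\<^sup>2 / s)) / (sqrt 2 * sqrt s)" for s :: real
  have dF: "(F has_real_derivative f s) (at s)" if s: "0 < s" for s
  proof -
    have q: "sqrt s * sqrt s = s" using s by simp
    have du: "(?u has_real_derivative (1 / sqrt s + t / (s * sqrt s)) / (2 * sqrt 2)) (at s)"
      using s by (auto intro!: derivative_eq_intros simp: field_simps)
    have dv: "(?v has_real_derivative (1 / sqrt s - t / (s * sqrt s)) / (2 * sqrt 2)) (at s)"
      using s by (auto intro!: derivative_eq_intros simp: field_simps)
    have squ: "(?u s)\<^sup>2 = (s + t\<^sup>2 / s) / 2 - t"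
      using s by (simp add: power_divide power2_diff diff_divide_distrib power_mult_distrib)
    have sqv: "(?v s)\<^sup>2 = (s + t\<^sup>2 / s) / 2 + t"
      using s by (simp add: power_divide power2_sum add_divide_distrib power_mult_distrib)
    have eu: "exp (- t) * exp (- (?u s)\<^sup>2) = exp (- (1/2) * (s + t\<^sup>2 / s))"
      unfolding squ exp_add[symmetric] by simp
    have ev: "exp t * exp (- (?v s)\<^sup>2) = exp (- (1/2) * (s + t\<^sup>2 / s))"
      unfolding sqv exp_add[symmetric] by simp
    have "(F has_real_derivative
       exp (- t) * (exp (- (?u s)\<^sup>2) * ((1 / sqrt s + t / (s * sqrt s)) / (2 * sqrt 2)))
     + exp t * (exp (- (?v s)\<^sup>2) * ((1 / sqrt s - t / (s * sqrt s)) / (2 * sqrt 2)))) (at s)"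
      unfolding F_def[abs_def]
      by (intro DERIV_add DERIV_cmult DERIV_chain2[OF gauss_deriv du] DERIV_chain2[OF gauss_deriv dv])
    moreover have "exp (- t) * (exp (- (?u s)\<^sup>2) * ((1 / sqrt s + t / (s * sqrt s)) / (2 * sqrt 2)))
     + exp t * (exp (- (?v s)\<^sup>2) * ((1 / sqrt s - t / (s * sqrt s)) / (2 * sqrt 2)))
     = exp (- (1/2) * (s + t\<^sup>2 / s)) * ((1 / sqrt s + t / (s * sqrt s)) / (2 * sqrt 2)
         + (1 / sqrt s - t / (s * sqrt s)) / (2 * sqrt 2))"
      unfolding mult.assoc[symmetric] eu ev by (simp only: distrib_left mult.assoc)
    moreover have "(1 / sqrt s + t / (s * sqrt s)) / (2 * sqrt 2)
         + (1 / sqrt s - t / (s * sqrt s)) / (2 * sqrt 2) = 1 / (sqrt 2 * sqrt s)"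
      using s by (simp add: field_simps)
    ultimately show ?thesis by (simp add: f_def)
  qed
  have limB: "(F \<longlongrightarrow> (exp (- t) + exp t) * (sqrt pi / 2)) at_top"
  proof -
    have "filterlim ?u at_top at_top" "filterlim ?v at_top at_top" by real_asymp+
    then have "(F \<longlongrightarrow> exp (- t) * (sqrt pi / 2) + exp t * (sqrt pi / 2)) at_top"
      unfolding F_def[abs_def] by (intro tendsto_intros filterlim_compose[OF gauss_top])
    then show ?thesis by (simp add: distrib_right add_divide_distrib)
  qed
  \<comment> \<open>At \<open>0\<close> the argument \<open>(\<surd>s - t / \<surd>s) / \<surd>2\<close> tends to \<open>-\<infinity>\<close> only if \<open>t > 0\<close>.\<close>
  have limA: "(F \<longlongrightarrow> (exp t - exp (- t)) * (sqrt pi / 2)) (at_right 0)"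
  proof (cases "t = 0")
    case True
    have "((\<lambda>s. gauss (sqrt s / sqrt 2)) \<longlongrightarrow> gauss (sqrt 0 / sqrt 2)) (at_right 0)"
      by (intro isCont_tendsto_compose[OF DERIV_isCont[OF gauss_deriv]] tendsto_intros) simp
    then have "((\<lambda>s. gauss (sqrt s / sqrt 2)) \<longlongrightarrow> 0) (at_right 0)" by (simp add: gauss_def zero_ereal_def[symmetric])
    from tendsto_mult[OF tendsto_const[of 2] this] show ?thesis
      using True by (simp add: F_def[abs_def])
  next
    case False
    then have t': "t > 0" using t by simp
    have "filterlim ?u at_bot (at_right 0)" "filterlim ?v at_top (at_right 0)"
      using t' by real_asymp+
    then have "(F \<longlongrightarrow> exp (- t) * (- (sqrt pi / 2)) + exp t * (sqrt pi / 2)) (at_right 0)"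
      unfolding F_def[abs_def]
      by (intro tendsto_intros filterlim_compose[OF gauss_top] filterlim_compose[OF gauss_bot])
    then show ?thesis by (simp add: algebra_simps diff_divide_distrib)
  qed
  have f_nonneg: "0 \<le> f s" if "0 < s" for s using that by (simp add: f_def)
  have "set_integrable lborel (einterval 0 \<infinity>) f"
    "(LBINT s=0..\<infinity>. f s) = sqrt pi * exp (- t)"
  proof -
    have c: "isCont f s" if "0 < s" for s
      unfolding f_def using that by (intro continuous_intros) auto
    have A: "((F \<circ> real_of_ereal) \<longlongrightarrow> (exp t - exp (- t)) * (sqrt pi / 2)) (at_right 0)"
      unfolding zero_ereal_def using limA by (simp add: ereal_tendsto_simps)
    have B: "((F \<circ> real_of_ereal) \<longlongrightarrow> (exp (- t) + exp t) * (sqrt pi / 2)) (at_left \<infinity>)"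
      using limB by (simp add: ereal_tendsto_simps)
    have pos: "0 < s" if "0 < ereal s" for s using that by simp
    note FTC = interval_integral_FTC_nonneg[of 0 \<infinity> F f, OF _ dF[OF pos] c[OF pos] _ A B]
    show "set_integrable lborel (einterval 0 \<infinity>) f"
      by (rule FTC(1)) (use f_nonneg in auto)
    show "(LBINT s=0..\<infinity>. f s) = sqrt pi * exp (- t)"
    proof -
      have eq: "(exp (- t) + exp t) * (sqrt pi / 2) - (exp t - exp (- t)) * (sqrt pi / 2) = sqrt pi * exp (- t)"
        by (simp add: field_simps)
      show ?thesis unfolding eq[symmetric] by (rule FTC(2)) (use f_nonneg in auto)
    qed
  qed
  then have si: "integrable lborel (\<lambda>s. indicator {0<..} s * f s)"
    and "(\<integral>s. indicator {0<..} s * f s \<partial>lborel) = sqrt pi * exp (- t)"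
    by (simp_all add: set_integrable_def einterval_eq zero_ereal_def interval_lebesgue_integral_def
      set_lebesgue_integral_def)
  then have "(\<integral>\<^sup>+ s. ennreal (indicator {0<..} s * f s) \<partial>lborel) = ennreal (sqrt pi * exp (- t))"
    using nn_integral_eq_integral[OF si] f_nonneg by (simp add: indicator_def)
  then have "ennreal (sqrt 2) * (\<integral>\<^sup>+ s. ennreal (indicator {0<..} s * f s) \<partial>lborel)
      = ennreal (sqrt (2 * pi) * exp (- t))"
    by (simp add: ennreal_mult'[symmetric] real_sqrt_mult mult.assoc)
  moreover have "ennreal (sqrt 2) * (\<integral>\<^sup>+ s. ennreal (indicator {0<..} s * f s) \<partial>lborel)
     = (\<integral>\<^sup>+ s. ennreal (sqrt 2) * ennreal (indicator {0<..} s * f s) \<partial>lborel)"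
    using si by (intro nn_integral_cmult[symmetric]) auto
  moreover have "ennreal (sqrt 2) * ennreal (indicator {0<..} s * f s)
     = ennreal (indicator {0<..} s * (exp (- (1/2) * (s + t\<^sup>2 / s)) / sqrt s))" for s
    unfolding ennreal_mult'[symmetric, OF real_sqrt_ge_zero[OF zero_le_numeral]]
    by (simp add: f_def indicator_def)
  ultimately show ?thesis by simp
qed

section \<open>The finite-volume measures\<close>

definition nu_dens :: "'a set \<Rightarrow> ('a \<Rightarrow> 'a \<Rightarrow> real) \<Rightarrow> ('a \<Rightarrow> real) \<Rightarrow> ('a \<Rightarrow> real) \<Rightarrow> real" where
  "nu_dens U W \<eta> \<beta> = indicator (dom_fin U W) \<beta> * (2 / pi) powr (real (card U) / 2)
      * exp (- (1/2) * ((\<Sum>i\<in>U. \<Sum>j\<in>U. Hmat W \<beta> i j)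
                        + (\<Sum>i\<in>U. \<Sum>j\<in>U. \<eta> i * inv_on U (Hmat W \<beta>) i j * \<eta> j)))
      * exp (\<Sum>i\<in>U. \<eta> i) / sqrt (det_on U (Hmat W \<beta>))"

lemma nu_fin_dens: "nu_fin U W \<eta> = density (PiM U (\<lambda>_. lborel)) (\<lambda>\<beta>. ennreal (nu_dens U W \<eta> \<beta>))"
  unfolding nu_fin_def nu_dens_def ..

definition weights_on :: "'a set \<Rightarrow> ('a \<Rightarrow> 'a \<Rightarrow> real) \<Rightarrow> bool" where
  "weights_on U W \<longleftrightarrow> (\<forall>i\<in>U. \<forall>j\<in>U. W i j = W j i \<and> 0 \<le> W i j) \<and> (\<forall>i\<in>U. W i i = 0)"

lemma weights_on_subset: "weights_on U W \<Longrightarrow> V \<subseteq> U \<Longrightarrow> weights_on V W"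
  unfolding weights_on_def by blast

lemma weights_onD:
  assumes "weights_on U W" "i \<in> U" "j \<in> U"
  shows "W i j = W j i" "0 \<le> W i j" "W i i = 0"
  using assms unfolding weights_on_def by blast+

lemma Hmat_symm: "weights_on U W \<Longrightarrow> symm_on U (Hmat W \<beta>)"
  unfolding symm_on_def Hmat_def using weights_onD(1) by fastforce

lemma Hmat_Zmat: "weights_on U W \<Longrightarrow> Zmat U (Hmat W \<beta>)"
  unfolding Zmat_def Hmat_def using weights_onD(2) by fastforce

lemma inv_on_cong:
  assumes "\<And>i j. i \<in> U \<Longrightarrow> j \<in> U \<Longrightarrow> A i j = B i j"
  shows "inv_on U A = inv_on U B"
proof -
  have "(\<Sum>k\<in>U. A i k * C k j) = (\<Sum>k\<in>U. B i k * C k j)"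
    "(\<Sum>k\<in>U. C j k * A k i) = (\<Sum>k\<in>U. C j k * B k i)" if "i \<in> U" for i j C
    using assms that by (auto intro!: sum.cong)
  then have "is_inv_on U A C \<longleftrightarrow> is_inv_on U B C" for C
    unfolding is_inv_on_def by simp
  then show ?thesis unfolding inv_on_def is_inv_on_def[symmetric] by simp
qed

lemma posdef_on_cong:
  assumes "\<And>i j. i \<in> U \<Longrightarrow> j \<in> U \<Longrightarrow> A i j = B i j"
  shows "posdef_on U A \<longleftrightarrow> posdef_on U B"
proof -
  have "(\<Sum>i\<in>U. \<Sum>j\<in>U. f i * A i j * f j) = (\<Sum>i\<in>U. \<Sum>j\<in>U. f i * B i j * f j)" for f
    using assms by (auto intro!: sum.cong)
  then show ?thesis unfolding posdef_on_def by simp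
qed

lemma det_on_cong:
  assumes "\<And>i j. i \<in> U \<Longrightarrow> j \<in> U \<Longrightarrow> A i j = B i j"
  shows "det_on U A = det_on U B"
  unfolding det_on_def
proof (intro sum.cong refl arg_cong2[where f="(*)"] prod.cong)
  fix p i assume "p \<in> {p. p permutes U}" "i \<in> U"
  then have "p i \<in> U" using permutes_in_image[of p U i] by blast
  then show "A i (p i) = B i (p i)" using assms \<open>i \<in> U\<close> by blast
qed

lemma Hmat_cong: "\<beta> i = \<beta>' i \<Longrightarrow> Hmat W \<beta> i j = Hmat W \<beta>' i j"
  by (cases "i = j") (simp_all add: Hmat_def)

lemma nu_dens_cong:
  assumes "\<And>i. i \<in> U \<Longrightarrow> \<beta> i = \<beta>' i" "\<And>i. i \<in> U \<Longrightarrow> \<eta> i = \<eta>' i"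
  shows "nu_dens U W \<eta> \<beta> = nu_dens U W \<eta>' \<beta>'"
proof -
  have H: "Hmat W \<beta> i j = Hmat W \<beta>' i j" if "i \<in> U" for i j
    using assms(1)[OF that] by (rule Hmat_cong)
  have "posdef_on U (Hmat W \<beta>) = posdef_on U (Hmat W \<beta>')"
    "inv_on U (Hmat W \<beta>) = inv_on U (Hmat W \<beta>')"
    "det_on U (Hmat W \<beta>) = det_on U (Hmat W \<beta>')"
    by (intro posdef_on_cong inv_on_cong det_on_cong H; assumption)+
  moreover have "(\<Sum>i\<in>U. \<Sum>j\<in>U. Hmat W \<beta> i j) = (\<Sum>i\<in>U. \<Sum>j\<in>U. Hmat W \<beta>' i j)"
    using H by (intro sum.cong refl) blast
  moreover have "(\<Sum>i\<in>U. \<eta> i) = (\<Sum>i\<in>U. \<eta>' i)"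
    "\<And>G. (\<Sum>i\<in>U. \<Sum>j\<in>U. \<eta> i * G i j * \<eta> j) = (\<Sum>i\<in>U. \<Sum>j\<in>U. \<eta>' i * G i j * \<eta>' j)"
    using assms(2) by (auto intro!: sum.cong)
  ultimately show ?thesis by (simp add: nu_dens_def dom_fin_def indicator_def)
qed

lemma nu_fin_cong: "(\<And>i. i \<in> U \<Longrightarrow> \<eta> i = \<eta>' i) \<Longrightarrow> nu_fin U W \<eta> = nu_fin U W \<eta>'"
  unfolding nu_fin_dens by (intro arg_cong2[where f=density] ext refl arg_cong[where f=ennreal] nu_dens_cong) auto

text \<open>Measurability is stated with weights that may depend on a further parameter, as the
  boundary weights depend on the potential.\<close>

lemma Hmat_inv_measurable:
  assumes "finite U"
    and W: "\<And>i j. i \<in> U \<Longrightarrow> j \<in> U \<Longrightarrow> (\<lambda>x. W x i j) \<in> borel_measurable N"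
    and b: "\<And>i. i \<in> U \<Longrightarrow> (\<lambda>x. b x i) \<in> borel_measurable N"
    and w: "\<And>x. x \<in> space N \<Longrightarrow> weights_on U (W x)"
  shows "{x \<in> space N. posdef_on U (Hmat (W x) (b x))} \<in> sets N"
    "(\<lambda>x. if posdef_on U (Hmat (W x) (b x)) then inv_on U (Hmat (W x) (b x)) i j else 0) \<in> borel_measurable N"
proof -
  have "(\<lambda>x. Hmat (W x) (b x) i j) \<in> borel_measurable N" if "i \<in> U" "j \<in> U" for i j
    unfolding Hmat_def using W[OF that] b[OF that(1)] by (cases "i = j") simp_all
  note * = posdef_inv_measurable[OF assms(1), of "\<lambda>x. Hmat (W x) (b x)" N, OF this Hmat_symm[OF w]]
  from * show "{x \<in> space N. posdef_on U (Hmat (W x) (b x))} \<in> sets N" by blast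
  from * show "(\<lambda>x. if posdef_on U (Hmat (W x) (b x)) then inv_on U (Hmat (W x) (b x)) i j else 0)
    \<in> borel_measurable N" by blast
qed

lemma nu_dens_measurable:
  assumes "finite U"
    and W: "\<And>i j. i \<in> U \<Longrightarrow> j \<in> U \<Longrightarrow> (\<lambda>x. W x i j) \<in> borel_measurable N"
    and b: "\<And>i. i \<in> U \<Longrightarrow> (\<lambda>x. b x i) \<in> borel_measurable N"
    and w: "\<And>x. x \<in> space N \<Longrightarrow> weights_on U (W x)"
  shows "(\<lambda>x. nu_dens U (W x) \<eta> (b x)) \<in> borel_measurable N"
proof -
  define P where "P = {x \<in> space N. posdef_on U (Hmat (W x) (b x))}"
  define I where "I x i j = (if posdef_on U (Hmat (W x) (b x)) then inv_on U (Hmat (W x) (b x)) i j else 0)" for x i j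
  have [measurable]: "P \<in> sets N" "\<And>i j. (\<lambda>x. I x i j) \<in> borel_measurable N"
    unfolding P_def I_def using Hmat_inv_measurable[OF assms] by auto
  have H: "(\<lambda>x. Hmat (W x) (b x) i j) \<in> borel_measurable N" if "i \<in> U" "j \<in> U" for i j
    unfolding Hmat_def using W[OF that] b[OF that(1)] by (cases "i = j") simp_all
  have [measurable]: "(\<lambda>x. \<Sum>i\<in>U. \<Sum>j\<in>U. Hmat (W x) (b x) i j) \<in> borel_measurable N"
    using H by (intro borel_measurable_sum) auto
  have [measurable]: "(\<lambda>x. det_on U (Hmat (W x) (b x))) \<in> borel_measurable N"
    by (rule det_measurable) (rule H)
  have "(\<lambda>x. indicator P x * (2 / pi) powr (real (card U) / 2)
      * exp (- (1/2) * ((\<Sum>i\<in>U. \<Sum>j\<in>U. Hmat (W x) (b x) i j)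
                        + (\<Sum>i\<in>U. \<Sum>j\<in>U. \<eta> i * I x i j * \<eta> j)))
      * exp (\<Sum>i\<in>U. \<eta> i) / sqrt (det_on U (Hmat (W x) (b x)))) \<in> borel_measurable N"
    by measurable
  then show ?thesis
    by (rule measurable_cong[THEN iffD1, rotated])
      (auto simp: nu_dens_def P_def I_def dom_fin_def indicator_def)
qed

lemma nu_dens_measurable':
  assumes "finite U" "weights_on U W"
  shows "nu_dens U W \<eta> \<in> borel_measurable (PiM U (\<lambda>_. lborel))"
  using assms by (intro nu_dens_measurable) (auto intro: measurable_component_singleton)

lemma sets_nu_fin [simp]: "sets (nu_fin U W \<eta>) = sets (PiM U (\<lambda>_. borel))"
  by (simp add: nu_fin_dens cong: sets_PiM_cong)

lemma space_nu_fin [simp]: "space (nu_fin U W \<eta>) = space (PiM U (\<lambda>_. borel))"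
  by (rule sets_eq_imp_space_eq) simp

lemma nu_dens_nonneg:
  assumes "finite U" "weights_on U W"
  shows "0 \<le> nu_dens U W \<eta> \<beta>"
  using det_pos[OF assms(1) Hmat_symm[OF assms(2)], of \<beta>]
  by (auto simp: nu_dens_def dom_fin_def indicator_def)

text \<open>Conditioning the quadratic form on \<open>k\<close> removes the vertex \<open>k\<close>: the Schur complement is
  \<open>s = 2 y - c\<close>, the determinant and the inverse factor through it, and what is left is the
  inverse Gaussian integral with \<open>t = \<langle>e, \<eta>\<rangle>\<close>. Its value \<open>e\<^sup>-\<^sup>t\<close> is what turns the boundary
  weight \<open>\<eta>\<close> into \<open>\<eta> + W \<delta>\<^sub>k\<close> on the remaining vertices.\<close>

lemma nu_dens_integrate_vertex:
  assumes fin: "finite V" and k: "k \<notin> V" and W: "weights_on (insert k V) W"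
    and \<eta>: "\<And>i. i \<in> insert k V \<Longrightarrow> 0 \<le> \<eta> i"
  shows "(\<integral>\<^sup>+ y. ennreal (nu_dens (insert k V) W \<eta> (\<beta>(k := y))) \<partial>lborel)
    = ennreal (nu_dens V W (\<lambda>i. \<eta> i + W i k) \<beta>)"
proof -
  let ?U = "insert k V"
  let ?H = "\<lambda>y. Hmat W (\<beta>(k := y))"
  have WV: "weights_on V W" using weights_on_subset[OF W] by blast
  have HV: "?H y i j = Hmat W \<beta> i j" if "i \<in> V" for i j y
    using that k by (intro Hmat_cong) auto
  have pdV: "posdef_on V (?H y) \<longleftrightarrow> posdef_on V (Hmat W \<beta>)" for y
    by (rule posdef_on_cong) (rule HV)
  have sy: "symm_on ?U (?H y)" for y by (rule Hmat_symm[OF W])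
  show ?thesis
  proof (cases "posdef_on V (Hmat W \<beta>)")
    case False
    then have "\<not> posdef_on ?U (?H y)" for y
      using posdef_on_subset[of ?U "?H y" V] fin pdV[of y] by blast
    then show ?thesis using False by (simp add: nu_dens_def dom_fin_def)
  next
    case True
    define G where "G = inv_on V (Hmat W \<beta>)"
    have G: "inv_on V (?H y) = G" for y unfolding G_def by (rule inv_on_cong) (rule HV)
    have G0: "0 \<le> G i j" for i j
      unfolding G_def by (rule inv_nonneg[OF fin Hmat_symm[OF WV] True Hmat_Zmat[OF WV]])
    have Gs: "G i j = G j i" for i j
      unfolding G_def by (rule inv_sym[OF fin Hmat_symm[OF WV] True])
    define c where "c = (\<Sum>i\<in>V. \<Sum>j\<in>V. W k i * G i j * W j k)"
    define e where "e i = (\<Sum>j\<in>V. G i j * W j k)" for i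
    define t where "t = \<eta> k + (\<Sum>i\<in>V. e i * \<eta> i)"
    have Wsym: "W i k = W k i" if "i \<in> V" for i using weights_onD(1)[OF W, of i k] that by blast
    have W0: "0 \<le> W i k" if "i \<in> V" for i using weights_onD(2)[OF W, of i k] that by blast
    have Wk: "W k k = 0" using weights_onD(3)[OF W, of k k] by blast
    have t0: "0 \<le> t" unfolding t_def e_def
      using \<eta> W0 G0 by (intro add_nonneg_nonneg sum_nonneg mult_nonneg_nonneg) auto
    have Hik: "?H y i k = - W i k" "?H y k i = - W k i" if "i \<in> V" for i y
      using that k by (auto simp: Hmat_def)
    have sch: "schur V (?H y) k = 2 * y - c" for y
      unfolding schur_def G c_def using Wk Hik by (simp add: Hmat_def cong: sum.cong)
    have pv: "pivot V (?H y) k i = (if i = k then 1 else 0) + e i" for y i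
      unfolding pivot_def G e_def using Hik by (simp add: sum_negf cong: sum.cong)
    have ek: "e k = 0" unfolding e_def
      using inv_outside[OF fin Hmat_symm[OF WV] True, of k] k by (simp add: G_def)
    have pdU: "posdef_on ?U (?H y) \<longleftrightarrow> 0 < 2 * y - c" for y
      unfolding posdef_insert[OF fin k sy] pdV sch using True by blast
    define D where "D = det_on V (Hmat W \<beta>)"
    have D0: "0 < D" unfolding D_def by (rule det_pos[OF fin Hmat_symm[OF WV] True])
    have det: "det_on ?U (?H y) = D * (2 * y - c)" for y
    proof -
      have "det_on V (?H y) = D" unfolding D_def by (rule det_on_cong) (rule HV)
      then show ?thesis using det_insert[OF fin k sy, of y] True by (simp add: pdV sch)
    qed
    define S where "S = (\<Sum>i\<in>V. \<Sum>j\<in>V. Hmat W \<beta> i j)"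
    have sumH: "(\<Sum>i\<in>?U. \<Sum>j\<in>?U. ?H y i j) = S + 2 * y - 2 * (\<Sum>i\<in>V. W i k)" for y
    proof -
      have "(\<Sum>i\<in>?U. \<Sum>j\<in>?U. ?H y i j) = ?H y k k + (\<Sum>i\<in>V. ?H y k i) + (\<Sum>i\<in>V. ?H y i k)
          + (\<Sum>i\<in>V. \<Sum>j\<in>V. ?H y i j)"
        using fin k by (simp add: sum.distrib)
      also have "(\<Sum>i\<in>V. \<Sum>j\<in>V. ?H y i j) = S" unfolding S_def using HV by (intro sum.cong refl) auto
      also have "(\<Sum>i\<in>V. ?H y k i) = - (\<Sum>i\<in>V. W i k)"
        using Hik Wsym by (simp add: sum_negf)
      also have "(\<Sum>i\<in>V. ?H y i k) = - (\<Sum>i\<in>V. W i k)" using Hik by (simp add: sum_negf)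
      also have "?H y k k = 2 * y" using Wk by (simp add: Hmat_def)
      finally show ?thesis by linarith
    qed
    define q where "q = (\<Sum>i\<in>V. \<Sum>j\<in>V. \<eta> i * G i j * \<eta> j)"
    have quad: "(\<Sum>i\<in>?U. \<Sum>j\<in>?U. \<eta> i * inv_on ?U (?H y) i j * \<eta> j) = q + t\<^sup>2 / (2 * y - c)"
      if "0 < 2 * y - c" for y
    proof -
      let ?p = "\<lambda>i. (if i = k then 1 else 0) + e i"
      have "(\<Sum>i\<in>?U. \<Sum>j\<in>?U. \<eta> i * inv_on ?U (?H y) i j * \<eta> j)
        = (\<Sum>i\<in>?U. \<Sum>j\<in>?U. \<eta> i * G i j * \<eta> j + (?p i * \<eta> i) * (?p j * \<eta> j) / (2 * y - c))"
        using that pdU by (intro sum.cong refl)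
          (simp add: inv_insert[OF fin k sy] G pv sch algebra_simps)
      also have "\<dots> = (\<Sum>i\<in>?U. \<Sum>j\<in>?U. \<eta> i * G i j * \<eta> j) + (\<Sum>i\<in>?U. ?p i * \<eta> i)\<^sup>2 / (2 * y - c)"
        by (simp only: sum.distrib power2_eq_square sum_product sum_divide_distrib)
      also have "(\<Sum>i\<in>?U. ?p i * \<eta> i) = t"
      proof -
        have "(\<Sum>i\<in>V. ?p i * \<eta> i) = (\<Sum>i\<in>V. e i * \<eta> i)" using k by (intro sum.cong refl) auto
        then show ?thesis using fin k ek by (simp add: t_def)
      qed
      also have "(\<Sum>i\<in>?U. \<Sum>j\<in>?U. \<eta> i * G i j * \<eta> j) = q"
        using fin k inv_outside[OF fin Hmat_symm[OF WV] True] by (simp add: q_def G_def)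
      finally show ?thesis .
    qed
    \<comment> \<open>The factor of the density that is constant in \<open>y\<close>.\<close>
    define K where "K = (2 / pi) powr (real (card V) / 2) * sqrt (2 / pi)
      * exp (- (1/2) * (S + q + c) + (\<Sum>i\<in>V. W i k) + (\<Sum>i\<in>V. \<eta> i) + \<eta> k) / sqrt D"
    have K0: "0 \<le> K" unfolding K_def using D0 by simp
    let ?f = "\<lambda>s. indicator {0<..} s * (exp (- (1/2) * (s + t\<^sup>2 / s)) / sqrt s)"
    have dens: "nu_dens ?U W \<eta> (\<beta>(k := y)) = K * ?f (- c + 2 * y)" for y
    proof (cases "0 < 2 * y - c")
      case False
      then show ?thesis using pdU by (simp add: nu_dens_def dom_fin_def)
    next
      case T: True
      have p: "(2 / pi) powr (real (card ?U) / 2) = (2 / pi) powr (real (card V) / 2) * sqrt (2 / pi)"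
        using fin k by (simp add: powr_add add_divide_distrib powr_half_sqrt[symmetric])
      have "nu_dens ?U W \<eta> (\<beta>(k := y)) = (2 / pi) powr (real (card V) / 2) * sqrt (2 / pi)
        * exp (- (1/2) * (S + 2 * y - 2 * (\<Sum>i\<in>V. W i k) + (q + t\<^sup>2 / (2 * y - c))))
        * exp (\<eta> k + (\<Sum>i\<in>V. \<eta> i)) / sqrt (D * (2 * y - c))"
        unfolding nu_dens_def sumH quad[OF T] det p using T pdU fin k by (simp add: dom_fin_def)
      also have "\<dots> = (2 / pi) powr (real (card V) / 2) * sqrt (2 / pi) *
         (exp (- (1/2) * (S + 2 * y - 2 * (\<Sum>i\<in>V. W i k) + (q + t\<^sup>2 / (2 * y - c)))) * exp (\<eta> k + (\<Sum>i\<in>V. \<eta> i)))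
         / (sqrt D * sqrt (2 * y - c))" by (simp add: real_sqrt_mult)
      also have "exp (- (1/2) * (S + 2 * y - 2 * (\<Sum>i\<in>V. W i k) + (q + t\<^sup>2 / (2 * y - c)))) * exp (\<eta> k + (\<Sum>i\<in>V. \<eta> i))
         = exp (- (1/2) * (S + q + c) + (\<Sum>i\<in>V. W i k) + (\<Sum>i\<in>V. \<eta> i) + \<eta> k)
           * exp (- (1/2) * ((- c + 2 * y) + t\<^sup>2 / (- c + 2 * y)))"
        unfolding exp_add[symmetric] by (simp add: algebra_simps)
      also have "(2 / pi) powr (real (card V) / 2) * sqrt (2 / pi) *
         (exp (- (1/2) * (S + q + c) + (\<Sum>i\<in>V. W i k) + (\<Sum>i\<in>V. \<eta> i) + \<eta> k)
           * exp (- (1/2) * ((- c + 2 * y) + t\<^sup>2 / (- c + 2 * y))))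
         / (sqrt D * sqrt (2 * y - c)) = K * ?f (- c + 2 * y)" using T by (simp add: K_def)
      finally show ?thesis .
    qed
    have meas: "(\<lambda>s. ennreal (?f s)) \<in> borel_measurable borel" by measurable
    have "(\<integral>\<^sup>+ y. ennreal (nu_dens ?U W \<eta> (\<beta>(k := y))) \<partial>lborel)
       = (\<integral>\<^sup>+ y. ennreal K * ennreal (?f (- c + 2 * y)) \<partial>lborel)"
      unfolding dens using K0 by (simp only: ennreal_mult')
    also have "\<dots> = ennreal K * (\<integral>\<^sup>+ y. ennreal (?f (- c + 2 * y)) \<partial>lborel)"
      by (rule nn_integral_cmult) measurable
    also have "(\<integral>\<^sup>+ y. ennreal (?f (- c + 2 * y)) \<partial>lborel) = ennreal (sqrt (2 * pi) * exp (- t) / 2)"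
    proof -
      have "ennreal (sqrt (2 * pi) * exp (- t)) = ennreal 2 * (\<integral>\<^sup>+ y. ennreal (?f (- c + 2 * y)) \<partial>lborel)"
        using nn_integral_real_affine[OF meas, of 2 "- c"] inverse_gaussian_integral[OF t0] by simp
      also have "ennreal (sqrt (2 * pi) * exp (- t)) = ennreal 2 * ennreal (sqrt (2 * pi) * exp (- t) / 2)"
        by (subst ennreal_mult'[symmetric]) auto
      finally show ?thesis by (subst (asm) ennreal_mult_cancel_left) auto
    qed
    also have "ennreal K * ennreal (sqrt (2 * pi) * exp (- t) / 2)
        = ennreal (K * (sqrt (2 * pi) * exp (- t) / 2))"
      by (subst ennreal_mult[symmetric]) (use K0 in auto)
    also have "K * (sqrt (2 * pi) * exp (- t) / 2) = nu_dens V W (\<lambda>i. \<eta> i + W i k) \<beta>"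
    proof -
      have s1: "sqrt (2 / pi) * sqrt (2 * pi) = 2"
        by (simp add: real_sqrt_mult[symmetric])
      have e1: "(\<Sum>i\<in>V. \<Sum>j\<in>V. \<eta> i * G i j * W j k) = (\<Sum>i\<in>V. e i * \<eta> i)"
        unfolding e_def by (simp add: sum_distrib_left sum_distrib_right mult_ac)
      have e2: "(\<Sum>i\<in>V. \<Sum>j\<in>V. W i k * G i j * \<eta> j) = (\<Sum>i\<in>V. e i * \<eta> i)"
      proof -
        have "(\<Sum>i\<in>V. \<Sum>j\<in>V. W i k * G i j * \<eta> j) = (\<Sum>j\<in>V. \<Sum>i\<in>V. W i k * G j i * \<eta> j)"
          by (subst sum.swap) (simp only: Gs[of _ _])
        also have "\<dots> = (\<Sum>i\<in>V. e i * \<eta> i)"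
          unfolding e_def by (simp add: sum_distrib_left sum_distrib_right mult_ac)
        finally show ?thesis .
      qed
      have e3: "(\<Sum>i\<in>V. \<Sum>j\<in>V. W i k * G i j * W j k) = c"
        unfolding c_def using Wsym by (intro sum.cong refl) simp
      have "(\<Sum>i\<in>V. \<Sum>j\<in>V. (\<eta> i + W i k) * G i j * (\<eta> j + W j k))
         = q + (\<Sum>i\<in>V. \<Sum>j\<in>V. \<eta> i * G i j * W j k) + (\<Sum>i\<in>V. \<Sum>j\<in>V. W i k * G i j * \<eta> j)
           + (\<Sum>i\<in>V. \<Sum>j\<in>V. W i k * G i j * W j k)"
        unfolding q_def sum.distrib[symmetric] by (intro sum.cong refl) (simp add: algebra_simps)
      also have "\<dots> = q + 2 * (t - \<eta> k) + c" unfolding e1 e2 e3 t_def by simp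
      finally have Q: "(\<Sum>i\<in>V. \<Sum>j\<in>V. (\<eta> i + W i k) * G i j * (\<eta> j + W j k)) = q + 2 * (t - \<eta> k) + c" .
      have "nu_dens V W (\<lambda>i. \<eta> i + W i k) \<beta> = (2 / pi) powr (real (card V) / 2)
        * (exp (- (1/2) * (S + (q + 2 * (t - \<eta> k) + c))) * exp (\<Sum>i\<in>V. \<eta> i + W i k)) / sqrt D"
        unfolding nu_dens_def G_def[symmetric] S_def[symmetric] Q D_def[symmetric]
        using True by (simp add: dom_fin_def)
      also have "exp (- (1/2) * (S + (q + 2 * (t - \<eta> k) + c))) * exp (\<Sum>i\<in>V. \<eta> i + W i k)
        = exp (- (1/2) * (S + q + c) + (\<Sum>i\<in>V. W i k) + (\<Sum>i\<in>V. \<eta> i) + \<eta> k) * exp (- t)"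
        unfolding exp_add[symmetric] sum.distrib by (simp add: field_simps)
      finally have "nu_dens V W (\<lambda>i. \<eta> i + W i k) \<beta> = (2 / pi) powr (real (card V) / 2)
        * (exp (- (1/2) * (S + q + c) + (\<Sum>i\<in>V. W i k) + (\<Sum>i\<in>V. \<eta> i) + \<eta> k) * exp (- t)) / sqrt D" .
      moreover have "K * (sqrt (2 * pi) * exp (- t) / 2) = (sqrt (2 / pi) * sqrt (2 * pi)) / 2 *
        ((2 / pi) powr (real (card V) / 2)
        * (exp (- (1/2) * (S + q + c) + (\<Sum>i\<in>V. W i k) + (\<Sum>i\<in>V. \<eta> i) + \<eta> k) * exp (- t)) / sqrt D)"
        unfolding K_def by (simp only: times_divide_eq_left times_divide_eq_right mult_ac)
      ultimately show ?thesis unfolding s1 by simp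
    qed
    finally show ?thesis .
  qed
qed

lemma nu_fin_remove_vertex:
  assumes fin: "finite V" and k: "k \<notin> V" and W: "weights_on (insert k V) W"
    and \<eta>: "\<And>i. i \<in> insert k V \<Longrightarrow> 0 \<le> \<eta> i"
  shows "distr (nu_fin (insert k V) W \<eta>) (PiM V (\<lambda>_. borel)) (\<lambda>\<beta>. restrict \<beta> V)
    = nu_fin V W (\<lambda>i. \<eta> i + W i k)"
proof (rule measure_eqI)
  interpret product_sigma_finite "\<lambda>_::'a. lborel :: real measure" by unfold_locales
  have WV: "weights_on V W" using weights_on_subset[OF W] by blast
  note [measurable] = nu_dens_measurable'[OF _ W] nu_dens_measurable'[OF fin WV]
  show "sets (distr (nu_fin (insert k V) W \<eta>) (PiM V (\<lambda>_. borel)) (\<lambda>\<beta>. restrict \<beta> V))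
    = sets (nu_fin V W (\<lambda>i. \<eta> i + W i k))" by simp
  fix A assume "A \<in> sets (distr (nu_fin (insert k V) W \<eta>) (PiM V (\<lambda>_. borel)) (\<lambda>\<beta>. restrict \<beta> V))"
  then have A: "A \<in> sets (PiM V (\<lambda>_. borel :: real measure))" by simp
  have A'[measurable]: "A \<in> sets (PiM V (\<lambda>_. lborel :: real measure))"
    using A by (simp cong: sets_PiM_cong)
  have mr[measurable]: "(\<lambda>\<beta>. restrict \<beta> V) \<in> measurable (PiM (insert k V) (\<lambda>_. lborel :: real measure)) (PiM V (\<lambda>_. lborel))"
    by (rule measurable_restrict_subset) auto
  have mr': "(\<lambda>\<beta>. restrict \<beta> V) \<in> measurable (nu_fin (insert k V) W \<eta>) (PiM V (\<lambda>_. borel))"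
    using measurable_restrict_subset[of V "insert k V" "\<lambda>_. borel"] by (simp cong: measurable_cong_sets)
  have "emeasure (distr (nu_fin (insert k V) W \<eta>) (PiM V (\<lambda>_. borel)) (\<lambda>\<beta>. restrict \<beta> V)) A
    = emeasure (nu_fin (insert k V) W \<eta>) ((\<lambda>\<beta>. restrict \<beta> V) -` A \<inter> space (PiM (insert k V) (\<lambda>_. lborel)))"
    using mr' A by (simp add: emeasure_distr space_PiM)
  also have "\<dots> = (\<integral>\<^sup>+ \<beta>. ennreal (nu_dens (insert k V) W \<eta> \<beta>)
      * indicator ((\<lambda>\<beta>. restrict \<beta> V) -` A \<inter> space (PiM (insert k V) (\<lambda>_. lborel))) \<beta> \<partial>PiM (insert k V) (\<lambda>_. lborel))"
    unfolding nu_fin_dens using fin by (intro emeasure_density) measurable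
  also have "\<dots> = (\<integral>\<^sup>+ \<beta>. ennreal (nu_dens (insert k V) W \<eta> \<beta>) * indicator A (restrict \<beta> V)
      \<partial>PiM (insert k V) (\<lambda>_. lborel))"
    by (intro nn_integral_cong) (auto simp: indicator_def)
  also have "\<dots> = (\<integral>\<^sup>+ x. (\<integral>\<^sup>+ y. ennreal (nu_dens (insert k V) W \<eta> (x(k := y))) * indicator A (restrict (x(k := y)) V) \<partial>lborel)
      \<partial>PiM V (\<lambda>_. lborel))"
    using fin k by (intro product_nn_integral_insert) measurable
  also have "\<dots> = (\<integral>\<^sup>+ x. ennreal (nu_dens V W (\<lambda>i. \<eta> i + W i k) x) * indicator A x \<partial>PiM V (\<lambda>_. lborel))"
  proof (rule nn_integral_cong)
    fix x assume x: "x \<in> space (PiM V (\<lambda>_. lborel :: real measure))"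
    have r: "restrict (x(k := y)) V = x" for y
      using x k by (auto simp: space_PiM PiE_def extensional_def fun_eq_iff)
    have m: "(\<lambda>y. ennreal (nu_dens (insert k V) W \<eta> (x(k := y)))) \<in> borel_measurable lborel"
      using fin x k by (intro measurable_compose[OF measurable_component_update[OF x k]] measurable_compose[OF _ measurable_ennreal]) measurable
    have "(\<integral>\<^sup>+ y. ennreal (nu_dens (insert k V) W \<eta> (x(k := y))) * indicator A x \<partial>lborel)
      = (\<integral>\<^sup>+ y. ennreal (nu_dens (insert k V) W \<eta> (x(k := y))) \<partial>lborel) * indicator A x"
      by (rule nn_integral_multc[OF m])
    also have "(\<integral>\<^sup>+ y. ennreal (nu_dens (insert k V) W \<eta> (x(k := y))) \<partial>lborel)
      = ennreal (nu_dens V W (\<lambda>i. \<eta> i + W i k) x)"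
      by (rule nu_dens_integrate_vertex[OF fin k W \<eta>])
    finally show "(\<integral>\<^sup>+ y. ennreal (nu_dens (insert k V) W \<eta> (x(k := y))) * indicator A (restrict (x(k := y)) V) \<partial>lborel)
      = ennreal (nu_dens V W (\<lambda>i. \<eta> i + W i k) x) * indicator A x"
      unfolding r .
  qed
  also have "\<dots> = emeasure (nu_fin V W (\<lambda>i. \<eta> i + W i k)) A"
    unfolding nu_fin_dens using fin by (intro emeasure_density[symmetric]) measurable
  finally show "emeasure (distr (nu_fin (insert k V) W \<eta>) (PiM V (\<lambda>_. borel)) (\<lambda>\<beta>. restrict \<beta> V)) A
    = emeasure (nu_fin V W (\<lambda>i. \<eta> i + W i k)) A" .
qed

lemma nu_fin_restrict:
  assumes fin: "finite U" and V: "V \<subseteq> U" and W: "weights_on U W"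
    and \<eta>: "\<And>i. i \<in> U \<Longrightarrow> 0 \<le> \<eta> i"
  shows "distr (nu_fin U W \<eta>) (PiM V (\<lambda>_. borel)) (\<lambda>\<beta>. restrict \<beta> V)
    = nu_fin V W (\<lambda>i. \<eta> i + (\<Sum>j\<in>U - V. W i j))"
proof -
  have "distr (nu_fin (V \<union> D) W \<eta>) (PiM V (\<lambda>_. borel)) (\<lambda>\<beta>. restrict \<beta> V)
      = nu_fin V W (\<lambda>i. \<eta> i + (\<Sum>j\<in>D. W i j))"
    if "finite D" "D \<subseteq> U - V" "\<And>i. i \<in> U \<Longrightarrow> 0 \<le> \<eta> i" for D \<eta>
    using that
  proof (induction D arbitrary: \<eta> rule: finite_induct)
    case empty
    have "distr (nu_fin V W \<eta>) (PiM V (\<lambda>_. borel)) (\<lambda>\<beta>. restrict \<beta> V)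
       = distr (nu_fin V W \<eta>) (nu_fin V W \<eta>) (\<lambda>\<beta>. \<beta>)"
      by (intro distr_cong) (auto simp: space_PiM)
    also have "\<dots> = nu_fin V W \<eta>" by (simp add: distr_id2)
    finally show ?case by (simp only: sum.empty Un_empty_right add_0_right)
  next
    case (insert k D)
    let ?V = "V \<union> D"
    have k: "k \<notin> ?V" "finite ?V" "weights_on (insert k ?V) W"
      using insert fin V W finite_subset[OF V] by (auto intro: weights_on_subset)
    have sub: "insert k ?V \<subseteq> U" using insert.prems V by auto
    have r: "(\<lambda>\<beta>. restrict \<beta> ?V) \<in> measurable (nu_fin (insert k ?V) W \<eta>) (PiM ?V (\<lambda>_. borel))"
      using measurable_restrict_subset[of ?V "insert k ?V" "\<lambda>_. borel"] by (auto cong: measurable_cong_sets)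
    have "distr (nu_fin (V \<union> insert k D) W \<eta>) (PiM V (\<lambda>_. borel)) (\<lambda>\<beta>. restrict \<beta> V)
      = distr (distr (nu_fin (insert k ?V) W \<eta>) (PiM ?V (\<lambda>_. borel)) (\<lambda>\<beta>. restrict \<beta> ?V)) (PiM V (\<lambda>_. borel)) (\<lambda>\<beta>. restrict \<beta> V)"
      by (subst distr_distr[OF _ r]) (auto intro!: measurable_restrict_subset simp: comp_def Int_absorb1 Un_Int_distrib)
    also have "distr (nu_fin (insert k ?V) W \<eta>) (PiM ?V (\<lambda>_. borel)) (\<lambda>\<beta>. restrict \<beta> ?V)
       = nu_fin ?V W (\<lambda>i. \<eta> i + W i k)"
      using insert.prems sub by (intro nu_fin_remove_vertex[OF k(2,1,3)]) auto
    also have "distr (nu_fin ?V W (\<lambda>i. \<eta> i + W i k)) (PiM V (\<lambda>_. borel)) (\<lambda>\<beta>. restrict \<beta> V)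
        = nu_fin V W (\<lambda>i. \<eta> i + W i k + (\<Sum>j\<in>D. W i j))"
      using insert.prems sub weights_onD(2)[OF W] by (intro insert.IH) auto
    finally show ?case using insert.hyps by (simp add: add.assoc)
  qed
  from this[of "U - V" \<eta>] \<eta> fin V show ?thesis by (simp add: Un_absorb1)
qed

text \<open>Removing all vertices leaves a one-point space with density \<open>1\<close>.\<close>

lemma prob_space_nu_fin:
  assumes fin: "finite U" and W: "weights_on U W" and \<eta>: "\<And>i. i \<in> U \<Longrightarrow> 0 \<le> \<eta> i"
  shows "prob_space (nu_fin U W \<eta>)"
proof
  have m: "(\<lambda>\<beta>. restrict \<beta> {}) \<in> measurable (nu_fin U W \<eta>) (PiM {} (\<lambda>_. borel))"
    using measurable_restrict_subset[of "{}" U "\<lambda>_. borel"] by (auto cong: measurable_cong_sets)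
  have pd: "posdef_on {} A" for A :: "'a \<Rightarrow> 'a \<Rightarrow> real" by (simp add: posdef_on_def)
  have "emeasure (nu_fin U W \<eta>) (space (nu_fin U W \<eta>))
    = emeasure (distr (nu_fin U W \<eta>) (PiM {} (\<lambda>_. borel)) (\<lambda>\<beta>. restrict \<beta> {})) (space (PiM {} (\<lambda>_. borel)))"
    using m by (subst emeasure_distr) (auto simp: space_PiM sets_PiM_empty intro!: arg_cong2[where f=emeasure])
  also have "\<dots> = emeasure (nu_fin {} W (\<lambda>i. \<eta> i + (\<Sum>j\<in>U - {}. W i j))) (space (PiM {} (\<lambda>_. borel)))"
    using nu_fin_restrict[OF fin _ W \<eta>, of "{}"] by simp
  also have "\<dots> = 1"
    unfolding nu_fin_dens
    by (subst emeasure_density) (auto simp: space_PiM nu_dens_def dom_fin_def pd det_on_def PiM_empty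
      nn_integral_count_space_finite sets_PiM_empty)
  finally show "emeasure (nu_fin U W \<eta>) (space (nu_fin U W \<eta>)) = 1" .
qed

lemma AE_nu_fin_posdef:
  assumes fin: "finite U" and W: "weights_on U W"
  shows "AE \<beta> in nu_fin U W \<eta>. posdef_on U (Hmat W \<beta>)"
proof -
  have m: "(\<lambda>\<beta>. ennreal (nu_dens U W \<eta> \<beta>)) \<in> borel_measurable (PiM U (\<lambda>_. lborel))"
    by (intro measurable_compose[OF nu_dens_measurable'[OF fin W]]) simp
  show ?thesis unfolding nu_fin_dens AE_density[OF m]
    by (rule AE_I2) (auto simp: nu_dens_def dom_fin_def indicator_def)
qed

text \<open>Additional boundary weight \<open>l\<close> at one vertex tilts the density by an exponential of
  \<open>l\<close> times the field \<open>H\<^sup>-\<^sup>1 \<eta>\<close> at this vertex, with a quadratic correction.\<close>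

lemma nu_dens_tilt:
  assumes fin: "finite U" and W: "weights_on U W" and i0: "i0 \<in> U"
  shows "nu_dens U W (\<lambda>i. \<eta> i + (if i = i0 then l else 0)) \<beta> =
    exp l * exp (- l * (\<Sum>j\<in>U. inv_on U (Hmat W \<beta>) i0 j * \<eta> j) - l\<^sup>2 / 2 * inv_on U (Hmat W \<beta>) i0 i0)
      * nu_dens U W \<eta> \<beta>"
proof (cases "posdef_on U (Hmat W \<beta>)")
  case False
  then show ?thesis by (simp add: nu_dens_def dom_fin_def)
next
  case True
  define G where "G = inv_on U (Hmat W \<beta>)"
  have Gs: "G i j = G j i" for i j
    unfolding G_def by (rule inv_sym[OF fin Hmat_symm[OF W] True])
  let ?d = "\<lambda>i. if i = i0 then l else 0"
  have d1: "(\<Sum>i\<in>U. ?d i * f i) = l * f i0" for f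
  proof -
    have "(\<Sum>i\<in>U. ?d i * f i) = (\<Sum>i\<in>U. if i = i0 then l * f i else 0)" by (intro sum.cong) auto
    then show ?thesis using fin i0 by simp
  qed
  define p where "p = (\<Sum>j\<in>U. G i0 j * \<eta> j)"
  have "(\<Sum>i\<in>U. \<Sum>j\<in>U. (\<eta> i + ?d i) * G i j * (\<eta> j + ?d j))
    = (\<Sum>i\<in>U. \<Sum>j\<in>U. \<eta> i * G i j * \<eta> j) + (\<Sum>i\<in>U. ?d i * (\<Sum>j\<in>U. G i j * \<eta> j))
      + (\<Sum>i\<in>U. \<Sum>j\<in>U. ?d j * (\<eta> i * G i j)) + (\<Sum>i\<in>U. ?d i * (\<Sum>j\<in>U. ?d j * G i j))"
    unfolding sum_distrib_left sum.distrib[symmetric] by (intro sum.cong refl) (simp add: algebra_simps)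
  also have "\<dots> = (\<Sum>i\<in>U. \<Sum>j\<in>U. \<eta> i * G i j * \<eta> j) + l * p + (\<Sum>i\<in>U. l * (\<eta> i * G i i0)) + l * (l * G i0 i0)"
    unfolding d1 p_def ..
  also have "(\<Sum>i\<in>U. l * (\<eta> i * G i i0)) = l * p"
    unfolding p_def sum_distrib_left by (intro sum.cong refl) (simp add: Gs[of i0])
  finally have Q: "(\<Sum>i\<in>U. \<Sum>j\<in>U. (\<eta> i + ?d i) * G i j * (\<eta> j + ?d j))
    = (\<Sum>i\<in>U. \<Sum>j\<in>U. \<eta> i * G i j * \<eta> j) + 2 * l * p + l\<^sup>2 * G i0 i0"
    by (simp add: power2_eq_square)
  have s: "(\<Sum>i\<in>U. \<eta> i + ?d i) = l + sum \<eta> U"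
    using fin i0 by (simp add: sum.distrib)
  define q where "q = (\<Sum>i\<in>U. \<Sum>j\<in>U. \<eta> i * G i j * \<eta> j)"
  define S where "S = (\<Sum>i\<in>U. \<Sum>j\<in>U. Hmat W \<beta> i j)"
  have e: "exp (- (1/2) * (S + (q + 2 * l * p + l\<^sup>2 * G i0 i0))) * exp (l + sum \<eta> U)
    = exp l * exp (- l * p - l\<^sup>2 / 2 * G i0 i0) * (exp (- (1/2) * (S + q)) * exp (sum \<eta> U))"
    unfolding exp_add[symmetric] by (simp add: field_simps)
  have "nu_dens U W (\<lambda>i. \<eta> i + ?d i) \<beta> = indicator (dom_fin U W) \<beta> * (2 / pi) powr (real (card U) / 2)
      * (exp (- (1/2) * (S + (q + 2 * l * p + l\<^sup>2 * G i0 i0))) * exp (l + sum \<eta> U)) / sqrt (det_on U (Hmat W \<beta>))"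
    unfolding nu_dens_def G_def[symmetric] Q s S_def[symmetric] q_def[symmetric] by (simp only: mult.assoc)
  also have "\<dots> = exp l * exp (- l * p - l\<^sup>2 / 2 * G i0 i0) * nu_dens U W \<eta> \<beta>"
    unfolding e nu_dens_def G_def[symmetric] S_def[symmetric] q_def[symmetric]
    by (simp only: times_divide_eq_right mult_ac)
  finally show ?thesis by (simp only: p_def G_def)
qed

section \<open>The infinite-volume measure\<close>

definition eta_out :: "'a set \<Rightarrow> ('a \<Rightarrow> 'a \<Rightarrow> real) \<Rightarrow> 'a set \<Rightarrow> 'a \<Rightarrow> real" where
  "eta_out T W U i = (\<Sum>\<^sub>\<infinity>j\<in>T - U. W i j)"

locale weighted_graph =
  fixes T :: "'a set" and W :: "'a \<Rightarrow> 'a \<Rightarrow> real"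
  assumes countable_T: "countable T" and weights: "weights_on T W"
    and loc_fin: "\<And>i. i \<in> T \<Longrightarrow> finite {j \<in> T. W i j \<noteq> 0}"
begin

abbreviation "\<eta> U \<equiv> eta_out T W U"

lemma eta_out_sum:
  assumes i: "i \<in> T"
  shows "\<eta> U i = (\<Sum>j\<in>{j \<in> T. W i j \<noteq> 0} - U. W i j)"
proof -
  have "\<eta> U i = (\<Sum>\<^sub>\<infinity>j\<in>{j \<in> T. W i j \<noteq> 0} - U. W i j)"
    unfolding eta_out_def by (rule infsum_cong_neutral) auto
  then show ?thesis using loc_fin[OF i] by simp
qed

lemma eta_out_nonneg: "i \<in> T \<Longrightarrow> 0 \<le> \<eta> U i"
  using weights_onD(2)[OF weights] by (auto simp: eta_out_sum intro!: sum_nonneg)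

text \<open>This is the consistency condition: the weight from \<open>T - V\<close> is the weight from
  \<open>T - U\<close> plus what removing the vertices of \<open>U - V\<close> adds.\<close>

lemma eta_out_split:
  assumes "i \<in> T" "V \<subseteq> U" "U \<subseteq> T" "finite U"
  shows "\<eta> U i + (\<Sum>j\<in>U - V. W i j) = \<eta> V i"
proof -
  let ?N = "{j \<in> T. W i j \<noteq> 0}"
  have "(\<Sum>j\<in>U - V. W i j) = (\<Sum>j\<in>?N \<inter> (U - V). W i j)"
    using assms by (intro sum.mono_neutral_right) auto
  moreover have "?N - V = (?N - U) \<union> (?N \<inter> (U - V))" using assms by auto
  then have "(\<Sum>j\<in>?N - V. W i j) = (\<Sum>j\<in>?N - U. W i j) + (\<Sum>j\<in>?N \<inter> (U - V). W i j)"
    by (simp only:) (rule sum.union_disjoint; use loc_fin[OF assms(1)] in auto)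
  ultimately show ?thesis by (simp add: eta_out_sum assms(1))
qed

definition nu_proj :: "'a set \<Rightarrow> ('a \<Rightarrow> real) measure" where
  "nu_proj U = nu_fin U W (\<eta> U)"

lemma nu_proj_restrict:
  assumes "V \<subseteq> U" "finite U" "U \<subseteq> T"
  shows "distr (nu_proj U) (PiM V (\<lambda>_. borel)) (\<lambda>f. restrict f V) = nu_proj V"
proof -
  have "distr (nu_proj U) (PiM V (\<lambda>_. borel)) (\<lambda>f. restrict f V)
     = nu_fin V W (\<lambda>i. \<eta> U i + (\<Sum>j\<in>U - V. W i j))"
    unfolding nu_proj_def using assms eta_out_nonneg
    by (intro nu_fin_restrict weights_on_subset[OF weights]) auto
  also have "\<dots> = nu_proj V"
    unfolding nu_proj_def using assms by (intro nu_fin_cong eta_out_split) auto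
  finally show ?thesis .
qed

sublocale polish_projective T nu_proj
proof (intro polish_projective.intro projective_family.intro)
  show "nu_proj J = distr (nu_proj H) (PiM J (\<lambda>_. borel)) (\<lambda>f. restrict f J)"
    if "J \<subseteq> H" "finite H" "H \<subseteq> T" for J H
    using nu_proj_restrict[OF that] by simp
  show "prob_space (nu_proj J)" if "finite J" "J \<subseteq> T" for J
    unfolding nu_proj_def using that eta_out_nonneg
    by (intro prob_space_nu_fin weights_on_subset[OF weights]) auto
qed

definition nu_spec :: "('a \<Rightarrow> real) measure \<Rightarrow> bool" where
  "nu_spec M \<longleftrightarrow> prob_space M \<and> sets M = sets (PiM T (\<lambda>_. borel)) \<and>
     (AE \<beta> in M. \<beta> \<in> dom_inf T W) \<and>
     (\<forall>U. finite U \<longrightarrow> U \<subseteq> T \<longrightarrow>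
        distr M (PiM U (\<lambda>_. borel)) (\<lambda>\<beta>. restrict \<beta> U) = nu_proj U)"

lemma nu_spec_lim: "nu_spec lim"
  unfolding nu_spec_def
proof (intro conjI allI impI)
  show "prob_space lim" by (rule P.prob_space_axioms)
  show "sets lim = sets (PiM T (\<lambda>_. borel))" by simp
  have r: "(\<lambda>\<beta>. restrict \<beta> U) \<in> measurable lim (PiM U (\<lambda>_. borel))" if "U \<subseteq> T" for U
    using measurable_restrict_subset[OF that, of "\<lambda>_. borel"] by (simp cong: measurable_cong_sets)
  show d: "distr lim (PiM U (\<lambda>_. borel)) (\<lambda>\<beta>. restrict \<beta> U) = nu_proj U" if "finite U" "U \<subseteq> T" for U
  proof (rule measure_eqI)
    show "sets (distr lim (PiM U (\<lambda>_. borel)) (\<lambda>\<beta>. restrict \<beta> U)) = sets (nu_proj U)"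
      by (simp add: nu_proj_def)
    fix A assume "A \<in> sets (distr lim (PiM U (\<lambda>_. borel)) (\<lambda>\<beta>. restrict \<beta> U))"
    then have A: "A \<in> sets (PiM U (\<lambda>_. borel))" by simp
    have "emeasure (distr lim (PiM U (\<lambda>_. borel)) (\<lambda>\<beta>. restrict \<beta> U)) A
      = emeasure lim ((\<lambda>\<beta>. restrict \<beta> U) -` A \<inter> space lim)"
      using r[OF that(2)] A by (rule emeasure_distr)
    also have "\<dots> = emeasure lim (prod_emb T (\<lambda>_. borel) U A)"
      by (simp add: prod_emb_def space_PiM)
    also have "\<dots> = emeasure (nu_proj U) A"
      using that A by (intro emeasure_lim_emb)
    finally show "emeasure (distr lim (PiM U (\<lambda>_. borel)) (\<lambda>\<beta>. restrict \<beta> U)) A = emeasure (nu_proj U) A" .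
  qed
  have "AE \<beta> in lim. posdef_on U (Hmat W \<beta>)" if "finite U" "U \<subseteq> T" for U
  proof -
    have "AE \<beta> in distr lim (PiM U (\<lambda>_. borel)) (\<lambda>\<beta>. restrict \<beta> U). posdef_on U (Hmat W \<beta>)"
      unfolding d[OF that] nu_proj_def using that by (intro AE_nu_fin_posdef weights_on_subset[OF weights])
    from AE_distrD[OF r[OF that(2)] this] show ?thesis
    proof eventually_elim
      case (elim \<beta>)
      then show ?case by (subst posdef_on_cong[of U _ "Hmat W (restrict \<beta> U)"]) (auto intro: Hmat_cong)
    qed
  qed
  moreover have "countable {U. finite U \<and> U \<subseteq> T}"
    using countable_T by (rule countable_Collect_finite_subset)
  ultimately have "AE \<beta> in lim. \<forall>U\<in>{U. finite U \<and> U \<subseteq> T}. posdef_on U (Hmat W \<beta>)"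
    by (subst AE_ball_countable) auto
  then show "AE \<beta> in lim. \<beta> \<in> dom_inf T W"
    by eventually_elim (simp add: dom_inf_def)
qed

lemma nu_spec_unique:
  assumes M: "nu_spec M" and N: "nu_spec N"
  shows "M = N"
proof (rule measure_eqI_PiM_infinite[where I=T and M="\<lambda>_. borel"])
  show "sets M = sets (PiM T (\<lambda>_. borel))" "sets N = sets (PiM T (\<lambda>_. borel))"
    using M N by (auto simp: nu_spec_def)
  show "finite_measure M" using M by (auto simp: nu_spec_def intro: prob_space.finite_measure)
  fix A :: "'a \<Rightarrow> real set" and J :: "'a set" assume J: "finite J" "J \<subseteq> T" and A: "\<And>i. i \<in> J \<Longrightarrow> A i \<in> sets borel"
  have "emeasure K (prod_emb T (\<lambda>_. borel) J (Pi\<^sub>E J A)) = emeasure (nu_proj J) (Pi\<^sub>E J A)"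
    if K: "nu_spec K" for K
  proof -
    have sK: "sets K = sets (PiM T (\<lambda>_. borel))" using K by (simp add: nu_spec_def)
    have "(\<lambda>\<beta>. restrict \<beta> J) \<in> measurable K (PiM J (\<lambda>_. borel))"
      using measurable_restrict_subset[OF J(2), of "\<lambda>_. borel"] by (simp add: measurable_cong_sets[OF sK refl])
    moreover have "Pi\<^sub>E J A \<in> sets (PiM J (\<lambda>_. borel))" using J A by (intro sets_PiM_I_finite) auto
    ultimately have "emeasure (distr K (PiM J (\<lambda>_. borel)) (\<lambda>\<beta>. restrict \<beta> J)) (Pi\<^sub>E J A)
      = emeasure K ((\<lambda>\<beta>. restrict \<beta> J) -` Pi\<^sub>E J A \<inter> space K)" by (rule emeasure_distr)
    then show ?thesis
      using K J sets_eq_imp_space_eq[OF sK] by (simp add: nu_spec_def prod_emb_def space_PiM)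
  qed
  from this[OF M] this[OF N]
  show "emeasure M (prod_emb T (\<lambda>_. borel) J (Pi\<^sub>E J A)) = emeasure N (prod_emb T (\<lambda>_. borel) J (Pi\<^sub>E J A))"
    by simp
qed

text \<open>The definite description in \<^const>\<open>nu_inf\<close> is meaningful because the projective limit
  satisfies it and a measure on the product space is determined by its finite marginals.\<close>

lemma nu_inf_spec: "nu_spec (nu_inf T W)"
proof -
  have eq: "nu_inf T W = (THE M. nu_spec M)"
    unfolding nu_inf_def nu_spec_def nu_proj_def eta_out_def ..
  show ?thesis unfolding eq
    by (rule theI[of nu_spec, OF nu_spec_lim]) (rule nu_spec_unique[OF _ nu_spec_lim])
qed

end

section \<open>Convergence of bounded martingales\<close>

text \<open>A bounded martingale is Cauchy in \<open>L\<^sup>2\<close>, and Kolmogorov's maximal inequality turns this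
  into almost sure Cauchyness.\<close>

locale bounded_martingale = prob_space M for M :: "'a measure" +
  fixes F :: "nat \<Rightarrow> 'a measure" and X :: "nat \<Rightarrow> 'a \<Rightarrow> real"
  assumes sub: "\<And>n. subalgebra M (F n)"
    and mono_F: "\<And>n. sets (F n) \<subseteq> sets (F (Suc n))"
    and X_F: "\<And>n. X n \<in> borel_measurable (F n)"
    and X_bounds: "\<And>n x. x \<in> space M \<Longrightarrow> 0 \<le> X n x \<and> X n x \<le> 1"
    and mart: "\<And>n A. A \<in> sets (F n) \<Longrightarrow> (\<integral>x\<in>A. X (Suc n) x \<partial>M) = (\<integral>x\<in>A. X n x \<partial>M)"
begin

lemma F_mono: "m \<le> n \<Longrightarrow> sets (F m) \<subseteq> sets (F n)"
  by (rule lift_Suc_mono_le[of "\<lambda>n. sets (F n)"]) (rule mono_F)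

lemma space_F: "space (F n) = space M" using sub by (simp add: subalgebra_def)

lemma X_F_mono: "m \<le> n \<Longrightarrow> X m \<in> borel_measurable (F n)"
  using measurable_mono[OF order_refl refl F_mono, of m n borel] X_F[of m] space_F by auto

lemma X_M [measurable]: "X n \<in> borel_measurable M"
  by (rule measurable_from_subalg[OF sub X_F])

lemma integrable_bounded:
  assumes [measurable]: "Z \<in> borel_measurable M" and "\<And>x. x \<in> space M \<Longrightarrow> \<bar>Z x\<bar> \<le> (K :: real)"
  shows "integrable M Z"
  by (rule integrable_const_bound[of _ K]) (use assms in auto)

lemma mart_le: "m \<le> n \<Longrightarrow> A \<in> sets (F m) \<Longrightarrow> (\<integral>x\<in>A. X n x \<partial>M) = (\<integral>x\<in>A. X m x \<partial>M)"
proof (induction n rule: dec_induct)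
  case (step n)
  then show ?case using mart[of A n] F_mono[of m n] by auto
qed simp

lemma mart_test:
  assumes mn: "m \<le> n" and Z: "Z \<in> borel_measurable (F m)" and K: "\<And>x. x \<in> space M \<Longrightarrow> \<bar>Z x\<bar> \<le> (K :: real)"
  shows "(\<integral>x. Z x * X n x \<partial>M) = (\<integral>x. Z x * X m x \<partial>M)"
proof -
  interpret finite_measure_subalgebra M "F m" by unfold_locales (rule sub)
  have [measurable]: "Z \<in> borel_measurable M" by (rule measurable_from_subalg[OF sub Z])
  have Xi: "integrable M (X k)" for k using X_bounds by (intro integrable_bounded[of _ 1]) (auto simp: abs_le_iff)
  have ZX: "integrable M (\<lambda>x. Z x * X k x)" for k
  proof (rule integrable_bounded[of _ K])
    fix x assume x: "x \<in> space M"
    have "\<bar>Z x * X k x\<bar> \<le> K * 1" unfolding abs_mult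
      using K[OF x] X_bounds[OF x, of k] by (intro mult_mono) (auto intro: order_trans[OF abs_ge_zero])
    then show "\<bar>Z x * X k x\<bar> \<le> K" by simp
  qed measurable
  have AE: "AE x in M. real_cond_exp M (F m) (X n) x = X m x"
    by (rule real_cond_exp_charact[OF mart_le[OF mn] Xi Xi X_F])
  have "(\<integral>x. Z x * X n x \<partial>M) = (\<integral>x. Z x * real_cond_exp M (F m) (X n) x \<partial>M)"
    using real_cond_exp_intg(2)[OF ZX Z X_M] by simp
  also have "\<dots> = (\<integral>x. Z x * X m x \<partial>M)"
    using AE by (intro integral_cong_AE) (auto simp: measurable_from_subalg[OF sub])
  finally show ?thesis .
qed

definition S :: "nat \<Rightarrow> real" where "S n = (\<integral>x. (X n x)\<^sup>2 \<partial>M)"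

text \<open>Orthogonality of the increments \<open>X\<^sub>k - X\<^sub>m\<close> and \<open>X\<^sub>n - X\<^sub>k\<close> on an event of time \<open>k\<close>.\<close>

lemma increment:
  assumes mk: "m \<le> k" and kn: "k \<le> n" and A: "A \<in> sets (F k)"
  shows "(\<integral>x. indicator A x * (X n x - X m x)\<^sup>2 \<partial>M)
    = (\<integral>x. indicator A x * (X k x - X m x)\<^sup>2 \<partial>M) + (\<integral>x. indicator A x * (X n x - X k x)\<^sup>2 \<partial>M)"
proof -
  have [measurable]: "A \<in> sets M" using A sub by (auto simp: subalgebra_def)
  have b: "x \<in> space M \<Longrightarrow> \<bar>X i x - X j x\<bar> \<le> 1" for x i j
    using X_bounds[of x i] X_bounds[of x j] by (auto simp: abs_le_iff)
  have sq: "x \<in> space M \<Longrightarrow> (X i x - X j x)\<^sup>2 \<le> 1" for x i j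
    using b by (simp add: abs_square_le_1)
  have int: "integrable M (\<lambda>x. indicator A x * (X i x - X j x)\<^sup>2)" for i j
    by (rule integrable_bounded[of _ 1]) (use sq in \<open>auto simp: indicator_def\<close>)
  let ?Z = "\<lambda>x. indicator A x * (X k x - X m x)"
  have Zm: "?Z \<in> borel_measurable (F k)"
    using A X_F[of k] X_F_mono[OF mk] by measurable
  have Zb: "x \<in> space M \<Longrightarrow> \<bar>?Z x\<bar> \<le> 1" for x using b by (auto simp: indicator_def)
  have [measurable]: "?Z \<in> borel_measurable M" by (rule measurable_from_subalg[OF sub Zm])
  have intZ: "integrable M (\<lambda>x. ?Z x * X i x)" for i
  proof (rule integrable_bounded[of _ 1])
    fix x assume x: "x \<in> space M"
    have "\<bar>?Z x * X i x\<bar> \<le> 1 * 1" unfolding abs_mult[of "?Z x"]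
      using Zb[OF x] X_bounds[OF x, of i] by (intro mult_mono) auto
    then show "\<bar>?Z x * X i x\<bar> \<le> 1" by simp
  qed measurable
  have "(\<integral>x. indicator A x * (X n x - X m x)\<^sup>2 \<partial>M)
    = (\<integral>x. indicator A x * (X k x - X m x)\<^sup>2 + indicator A x * (X n x - X k x)\<^sup>2
        + 2 * (?Z x * X n x - ?Z x * X k x) \<partial>M)"
    by (intro Bochner_Integration.integral_cong) (auto simp: algebra_simps power2_eq_square)
  also have "\<dots> = (\<integral>x. indicator A x * (X k x - X m x)\<^sup>2 \<partial>M) + (\<integral>x. indicator A x * (X n x - X k x)\<^sup>2 \<partial>M)
        + 2 * ((\<integral>x. ?Z x * X n x \<partial>M) - (\<integral>x. ?Z x * X k x \<partial>M))"
    using int intZ by (simp del: times_divide_eq_left)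
  also have "(\<integral>x. ?Z x * X n x \<partial>M) = (\<integral>x. ?Z x * X k x \<partial>M)"
    by (rule mart_test[OF kn Zm Zb])
  finally show ?thesis by simp
qed

lemma S_increment:
  assumes "m \<le> n"
  shows "(\<integral>x. (X n x - X m x)\<^sup>2 \<partial>M) = S n - S m"
proof -
  have sq: "x \<in> space M \<Longrightarrow> (X i x)\<^sup>2 \<le> 1" for x i
    using X_bounds[of x i] by (simp add: power_le_one)
  have int: "integrable M (\<lambda>x. (X i x)\<^sup>2)" for i
    by (rule integrable_bounded[of _ 1]) (use sq in auto)
  have intXX: "integrable M (\<lambda>x. X m x * X i x)" for i
  proof (rule integrable_bounded[of _ 1])
    fix x assume x: "x \<in> space M"
    have "\<bar>X m x * X i x\<bar> \<le> 1 * 1" unfolding abs_mult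
      using X_bounds[OF x, of m] X_bounds[OF x, of i] by (intro mult_mono) auto
    then show "\<bar>X m x * X i x\<bar> \<le> 1" by simp
  qed measurable
  have "(\<integral>x. (X n x - X m x)\<^sup>2 \<partial>M) = (\<integral>x. (X n x)\<^sup>2 - (X m x)\<^sup>2 + 2 * (X m x * X m x - X m x * X n x) \<partial>M)"
    by (intro Bochner_Integration.integral_cong) (auto simp: algebra_simps power2_eq_square)
  also have "\<dots> = S n - S m + 2 * ((\<integral>x. X m x * X m x \<partial>M) - (\<integral>x. X m x * X n x \<partial>M))"
    using int intXX by (simp add: S_def)
  also have "(\<integral>x. X m x * X n x \<partial>M) = (\<integral>x. X m x * X m x \<partial>M)"
    using X_bounds by (intro mart_test[OF assms X_F, of 1]) (auto simp: abs_le_iff)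
  finally show ?thesis by simp
qed

lemma S_bounded: "S n \<le> 1"
proof -
  have "S n \<le> (\<integral>x. 1 \<partial>M)" unfolding S_def
    using X_bounds by (intro integral_mono' ) (auto simp: power_le_one)
  then show ?thesis by (simp add: prob_space)
qed

lemma S_incseq: "incseq S"
proof (rule incseq_SucI)
  fix n
  have "0 \<le> (\<integral>x. (X (Suc n) x - X n x)\<^sup>2 \<partial>M)" by simp
  then show "S n \<le> S (Suc n)" using S_increment[of n "Suc n"] by simp
qed

lemma maximal:
  assumes e: "0 < e" and mn: "m \<le> n"
  shows "prob {x \<in> space M. \<exists>k\<in>{m..n}. e < \<bar>X k x - X m x\<bar>} \<le> (S n - S m) / e\<^sup>2"
proof -
  \<comment> \<open>\<open>A k\<close>: the first time from \<open>m\<close> on at which the deviation exceeds \<open>e\<close> is \<open>k\<close>.\<close>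
  define A where "A k = {x \<in> space M. e < \<bar>X k x - X m x\<bar> \<and> (\<forall>j\<in>{m..<k}. \<not> e < \<bar>X j x - X m x\<bar>)}" for k
  have AF: "A k \<in> sets (F k)" if "m \<le> k" for k
  proof -
    have [measurable]: "X j \<in> borel_measurable (F k)" if "j \<le> k" for j using X_F_mono[OF that] .
    have [measurable]: "X m \<in> borel_measurable (F k)" "X k \<in> borel_measurable (F k)"
      using X_F_mono[OF \<open>m \<le> k\<close>] X_F by auto
    have "{x \<in> space (F k). e < \<bar>X k x - X m x\<bar>} \<in> sets (F k)" by measurable
    moreover have "{x \<in> space (F k). \<forall>j\<in>{m..<k}. \<not> e < \<bar>X j x - X m x\<bar>} \<in> sets (F k)"
    proof (rule sets.sets_Collect_finite_All)
      fix j assume "j \<in> {m..<k}"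
      then have [measurable]: "X j \<in> borel_measurable (F k)" by (intro X_F_mono) auto
      show "{x \<in> space (F k). \<not> e < \<bar>X j x - X m x\<bar>} \<in> sets (F k)" by measurable
    qed simp
    ultimately have "{x \<in> space (F k). e < \<bar>X k x - X m x\<bar>} \<inter> {x \<in> space (F k). \<forall>j\<in>{m..<k}. \<not> e < \<bar>X j x - X m x\<bar>} \<in> sets (F k)"
      by (rule sets.Int)
    also have "{x \<in> space (F k). e < \<bar>X k x - X m x\<bar>} \<inter> {x \<in> space (F k). \<forall>j\<in>{m..<k}. \<not> e < \<bar>X j x - X m x\<bar>} = A k"
      by (auto simp: A_def space_F)
    finally show ?thesis .
  qed
  have AM: "A k \<in> sets M" if "m \<le> k" for k using AF[OF that] sub by (auto simp: subalgebra_def)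
  have disj: "disjoint_family_on A {m..n}"
    unfolding disjoint_family_on_def A_def
  proof (intro ballI impI)
    fix i j assume "i \<in> {m..n}" "j \<in> {m..n}" "i \<noteq> j"
    then have "i \<in> {m..<j} \<or> j \<in> {m..<i}" by auto
    then show "{x \<in> space M. e < \<bar>X i x - X m x\<bar> \<and> (\<forall>j\<in>{m..<i}. \<not> e < \<bar>X j x - X m x\<bar>)} \<inter>
      {x \<in> space M. e < \<bar>X j x - X m x\<bar> \<and> (\<forall>j\<in>{m..<j}. \<not> e < \<bar>X j x - X m x\<bar>)} = {}" by blast
  qed
  have cover: "{x \<in> space M. \<exists>k\<in>{m..n}. e < \<bar>X k x - X m x\<bar>} = (\<Union>k\<in>{m..n}. A k)"
  proof (intro subset_antisym subsetI)
    fix x assume x: "x \<in> {x \<in> space M. \<exists>k\<in>{m..n}. e < \<bar>X k x - X m x\<bar>}"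
    define P where "P k \<longleftrightarrow> m \<le> k \<and> k \<le> n \<and> e < \<bar>X k x - X m x\<bar>" for k
    have "\<exists>k. P k" using x by (auto simp: P_def)
    then obtain k0 where k0: "P k0" "\<And>j. j < k0 \<Longrightarrow> \<not> P j" using exists_least_iff[of P] by auto
    have "\<not> e < \<bar>X j x - X m x\<bar>" if "j \<in> {m..<k0}" for j
      using k0(2)[of j] k0(1) that by (auto simp: P_def)
    then have "k0 \<in> {m..n}" "x \<in> A k0"
      using x k0(1) unfolding A_def P_def by auto
    then show "x \<in> (\<Union>k\<in>{m..n}. A k)" by blast
  qed (auto simp: A_def)
  have sqb: "x \<in> space M \<Longrightarrow> (X i x - X j x)\<^sup>2 \<le> 1" for x i j
    using X_bounds[of x i] X_bounds[of x j] by (simp add: abs_square_le_1 abs_le_iff)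
  have int: "integrable M (\<lambda>x. indicator (A k) x * (X i x - X j x)\<^sup>2)" if "m \<le> k" for i j k
    by (rule integrable_bounded[of _ 1]) (use sqb AM[OF that] in \<open>auto simp: indicator_def\<close>)
  have int': "integrable M (\<lambda>x. (X n x - X m x)\<^sup>2)"
    by (rule integrable_bounded[of _ 1]) (use sqb in auto)
  have "e\<^sup>2 * prob (A k) \<le> (\<integral>x. indicator (A k) x * (X n x - X m x)\<^sup>2 \<partial>M)" if k: "k \<in> {m..n}" for k
  proof -
    have "e\<^sup>2 * prob (A k) = (\<integral>x. e\<^sup>2 * indicator (A k) x \<partial>M)" using AM k by simp
    also have "\<dots> \<le> (\<integral>x. indicator (A k) x * (X k x - X m x)\<^sup>2 \<partial>M)"
    proof (rule integral_mono)
      show "integrable M (\<lambda>x. e\<^sup>2 * indicator (A k) x)"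
        using AM k by (intro integrable_mult_right) (simp add: emeasure_eq_measure)
      show "e\<^sup>2 * indicator (A k) x \<le> indicator (A k) x * (X k x - X m x)\<^sup>2" for x
      proof (cases "x \<in> A k")
        case True
        then have "e \<le> \<bar>X k x - X m x\<bar>" by (simp add: A_def)
        then have "e\<^sup>2 \<le> \<bar>X k x - X m x\<bar>\<^sup>2" using e by (intro power_mono) auto
        then show ?thesis using True by simp
      qed simp
    qed (use int k in auto)
    also have "\<dots> \<le> (\<integral>x. indicator (A k) x * (X n x - X m x)\<^sup>2 \<partial>M)"
      using increment[OF _ _ AF, of m k n] k by simp
    finally show ?thesis .
  qed
  then have "(\<Sum>k\<in>{m..n}. e\<^sup>2 * prob (A k)) \<le> (\<Sum>k\<in>{m..n}. \<integral>x. indicator (A k) x * (X n x - X m x)\<^sup>2 \<partial>M)"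
    by (rule sum_mono)
  also have "\<dots> = (\<integral>x. (\<Sum>k\<in>{m..n}. indicator (A k) x * (X n x - X m x)\<^sup>2) \<partial>M)"
    using int by (intro Bochner_Integration.integral_sum[symmetric]) auto
  also have "\<dots> \<le> (\<integral>x. (X n x - X m x)\<^sup>2 \<partial>M)"
  proof (rule integral_mono)
    show "integrable M (\<lambda>x. \<Sum>k\<in>{m..n}. indicator (A k) x * (X n x - X m x)\<^sup>2)"
      using int by (intro Bochner_Integration.integrable_sum) auto
    show "(\<Sum>k\<in>{m..n}. indicator (A k) x * (X n x - X m x)\<^sup>2) \<le> (X n x - X m x)\<^sup>2" for x
    proof -
      have "(\<Sum>k\<in>{m..n}. indicator (A k) x) = (indicator (\<Union>k\<in>{m..n}. A k) x :: real)"
        using disj by (intro indicator_UN_disjoint[symmetric]) auto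
      also have "\<dots> \<le> 1" by (simp add: indicator_def)
      finally have "(\<Sum>k\<in>{m..n}. indicator (A k) x) * (X n x - X m x)\<^sup>2 \<le> 1 * (X n x - X m x)\<^sup>2"
        by (rule mult_right_mono) simp
      then show ?thesis by (simp add: sum_distrib_right)
    qed
  qed (rule int')
  also have "\<dots> = S n - S m" by (rule S_increment[OF mn])
  finally have "e\<^sup>2 * (\<Sum>k\<in>{m..n}. prob (A k)) \<le> S n - S m" by (simp add: sum_distrib_left)
  moreover have "prob (\<Union>k\<in>{m..n}. A k) = (\<Sum>k\<in>{m..n}. prob (A k))"
    using disj AM by (intro finite_measure_finite_Union) auto
  ultimately show ?thesis unfolding cover using e by (simp add: field_simps)
qed

theorem converges: "AE x in M. convergent (\<lambda>n. X n x)"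
proof -
  obtain L where L: "S \<longlonglongrightarrow> L"
    by (rule incseq_convergent[OF S_incseq, of 1]) (use S_bounded in blast)
  have SL: "S n \<le> L" for n using incseq_le[OF S_incseq L] .
  define B where "B e m = {x \<in> space M. \<exists>k\<in>{m..}. e < \<bar>X k x - X m x\<bar>}" for e m
  have BM[measurable]: "B e m \<in> sets M" for e m unfolding B_def by measurable
  have pB: "prob (B e m) \<le> (L - S m) / e\<^sup>2" if e: "0 < e" for e m
  proof -
    let ?B = "\<lambda>i. {x \<in> space M. \<exists>k\<in>{m..m + i}. e < \<bar>X k x - X m x\<bar>}"
    have "(\<lambda>i. prob (?B i)) \<longlonglongrightarrow> prob (\<Union>i. ?B i)"
      by (rule finite_Lim_measure_incseq) (force simp: incseq_def)+
    also have "(\<Union>i. ?B i) = B e m"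
      unfolding B_def by (auto; metis atLeastAtMost_iff le_add_diff_inverse order_refl)
    finally have lim: "(\<lambda>i. prob (?B i)) \<longlonglongrightarrow> prob (B e m)" .
    show ?thesis
    proof (rule LIMSEQ_le_const2[OF lim], intro exI allI impI)
      fix i
      have "prob (?B i) \<le> (S (m + i) - S m) / e\<^sup>2" by (rule maximal[OF e]) simp
      also have "\<dots> \<le> (L - S m) / e\<^sup>2" using SL[of "m + i"] by (intro divide_right_mono) auto
      finally show "prob (?B i) \<le> (L - S m) / e\<^sup>2" .
    qed
  qed
  have null: "AE x in M. \<exists>m. x \<notin> B e m" if e: "0 < e" for e
  proof -
    have "prob (\<Inter>m. B e m) \<le> (L - S m) / e\<^sup>2" for m
      using pB[OF e, of m] finite_measure_mono[of "\<Inter>m. B e m" "B e m"] by (fastforce intro: order_trans)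
    moreover have "(\<lambda>m. (L - S m) / e\<^sup>2) \<longlonglongrightarrow> (L - L) / e\<^sup>2"
      by (intro tendsto_intros L) (use e in simp)
    ultimately have "prob (\<Inter>m. B e m) \<le> 0" by (intro LIMSEQ_le_const) auto
    then have "prob (\<Inter>m. B e m) = 0" using measure_nonneg[of M] by (metis antisym)
    then have "emeasure M (\<Inter>m. B e m) = 0" by (simp add: emeasure_eq_measure)
    then have "(\<Inter>m. B e m) \<in> null_sets M" by (auto simp: null_sets_def)
    from AE_not_in[OF this] show ?thesis by eventually_elim auto
  qed
  have "AE x in M. \<forall>j. \<exists>m. x \<notin> B (1 / real (Suc j)) m"
    unfolding AE_all_countable using null by simp
  then show ?thesis
  proof (rule AE_mp, intro AE_I2 impI)
    fix x assume x: "x \<in> space M" and *: "\<forall>j. \<exists>m. x \<notin> B (1 / real (Suc j)) m"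
    have "Cauchy (\<lambda>n. X n x)"
    proof (rule metric_CauchyI)
      fix e :: real assume e: "0 < e"
      then obtain j where j: "1 / real (Suc j) < e / 2" using nat_approx_posE[of "e / 2"] by auto
      obtain m where m: "x \<notin> B (1 / real (Suc j)) m" using * by blast
      have c: "\<bar>X k x - X m x\<bar> < e / 2" if "m \<le> k" for k
        using m x that j by (force simp: B_def)
      show "\<exists>M. \<forall>m\<ge>M. \<forall>n\<ge>M. dist (X m x) (X n x) < e"
      proof (intro exI[of _ m] allI impI)
        fix k l assume "m \<le> k" "m \<le> l"
        then show "dist (X k x) (X l x) < e" using c[of k] c[of l] unfolding dist_real_def by linarith
      qed
    qed
    then show "convergent (\<lambda>n. X n x)" by (rule Cauchy_convergent)
  qed
qed

end

section \<open>Rooted regular trees\<close>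

locale rtree =
  fixes T :: "'v set" and E :: "'v set set" and r :: 'v and d :: nat
  assumes tree: "is_tree T E" and root: "r \<in> T" and d3: "3 \<le> d" and reg: "regular T E d"
begin

abbreviation lev :: "'v \<Rightarrow> nat" where "lev \<equiv> gdist E r"
abbreviation nbr :: "'v \<Rightarrow> 'v set" where "nbr x \<equiv> {y. {x, y} \<in> E}"

lemma edgeD:
  assumes "{x, y} \<in> E"
  shows "x \<in> T" "y \<in> T" "x \<noteq> y" "{y, x} \<in> E"
proof -
  have "E \<subseteq> {{x, y} | x y. x \<in> T \<and> y \<in> T \<and> x \<noteq> y}" using tree unfolding is_tree_def by blast
  then obtain a b where "{x, y} = {a, b}" "a \<in> T" "b \<in> T" "a \<noteq> b" using assms by blast
  then show "x \<in> T" "y \<in> T" "x \<noteq> y" by (auto simp: doubleton_eq_iff)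
  show "{y, x} \<in> E" using assms by (simp add: insert_commute)
qed

lemma edge_sym: "{x, y} \<in> E \<longleftrightarrow> {y, x} \<in> E"
  by (simp add: insert_commute)

lemma nbr_finite: "x \<in> T \<Longrightarrow> finite (nbr x)" and nbr_card: "x \<in> T \<Longrightarrow> card (nbr x) = d"
  using reg unfolding regular_def by blast+

abbreviation "adj \<equiv> {(u, v). {u, v} \<in> E}"

lemma no_cycle:
  assumes "3 \<le> length xs" "distinct xs" "successively (\<lambda>u v. {u, v} \<in> E) xs" "{last xs, hd xs} \<in> E"
  shows False
  using tree assms unfolding is_tree_def by blast

lemma lev_relpow: "x \<in> T \<Longrightarrow> (r, x) \<in> adj ^^ lev x"
proof -
  assume "x \<in> T"
  then have "(r, x) \<in> adj\<^sup>*" using tree root unfolding is_tree_def by blast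
  then obtain n where "(r, x) \<in> adj ^^ n" using rtrancl_imp_relpow by blast
  then show ?thesis unfolding gdist_def by (rule LeastI)
qed

lemma lev_le: "(r, x) \<in> adj ^^ n \<Longrightarrow> lev x \<le> n"
  unfolding gdist_def by (rule Least_le)

lemma lev_root [simp]: "lev r = 0"
  using lev_le[of r 0] by simp

lemma lev_0_iff: "x \<in> T \<Longrightarrow> lev x = 0 \<longleftrightarrow> x = r"
  using lev_relpow[of x] by auto

lemma lev_edge: "{x, y} \<in> E \<Longrightarrow> lev y \<le> Suc (lev x)"
  using edgeD(1)[of x y] by (intro lev_le) (auto intro: lev_relpow)

definition par :: "'v \<Rightarrow> 'v" where
  "par x = (SOME y. {y, x} \<in> E \<and> lev x = Suc (lev y))"

lemma par:
  assumes "x \<in> T" "x \<noteq> r"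
  shows "{par x, x} \<in> E" "lev x = Suc (lev (par x))"
proof -
  have "lev x \<noteq> 0" using lev_0_iff assms by blast
  then obtain n where n: "lev x = Suc n" by (cases "lev x") auto
  from lev_relpow[OF assms(1)] n obtain y where y: "(r, y) \<in> adj ^^ n" "{y, x} \<in> E" by auto
  have "lev x = Suc (lev y)" using lev_le[OF y(1)] lev_edge[OF y(2)] n by simp
  with y(2) have "{y, x} \<in> E \<and> lev x = Suc (lev y)" by simp
  then have "{par x, x} \<in> E \<and> lev x = Suc (lev (par x))" unfolding par_def by (rule someI)
  then show "{par x, x} \<in> E" "lev x = Suc (lev (par x))" by auto
qed

lemma par_T: "x \<in> T \<Longrightarrow> x \<noteq> r \<Longrightarrow> par x \<in> T"
  using par(1) edgeD(1) by blast

definition up :: "'v \<Rightarrow> nat \<Rightarrow> 'v" where "up x k = (par ^^ k) x"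

lemma up_0 [simp]: "up x 0 = x" and up_Suc: "up x (Suc k) = par (up x k)"
  and up_add: "up x (k + l) = up (up x k) l"
  by (simp_all add: up_def) (metis add.commute comp_apply funpow_add)

lemma up_T: "x \<in> T \<Longrightarrow> k \<le> lev x \<Longrightarrow> up x k \<in> T \<and> lev (up x k) = lev x - k"
proof (induction k)
  case (Suc k)
  then have IH: "up x k \<in> T" "lev (up x k) = lev x - k" by auto
  then have "up x k \<noteq> r" using Suc.prems by auto
  then show ?case using par[OF IH(1)] par_T[OF IH(1)] IH Suc.prems by (simp add: up_Suc)
qed simp

lemma up_lev: "x \<in> T \<Longrightarrow> up x (lev x) = r"
  using up_T[of x "lev x"] lev_0_iff[of "up x (lev x)"] by simp

lemma up_edge: "x \<in> T \<Longrightarrow> k < lev x \<Longrightarrow> {up x (Suc k), up x k} \<in> E"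
  using par(1)[of "up x k"] up_T[of x k] lev_root by (cases "up x k = r") (auto simp: up_Suc)

lemma up_inj: "x \<in> T \<Longrightarrow> k \<le> lev x \<Longrightarrow> l \<le> lev x \<Longrightarrow> up x k = up x l \<Longrightarrow> k = l"
  using up_T[of x k] up_T[of x l] by auto

text \<open>An edge that joins neither endpoint to its parent would close a cycle with the two
  ancestral lines up to their first common vertex.\<close>

lemma edge_par:
  assumes uv: "{u, v} \<in> E"
  shows "(v = par u \<and> u \<noteq> r) \<or> (u = par v \<and> v \<noteq> r)"
proof -
  have T: "u \<in> T" "v \<in> T" "u \<noteq> v" using edgeD[OF uv] by auto
  define P where "P i \<longleftrightarrow> i \<le> lev u \<and> (\<exists>j\<le>lev v. up v j = up u i)" for i
  have "P (lev u)" using T by (auto simp: P_def up_lev intro: exI[of _ "lev v"])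
  then obtain i where i: "P i" "\<And>k. k < i \<Longrightarrow> \<not> P k" using exists_least_iff[of P] by auto
  then obtain j where j: "j \<le> lev v" "up v j = up u i" and iu: "i \<le> lev u" by (auto simp: P_def)
  define xs where "xs = map (up u) [0..<i] @ rev (map (up v) [0..<Suc j])"
  have "\<not> 3 \<le> length xs"
  proof
    assume len: "3 \<le> length xs"
    have "distinct xs"
    proof -
      have "inj_on (up u) {0..<i}" "inj_on (up v) {0..<Suc j}"
        using up_inj[OF T(1)] up_inj[OF T(2)] iu j by (auto simp: inj_on_def)
      moreover have "up u k \<noteq> up v l" if "k < i" "l \<le> j" for k l
      proof
        assume "up u k = up v l"
        then have "P k" unfolding P_def using that iu j(1) by (intro conjI exI[of _ l]) auto
        then show False using i(2)[OF that(1)] by blast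
      qed
      ultimately show ?thesis unfolding xs_def
        by (auto simp: distinct_map simp del: upt_Suc)
    qed
    moreover have "successively (\<lambda>u v. {u, v} \<in> E) xs"
    proof -
      have 1: "successively (\<lambda>u v. {u, v} \<in> E) (map (up u) [0..<i])"
        unfolding successively_conv_nth using up_edge[OF T(1)] iu edge_sym by auto
      have 2: "successively (\<lambda>u v. {u, v} \<in> E) (rev (map (up v) [0..<Suc j]))"
        unfolding successively_rev unfolding successively_conv_nth
        using up_edge[OF T(2)] j by (auto simp del: upt_Suc)
      have 3: "{last (map (up u) [0..<i]), hd (rev (map (up v) [0..<Suc j]))} \<in> E" if "0 < i"
        using up_edge[OF T(1), of "i - 1"] iu that j edge_sym by (simp add: hd_rev last_map)
      show ?thesis unfolding xs_def successively_append_iff using 1 2 3 by auto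
    qed
    moreover have "last xs = v" by (simp add: xs_def last_rev hd_map del: upt_Suc)
    moreover have "hd xs = u"
    proof (cases "i = 0")
      case True
      then show ?thesis using j(2) by (simp add: xs_def hd_rev last_map)
    next
      case False
      then show ?thesis by (simp add: xs_def hd_append hd_map del: upt_Suc)
    qed
    ultimately show False using no_cycle[OF len] edgeD(4)[OF uv] by simp
  qed
  then have "i + j \<le> 1" by (simp add: xs_def)
  then consider "i = 0" "j = 0" | "i = 1" "j = 0" | "i = 0" "j = 1" by linarith
  then show ?thesis
  proof cases
    case 1 then show ?thesis using j(2) T(3) by simp
  next
    case 2
    then show ?thesis using j(2) iu by (auto simp: up_Suc)
  next
    case 3
    then show ?thesis using j by (auto simp: up_Suc)
  qed
qed

definition ch :: "'v \<Rightarrow> 'v set" where "ch x = {c \<in> T. c \<noteq> r \<and> par c = x}"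

lemma chD: "c \<in> ch x \<Longrightarrow> c \<in> T \<and> c \<noteq> r \<and> par c = x \<and> {x, c} \<in> E \<and> lev c = Suc (lev x) \<and> x \<in> T"
  using par[of c] par_T[of c] by (auto simp: ch_def)

lemma nbr_eq: "x \<in> T \<Longrightarrow> nbr x = ch x \<union> (if x = r then {} else {par x})"
proof (intro subset_antisym subsetI)
  fix y assume x: "x \<in> T" and "y \<in> nbr x"
  then have "{x, y} \<in> E" by simp
  from edge_par[OF this] edgeD[OF this] show "y \<in> ch x \<union> (if x = r then {} else {par x})"
    by (auto simp: ch_def)
next
  fix y assume "x \<in> T" "y \<in> ch x \<union> (if x = r then {} else {par x})"
  then show "y \<in> nbr x" using chD par(1)[of x] edge_sym by (auto split: if_splits)
qed

lemma ch_finite: "x \<in> T \<Longrightarrow> finite (ch x)"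
  using nbr_finite[of x] nbr_eq[of x] by simp

lemma par_not_ch: "x \<in> T \<Longrightarrow> x \<noteq> r \<Longrightarrow> par x \<notin> ch x"
  using chD[of "par x" x] par(2)[of x] by auto

lemma card_ch: "x \<in> T \<Longrightarrow> card (ch x) = (if x = r then d else d - 1)"
  using nbr_card[of x] nbr_eq[of x] ch_finite[of x] par_not_ch[of x] by (auto split: if_splits)

lemma card_ch_ge: "x \<in> T \<Longrightarrow> 2 \<le> card (ch x)"
  using card_ch[of x] d3 by (simp split: if_splits)

lemma nbr_root: "nbr r = ch r"
  using nbr_eq[OF root] by simp

text \<open>The descendants of \<open>y\<close> and \<open>y\<close> itself, described by ancestral lines because these are
  easier to compare than paths; \<open>ancestor_iff\<close> gives the description by paths.\<close>

definition sub :: "'v \<Rightarrow> 'v set" where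
  "sub y = {z \<in> T. lev y \<le> lev z \<and> up z (lev z - lev y) = y}"

lemma sub_T: "z \<in> sub y \<Longrightarrow> z \<in> T \<and> lev y \<le> lev z"
  by (simp add: sub_def)

lemma sub_self: "y \<in> T \<Longrightarrow> y \<in> sub y"
  by (simp add: sub_def)

lemma sub_root: "sub r = T"
  by (auto simp: sub_def up_lev)

lemma sub_in_T: "z \<in> sub y \<Longrightarrow> y \<in> T"
  using up_T[of z "lev z - lev y"] by (auto simp: sub_def)

lemma sub_level_eq: "z \<in> sub y \<Longrightarrow> lev z = lev y \<Longrightarrow> z = y"
  by (simp add: sub_def)

lemma sub_par:
  assumes "z \<in> sub y" "z \<noteq> y"
  shows "par z \<in> sub y" "z \<noteq> r" "lev y < lev z"
proof -
  have z: "z \<in> T" "lev y \<le> lev z" "up z (lev z - lev y) = y" using assms(1) by (auto simp: sub_def)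
  show lt: "lev y < lev z" using sub_level_eq[OF assms(1)] assms(2) z(2) by fastforce
  then show zr: "z \<noteq> r" by auto
  have l: "lev z = Suc (lev (par z))" using par(2)[OF z(1) zr] .
  have "up z (1 + (lev (par z) - lev y)) = up (par z) (lev (par z) - lev y)"
    unfolding up_add by (simp add: up_Suc)
  then show "par z \<in> sub y" using lt l z par_T[OF z(1) zr] by (auto simp: sub_def Suc_diff_le)
qed

lemma sub_ch:
  assumes "z \<in> sub y" "c \<in> ch z"
  shows "c \<in> sub y"
proof -
  note c = chD[OF assms(2)]
  have "up c (1 + (lev z - lev y)) = up z (lev z - lev y)"
    unfolding up_add using c by (simp add: up_Suc)
  then show ?thesis using assms(1) c by (auto simp: sub_def Suc_diff_le)
qed

lemma ch_sub: "c \<in> ch y \<Longrightarrow> c \<in> sub y"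
  using sub_ch[OF sub_self] chD by blast

lemma sub_boundary:
  assumes "{u, v} \<in> E" "u \<in> sub y" "v \<notin> sub y"
  shows "u = y \<and> v = par y \<and> y \<noteq> r"
proof -
  from edge_par[OF assms(1)] show ?thesis
  proof
    assume v: "v = par u \<and> u \<noteq> r"
    then show ?thesis using sub_par(1)[OF assms(2)] assms(3) by (cases "u = y") auto
  next
    assume "u = par v \<and> v \<noteq> r"
    then have "v \<in> ch u" using edgeD[OF assms(1)] by (simp add: ch_def)
    then show ?thesis using sub_ch[OF assms(2)] assms(3) by blast
  qed
qed

lemma sub_disjoint: "lev y = lev y' \<Longrightarrow> y \<noteq> y' \<Longrightarrow> sub y \<inter> sub y' = {}"
  by (auto simp: sub_def)

lemma sub_trans:
  assumes "z \<in> sub y"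
  shows "sub z \<subseteq> sub y"
proof
  fix x assume x: "x \<in> sub z"
  have l: "lev y \<le> lev z" "lev z \<le> lev x" using assms x by (auto simp: sub_def)
  have "up x ((lev x - lev z) + (lev z - lev y)) = y"
    unfolding up_add using assms x by (simp add: sub_def)
  moreover have "(lev x - lev z) + (lev z - lev y) = lev x - lev y" using l by simp
  ultimately show "x \<in> sub y" using x l by (simp add: sub_def)
qed

lemma par_not_sub: "y \<in> T \<Longrightarrow> y \<noteq> r \<Longrightarrow> par y \<notin> sub y"
  using par(2)[of y] by (auto simp: sub_def)

lemma sub_cover:
  assumes "z \<in> T" "m \<le> lev z"
  obtains u where "u \<in> T" "lev u = m" "z \<in> sub u"
  using that[of "up z (lev z - m)"] up_T[of z "lev z - m"] assms by (simp add: sub_def)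

lemma sub_comparable:
  assumes "z \<in> sub y" "z \<in> sub y'" "lev y \<le> lev y'"
  shows "y' \<in> sub y"
proof -
  have l: "lev y' \<le> lev z" "z \<in> T" using assms by (auto simp: sub_def)
  have y': "y' \<in> T" "up z (lev z - lev y') = y'"
    using sub_in_T[OF assms(2)] assms(2) by (auto simp: sub_def)
  have "up y' (lev y' - lev y) = up z ((lev z - lev y') + (lev y' - lev y))"
    unfolding up_add y'(2) ..
  also have "(lev z - lev y') + (lev y' - lev y) = lev z - lev y" using l assms(3) by simp
  also have "up z (lev z - lev y) = y" using assms(1) by (simp add: sub_def)
  finally show ?thesis using y' assms(3) by (simp add: sub_def)
qed

lemma level_iff: "x \<in> level T E r n \<longleftrightarrow> x \<in> T \<and> lev x = n"
  by (simp add: level_def)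

lemma tball_iff: "x \<in> tball T E r n \<longleftrightarrow> x \<in> T \<and> lev x \<le> n"
  by (simp add: tball_def)

abbreviation "Bn \<equiv> tball T E r"

lemma tball_finite: "finite (Bn n)"
proof (induction n)
  case 0
  have "Bn 0 \<subseteq> {r}" using lev_0_iff by (auto simp: tball_iff)
  then show ?case by (rule finite_subset) simp
next
  case (Suc n)
  have "Bn (Suc n) \<subseteq> Bn n \<union> (\<Union>x\<in>Bn n. nbr x)"
  proof
    fix x assume x: "x \<in> Bn (Suc n)"
    show "x \<in> Bn n \<union> (\<Union>x\<in>Bn n. nbr x)"
    proof (cases "lev x \<le> n")
      case False
      then have "x \<noteq> r" "x \<in> T" using x by (auto simp: tball_iff)
      then show ?thesis using par[of x] par_T[of x] x by (auto simp: tball_iff)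
    qed (use x in \<open>auto simp: tball_iff\<close>)
  qed
  moreover have "finite (Bn n \<union> (\<Union>x\<in>Bn n. nbr x))"
    using Suc nbr_finite by (auto simp: tball_iff)
  ultimately show ?case by (rule finite_subset)
qed

lemma tball_T: "Bn n \<subseteq> T" by (auto simp: tball_iff)

lemma tball_mono: "m \<le> n \<Longrightarrow> Bn m \<subseteq> Bn n" by (auto simp: tball_iff)

lemma level_finite: "finite (level T E r n)"
  by (rule finite_subset[OF _ tball_finite[of n]]) (auto simp: level_iff tball_iff)

lemma T_UN: "T = (\<Union>n. Bn n)" by (auto simp: tball_iff)

lemma countable_T: "countable T"
  by (subst T_UN) (intro countable_UN countableI_type countable_finite tball_finite)

lemma finite_in_ball: "finite U \<Longrightarrow> U \<subseteq> T \<Longrightarrow> \<exists>n. U \<subseteq> Bn n"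
  by (rule exI[of _ "Max (lev ` U)"]) (auto simp: tball_iff)

lemma tree_induct:
  assumes i: "i \<in> T" and j: "j \<in> T" and P: "P i"
    and step: "\<And>x y. {x, y} \<in> E \<Longrightarrow> P x \<Longrightarrow> P y"
  shows "P j"
proof -
  have "(i, j) \<in> adj\<^sup>*" using tree i j unfolding is_tree_def by blast
  then show ?thesis by (induction rule: rtrancl_induct) (use P step in auto)
qed

subsection \<open>Ancestors, ends and convergence to ends\<close>

lemma simple_path_levels:
  assumes "\<omega> 0 = r" "\<And>k. k < N \<Longrightarrow> {\<omega> k, \<omega> (Suc k)} \<in> E" "inj_on \<omega> {..N}"
  shows "k \<le> N \<Longrightarrow> lev (\<omega> k) = k \<and> \<omega> k \<in> T \<and> (\<forall>j<k. par (\<omega> (Suc j)) = \<omega> j \<and> \<omega> (Suc j) \<noteq> r)"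
proof (induction k)
  case 0
  then show ?case using assms(1) root by simp
next
  case (Suc k)
  then have IH: "lev (\<omega> k) = k" "\<omega> k \<in> T" "\<forall>j<k. par (\<omega> (Suc j)) = \<omega> j \<and> \<omega> (Suc j) \<noteq> r" by auto
  have e: "{\<omega> k, \<omega> (Suc k)} \<in> E" using assms(2) Suc.prems by simp
  have "\<omega> k = par (\<omega> (Suc k)) \<and> \<omega> (Suc k) \<noteq> r"
    using edge_par[OF e]
  proof
    assume *: "\<omega> (Suc k) = par (\<omega> k) \<and> \<omega> k \<noteq> r"
    then have "k \<noteq> 0" using assms(1) by (cases k) auto
    then obtain l where l: "k = Suc l" by (cases k) auto
    then have "\<omega> (Suc k) = \<omega> l" using * IH(3) by simp
    then have "Suc k = l" using assms(3) Suc.prems l by (auto dest!: inj_onD)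
    then show ?thesis using l by simp
  qed
  moreover have "lev (\<omega> (Suc k)) = Suc k"
    using par(2)[of "\<omega> (Suc k)"] calculation edgeD(2)[OF e] IH(1) by auto
  ultimately show ?case using IH edgeD(2)[OF e] by (auto simp: less_Suc_eq)
qed

lemma simple_path_up:
  assumes "\<And>j. j < k \<Longrightarrow> par (\<omega> (Suc j)) = \<omega> j" "j \<le> k"
  shows "up (\<omega> k) j = \<omega> (k - j)"
  using assms(2)
proof (induction j)
  case (Suc j)
  then have "up (\<omega> k) (Suc j) = par (\<omega> (Suc (k - Suc j)))" by (simp add: up_Suc Suc_diff_Suc)
  then show ?case using assms(1)[of "k - Suc j"] Suc.prems by simp
qed simp

text \<open>The simple path from the root to \<open>x\<close> runs through the ancestors of \<open>x\<close>, because
  each step of a simple path from the root increases the level.\<close>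

lemma ancestor_iff: "ancestor E r z x \<longleftrightarrow> x \<in> sub z"
proof
  assume "ancestor E r z x"
  then obtain xs where xs: "xs \<noteq> []" "distinct xs" "successively (\<lambda>u v. {u, v} \<in> E) xs"
    "hd xs = r" "last xs = x" "z \<in> set xs" unfolding ancestor_def by blast
  define N where "N = length xs - 1"
  have len: "length xs = Suc N" using xs(1) by (cases xs) (auto simp: N_def)
  have 0: "xs ! 0 = r" using xs(1,4) by (simp add: hd_conv_nth)
  have e: "{xs ! k, xs ! Suc k} \<in> E" if "k < N" for k
    using xs(3) that len by (simp add: successively_conv_nth)
  have inj: "inj_on ((!) xs) {..N}" using xs(2) len by (auto simp: inj_on_def nth_eq_iff_index_eq)
  have x: "x = xs ! N" using xs(1,5) len by (simp add: last_conv_nth)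
  obtain i where i: "z = xs ! i" "i \<le> N" using xs(6) len by (auto simp: in_set_conv_nth)
  note L = simple_path_levels[of "(!) xs" N, OF 0 e inj]
  have "up (xs ! N) (N - i) = xs ! (N - (N - i))" using L[of N] by (intro simple_path_up) auto
  then show "x \<in> sub z" using L[of N] L[of i] i x by (simp add: sub_def)
next
  assume x: "x \<in> sub z"
  then have xT: "x \<in> T" "lev z \<le> lev x" "up x (lev x - lev z) = z" by (auto simp: sub_def)
  let ?xs = "rev (map (up x) [0..<Suc (lev x)])"
  have "distinct ?xs" using up_inj[OF xT(1)] by (auto simp: distinct_map inj_on_def simp del: upt_Suc)
  moreover have "successively (\<lambda>u v. {u, v} \<in> E) ?xs"
    unfolding successively_rev unfolding successively_conv_nth
    using up_edge[OF xT(1)] by (auto simp del: upt_Suc)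
  moreover have "hd ?xs = r" by (simp add: hd_rev last_map up_lev[OF xT(1)])
  moreover have "last ?xs = x" by (simp add: last_rev hd_map del: upt_Suc)
  moreover have "z \<in> set ?xs"
    using xT(3) by (auto simp del: upt_Suc intro!: image_eqI[of _ _ "lev x - lev z"])
  ultimately show "ancestor E r z x" unfolding ancestor_def by (intro exI[of _ ?xs]) auto
qed

lemma meet_T: "x \<in> T \<Longrightarrow> y \<in> T \<Longrightarrow> meet E r x y \<in> T"
proof -
  assume x: "x \<in> T" and y: "y \<in> T"
  let ?P = "\<lambda>z. x \<in> sub z \<and> y \<in> sub z"
  have "?P (arg_max lev ?P)"
  proof (rule arg_max_natI)
    show "?P r" using x y by (simp add: sub_root)
    show "\<forall>z. ?P z \<longrightarrow> lev z < Suc (lev x)" by (auto simp: sub_def)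
  qed
  then show ?thesis unfolding meet_def ancestor_iff using sub_in_T by blast
qed

lemma meet_commute: "meet E r x y = meet E r y x"
  unfolding meet_def by (rule arg_cong[where f="arg_max lev"]) (simp add: conj_commute)

lemma endsD:
  assumes "\<omega> \<in> ends E r"
  shows "\<omega> n \<in> T" "lev (\<omega> n) = n" "\<omega> (Suc n) \<in> ch (\<omega> n)"
proof -
  have *: "lev (\<omega> n) = n \<and> \<omega> n \<in> T \<and> (\<forall>j<n. par (\<omega> (Suc j)) = \<omega> j \<and> \<omega> (Suc j) \<noteq> r)" for n
    using assms by (intro simple_path_levels[of \<omega> n]) (auto simp: ends_def intro: inj_on_subset)
  show "\<omega> n \<in> T" "lev (\<omega> n) = n" using *[of n] by auto
  show "\<omega> (Suc n) \<in> ch (\<omega> n)" using *[of "Suc n"] by (auto simp: ch_def)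
qed

lemma endsI:
  assumes "\<omega> 0 = r" "\<And>n. \<omega> (Suc n) \<in> ch (\<omega> n)"
  shows "\<omega> \<in> ends E r"
proof -
  have "lev (\<omega> n) = n" for n
  proof (induction n)
    case 0
    show ?case by (simp add: assms(1))
  next
    case (Suc n)
    then show ?case using chD[OF assms(2)[of n]] by simp
  qed
  then have "inj \<omega>" by (intro injI) (auto dest: arg_cong[where f=lev])
  moreover have "{\<omega> n, \<omega> (Suc n)} \<in> E" for n using chD[OF assms(2)[of n]] by simp
  ultimately show ?thesis using assms(1) by (simp add: ends_def)
qed

lemma ends_sub:
  assumes "\<omega> \<in> ends E r" "m \<le> n"
  shows "\<omega> n \<in> sub (\<omega> m)"
  using assms(2)
proof (induction n rule: dec_induct)
  case base
  then show ?case using endsD(1)[OF assms(1)] sub_self by blast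
next
  case (step n)
  then show ?case using endsD(3)[OF assms(1)] sub_ch by blast
qed

lemma ends_through_iff: "x \<in> T \<Longrightarrow> \<omega> \<in> ends_through E r x \<longleftrightarrow> \<omega> \<in> ends E r \<and> \<omega> (lev x) = x"
  unfolding ends_through_def using endsD(2)[of \<omega>] by (auto intro: rangeI[of \<omega> "lev x", THEN subst[where P="\<lambda>y. y \<in> range \<omega>", rotated]])

lemma ends_through_disjoint:
  "x \<in> T \<Longrightarrow> y \<in> T \<Longrightarrow> lev x = lev y \<Longrightarrow> x \<noteq> y \<Longrightarrow> ends_through E r x \<inter> ends_through E r y = {}"
  by (auto simp: ends_through_iff)

lemma tends_unique: "tends_to_end E r X \<omega> \<Longrightarrow> tends_to_end E r X \<omega>' \<Longrightarrow> \<omega> = \<omega>'"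
proof (rule ext)
  fix n assume t: "tends_to_end E r X \<omega>" "tends_to_end E r X \<omega>'"
  then have "\<forall>\<^sub>F k in sequentially. X k \<in> sub (\<omega> n)" "\<forall>\<^sub>F k in sequentially. X k \<in> sub (\<omega>' n)"
    and w: "\<omega> \<in> ends E r" "\<omega>' \<in> ends E r"
    by (auto simp: tends_to_end_def ancestor_iff)
  from this(1,2) have "\<forall>\<^sub>F k in sequentially. X k \<in> sub (\<omega> n) \<inter> sub (\<omega>' n)" by eventually_elim auto
  then obtain k where "X k \<in> sub (\<omega> n) \<inter> sub (\<omega>' n)"
    using eventually_happens'[OF sequentially_bot] by blast
  then show "\<omega> n = \<omega>' n" using sub_disjoint[of "\<omega> n" "\<omega>' n"] endsD(2) w by auto
qed

text \<open>A nearest-neighbour path that visits every vertex finitely often leaves every ball, and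
  outside a ball it cannot change the branch it is in.\<close>

lemma transient_branches:
  assumes X: "\<And>k. {X k, X (Suc k)} \<in> E" and fin: "\<And>v. v \<in> T \<Longrightarrow> finite {k. X k = v}"
  shows "\<exists>u\<in>level T E r n. \<forall>\<^sub>F k in sequentially. X k \<in> sub u"
proof -
  have ex: "\<exists>u. u \<in> T \<and> lev u = n \<and> (\<forall>\<^sub>F k in sequentially. X k \<in> sub u)"
  proof -
    have "finite {k. X k \<in> Bn n}"
    proof -
      have "{k. X k \<in> Bn n} = (\<Union>v\<in>Bn n. {k. X k = v})" by auto
      then show ?thesis using tball_finite[of n] fin tball_T[of n] by (auto simp: subset_iff)
    qed
    then obtain K where K: "\<And>k. X k \<in> Bn n \<Longrightarrow> k < K"
      using finite_nat_set_iff_bounded by auto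
    have XT: "X k \<in> T" for k using edgeD(1)[OF X] .
    have big: "n < lev (X k)" if "K \<le> k" for k using K[of k] that XT[of k] by (force simp: tball_iff)
    obtain u where u: "u \<in> T" "lev u = n" "X K \<in> sub u"
      using sub_cover[OF XT, of n K] big[of K] by auto
    have "X k \<in> sub u" if "K \<le> k" for k using that
    proof (induction k rule: dec_induct)
      case (step k)
      show ?case
      proof (rule ccontr)
        assume "X (Suc k) \<notin> sub u"
        from sub_boundary[OF X step.IH this] have "X k = u" by simp
        then show False using big[of k] step.hyps u by simp
      qed
    qed (rule u(3))
    then show ?thesis using u by (auto simp: eventually_sequentially)
  qed
  then show ?thesis by (auto simp: level_iff)
qed

text \<open>Vertices of consecutive levels whose subtrees finally contain the path are parent and
  child, so choosing one on each level yields a ray.\<close>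

lemma tends_iff:
  "(\<exists>\<omega>. tends_to_end E r X \<omega>) \<longleftrightarrow> (\<forall>n. \<exists>u\<in>level T E r n. \<forall>\<^sub>F k in sequentially. X k \<in> sub u)"
proof
  assume "\<exists>\<omega>. tends_to_end E r X \<omega>"
  then obtain \<omega> where w: "\<omega> \<in> ends E r" "\<And>n. \<forall>\<^sub>F k in sequentially. X k \<in> sub (\<omega> n)"
    by (auto simp: tends_to_end_def ancestor_iff)
  show "\<forall>n. \<exists>u\<in>level T E r n. \<forall>\<^sub>F k in sequentially. X k \<in> sub u"
    using w(2) endsD(1,2)[OF w(1)] by (intro allI bexI[of _ "\<omega> _"]) (auto simp: level_iff)
next
  assume h: "\<forall>n. \<exists>u\<in>level T E r n. \<forall>\<^sub>F k in sequentially. X k \<in> sub u"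
  have ex: "\<exists>u. u \<in> T \<and> lev u = n \<and> (\<forall>\<^sub>F k in sequentially. X k \<in> sub u)" for n
    using spec[OF h, of n] unfolding Bex_def level_iff by auto
  then obtain \<omega> where \<omega>: "\<And>n. \<omega> n \<in> T" "\<And>n. lev (\<omega> n) = n" "\<And>n. \<forall>\<^sub>F k in sequentially. X k \<in> sub (\<omega> n)"
    using choice[of "\<lambda>n u. u \<in> T \<and> lev u = n \<and> (\<forall>\<^sub>F k in sequentially. X k \<in> sub u)"] ex by blast
  have "\<omega> (Suc n) \<in> ch (\<omega> n)" for n
  proof -
    have "\<forall>\<^sub>F k in sequentially. X k \<in> sub (\<omega> n) \<and> X k \<in> sub (\<omega> (Suc n))"
      using \<omega>(3)[of n] \<omega>(3)[of "Suc n"] by eventually_elim auto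
    then obtain k where k: "X k \<in> sub (\<omega> n)" "X k \<in> sub (\<omega> (Suc n))"
      using eventually_happens'[OF sequentially_bot] by blast
    have s: "\<omega> (Suc n) \<in> sub (\<omega> n)" using sub_comparable[OF k] \<omega>(2) by simp
    have ne: "\<omega> (Suc n) \<noteq> \<omega> n" using \<omega>(2)[of n] \<omega>(2)[of "Suc n"] by auto
    note p = sub_par[OF s ne]
    have "lev (par (\<omega> (Suc n))) = n" using par(2)[OF \<omega>(1) p(2)] \<omega>(2)[of "Suc n"] by simp
    then have "par (\<omega> (Suc n)) = \<omega> n" using sub_level_eq[OF p(1)] \<omega>(2)[of n] by simp
    then show ?thesis using p \<omega>(1) by (simp add: ch_def)
  qed
  moreover have "\<omega> 0 = r" using lev_0_iff[OF \<omega>(1)[of 0]] \<omega>(2)[of 0] by simp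
  ultimately have "\<omega> \<in> ends E r" by (intro endsI)
  then show "\<exists>\<omega>. tends_to_end E r X \<omega>" using \<omega>(3) by (auto simp: tends_to_end_def ancestor_iff)
qed

lemma the_end_through_iff:
  assumes "\<exists>\<omega>. tends_to_end E r X \<omega>" and u: "u \<in> T"
  shows "(THE \<omega>. tends_to_end E r X \<omega>) \<in> ends_through E r u \<longleftrightarrow> (\<forall>\<^sub>F k in sequentially. X k \<in> sub u)"
proof -
  obtain \<omega> where t: "tends_to_end E r X \<omega>" using assms by blast
  then have eq: "(THE \<omega>. tends_to_end E r X \<omega>) = \<omega>" using tends_unique by blast
  have w: "\<omega> \<in> ends E r" and ev: "\<And>n. \<forall>\<^sub>F k in sequentially. X k \<in> sub (\<omega> n)"
    using t by (auto simp: tends_to_end_def ancestor_iff)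
  show ?thesis unfolding eq ends_through_iff[OF u]
  proof
    assume "\<omega> \<in> ends E r \<and> \<omega> (lev u) = u"
    then show "\<forall>\<^sub>F k in sequentially. X k \<in> sub u" using ev[of "lev u"] by simp
  next
    assume "\<forall>\<^sub>F k in sequentially. X k \<in> sub u"
    then have "\<forall>\<^sub>F k in sequentially. X k \<in> sub u \<and> X k \<in> sub (\<omega> (lev u))"
      using ev[of "lev u"] by eventually_elim auto
    then obtain k where "X k \<in> sub u" "X k \<in> sub (\<omega> (lev u))"
      using eventually_happens'[OF sequentially_bot] by blast
    then show "\<omega> \<in> ends E r \<and> \<omega> (lev u) = u"
      using sub_disjoint[of u "\<omega> (lev u)"] endsD(2)[OF w, of "lev u"] w by (cases "u = \<omega> (lev u)") auto
  qed
qed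

lemma descendant_at_level:
  assumes "c \<in> T" "lev c \<le> m"
  shows "\<exists>x. x \<in> sub c \<and> lev x = m"
  using assms(2)
proof (induction m rule: dec_induct)
  case base
  then show ?case using sub_self[OF assms(1)] by blast
next
  case (step m)
  then obtain x where x: "x \<in> sub c" "lev x = m" by blast
  then have "ch x \<noteq> {}" using card_ch_ge[of x] sub_T by fastforce
  then obtain y where "y \<in> ch x" by blast
  then show ?case using sub_ch[OF x(1)] chD[of y x] x(2) by auto
qed

end

section \<open>Green's functions and harmonic functions on the balls\<close>

locale wtree = rtree T E r d for T :: "'v set" and E r d +
  fixes w :: real
  assumes w_pos: "0 < w"
begin

abbreviation "W \<equiv> edge_weight E w"
abbreviation "Dm \<equiv> dom_inf T W"
abbreviation "nu \<equiv> nu_inf T W"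

lemma no_loop: "{i} \<notin> E"
  using edgeD(3)[of i i] by auto

lemma tball_in_T: "z \<in> Bn n \<Longrightarrow> z \<in> T"
  using tball_T by blast

lemma weights_T: "weights_on T W"
  using w_pos no_loop by (auto simp: weights_on_def edge_weight_def insert_commute)

lemma weights_U: "U \<subseteq> T \<Longrightarrow> weights_on U W"
  by (rule weights_on_subset[OF weights_T])

lemma W_supp: "i \<in> T \<Longrightarrow> {j \<in> T. W i j \<noteq> 0} = nbr i"
  using w_pos edgeD(2) by (auto simp: edge_weight_def)

lemma weighted_graph: "weighted_graph T W"
  using countable_T weights_T W_supp nbr_finite by unfold_locales auto

abbreviation "eta \<equiv> eta_out T W"

lemma eta_eq: "i \<in> T \<Longrightarrow> eta U i = w * card (nbr i - U)"
proof -
  assume i: "i \<in> T"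
  have "eta U i = (\<Sum>j\<in>nbr i - U. W i j)"
    using weighted_graph.eta_out_sum[OF weighted_graph i] unfolding W_supp[OF i] .
  also have "\<dots> = (\<Sum>j\<in>nbr i - U. w)" by (intro sum.cong) (auto simp: edge_weight_def)
  finally show ?thesis by simp
qed

lemma nu_facts:
  shows nu_prob: "prob_space nu" and nu_sets: "sets nu = sets (PiM T (\<lambda>_. borel))"
    and nu_dom: "AE \<beta> in nu. \<beta> \<in> Dm"
    and nu_restrict: "finite U \<Longrightarrow> U \<subseteq> T \<Longrightarrow>
        distr nu (PiM U (\<lambda>_. borel)) (\<lambda>\<beta>. restrict \<beta> U) = nu_fin U W (eta U)"
  using weighted_graph.nu_inf_spec[OF weighted_graph]
  by (auto simp: weighted_graph.nu_spec_def[OF weighted_graph] weighted_graph.nu_proj_def[OF weighted_graph])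

lemma Hop_eq: "Hop E w \<beta> f i = 2 * \<beta> i * f i - w * (\<Sum>j\<in>nbr i. f j)"
  unfolding Hop_def by (simp add: edge_weight_def sum_distrib_left)

lemma Hop_split:
  assumes "finite U" "i \<in> U" "U \<subseteq> T"
  shows "Hop E w \<beta> f i = (\<Sum>j\<in>U. Hmat W \<beta> i j * f j) - w * (\<Sum>j\<in>nbr i - U. f j)"
proof -
  have iT: "i \<in> T" using assms by auto
  have "(\<Sum>j\<in>U. Hmat W \<beta> i j * f j) = (\<Sum>j\<in>U. (if j = i then 2 * \<beta> i * f i else 0) - (if j \<in> nbr i then w * f j else 0))"
    using no_loop by (intro sum.cong refl) (auto simp: Hmat_def edge_weight_def)
  also have "\<dots> = 2 * \<beta> i * f i - (\<Sum>j\<in>U \<inter> nbr i. w * f j)"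
    using assms by (simp add: sum_subtractf sum.inter_restrict)
  finally have "(\<Sum>j\<in>U. Hmat W \<beta> i j * f j) = 2 * \<beta> i * f i - w * (\<Sum>j\<in>nbr i \<inter> U. f j)"
    by (simp add: sum_distrib_left Int_commute)
  moreover have "(\<Sum>j\<in>nbr i. f j) = (\<Sum>j\<in>nbr i \<inter> U. f j) + (\<Sum>j\<in>nbr i - U. f j)"
    using nbr_finite[OF iT] by (rule sum.Int_Diff)
  ultimately show ?thesis unfolding Hop_eq by (simp add: distrib_left)
qed

text \<open>The part of a subtree inside a ball, its Green's function at its root, and the part of
  \<open>\<psi>\<close> that comes from the boundary beyond the subtree.\<close>

definition Sb :: "'v \<Rightarrow> nat \<Rightarrow> 'v set" where "Sb y n = sub y \<inter> Bn n"

definition green_n :: "'v \<Rightarrow> nat \<Rightarrow> ('v \<Rightarrow> real) \<Rightarrow> real" where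
  "green_n y n \<beta> = inv_on (Sb y n) (Hmat W \<beta>) y y"

definition inflow_n :: "'v \<Rightarrow> nat \<Rightarrow> ('v \<Rightarrow> real) \<Rightarrow> real" where
  "inflow_n y n \<beta> = (\<Sum>z\<in>Sb y n. inv_on (Sb y n) (Hmat W \<beta>) y z * eta (Sb y n) z) - w * green_n y n \<beta>"

definition green :: "'v \<Rightarrow> ('v \<Rightarrow> real) \<Rightarrow> real" where "green y \<beta> = lim (\<lambda>n. green_n y n \<beta>)"
definition inflow :: "'v \<Rightarrow> ('v \<Rightarrow> real) \<Rightarrow> real" where "inflow y \<beta> = lim (\<lambda>n. inflow_n y n \<beta>)"

abbreviation "Gn n \<beta> \<equiv> Ghat_n T E r w n \<beta>"
abbreviation "psin n \<beta> \<equiv> psi_n T E r w n \<beta>"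
abbreviation "Gh \<beta> \<equiv> Ghat T E r w \<beta>"
abbreviation "ps \<beta> \<equiv> psi T E r w \<beta>"

lemma Sb_finite: "finite (Sb y n)" and Sb_T: "Sb y n \<subseteq> T"
  using tball_finite tball_T by (auto simp: Sb_def)

lemma Sb_self: "y \<in> T \<Longrightarrow> lev y \<le> n \<Longrightarrow> y \<in> Sb y n"
  using sub_self by (simp add: Sb_def tball_iff)

lemma nbr_Sb:
  assumes z: "z \<in> Sb y n" and y: "y \<noteq> r"
  shows "nbr z - Sb y n = (ch z - Bn n) \<union> (if z = y then {par y} else {})"
proof -
  have zT: "z \<in> T" "z \<in> sub y" "lev z \<le> n" using z by (auto simp: Sb_def tball_iff)
  have yT: "y \<in> T" using sub_in_T zT by blast
  have c: "c \<in> ch z \<Longrightarrow> c \<in> sub y" for c using sub_ch zT(2) by blast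
  have p: "par z \<in> sub y \<and> par z \<in> Bn n" if "z \<noteq> y"
    using sub_par[OF zT(2) that] par[of z] par_T[of z] zT by (auto simp: tball_iff)
  have "par y \<notin> sub y" by (rule par_not_sub[OF yT y])
  moreover have "z \<noteq> r" if "z \<noteq> y" using sub_par(2)[OF zT(2) that] .
  ultimately show ?thesis using c p y unfolding nbr_eq[OF zT(1)] Sb_def by (auto split: if_splits)
qed

lemma ch_par_disjoint: "z \<in> T \<Longrightarrow> z \<noteq> r \<Longrightarrow> (ch z - B) \<inter> {par z} = {}"
  using par_not_ch by auto

context
  fixes \<beta> :: "'v \<Rightarrow> real"
  assumes dom: "\<beta> \<in> Dm"
begin

abbreviation "H \<equiv> Hmat W \<beta>"
abbreviation "HO \<equiv> Hop E w \<beta>"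

lemma pd: "finite U \<Longrightarrow> U \<subseteq> T \<Longrightarrow> posdef_on U H"
  using dom by (simp add: dom_inf_def)

lemma symH: "U \<subseteq> T \<Longrightarrow> symm_on U H" and ZH: "U \<subseteq> T \<Longrightarrow> Zmat U H"
  using Hmat_symm Hmat_Zmat weights_U by blast+

lemma invU_nonneg: "finite U \<Longrightarrow> U \<subseteq> T \<Longrightarrow> 0 \<le> inv_on U H i j"
  by (rule inv_nonneg[OF _ symH pd ZH])

text \<open>The values at neighbours outside \<open>U\<close> are moved to the right-hand side and act as a source.\<close>

lemma dirichlet:
  assumes "finite U" "U \<subseteq> T" "i \<in> U" "\<And>z. z \<in> U \<Longrightarrow> HO f z = g z"
  shows "f i = (\<Sum>z\<in>U. inv_on U H i z * (g z + w * (\<Sum>j\<in>nbr z - U. f j)))"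
proof (rule inv_solve[OF assms(1) symH[OF assms(2)] pd[OF assms(1,2)] assms(3)])
  fix z assume "z \<in> U"
  then show "(\<Sum>k\<in>U. H z k * f k) = g z + w * (\<Sum>j\<in>nbr z - U. f j)"
    using Hop_split[OF assms(1) _ assms(2), of z \<beta> f] assms(4) by simp
qed

lemma Gn_sym: "Gn n \<beta> i j = Gn n \<beta> j i"
  unfolding Ghat_n_def by (rule inv_sym[OF tball_finite symH[OF tball_T] pd[OF tball_finite tball_T]])

lemma Gn_nonneg: "0 \<le> Gn n \<beta> i j"
  unfolding Ghat_n_def by (rule invU_nonneg[OF tball_finite tball_T])

lemma Gn_outside: "i \<notin> Bn n \<or> j \<notin> Bn n \<Longrightarrow> Gn n \<beta> i j = 0"
  unfolding Ghat_n_def by (rule inv_outside[OF tball_finite symH[OF tball_T] pd[OF tball_finite tball_T]])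

lemma Gn_mono: "m \<le> n \<Longrightarrow> Gn m \<beta> i j \<le> Gn n \<beta> i j"
  unfolding Ghat_n_def
  by (rule inv_mono[OF tball_finite tball_mono symH[OF tball_T] pd[OF tball_finite tball_T] ZH[OF tball_T]])

lemma Gn_Hop:
  assumes "i \<in> Bn n" "j \<in> Bn n"
  shows "HO (\<lambda>k. Gn n \<beta> k j) i = (if i = j then 1 else 0)"
proof -
  have "(\<Sum>k\<in>nbr i - Bn n. Gn n \<beta> k j) = 0" by (rule sum.neutral) (auto intro: Gn_outside)
  then show ?thesis
    using Hop_split[OF tball_finite assms(1) tball_T, of \<beta> "\<lambda>k. Gn n \<beta> k j"]
      inv_right[OF tball_finite symH[OF tball_T] pd[OF tball_finite tball_T] assms]
    by (simp add: Ghat_n_def)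
qed

text \<open>Positivity of the quadratic form of the inverse at \<open>\<delta>\<^sub>i - \<delta>\<^sub>j\<close>. With monotonicity it
  reduces the convergence of all entries to that of the diagonal.\<close>

lemma Gn_diag_bound: "i \<in> Bn n \<Longrightarrow> j \<in> Bn n \<Longrightarrow> 2 * Gn n \<beta> i j \<le> Gn n \<beta> i i + Gn n \<beta> j j"
proof (cases "i = j")
  case False
  assume ij: "i \<in> Bn n" "j \<in> Bn n"
  let ?x = "\<lambda>k. (if k = i then 1 else 0) - (if k = j then 1 else (0::real))"
  have s: "(\<Sum>k\<in>Bn n. ?x k * f k) = f i - f j" for f
  proof -
    have "(\<Sum>k\<in>Bn n. ?x k * f k) = (\<Sum>k\<in>Bn n. (if k = i then f k else 0) - (if k = j then f k else 0))"
      by (intro sum.cong) auto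
    then show ?thesis using ij tball_finite[of n] by (simp add: sum_subtractf)
  qed
  have "0 \<le> (\<Sum>k\<in>Bn n. \<Sum>l\<in>Bn n. ?x k * inv_on (Bn n) H k l * ?x l)"
    by (rule inv_psd[OF tball_finite symH[OF tball_T] pd[OF tball_finite tball_T]])
  also have "\<dots> = (\<Sum>k\<in>Bn n. ?x k * (\<Sum>l\<in>Bn n. ?x l * Gn n \<beta> k l))"
    unfolding sum_distrib_left Ghat_n_def by (intro sum.cong refl) (simp only: mult_ac)
  also have "\<dots> = (Gn n \<beta> i i - Gn n \<beta> i j) - (Gn n \<beta> j i - Gn n \<beta> j j)" unfolding s ..
  finally show ?thesis using Gn_sym[of n i j] by simp
qed simp

text \<open>The Dirichlet problem in the definition of \<^const>\<open>psi_n\<close> has exactly one solution.\<close>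

lemma psin_eq: "psin n \<beta> i = (if i \<in> Bn n then \<Sum>z\<in>Bn n. Gn n \<beta> i z * eta (Bn n) z else 1)"
proof -
  define P where "P i = (if i \<in> Bn n then \<Sum>z\<in>Bn n. Gn n \<beta> i z * eta (Bn n) z else 1)" for i
  have out: "w * (\<Sum>j\<in>nbr i - Bn n. 1) = eta (Bn n) i" if "i \<in> Bn n" for i
    using eta_eq[of i "Bn n", OF tball_in_T[OF that]] by simp
  have "psin n \<beta> = P"
    unfolding psi_n_def
  proof (rule the_equality, intro conjI ballI allI impI)
    fix i assume i: "i \<in> Bn n"
    have "(\<Sum>j\<in>Bn n. H i j * P j) = (\<Sum>j\<in>Bn n. \<Sum>z\<in>Bn n. H i j * Gn n \<beta> j z * eta (Bn n) z)"
      by (simp add: P_def sum_distrib_left mult.assoc)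
    also have "\<dots> = (\<Sum>z\<in>Bn n. (\<Sum>j\<in>Bn n. H i j * Gn n \<beta> j z) * eta (Bn n) z)"
      by (subst sum.swap) (simp add: sum_distrib_right)
    also have "\<dots> = (\<Sum>z\<in>Bn n. if z = i then eta (Bn n) z else 0)"
      unfolding Ghat_n_def using inv_right[OF tball_finite symH[OF tball_T] pd[OF tball_finite tball_T] i]
      by (intro sum.cong refl) auto
    also have "\<dots> = eta (Bn n) i" using i tball_finite by simp
    finally have "(\<Sum>j\<in>Bn n. H i j * P j) = eta (Bn n) i" .
    moreover have "(\<Sum>j\<in>nbr i - Bn n. P j) = (\<Sum>j\<in>nbr i - Bn n. 1)"
      by (intro sum.cong refl) (auto simp: P_def)
    ultimately show "HO P i = 0"
      unfolding Hop_split[OF tball_finite i tball_T] using out[OF i] by simp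
  next
    fix i assume "i \<notin> Bn n" then show "P i = 1" by (simp add: P_def)
  next
    fix f assume f: "(\<forall>i\<in>Bn n. HO f i = 0) \<and> (\<forall>i. i \<notin> Bn n \<longrightarrow> f i = 1)"
    show "f = P"
    proof
      fix i show "f i = P i"
      proof (cases "i \<in> Bn n")
        case True
        have "f i = (\<Sum>z\<in>Bn n. inv_on (Bn n) H i z * (0 + w * (\<Sum>j\<in>nbr z - Bn n. f j)))"
          using f by (intro dirichlet[OF tball_finite tball_T True]) auto
        also have "\<dots> = (\<Sum>z\<in>Bn n. Gn n \<beta> i z * eta (Bn n) z)"
          unfolding Ghat_n_def
        proof (intro sum.cong refl arg_cong2[where f="(*)"])
          fix z assume z: "z \<in> Bn n"
          have "(\<Sum>j\<in>nbr z - Bn n. f j) = (\<Sum>j\<in>nbr z - Bn n. 1)" using f by (intro sum.cong) auto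
          then show "0 + w * (\<Sum>j\<in>nbr z - Bn n. f j) = eta (Bn n) z" using out[OF z] by simp
        qed
        finally show ?thesis using True by (simp add: P_def)
      qed (use f in \<open>simp add: P_def\<close>)
    qed
  qed
  then show ?thesis by (simp add: P_def)
qed

lemma psin_nonneg: "0 \<le> psin n \<beta> i"
  unfolding psin_eq using Gn_nonneg weighted_graph.eta_out_nonneg[OF weighted_graph] tball_in_T
  by (auto intro!: sum_nonneg mult_nonneg_nonneg)

lemma psin_Hop: "i \<in> Bn n \<Longrightarrow> HO (psin n \<beta>) i = 0"
proof -
  assume i: "i \<in> Bn n"
  have out: "w * (\<Sum>j\<in>nbr i - Bn n. psin n \<beta> j) = eta (Bn n) i"
  proof -
    have "(\<Sum>j\<in>nbr i - Bn n. psin n \<beta> j) = (\<Sum>j\<in>nbr i - Bn n. 1)"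
      by (intro sum.cong refl) (auto simp: psin_eq)
    then show ?thesis using eta_eq[of i "Bn n", OF tball_in_T[OF i]] by simp
  qed
  have "(\<Sum>j\<in>Bn n. H i j * psin n \<beta> j) = (\<Sum>j\<in>Bn n. \<Sum>z\<in>Bn n. H i j * Gn n \<beta> j z * eta (Bn n) z)"
    by (simp add: psin_eq sum_distrib_left mult.assoc)
  also have "\<dots> = (\<Sum>z\<in>Bn n. (\<Sum>j\<in>Bn n. H i j * Gn n \<beta> j z) * eta (Bn n) z)"
    by (subst sum.swap) (simp add: sum_distrib_right)
  also have "\<dots> = (\<Sum>z\<in>Bn n. if z = i then eta (Bn n) z else 0)"
    unfolding Ghat_n_def using inv_right[OF tball_finite symH[OF tball_T] pd[OF tball_finite tball_T] i]
    by (intro sum.cong refl) auto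
  also have "\<dots> = eta (Bn n) i" using i tball_finite by simp
  finally show ?thesis unfolding Hop_split[OF tball_finite i tball_T] using out by simp
qed

text \<open>Inside a subtree a solution sees the outside through the edge to the parent of \<open>y\<close>
  and through the children beyond level \<open>n\<close>.\<close>

lemma subtree_dirichlet:
  assumes y: "y \<in> T" "y \<noteq> r" "lev y \<le> n" and f: "\<And>z. z \<in> Sb y n \<Longrightarrow> HO f z = 0"
  shows "f y = w * green_n y n \<beta> * f (par y)
    + (\<Sum>z\<in>Sb y n. inv_on (Sb y n) H y z * (w * (\<Sum>c\<in>ch z - Bn n. f c)))"
proof -
  let ?S = "Sb y n" and ?I = "inv_on (Sb y n) H"
  have yS: "y \<in> ?S" using Sb_self y by blast
  have "f y = (\<Sum>z\<in>?S. ?I y z * (0 + w * (\<Sum>j\<in>nbr z - ?S. f j)))"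
    by (rule dirichlet[OF Sb_finite Sb_T yS]) (rule f)
  also have "\<dots> = (\<Sum>z\<in>?S. ?I y z * (w * (\<Sum>c\<in>ch z - Bn n. f c)) + (if z = y then w * ?I y y * f (par y) else 0))"
  proof (intro sum.cong refl)
    fix z assume z: "z \<in> ?S"
    have zT: "z \<in> T" using z Sb_T by auto
    have "(\<Sum>j\<in>nbr z - ?S. f j) = (\<Sum>c\<in>ch z - Bn n. f c) + (\<Sum>c\<in>(if z = y then {par y} else {}). f c)"
      unfolding nbr_Sb[OF z y(2)] using ch_finite[OF zT] ch_par_disjoint[OF y(1,2)]
      by (intro sum.union_disjoint) auto
    then show "?I y z * (0 + w * (\<Sum>j\<in>nbr z - ?S. f j))
      = ?I y z * (w * (\<Sum>c\<in>ch z - Bn n. f c)) + (if z = y then w * ?I y y * f (par y) else 0)"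
      by (simp add: distrib_left algebra_simps)
  qed
  also have "\<dots> = (\<Sum>z\<in>?S. ?I y z * (w * (\<Sum>c\<in>ch z - Bn n. f c))) + w * ?I y y * f (par y)"
    using yS Sb_finite by (simp add: sum.distrib)
  finally show ?thesis by (simp add: green_n_def)
qed

lemma inflow_n_eq:
  assumes y: "y \<in> T" "y \<noteq> r" "lev y \<le> n"
  shows "inflow_n y n \<beta> = (\<Sum>z\<in>Sb y n. inv_on (Sb y n) H y z * (w * real (card (ch z - Bn n))))"
proof -
  let ?S = "Sb y n" and ?I = "inv_on (Sb y n) H"
  have yS: "y \<in> ?S" using Sb_self y by blast
  have "(\<Sum>z\<in>?S. ?I y z * eta ?S z)
    = (\<Sum>z\<in>?S. ?I y z * (w * real (card (ch z - Bn n))) + (if z = y then w * ?I y y else 0))"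
  proof (intro sum.cong refl)
    fix z assume z: "z \<in> ?S"
    have zT: "z \<in> T" using z Sb_T by auto
    have "card (nbr z - ?S) = card (ch z - Bn n) + card (if z = y then {par y} else {})"
      unfolding nbr_Sb[OF z y(2)] using ch_finite[OF zT] ch_par_disjoint[OF y(1,2)]
      by (intro card_Un_disjoint) auto
    then show "?I y z * eta ?S z = ?I y z * (w * real (card (ch z - Bn n))) + (if z = y then w * ?I y y else 0)"
      unfolding eta_eq[OF zT] by (simp add: algebra_simps)
  qed
  then show ?thesis using yS Sb_finite by (simp add: inflow_n_def green_n_def sum.distrib)
qed

lemma inflow_n_nonneg: "y \<in> T \<Longrightarrow> y \<noteq> r \<Longrightarrow> lev y \<le> n \<Longrightarrow> 0 \<le> inflow_n y n \<beta>"
  unfolding inflow_n_eq using w_pos invU_nonneg[OF Sb_finite Sb_T]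
  by (intro sum_nonneg mult_nonneg_nonneg) auto

lemma Gn_subtree:
  assumes y: "y \<in> T" "y \<noteq> r" "lev y \<le> n" and j: "j \<in> Bn n" "j \<notin> sub y"
  shows "Gn n \<beta> y j = w * green_n y n \<beta> * Gn n \<beta> (par y) j"
proof -
  have "HO (\<lambda>k. Gn n \<beta> k j) z = 0" if "z \<in> Sb y n" for z
    using Gn_Hop[of z n j] that j by (auto simp: Sb_def)
  moreover have "(\<Sum>c\<in>ch z - Bn n. Gn n \<beta> c j) = 0" for z
    by (rule sum.neutral) (auto intro: Gn_outside)
  ultimately show ?thesis using subtree_dirichlet[OF y, of "\<lambda>k. Gn n \<beta> k j"] by simp
qed

lemma psin_subtree:
  assumes y: "y \<in> T" "y \<noteq> r" "lev y \<le> n"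
  shows "psin n \<beta> y = w * green_n y n \<beta> * psin n \<beta> (par y) + inflow_n y n \<beta>"
proof -
  have "HO (psin n \<beta>) z = 0" if "z \<in> Sb y n" for z
    using psin_Hop that by (auto simp: Sb_def)
  moreover have "(\<Sum>c\<in>ch z - Bn n. psin n \<beta> c) = real (card (ch z - Bn n))" for z
  proof -
    have "(\<Sum>c\<in>ch z - Bn n. psin n \<beta> c) = (\<Sum>c\<in>ch z - Bn n. 1)" by (intro sum.cong) (auto simp: psin_eq)
    then show ?thesis by simp
  qed
  ultimately show ?thesis using subtree_dirichlet[OF y, of "psin n \<beta>"] by (simp add: inflow_n_eq[OF y])
qed

text \<open>Where a nonnegative supersolution vanishes, the sum over its neighbours is nonpositive, so
  it vanishes at the neighbours too.\<close>

lemma zero_propagates: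
  assumes f: "\<And>i. i \<in> T \<Longrightarrow> 0 \<le> f i" "\<And>i. i \<in> T \<Longrightarrow> 0 \<le> HO f i" and v: "v \<in> T" "f v = 0"
    and u: "u \<in> T"
  shows "f u = 0"
proof (rule tree_induct[OF v(1) u, of "\<lambda>x. f x = 0"])
  fix x y assume e: "{x, y} \<in> E" and x: "f x = 0"
  have xT: "x \<in> T" using edgeD[OF e] by blast
  have nn: "\<And>j. j \<in> nbr x \<Longrightarrow> 0 \<le> f j" using f(1) edgeD(2) by blast
  have "w * (\<Sum>j\<in>nbr x. f j) \<le> 0" using f(2)[OF xT] x by (simp add: Hop_eq)
  then have "(\<Sum>j\<in>nbr x. f j) \<le> 0" using w_pos by (simp add: mult_le_0_iff)
  then have "(\<Sum>j\<in>nbr x. f j) = 0" using sum_nonneg[of "nbr x" f] nn by (simp add: order_antisym)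
  then show "f y = 0" using sum_nonneg_eq_0_iff[OF nbr_finite[OF xT], of f] nn e by auto
qed (rule v(2))

end

subsection \<open>The limits\<close>

text \<open>The potentials for which the definitions of \<^const>\<open>Ghat\<close> and \<^const>\<open>psi\<close> through \<^const>\<open>lim\<close>
  are meaningful.\<close>

definition conv :: "('v \<Rightarrow> real) \<Rightarrow> bool" where
  "conv \<beta> \<longleftrightarrow> \<beta> \<in> Dm \<and> (\<forall>i\<in>T. \<forall>j\<in>T. convergent (\<lambda>n. Gn n \<beta> i j))
     \<and> (\<forall>i\<in>T. convergent (\<lambda>n. psin n \<beta> i))"

context
  fixes \<beta> :: "'v \<Rightarrow> real"
  assumes conv: "conv \<beta>"
begin

lemma dm: "\<beta> \<in> Dm" using conv by (simp add: conv_def)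

lemma Gn_lim: "i \<in> T \<Longrightarrow> j \<in> T \<Longrightarrow> (\<lambda>n. Gn n \<beta> i j) \<longlonglongrightarrow> Gh \<beta> i j"
  unfolding Ghat_def using conv by (simp add: conv_def convergent_LIMSEQ_iff)

lemma psin_lim: "i \<in> T \<Longrightarrow> (\<lambda>n. psin n \<beta> i) \<longlonglongrightarrow> ps \<beta> i"
  unfolding psi_def using conv by (simp add: conv_def convergent_LIMSEQ_iff)

lemma Gh_sym: "Gh \<beta> i j = Gh \<beta> j i"
  unfolding Ghat_def using Gn_sym[OF dm] by simp

lemma Gh_ge: "i \<in> T \<Longrightarrow> j \<in> T \<Longrightarrow> Gn n \<beta> i j \<le> Gh \<beta> i j"
  by (rule incseq_le[OF _ Gn_lim]) (auto intro!: incseq_SucI Gn_mono[OF dm])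

lemma Gh_nonneg: "i \<in> T \<Longrightarrow> j \<in> T \<Longrightarrow> 0 \<le> Gh \<beta> i j"
  using Gh_ge[of i j 0] Gn_nonneg[OF dm, of 0 i j] by simp

lemma Hop_lim:
  assumes i: "i \<in> T" and f: "\<And>j. j \<in> T \<Longrightarrow> (\<lambda>n. f n j) \<longlonglongrightarrow> g j"
  shows "(\<lambda>n. Hop E w \<beta> (f n) i) \<longlonglongrightarrow> Hop E w \<beta> g i"
  unfolding Hop_eq using edgeD(2) i by (intro tendsto_intros f) auto

lemma Gh_Hop:
  assumes i: "i \<in> T" and j: "j \<in> T"
  shows "Hop E w \<beta> (\<lambda>k. Gh \<beta> k j) i = (if i = j then 1 else 0)"
proof (rule LIMSEQ_unique[OF Hop_lim[OF i]])
  show "(\<lambda>n. Gn n \<beta> k j) \<longlonglongrightarrow> Gh \<beta> k j" if "k \<in> T" for k by (rule Gn_lim[OF that j])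
  have "\<forall>\<^sub>F n in sequentially. Hop E w \<beta> (\<lambda>k. Gn n \<beta> k j) i = (if i = j then 1 else 0)"
    using eventually_ge_at_top[of "max (lev i) (lev j)"]
    by eventually_elim (intro Gn_Hop[OF dm], use i j in \<open>auto simp: tball_iff\<close>)
  then show "(\<lambda>n. Hop E w \<beta> (\<lambda>k. Gn n \<beta> k j) i) \<longlonglongrightarrow> (if i = j then 1 else 0)"
    by (rule tendsto_eventually)
qed

lemma ps_Hop:
  assumes i: "i \<in> T"
  shows "Hop E w \<beta> (ps \<beta>) i = 0"
proof (rule LIMSEQ_unique[OF Hop_lim[OF i]])
  show "(\<lambda>n. psin n \<beta> k) \<longlonglongrightarrow> ps \<beta> k" if "k \<in> T" for k by (rule psin_lim[OF that])
  have "\<forall>\<^sub>F n in sequentially. Hop E w \<beta> (psin n \<beta>) i = 0"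
    using eventually_ge_at_top[of "lev i"]
    by eventually_elim (intro psin_Hop[OF dm], use i in \<open>auto simp: tball_iff\<close>)
  then show "(\<lambda>n. Hop E w \<beta> (psin n \<beta>) i) \<longlonglongrightarrow> 0" by (rule tendsto_eventually)
qed

text \<open>By the strong minimum principle, a zero would spread to the diagonal, where \<open>H G = 1\<close>.\<close>

lemma Gh_pos:
  assumes i: "i \<in> T" and j: "j \<in> T"
  shows "0 < Gh \<beta> i j"
proof (rule ccontr)
  assume "\<not> 0 < Gh \<beta> i j"
  then have z: "Gh \<beta> i j = 0" using Gh_nonneg[OF i j] by simp
  have "Gh \<beta> k j = 0" if "k \<in> T" for k
    by (rule zero_propagates[of \<beta> "\<lambda>k. Gh \<beta> k j", OF dm _ _ i z that]) (auto simp: Gh_nonneg j Gh_Hop)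
  then have "Hop E w \<beta> (\<lambda>k. Gh \<beta> k j) j = 0" using edgeD(2) j unfolding Hop_eq by simp
  then show False using Gh_Hop[OF j j] by simp
qed

text \<open>\<open>w green\<^sub>n\<close> is the ratio of the Green's function at \<open>y\<close> and at its parent, so its
  convergence follows from that of the Green's function, which is positive.\<close>

lemma green_n_lim:
  assumes y: "y \<in> T" "y \<noteq> r"
  shows "(\<lambda>n. green_n y n \<beta>) \<longlonglongrightarrow> green y \<beta>" and Gh_green: "Gh \<beta> y (par y) = w * green y \<beta> * Gh \<beta> (par y) (par y)"
proof -
  have x: "par y \<in> T" using par_T y by blast
  have lx: "lev (par y) < lev y" using par(2)[OF y] by simp
  let ?a = "Gh \<beta> y (par y) / (w * Gh \<beta> (par y) (par y))"
  have ev: "\<forall>\<^sub>F n in sequentially. Gn n \<beta> y (par y) / (w * Gn n \<beta> (par y) (par y)) = green_n y n \<beta>"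
    using eventually_ge_at_top[of "lev y"] order_tendstoD(1)[OF Gn_lim[OF x x] Gh_pos[OF x x]]
  proof eventually_elim
    case (elim n)
    have "Gn n \<beta> y (par y) = w * green_n y n \<beta> * Gn n \<beta> (par y) (par y)"
      using elim lx x par_not_sub[OF y] by (intro Gn_subtree[OF dm y]) (auto simp: tball_iff)
    then show ?case using elim w_pos by simp
  qed
  have "(\<lambda>n. Gn n \<beta> y (par y) / (w * Gn n \<beta> (par y) (par y))) \<longlonglongrightarrow> ?a"
    using w_pos Gh_pos[OF x x] by (intro tendsto_intros Gn_lim y x) simp
  then have lim: "(\<lambda>n. green_n y n \<beta>) \<longlonglongrightarrow> ?a" using tendsto_cong[OF ev] by simp
  then have "green y \<beta> = ?a" unfolding green_def by (rule limI)
  then show "(\<lambda>n. green_n y n \<beta>) \<longlonglongrightarrow> green y \<beta>" "Gh \<beta> y (par y) = w * green y \<beta> * Gh \<beta> (par y) (par y)"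
    using lim w_pos Gh_pos[OF x x] by auto
qed

lemma inflow_n_lim:
  assumes y: "y \<in> T" "y \<noteq> r"
  shows "(\<lambda>n. inflow_n y n \<beta>) \<longlonglongrightarrow> inflow y \<beta>" and inflow_eq: "inflow y \<beta> = ps \<beta> y - w * green y \<beta> * ps \<beta> (par y)"
    and inflow_nonneg: "0 \<le> inflow y \<beta>"
proof -
  have x: "par y \<in> T" using par_T y by blast
  let ?b = "ps \<beta> y - w * green y \<beta> * ps \<beta> (par y)"
  have ev: "\<forall>\<^sub>F n in sequentially. psin n \<beta> y - w * green_n y n \<beta> * psin n \<beta> (par y) = inflow_n y n \<beta>"
    using eventually_ge_at_top[of "lev y"] by eventually_elim (simp add: psin_subtree[OF dm y])
  have "(\<lambda>n. psin n \<beta> y - w * green_n y n \<beta> * psin n \<beta> (par y)) \<longlonglongrightarrow> ?b"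
    by (intro tendsto_intros psin_lim green_n_lim y x)
  then have lim: "(\<lambda>n. inflow_n y n \<beta>) \<longlonglongrightarrow> ?b" using tendsto_cong[OF ev] by simp
  then show eq: "inflow y \<beta> = ?b" unfolding inflow_def by (rule limI)
  show "(\<lambda>n. inflow_n y n \<beta>) \<longlonglongrightarrow> inflow y \<beta>" using lim eq by simp
  then show "0 \<le> inflow y \<beta>"
    by (rule LIMSEQ_le_const) (use inflow_n_nonneg[OF dm y] in blast)
qed

lemma Gh_subtree:
  assumes y: "y \<in> T" "y \<noteq> r" and j: "j \<in> T" "j \<notin> sub y"
  shows "Gh \<beta> y j = w * green y \<beta> * Gh \<beta> (par y) j"
proof (rule LIMSEQ_unique[OF Gn_lim[OF y(1) j(1)]])
  have "\<forall>\<^sub>F n in sequentially. w * green_n y n \<beta> * Gn n \<beta> (par y) j = Gn n \<beta> y j"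
    using eventually_ge_at_top[of "max (lev y) (lev j)"]
    by eventually_elim (rule Gn_subtree[OF dm y, symmetric], use j in \<open>auto simp: tball_iff\<close>)
  moreover have "(\<lambda>n. w * green_n y n \<beta> * Gn n \<beta> (par y) j) \<longlonglongrightarrow> w * green y \<beta> * Gh \<beta> (par y) j"
    using par_T[OF y] by (intro tendsto_intros green_n_lim Gn_lim y j)
  ultimately show "(\<lambda>n. Gn n \<beta> y j) \<longlonglongrightarrow> w * green y \<beta> * Gh \<beta> (par y) j"
    using tendsto_cong[of "\<lambda>n. w * green_n y n \<beta> * Gn n \<beta> (par y) j" "\<lambda>n. Gn n \<beta> y j"] by simp
qed

text \<open>A solution on a subtree that is dominated by the Green's function is determined by its
  value at the attaching vertex: what it receives from the boundary at level \<open>n\<close> is at most a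
  multiple of what the Green's function receives, and this tends to \<open>0\<close>.\<close>

lemma potential_subtree:
  assumes y: "y \<in> T" "y \<noteq> r" and f: "\<And>z. z \<in> sub y \<Longrightarrow> Hop E w \<beta> f z = 0"
    and C: "\<And>z. z \<in> sub y \<Longrightarrow> \<bar>f z\<bar> \<le> C * Gh \<beta> z (par y)"
  shows "f y = w * green y \<beta> * f (par y)"
proof -
  let ?x = "par y" and ?I = "\<lambda>n. inv_on (Sb y n) (Hmat W \<beta>)"
  have x: "?x \<in> T" using par_T y by blast
  have "\<bar>f y - w * green_n y n \<beta> * f ?x\<bar> \<le> C * (Gh \<beta> y ?x - w * green_n y n \<beta> * Gh \<beta> ?x ?x)" if n: "lev y \<le> n" for n
  proof -
    have HG: "Hop E w \<beta> (\<lambda>k. Gh \<beta> k ?x) z = 0" if "z \<in> Sb y n" for z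
      using Gh_Hop[OF _ x, of z] that par_not_sub[OF y] Sb_T[of y n] by (auto simp: Sb_def)
    have "\<bar>f y - w * green_n y n \<beta> * f ?x\<bar> = \<bar>\<Sum>z\<in>Sb y n. ?I n y z * (w * (\<Sum>c\<in>ch z - Bn n. f c))\<bar>"
      using subtree_dirichlet[OF dm y n, of f] f by (simp add: Sb_def)
    also have "\<dots> \<le> (\<Sum>z\<in>Sb y n. ?I n y z * (w * (\<Sum>c\<in>ch z - Bn n. C * Gh \<beta> c ?x)))"
    proof (intro order_trans[OF sum_abs] sum_mono)
      fix z assume z: "z \<in> Sb y n"
      have "\<bar>\<Sum>c\<in>ch z - Bn n. f c\<bar> \<le> (\<Sum>c\<in>ch z - Bn n. C * Gh \<beta> c ?x)"
        using sub_ch z by (intro order_trans[OF sum_abs] sum_mono C) (auto simp: Sb_def)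
      then show "\<bar>?I n y z * (w * (\<Sum>c\<in>ch z - Bn n. f c))\<bar> \<le> ?I n y z * (w * (\<Sum>c\<in>ch z - Bn n. C * Gh \<beta> c ?x))"
        unfolding abs_mult using invU_nonneg[OF dm Sb_finite Sb_T, of y n y z] w_pos
        by (intro mult_mono mult_nonneg_nonneg) auto
    qed
    also have "\<dots> = C * (\<Sum>z\<in>Sb y n. ?I n y z * (w * (\<Sum>c\<in>ch z - Bn n. Gh \<beta> c ?x)))"
      by (simp add: sum_distrib_left mult_ac)
    also have "(\<Sum>z\<in>Sb y n. ?I n y z * (w * (\<Sum>c\<in>ch z - Bn n. Gh \<beta> c ?x))) = Gh \<beta> y ?x - w * green_n y n \<beta> * Gh \<beta> ?x ?x"
      using subtree_dirichlet[OF dm y n HG] by simp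
    finally show ?thesis .
  qed
  then have ev: "\<forall>\<^sub>F n in sequentially. \<bar>f y - w * green_n y n \<beta> * f ?x\<bar> \<le> C * (Gh \<beta> y ?x - w * green_n y n \<beta> * Gh \<beta> ?x ?x)"
    using eventually_ge_at_top[of "lev y"] by (rule eventually_mono[rotated])
  have "(\<lambda>n. C * (Gh \<beta> y ?x - w * green_n y n \<beta> * Gh \<beta> ?x ?x)) \<longlonglongrightarrow> C * (Gh \<beta> y ?x - w * green y \<beta> * Gh \<beta> ?x ?x)"
    by (intro tendsto_intros green_n_lim y)
  then have 1: "(\<lambda>n. C * (Gh \<beta> y ?x - w * green_n y n \<beta> * Gh \<beta> ?x ?x)) \<longlonglongrightarrow> 0" using Gh_green[OF y] by simp
  have 2: "(\<lambda>n. \<bar>f y - w * green_n y n \<beta> * f ?x\<bar>) \<longlonglongrightarrow> \<bar>f y - w * green y \<beta> * f ?x\<bar>"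
    by (intro tendsto_intros green_n_lim y)
  have "\<bar>f y - w * green y \<beta> * f ?x\<bar> \<le> 0"
    by (rule tendsto_le[OF sequentially_bot 1 2 ev])
  then show ?thesis by simp
qed

end

end

section \<open>Almost sure convergence\<close>

context wtree
begin

text \<open>For positive definite \<open>H\<close> this is the tilt of the finite-volume density by boundary
  weight \<open>l\<close> at \<open>i\<close>, up to the factor \<open>e\<^sup>l\<close>; on a ball it is
  \<open>exp (- l \<psi>\<^sup>(\<^sup>n\<^sup>)(i) - l\<^sup>2 G\<^sup>(\<^sup>n\<^sup>)(i, i) / 2)\<close>.\<close>

definition laplace :: "real \<Rightarrow> 'v \<Rightarrow> 'v set \<Rightarrow> ('v \<Rightarrow> real) \<Rightarrow> real" where
  "laplace l i U \<beta> = (if posdef_on U (Hmat W \<beta>)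
     then exp (- l * (\<Sum>j\<in>U. inv_on U (Hmat W \<beta>) i j * eta U j) - l\<^sup>2 / 2 * inv_on U (Hmat W \<beta>) i i) else 0)"

lemma laplace_cong: "(\<And>j. j \<in> U \<Longrightarrow> \<beta> j = \<beta>' j) \<Longrightarrow> laplace l i U \<beta> = laplace l i U \<beta>'"
proof -
  assume *: "\<And>j. j \<in> U \<Longrightarrow> \<beta> j = \<beta>' j"
  have "Hmat W \<beta> a b = Hmat W \<beta>' a b" if "a \<in> U" for a b using *[OF that] by (rule Hmat_cong)
  then have "posdef_on U (Hmat W \<beta>) = posdef_on U (Hmat W \<beta>')" "inv_on U (Hmat W \<beta>) = inv_on U (Hmat W \<beta>')"
    by (intro posdef_on_cong inv_on_cong; simp)+
  then show ?thesis by (simp add: laplace_def)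
qed

lemma laplace_measurable:
  assumes "finite U" "U \<subseteq> T" and b: "\<And>j. j \<in> U \<Longrightarrow> (\<lambda>\<beta>. \<beta> j) \<in> borel_measurable N"
  shows "laplace l i U \<in> borel_measurable N"
proof -
  note m = Hmat_inv_measurable[where W="\<lambda>_. W" and b="\<lambda>\<beta>. \<beta>" and N=N, OF assms(1) _ b weights_U[OF assms(2)]]
  define P where "P = {\<beta> \<in> space N. posdef_on U (Hmat W \<beta>)}"
  define I where "I \<beta> i j = (if posdef_on U (Hmat W \<beta>) then inv_on U (Hmat W \<beta>) i j else 0)" for \<beta> i j
  have [measurable]: "P \<in> sets N" "\<And>i j. (\<lambda>x. I x i j) \<in> borel_measurable N"
    unfolding P_def I_def using m by auto
  have "(\<lambda>\<beta>. indicator P \<beta> * exp (- l * (\<Sum>j\<in>U. I \<beta> i j * eta U j) - l\<^sup>2 / 2 * I \<beta> i i)) \<in> borel_measurable N"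
    by measurable
  then show ?thesis
    by (rule measurable_cong[THEN iffD1, rotated]) (auto simp: laplace_def P_def I_def indicator_def)
qed

lemma laplace_bounds:
  assumes "finite U" "U \<subseteq> T" "0 \<le> l"
  shows "0 \<le> laplace l i U \<beta> \<and> laplace l i U \<beta> \<le> 1"
proof (cases "posdef_on U (Hmat W \<beta>)")
  case True
  have nn: "0 \<le> inv_on U (Hmat W \<beta>) i j" for i j
    using inv_nonneg[OF assms(1) Hmat_symm[OF weights_U[OF assms(2)]] True Hmat_Zmat[OF weights_U[OF assms(2)]]] .
  have e: "0 \<le> eta U j" if "j \<in> U" for j
    using weighted_graph.eta_out_nonneg[OF weighted_graph] that assms(2) by blast
  have "0 \<le> l * (\<Sum>j\<in>U. inv_on U (Hmat W \<beta>) i j * eta U j)"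
    using nn e assms(3) by (intro mult_nonneg_nonneg sum_nonneg) auto
  moreover have "0 \<le> l\<^sup>2 / 2 * inv_on U (Hmat W \<beta>) i i" using nn[of i i] by simp
  ultimately have "- l * (\<Sum>j\<in>U. inv_on U (Hmat W \<beta>) i j * eta U j) - l\<^sup>2 / 2 * inv_on U (Hmat W \<beta>) i i \<le> 0"
    by linarith
  then show ?thesis using True by (simp add: laplace_def)
qed (simp add: laplace_def)

lemma component_borel: "j \<in> U \<Longrightarrow> (\<lambda>\<beta>. \<beta> j) \<in> borel_measurable (PiM U (\<lambda>_. borel :: real measure))"
  by (rule measurable_component_singleton)

lemma restrict_nu: "U \<subseteq> T \<Longrightarrow> (\<lambda>\<beta>. restrict \<beta> U) \<in> measurable nu (PiM U (\<lambda>_. borel))"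
  using measurable_restrict_subset[of U T "\<lambda>_. borel"] by (simp add: measurable_cong_sets[OF nu_sets refl])

lemma component_nu: "j \<in> T \<Longrightarrow> (\<lambda>\<beta>. \<beta> j) \<in> borel_measurable nu"
  using component_borel by (simp add: measurable_cong_sets[OF nu_sets refl])

text \<open>The expectation of \<open>laplace\<close> against an event of a smaller set \<open>V\<close> does not depend on
  \<open>U\<close>: up to the factor \<open>e\<^sup>-\<^sup>l\<close> it is the mass of the event under the measure on \<open>V\<close> with an
  additional boundary weight \<open>l\<close> at \<open>i\<close>.\<close>

lemma laplace_expectation:
  assumes U: "finite U" "U \<subseteq> T" and V: "V \<subseteq> U" "i \<in> V" and l: "0 \<le> l" and A: "A \<in> sets (PiM V (\<lambda>_. borel))"
  shows "(\<integral>\<beta>. indicator A (restrict \<beta> V) * laplace l i U \<beta> \<partial>nu)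
    = exp (- l) * measure (nu_fin V W (\<lambda>j. eta V j + (if j = i then l else 0))) A"
proof -
  let ?t = "\<lambda>U j. eta U j + (if j = i then l else 0)"
  have iU: "i \<in> U" using V by auto
  have WU: "weights_on U W" by (rule weights_U[OF U(2)])
  define B where "B = (\<lambda>\<beta>. restrict \<beta> V) -` A \<inter> space (PiM U (\<lambda>_. borel))"
  have r: "(\<lambda>\<beta>. restrict \<beta> V) \<in> measurable (PiM U (\<lambda>_. borel)) (PiM V (\<lambda>_. borel))"
    by (rule measurable_restrict_subset[OF V(1)])
  have B: "B \<in> sets (PiM U (\<lambda>_. borel))" unfolding B_def by (rule measurable_sets[OF r A])
  have Bl[measurable]: "B \<in> sets (PiM U (\<lambda>_. lborel :: real measure))"
    using B by (simp cong: sets_PiM_cong)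
  have md[measurable]: "nu_dens U W e \<in> borel_measurable (PiM U (\<lambda>_. lborel))" for e
    by (rule nu_dens_measurable'[OF U(1) WU])
  have mX: "laplace l i U \<in> borel_measurable (PiM U (\<lambda>_. borel))" by (rule laplace_measurable[OF U component_borel])
  have mXl[measurable]: "laplace l i U \<in> borel_measurable (PiM U (\<lambda>_. lborel))"
    by (rule laplace_measurable[OF U]) measurable
  let ?f = "\<lambda>\<beta>. indicator B \<beta> * laplace l i U \<beta>"
  have X0: "0 \<le> laplace l i U \<beta>" "laplace l i U \<beta> \<le> 1" for \<beta> using laplace_bounds[OF U l] by auto
  interpret fU: prob_space "nu_fin U W (eta U)"
    using U weighted_graph.eta_out_nonneg[OF weighted_graph] by (intro prob_space_nu_fin WU) auto
  have "emeasure (nu_fin U W (?t U)) B = (\<integral>\<^sup>+\<beta>. ennreal (nu_dens U W (?t U) \<beta>) * indicator B \<beta> \<partial>PiM U (\<lambda>_. lborel))"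
    unfolding nu_fin_dens by (rule emeasure_density) measurable
  also have "\<dots> = (\<integral>\<^sup>+\<beta>. ennreal (exp l) * (ennreal (nu_dens U W (eta U) \<beta>) * ennreal (?f \<beta>)) \<partial>PiM U (\<lambda>_. lborel))"
  proof (rule nn_integral_cong)
    fix \<beta>
    have "nu_dens U W (?t U) \<beta> = exp l * (nu_dens U W (eta U) \<beta> * laplace l i U \<beta>)"
      using nu_dens_tilt[OF U(1) WU iU, of "eta U" l \<beta>]
      by (cases "posdef_on U (Hmat W \<beta>)") (simp_all add: laplace_def nu_dens_def dom_fin_def mult_ac)
    then have "ennreal (nu_dens U W (?t U) \<beta>) * indicator B \<beta>
       = ennreal (exp l * (nu_dens U W (eta U) \<beta> * ?f \<beta>))"
      by (auto simp: indicator_def)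
    also have "\<dots> = ennreal (exp l) * (ennreal (nu_dens U W (eta U) \<beta>) * ennreal (?f \<beta>))"
      using nu_dens_nonneg[OF U(1) WU] X0 by (simp add: ennreal_mult')
    finally show "ennreal (nu_dens U W (?t U) \<beta>) * indicator B \<beta>
       = ennreal (exp l) * (ennreal (nu_dens U W (eta U) \<beta>) * ennreal (?f \<beta>))" .
  qed
  also have "\<dots> = ennreal (exp l) * (\<integral>\<^sup>+\<beta>. ennreal (nu_dens U W (eta U) \<beta>) * ennreal (?f \<beta>) \<partial>PiM U (\<lambda>_. lborel))"
    by (rule nn_integral_cmult) measurable
  also have "(\<integral>\<^sup>+\<beta>. ennreal (nu_dens U W (eta U) \<beta>) * ennreal (?f \<beta>) \<partial>PiM U (\<lambda>_. lborel))
    = (\<integral>\<^sup>+\<beta>. ennreal (?f \<beta>) \<partial>nu_fin U W (eta U))"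
    unfolding nu_fin_dens by (rule nn_integral_density[symmetric]) measurable
  also have "\<dots> = ennreal (\<integral>\<beta>. ?f \<beta> \<partial>nu_fin U W (eta U))"
  proof (rule nn_integral_eq_integral)
    show "integrable (nu_fin U W (eta U)) ?f"
      using X0 B mX by (intro fU.integrable_const_bound[of _ 1]) (auto simp: indicator_def measurable_cong_sets[OF sets_nu_fin refl])
  qed (use X0 in auto)
  finally have e: "emeasure (nu_fin U W (?t U)) B = ennreal (exp l * (\<integral>\<beta>. ?f \<beta> \<partial>nu_fin U W (eta U)))"
    by (simp add: ennreal_mult')
  have "(\<integral>\<beta>. ?f \<beta> \<partial>nu_fin U W (eta U)) = (\<integral>\<beta>. ?f \<beta> \<partial>distr nu (PiM U (\<lambda>_. borel)) (\<lambda>\<beta>. restrict \<beta> U))"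
    using nu_restrict[OF U] by simp
  also have "\<dots> = (\<integral>\<beta>. ?f (restrict \<beta> U) \<partial>nu)"
    using B mX by (intro integral_distr restrict_nu U(2)) auto
  also have "\<dots> = (\<integral>\<beta>. indicator A (restrict \<beta> V) * laplace l i U \<beta> \<partial>nu)"
  proof (intro Bochner_Integration.integral_cong refl arg_cong2[where f="(*)"])
    fix \<beta> :: "'v \<Rightarrow> real"
    have "restrict \<beta> U \<in> space (PiM U (\<lambda>_. borel))" by (simp add: space_PiM)
    moreover have "restrict (restrict \<beta> U) V = restrict \<beta> V" using V(1) by (simp add: Int_absorb1)
    ultimately show "indicator B (restrict \<beta> U) = indicator A (restrict \<beta> V)"
      by (simp add: B_def indicator_def)
    show "laplace l i U (restrict \<beta> U) = laplace l i U \<beta>" by (rule laplace_cong) simp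
  qed
  finally have *: "(\<integral>\<beta>. ?f \<beta> \<partial>nu_fin U W (eta U)) = (\<integral>\<beta>. indicator A (restrict \<beta> V) * laplace l i U \<beta> \<partial>nu)" .
  have "measure (nu_fin U W (?t U)) B = measure (distr (nu_fin U W (?t U)) (PiM V (\<lambda>_. borel)) (\<lambda>\<beta>. restrict \<beta> V)) A"
    using r A by (subst measure_distr) (auto simp: B_def measurable_cong_sets[OF sets_nu_fin refl])
  also have "\<dots> = measure (nu_fin V W (\<lambda>j. ?t U j + (\<Sum>k\<in>U - V. W j k))) A"
    using U l weighted_graph.eta_out_nonneg[OF weighted_graph]
    by (subst nu_fin_restrict[OF U(1) V(1) WU]) (auto intro!: add_nonneg_nonneg)
  also have "nu_fin V W (\<lambda>j. ?t U j + (\<Sum>k\<in>U - V. W j k)) = nu_fin V W (?t V)"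
  proof (rule nu_fin_cong)
    fix j assume "j \<in> V"
    then have "eta U j + (\<Sum>k\<in>U - V. W j k) = eta V j"
      using U V by (intro weighted_graph.eta_out_split[OF weighted_graph]) auto
    then show "?t U j + (\<Sum>k\<in>U - V. W j k) = ?t V j" by simp
  qed
  finally have "measure (nu_fin V W (?t V)) A = measure (nu_fin U W (?t U)) B" by simp
  also have "\<dots> = exp l * (\<integral>\<beta>. indicator A (restrict \<beta> V) * laplace l i U \<beta> \<partial>nu)"
  proof -
    have "0 \<le> (\<integral>\<beta>. ?f \<beta> \<partial>nu_fin U W (eta U))" using X0 by (intro Bochner_Integration.integral_nonneg) auto
    then show ?thesis unfolding measure_def e using * by simp
  qed
  finally show ?thesis by (simp add: exp_minus)
qed

text \<open>The sequence starts at the first ball that contains \<open>i\<close>.\<close>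

lemma laplace_martingale:
  assumes i: "i \<in> T" and l: "0 \<le> l"
  shows "AE \<beta> in nu. convergent (\<lambda>n. laplace l i (Bn (n + lev i)) \<beta>)"
proof -
  let ?B = "\<lambda>n. Bn (n + lev i)"
  define F where "F n = vimage_algebra (space nu) (\<lambda>\<beta>. restrict \<beta> (?B n)) (PiM (?B n) (\<lambda>_. borel :: real measure))" for n
  have iB: "i \<in> ?B n" for n using i by (simp add: tball_iff)
  have rs: "(\<lambda>\<beta>. restrict \<beta> U) \<in> space nu \<rightarrow> space (PiM U (\<lambda>_. borel))" for U :: "'v set"
    by (auto simp: space_PiM)
  have setsF: "sets (F n) = {(\<lambda>\<beta>. restrict \<beta> (?B n)) -` A \<inter> space nu | A. A \<in> sets (PiM (?B n) (\<lambda>_. borel))}" for n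
    unfolding F_def by (rule sets_vimage_algebra2[OF rs])
  have mF: "(\<lambda>\<beta>. restrict \<beta> (?B n)) \<in> measurable (F n) (PiM (?B n) (\<lambda>_. borel))" for n
    unfolding F_def by (rule measurable_vimage_algebra1[OF rs])
  interpret prob_space nu by (rule nu_prob)
  interpret bounded_martingale nu F "\<lambda>n. laplace l i (?B n)"
  proof
    fix n
    show "subalgebra nu (F n)"
      unfolding subalgebra_def setsF using measurable_sets[OF restrict_nu[OF tball_T]] by (auto simp: F_def)
    show "sets (F n) \<subseteq> sets (F (Suc n))"
    proof
      fix A assume "A \<in> sets (F n)"
      then obtain A' where A': "A' \<in> sets (PiM (?B n) (\<lambda>_. borel))" "A = (\<lambda>\<beta>. restrict \<beta> (?B n)) -` A' \<inter> space nu"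
        unfolding setsF by blast
      have sub: "?B n \<subseteq> ?B (Suc n)" by (rule tball_mono) simp
      have "(\<lambda>\<beta>. restrict \<beta> (?B n)) -` A' \<inter> space (PiM (?B (Suc n)) (\<lambda>_. borel)) \<in> sets (PiM (?B (Suc n)) (\<lambda>_. borel))"
        by (rule measurable_sets[OF measurable_restrict_subset[OF sub] A'(1)])
      moreover have "A = (\<lambda>\<beta>. restrict \<beta> (?B (Suc n))) -` ((\<lambda>\<beta>. restrict \<beta> (?B n)) -` A' \<inter> space (PiM (?B (Suc n)) (\<lambda>_. borel))) \<inter> space nu"
        unfolding A'(2) using sub by (auto simp: Int_absorb1 space_PiM)
      ultimately show "A \<in> sets (F (Suc n))" unfolding setsF by blast
    qed
    have "laplace l i (?B n) \<in> borel_measurable (PiM (?B n) (\<lambda>_. borel))"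
      by (rule laplace_measurable[OF tball_finite tball_T component_borel])
    from measurable_compose[OF mF this] have "(\<lambda>\<beta>. laplace l i (?B n) (restrict \<beta> (?B n))) \<in> borel_measurable (F n)" .
    also have "(\<lambda>\<beta>. laplace l i (?B n) (restrict \<beta> (?B n))) = laplace l i (?B n)"
      by (intro ext laplace_cong) simp
    finally show "laplace l i (?B n) \<in> borel_measurable (F n)" .
    show "0 \<le> laplace l i (?B n) x \<and> laplace l i (?B n) x \<le> 1" for x by (rule laplace_bounds[OF tball_finite tball_T l])
    fix A assume "A \<in> sets (F n)"
    then obtain A' where A': "A' \<in> sets (PiM (?B n) (\<lambda>_. borel))" "A = (\<lambda>\<beta>. restrict \<beta> (?B n)) -` A' \<inter> space nu"
      unfolding setsF by blast
    have eq: "(\<integral>\<beta>\<in>A. laplace l i (?B k) \<beta> \<partial>nu) = (\<integral>\<beta>. indicator A' (restrict \<beta> (?B n)) * laplace l i (?B k) \<beta> \<partial>nu)" for k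
      unfolding set_lebesgue_integral_def A'(2)
      by (intro Bochner_Integration.integral_cong refl) (simp add: indicator_def)
    show "(\<integral>\<beta>\<in>A. laplace l i (?B (Suc n)) \<beta> \<partial>nu) = (\<integral>\<beta>\<in>A. laplace l i (?B n) \<beta> \<partial>nu)"
      unfolding eq using laplace_expectation[OF tball_finite tball_T tball_mono iB l A'(1), of "n + lev i"]
        laplace_expectation[OF tball_finite tball_T tball_mono iB l A'(1), of "Suc n + lev i"] by simp
  qed
  show ?thesis by (rule converges)
qed

text \<open>The limit of the martingale has expectation \<open>e\<^sup>-\<^sup>l\<close>, so it is positive with probability at
  least \<open>e\<^sup>-\<^sup>l\<close>. Almost surely it is thus positive for one of the values \<open>l = 1 / (k + 1)\<close>. Then
  \<open>l \<psi>\<^sup>(\<^sup>n\<^sup>)(i) + l\<^sup>2 G\<^sup>(\<^sup>n\<^sup>)(i, i) / 2\<close> converges; \<open>G\<^sup>(\<^sup>n\<^sup>)(i, i)\<close> is bounded and increasing, hence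
  converges, and so does \<open>\<psi>\<^sup>(\<^sup>n\<^sup>)(i)\<close>.\<close>

lemma conv_at:
  assumes i: "i \<in> T"
  shows "AE \<beta> in nu. convergent (\<lambda>n. Gn n \<beta> i i) \<and> convergent (\<lambda>n. psin n \<beta> i)"
proof -
  interpret prob_space nu by (rule nu_prob)
  define l where "l k = 1 / real (Suc k)" for k
  have l0: "0 < l k" for k by (simp add: l_def)
  define X where "X k n = laplace (l k) i (Bn (n + lev i))" for k n
  have mX[measurable]: "X k n \<in> borel_measurable nu" for k n
    unfolding X_def using tball_in_T by (intro laplace_measurable[OF tball_finite tball_T component_nu]) auto
  have Xb: "0 \<le> X k n \<beta>" "X k n \<beta> \<le> 1" for k n \<beta>
    unfolding X_def using laplace_bounds[OF tball_finite tball_T, of "l k"] l0[of k] by auto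
  define Z where "Z k \<beta> = lim (\<lambda>n. X k n \<beta>)" for k \<beta>
  have mZ[measurable]: "Z k \<in> borel_measurable nu" for k
    unfolding Z_def[abs_def] by measurable
  have lim: "AE \<beta> in nu. (\<lambda>n. X k n \<beta>) \<longlonglongrightarrow> Z k \<beta>" for k
    using laplace_martingale[OF i, of "l k"] l0[of k] unfolding Z_def X_def by (simp add: convergent_LIMSEQ_iff)
  have EX: "(\<integral>\<beta>. X k n \<beta> \<partial>nu) = exp (- l k)" for k n
  proof -
    have iV: "i \<in> Bn (lev i)" "Bn (lev i) \<subseteq> Bn (n + lev i)" using i by (auto simp: tball_iff)
    let ?A = "space (PiM (Bn (lev i)) (\<lambda>_. borel :: real measure))"
    have "(\<integral>\<beta>. X k n \<beta> \<partial>nu) = (\<integral>\<beta>. indicator ?A (restrict \<beta> (Bn (lev i))) * laplace (l k) i (Bn (n + lev i)) \<beta> \<partial>nu)"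
      unfolding X_def by (intro Bochner_Integration.integral_cong refl) (simp add: space_PiM)
    also have "\<dots> = exp (- l k) * measure (nu_fin (Bn (lev i)) W (\<lambda>j. eta (Bn (lev i)) j + (if j = i then l k else 0))) ?A"
      using l0[of k] by (intro laplace_expectation[OF tball_finite tball_T iV(2,1)]) auto
    also have "measure (nu_fin (Bn (lev i)) W (\<lambda>j. eta (Bn (lev i)) j + (if j = i then l k else 0))) ?A = 1"
    proof -
      have "prob_space (nu_fin (Bn (lev i)) W (\<lambda>j. eta (Bn (lev i)) j + (if j = i then l k else 0)))"
        using l0[of k] weighted_graph.eta_out_nonneg[OF weighted_graph] tball_in_T
        by (intro prob_space_nu_fin tball_finite weights_U tball_T) (auto intro!: add_nonneg_nonneg)
      from prob_space.prob_space[OF this] show ?thesis by simp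
    qed
    finally show ?thesis by simp
  qed
  have Zb: "AE \<beta> in nu. 0 \<le> Z k \<beta> \<and> Z k \<beta> \<le> 1" for k
    using lim[of k]
  proof eventually_elim
    case (elim \<beta>)
    show ?case using LIMSEQ_le_const[OF elim, of 0] LIMSEQ_le_const2[OF elim, of 1] Xb by blast
  qed
  have "(\<lambda>n. \<integral>\<beta>. X k n \<beta> \<partial>nu) \<longlonglongrightarrow> (\<integral>\<beta>. Z k \<beta> \<partial>nu)" for k
    using lim[of k] Xb by (intro integral_dominated_convergence[where w="\<lambda>_. 1"]) auto
  then have EZ: "(\<integral>\<beta>. Z k \<beta> \<partial>nu) = exp (- l k)" for k
    unfolding EX by (simp add: LIMSEQ_const_iff)
  define C where "C k = {\<beta> \<in> space nu. 0 < Z k \<beta>}" for k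
  have C[measurable]: "C k \<in> sets nu" for k unfolding C_def by measurable
  have pC: "exp (- l k) \<le> prob (C k)" for k
  proof -
    have "exp (- l k) \<le> (\<integral>\<beta>. indicator (C k) \<beta> \<partial>nu)"
      unfolding EZ[symmetric]
    proof (rule integral_mono_AE)
      show "integrable nu (Z k)" using Zb[of k] by (intro integrable_const_bound[of _ 1]) (auto elim: eventually_mono)
      show "AE \<beta> in nu. Z k \<beta> \<le> indicator (C k) \<beta>"
        using Zb[of k] AE_space by eventually_elim (auto simp: C_def indicator_def)
    qed (auto simp: emeasure_eq_measure)
    then show ?thesis by simp
  qed
  have "1 \<le> prob (\<Union>k. C k)"
  proof (rule LIMSEQ_le_const2)
    have "l \<longlonglongrightarrow> 0" unfolding l_def[abs_def] by (rule LIMSEQ_Suc[OF lim_1_over_n])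
    then have "(\<lambda>k. exp (- l k)) \<longlonglongrightarrow> exp (- 0)" by (intro tendsto_intros)
    then show "(\<lambda>k. exp (- l k)) \<longlonglongrightarrow> 1" by simp
    have "prob (C k) \<le> prob (\<Union>k. C k)" for k by (intro finite_measure_mono) auto
    then show "\<exists>N. \<forall>n\<ge>N. exp (- l n) \<le> prob (\<Union>k. C k)" using pC order_trans by blast
  qed
  then have "prob (\<Union>k. C k) = 1" using prob_le_1 by (simp add: order_antisym)
  then have AEC: "AE \<beta> in nu. \<beta> \<in> (\<Union>k. C k)" by (intro AE_prob_1)
  have "AE \<beta> in nu. \<forall>k. (\<lambda>n. X k n \<beta>) \<longlonglongrightarrow> Z k \<beta>" using lim by (simp add: AE_all_countable)
  then show ?thesis using AEC nu_dom
  proof eventually_elim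
    case (elim \<beta>)
    then obtain k where k: "0 < Z k \<beta>" "(\<lambda>n. X k n \<beta>) \<longlonglongrightarrow> Z k \<beta>" by (auto simp: C_def)
    have D: "\<beta> \<in> Dm" by fact
    let ?N = "lev i"
    have X: "X k n \<beta> = exp (- l k * psin (n + ?N) \<beta> i - (l k)\<^sup>2 / 2 * Gn (n + ?N) \<beta> i i)" for n
    proof -
      have "i \<in> Bn (n + ?N)" using i by (simp add: tball_iff)
      then show ?thesis
        using pd[OF D tball_finite tball_T] by (simp add: X_def laplace_def psin_eq[OF D] Ghat_n_def)
    qed
    have lnX: "(\<lambda>n. - ln (X k n \<beta>)) \<longlonglongrightarrow> - ln (Z k \<beta>)" using k by (intro tendsto_intros) auto
    then have "convergent (\<lambda>n. - ln (X k n \<beta>))" by (auto simp: convergent_def)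
    then have "Bseq (\<lambda>n. - ln (X k n \<beta>))" by (rule convergent_imp_Bseq)
    then obtain K where K: "\<And>n. norm (- ln (X k n \<beta>)) \<le> K" unfolding Bseq_def by blast
    have GK: "Gn (n + ?N) \<beta> i i \<le> 2 * K / (l k)\<^sup>2" for n
    proof -
      have "(l k)\<^sup>2 / 2 * Gn (n + ?N) \<beta> i i \<le> - ln (X k n \<beta>)"
        unfolding X ln_exp using psin_nonneg[OF D, of "n + ?N" i] l0[of k] by simp
      also have "\<dots> \<le> K" using K[of n] by simp
      finally show ?thesis using l0[of k] by (simp add: field_simps)
    qed
    have "incseq (\<lambda>n. Gn (n + ?N) \<beta> i i)" by (intro incseq_SucI Gn_mono[OF D]) simp
    then obtain L where L: "(\<lambda>n. Gn (n + ?N) \<beta> i i) \<longlonglongrightarrow> L"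
      by (rule incseq_convergent) (use GK in blast)
    have "(\<lambda>n. (- ln (X k n \<beta>) - (l k)\<^sup>2 / 2 * Gn (n + ?N) \<beta> i i) / l k) \<longlonglongrightarrow> (- ln (Z k \<beta>) - (l k)\<^sup>2 / 2 * L) / l k"
      using l0[of k] by (intro tendsto_intros lnX L) auto
    moreover have "(- ln (X k n \<beta>) - (l k)\<^sup>2 / 2 * Gn (n + ?N) \<beta> i i) / l k = psin (n + ?N) \<beta> i" for n
      unfolding X ln_exp using l0[of k] by simp
    ultimately have P: "(\<lambda>n. psin (n + ?N) \<beta> i) \<longlonglongrightarrow> (- ln (Z k \<beta>) - (l k)\<^sup>2 / 2 * L) / l k" by simp
    from L P show ?case
      using LIMSEQ_offset[of "\<lambda>n. Gn n \<beta> i i" ?N] LIMSEQ_offset[of "\<lambda>n. psin n \<beta> i" ?N]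
      unfolding convergent_def by blast
  qed
qed

lemma AE_conv: "AE \<beta> in nu. conv \<beta>"
proof -
  have "AE \<beta> in nu. \<forall>i\<in>T. convergent (\<lambda>n. Gn n \<beta> i i) \<and> convergent (\<lambda>n. psin n \<beta> i)"
    using conv_at by (simp add: AE_ball_countable[OF countable_T])
  then show ?thesis using nu_dom
  proof eventually_elim
    case (elim \<beta>)
    have D: "\<beta> \<in> Dm" by fact
    have "convergent (\<lambda>n. Gn n \<beta> i j)" if ij: "i \<in> T" "j \<in> T" for i j
    proof -
      have "convergent (\<lambda>n. Gn n \<beta> i i + Gn n \<beta> j j)" using elim(1) ij by (intro convergent_add) auto
      then have "Bseq (\<lambda>n. Gn n \<beta> i i + Gn n \<beta> j j)" by (rule convergent_imp_Bseq)
      then obtain K where K: "\<And>n. norm (Gn n \<beta> i i + Gn n \<beta> j j) \<le> K" unfolding Bseq_def by blast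
      have "Gn n \<beta> i j \<le> K" for n
      proof (cases "i \<in> Bn n \<and> j \<in> Bn n")
        case True
        then have "2 * Gn n \<beta> i j \<le> Gn n \<beta> i i + Gn n \<beta> j j" using Gn_diag_bound[OF D] by blast
        moreover have "Gn n \<beta> i j \<le> 2 * Gn n \<beta> i j" using Gn_nonneg[OF D, of n i j] by simp
        ultimately show ?thesis using K[of n] by simp
      next
        case False
        then have "Gn n \<beta> i j = 0" using Gn_outside[OF D] by blast
        then show ?thesis using K[of n] norm_ge_zero order_trans by metis
      qed
      moreover have "incseq (\<lambda>n. Gn n \<beta> i j)" by (intro incseq_SucI Gn_mono[OF D]) simp
      ultimately obtain L where "(\<lambda>n. Gn n \<beta> i j) \<longlonglongrightarrow> L"
        using incseq_convergent[of "\<lambda>n. Gn n \<beta> i j" K] by metis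
      then show ?thesis by (auto simp: convergent_def)
    qed
    then show ?case using elim by (simp add: conv_def)
  qed
qed

subsection \<open>The good potentials\<close>

definition good :: "('v \<Rightarrow> real) \<Rightarrow> bool" where
  "good \<beta> \<longleftrightarrow> conv \<beta> \<and> (\<forall>i\<in>T. 0 < ps \<beta> i)"

text \<open>Countably many conditions describe the domain, because every finite set lies in a ball.\<close>

lemma Dm_iff: "\<beta> \<in> Dm \<longleftrightarrow> (\<forall>n. posdef_on (Bn n) (Hmat W \<beta>))"
proof
  assume "\<forall>n. posdef_on (Bn n) (Hmat W \<beta>)"
  then have p: "posdef_on (Bn n) (Hmat W \<beta>)" for n by blast
  show "\<beta> \<in> Dm"
    unfolding dom_inf_def
  proof (intro CollectI allI impI)
    fix U assume "finite U" "U \<subseteq> T"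
    then obtain n where "U \<subseteq> Bn n" using finite_in_ball[of U] by auto
    then show "posdef_on U (Hmat W \<beta>)" by (rule posdef_on_subset[OF p _ tball_finite])
  qed
qed (use tball_finite tball_T in \<open>auto simp: dom_inf_def\<close>)

lemma sets_Collect_Ball:
  assumes "countable I" "\<And>i. i \<in> I \<Longrightarrow> {x \<in> space N. P i x} \<in> sets N"
  shows "{x \<in> space N. \<forall>i\<in>I. P i x} \<in> sets N"
proof -
  have "{x \<in> space N. \<forall>i\<in>I. P i x} = space N - (\<Union>i\<in>I. space N - {x \<in> space N. P i x})" by auto
  also have "\<dots> \<in> sets N" using assms by (intro sets.Diff sets.top sets.countable_UN') auto
  finally show ?thesis .
qed

lemma Dm_sets: "{\<beta> \<in> space nu. \<beta> \<in> Dm} \<in> sets nu"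
proof -
  have "{\<beta> \<in> space nu. posdef_on (Bn n) (Hmat W \<beta>)} \<in> sets nu" for n
    using tball_in_T by (intro Hmat_inv_measurable[where W="\<lambda>_. W" and b="\<lambda>\<beta>. \<beta>"] tball_finite weights_U tball_T component_nu) auto
  then have "{\<beta> \<in> space nu. \<forall>n. posdef_on (Bn n) (Hmat W \<beta>)} \<in> sets nu"
    by (intro sets.sets_Collect_countable_All)
  then show ?thesis by (simp add: Dm_iff)
qed

lemma inv_measurable_D:
  assumes U: "finite U" "U \<subseteq> T"
  shows "(\<lambda>\<beta>. inv_on U (Hmat W \<beta>) i j) \<in> borel_measurable (restrict_space nu {\<beta> \<in> space nu. \<beta> \<in> Dm})"
proof -
  let ?N = "restrict_space nu {\<beta> \<in> space nu. \<beta> \<in> Dm}"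
  have "(\<lambda>\<beta>. if posdef_on U (Hmat W \<beta>) then inv_on U (Hmat W \<beta>) i j else 0) \<in> borel_measurable nu"
    using U by (intro Hmat_inv_measurable[where W="\<lambda>_. W" and b="\<lambda>\<beta>. \<beta>"] weights_U component_nu) auto
  then have "(\<lambda>\<beta>. if posdef_on U (Hmat W \<beta>) then inv_on U (Hmat W \<beta>) i j else 0) \<in> borel_measurable ?N"
    by (rule measurable_restrict_space1)
  then show ?thesis
    by (rule measurable_cong[THEN iffD1, rotated]) (use pd U in \<open>auto simp: space_restrict_space\<close>)
qed

lemma good_sets: "{\<beta> \<in> space nu. good \<beta>} \<in> sets nu"
proof -
  let ?D = "{\<beta> \<in> space nu. \<beta> \<in> Dm}"
  let ?N = "restrict_space nu ?D"
  have sp: "space ?N = ?D" using Dm_sets by (auto simp: space_restrict_space)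
  have G: "(\<lambda>\<beta>. Gn n \<beta> i j) \<in> borel_measurable ?N" for n i j
    unfolding Ghat_n_def by (rule inv_measurable_D[OF tball_finite tball_T])
  have "(\<lambda>\<beta>. if i \<in> Bn n then \<Sum>z\<in>Bn n. Gn n \<beta> i z * eta (Bn n) z else 1) \<in> borel_measurable ?N" for n i
    using G by (cases "i \<in> Bn n") simp_all
  then have P: "(\<lambda>\<beta>. psin n \<beta> i) \<in> borel_measurable ?N" for n i
    by (rule measurable_cong[THEN iffD1, rotated]) (auto simp: sp psin_eq)
  have cv: "{\<beta> \<in> space ?N. convergent (\<lambda>n. f n \<beta>)} \<in> sets ?N"
    if "\<And>n. f n \<in> borel_measurable ?N" for f :: "nat \<Rightarrow> ('v \<Rightarrow> real) \<Rightarrow> real"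
    unfolding Cauchy_convergent_iff[symmetric] by (rule sets_Collect_Cauchy[OF that])
  have [measurable]: "(\<lambda>\<beta>. ps \<beta> i) \<in> borel_measurable ?N" for i
    unfolding psi_def using P by (intro borel_measurable_lim_metric)
  have "{\<beta> \<in> space ?N. \<forall>i\<in>T. \<forall>j\<in>T. convergent (\<lambda>n. Gn n \<beta> i j)} \<in> sets ?N"
    by (intro sets_Collect_Ball countable_T cv G)
  moreover have "{\<beta> \<in> space ?N. \<forall>i\<in>T. convergent (\<lambda>n. psin n \<beta> i)} \<in> sets ?N"
    by (intro sets_Collect_Ball countable_T cv P)
  moreover have "{\<beta> \<in> space ?N. \<forall>i\<in>T. 0 < ps \<beta> i} \<in> sets ?N"
    by (intro sets_Collect_Ball countable_T) measurable
  ultimately have "{\<beta> \<in> space ?N. \<forall>i\<in>T. \<forall>j\<in>T. convergent (\<lambda>n. Gn n \<beta> i j)}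
     \<inter> {\<beta> \<in> space ?N. \<forall>i\<in>T. convergent (\<lambda>n. psin n \<beta> i)} \<inter> {\<beta> \<in> space ?N. \<forall>i\<in>T. 0 < ps \<beta> i} \<in> sets ?N"
    by (intro sets.Int)
  also have "{\<beta> \<in> space ?N. \<forall>i\<in>T. \<forall>j\<in>T. convergent (\<lambda>n. Gn n \<beta> i j)}
     \<inter> {\<beta> \<in> space ?N. \<forall>i\<in>T. convergent (\<lambda>n. psin n \<beta> i)} \<inter> {\<beta> \<in> space ?N. \<forall>i\<in>T. 0 < ps \<beta> i}
     = {\<beta> \<in> space nu. good \<beta>}" by (auto simp: sp good_def conv_def)
  finally have "{\<beta> \<in> space nu. good \<beta>} \<in> sets ?N" .
  then show ?thesis using sets_restrict_space_iff[of ?D nu] Dm_sets by auto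
qed

text \<open>On the measurable set of good potentials all limits exist and all inverses are proper,
  so every functional of the potential is measurable on this restricted space. The
  exceptional set, where limits and inverses are unspecified, is a null set.\<close>

definition good_space :: "('v \<Rightarrow> real) measure" where "good_space = restrict_space nu {\<beta> \<in> space nu. good \<beta>}"

lemma space_good_space: "space good_space = {\<beta> \<in> space nu. good \<beta>}"
  using good_sets by (auto simp: good_space_def space_restrict_space)

lemma good_space_good: "\<beta> \<in> space good_space \<Longrightarrow> good \<beta>" and good_conv: "good \<beta> \<Longrightarrow> conv \<beta>"
  by (auto simp: space_good_space good_def)

lemma inv_measurable_good_space:
  assumes U: "finite U" "U \<subseteq> T"
  shows "(\<lambda>\<beta>. inv_on U (Hmat W \<beta>) i j) \<in> borel_measurable good_space"
proof -
  have "(\<lambda>\<beta>. if posdef_on U (Hmat W \<beta>) then inv_on U (Hmat W \<beta>) i j else 0) \<in> borel_measurable nu"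
    using U by (intro Hmat_inv_measurable[where W="\<lambda>_. W" and b="\<lambda>\<beta>. \<beta>"] weights_U component_nu) auto
  then have "(\<lambda>\<beta>. if posdef_on U (Hmat W \<beta>) then inv_on U (Hmat W \<beta>) i j else 0) \<in> borel_measurable good_space"
    unfolding good_space_def by (rule measurable_restrict_space1)
  then show ?thesis
    by (rule measurable_cong[THEN iffD1, rotated]) (use pd[OF dm U] in \<open>auto simp: good_conv dest!: good_space_good\<close>)
qed

lemma Gh_measurable: "(\<lambda>\<beta>. Gh \<beta> i j) \<in> borel_measurable good_space"
  unfolding Ghat_def Ghat_n_def
  by (intro borel_measurable_lim_metric inv_measurable_good_space tball_finite tball_T)

lemma ps_measurable: "(\<lambda>\<beta>. ps \<beta> i) \<in> borel_measurable good_space"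
proof -
  have "(\<lambda>\<beta>. Gn n \<beta> i z) \<in> borel_measurable good_space" for n z
    unfolding Ghat_n_def by (rule inv_measurable_good_space[OF tball_finite tball_T])
  then have "(\<lambda>\<beta>. if i \<in> Bn n then \<Sum>z\<in>Bn n. Gn n \<beta> i z * eta (Bn n) z else 1) \<in> borel_measurable good_space" for n
    by (cases "i \<in> Bn n") simp_all
  then have "(\<lambda>\<beta>. psin n \<beta> i) \<in> borel_measurable good_space" for n
    by (rule measurable_cong[THEN iffD1, rotated]) (auto simp: psin_eq[OF dm] good_conv dest!: good_space_good)
  then show ?thesis unfolding psi_def by (intro borel_measurable_lim_metric)
qed

end

section \<open>Laws of Markov chains with finite range\<close>

locale mchain =
  fixes T :: "'v set" and N :: "'v \<Rightarrow> 'v set" and p :: "'v \<Rightarrow> 'v \<Rightarrow> real"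
  assumes cT: "countable T" and N_fin: "\<And>i. i \<in> T \<Longrightarrow> finite (N i)" and N_T: "\<And>i. i \<in> T \<Longrightarrow> N i \<subseteq> T"
    and p_nonneg: "\<And>i j. i \<in> T \<Longrightarrow> 0 \<le> p i j"
    and p_out: "\<And>i j. i \<in> T \<Longrightarrow> j \<notin> N i \<Longrightarrow> p i j = 0"
    and p_sum: "\<And>i. i \<in> T \<Longrightarrow> (\<Sum>j\<in>N i. p i j) = 1"
begin

abbreviation "PT \<equiv> PiM (UNIV :: nat set) (\<lambda>_. count_space T)"

definition is_chain :: "'v \<Rightarrow> (nat \<Rightarrow> 'v) measure \<Rightarrow> bool" where
  "is_chain y M \<longleftrightarrow> prob_space M \<and> sets M = sets PT \<and>
     (\<forall>n x. (\<forall>k\<le>n. x k \<in> T) \<longrightarrow>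
        measure M {X \<in> space M. \<forall>k\<le>n. X k = x k}
          = (if x 0 = y then \<Prod>k<n. p (x k) (x (Suc k)) else 0))"

text \<open>The chain is driven by independent choices: \<open>\<omega> (n, i)\<close> is the vertex to which the chain
  moves if it is at \<open>i\<close> at time \<open>n\<close>. Where \<open>i\<close> is not a vertex, the choice has the law of that at
  \<open>y\<close>, so that all factors of the product are probability measures.\<close>

definition step :: "'v \<Rightarrow> 'v \<Rightarrow> 'v measure" where
  "step y i = density (count_space T) (\<lambda>j. ennreal (p (if i \<in> T then i else y) j))"

fun walk :: "'v \<Rightarrow> (nat \<times> 'v \<Rightarrow> 'v) \<Rightarrow> nat \<Rightarrow> 'v" where
  "walk y \<omega> 0 = y"
| "walk y \<omega> (Suc n) = \<omega> (n, walk y \<omega> n)"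

lemma step_prob: "y \<in> T \<Longrightarrow> prob_space (step y i)"
proof
  assume y: "y \<in> T"
  define z where "z = (if i \<in> T then i else y)"
  have z: "z \<in> T" using y by (simp add: z_def)
  have "emeasure (step y i) (space (step y i)) = (\<integral>\<^sup>+j. ennreal (p z j) \<partial>count_space T)"
    unfolding step_def z_def[symmetric]
    by (subst emeasure_density) (auto intro!: nn_integral_cong)
  also have "\<dots> = (\<Sum>j\<in>N z. ennreal (p z j))"
    using N_fin[OF z] N_T[OF z] p_out[OF z] by (intro nn_integral_count_space') auto
  also have "\<dots> = 1" using p_nonneg[OF z] p_sum[OF z] by (simp add: sum_ennreal)
  finally show "emeasure (step y i) (space (step y i)) = 1" .
qed

lemma step_point: "i \<in> T \<Longrightarrow> j \<in> T \<Longrightarrow> emeasure (step y i) {j} = ennreal (p i j)"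
  unfolding step_def by (subst emeasure_density) (auto simp: nn_integral_count_space'[of "{j}"])

lemma is_chain_exists:
  assumes y: "y \<in> T"
  shows "\<exists>M. is_chain y M"
proof -
  let ?S = "\<lambda>q :: nat \<times> 'v. step y (snd q)"
  let ?P = "PiM UNIV ?S"
  interpret S: product_prob_space ?S UNIV
    by (rule product_prob_spaceI) (rule step_prob[OF y])
  have spS: "space (step y i) = T" for i by (simp add: step_def)
  have spP: "\<omega> \<in> space ?P \<Longrightarrow> \<omega> q \<in> T" for \<omega> q
    using spS by (cases q) (auto simp: space_PiM PiE_def Pi_def)
  have wT: "\<omega> \<in> space ?P \<Longrightarrow> walk y \<omega> n \<in> T" for \<omega> n
    using y spP by (cases n) auto
  have wm: "(\<lambda>\<omega>. walk y \<omega> n) \<in> measurable ?P (count_space T)" for n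
  proof (induction n)
    case 0
    then show ?case using y by simp
  next
    case (Suc n)
    have "(\<lambda>\<omega>. \<omega> (n, i)) \<in> measurable ?P (count_space T)" for i
    proof -
      have "(\<lambda>\<omega>. \<omega> (n, i)) \<in> measurable ?P (step y i)"
        using measurable_component_singleton[of "(n, i)" UNIV ?S] by simp
      also have "measurable ?P (step y i) = measurable ?P (count_space T)"
        by (rule measurable_cong_sets) (auto simp: step_def)
      finally show ?thesis .
    qed
    from measurable_compose_countable'[OF this Suc cT] show ?case by simp
  qed
  define L where "L = distr ?P PT (walk y)"
  have wm': "walk y \<in> measurable ?P PT"
  proof (rule measurable_PiM_single')
    show "walk y \<in> space ?P \<rightarrow> UNIV \<rightarrow>\<^sub>E space (count_space T)" using wT by auto
    show "(\<lambda>\<omega>. walk y \<omega> i) \<in> measurable ?P (count_space T)" for i by (rule wm)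
  qed
  have "is_chain y L"
    unfolding is_chain_def
  proof (intro conjI allI impI)
    show "prob_space L" unfolding L_def by (rule S.P.prob_space_distr[OF wm'])
    show "sets L = sets PT" by (simp add: L_def)
    fix n x assume x: "\<forall>k\<le>(n::nat). x k \<in> T"
    have cyl: "{X \<in> space PT. \<forall>k\<le>n. X k = x k} \<in> sets PT"
      using x by measurable
    have "measure L {X \<in> space L. \<forall>k\<le>n. X k = x k}
      = measure ?P (walk y -` {X \<in> space PT. \<forall>k\<le>n. X k = x k} \<inter> space ?P)"
      using wm' cyl by (simp add: L_def measure_distr)
    also have "\<dots> = measure ?P {\<omega> \<in> space ?P. \<forall>k\<le>n. walk y \<omega> k = x k}"
      using measurable_space[OF wm'] by (intro arg_cong2[where f=measure] refl) auto
    also have "\<dots> = (if x 0 = y then \<Prod>k<n. p (x k) (x (Suc k)) else 0)"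
    proof (cases "x 0 = y")
      case False
      then have "{\<omega> \<in> space ?P. \<forall>k\<le>n. walk y \<omega> k = x k} = {}" by auto
      then show ?thesis using False by (simp only: measure_empty if_False)
    next
      case True
      \<comment> \<open>The walk follows \<open>x\<close> if and only if the choice at each \<open>(k, x k)\<close> is \<open>x (k + 1)\<close>; these
      are different coordinates, hence independent.\<close>
      let ?J = "(\<lambda>k. (k, x k)) ` {..<n}"
      let ?A = "\<lambda>q. {x (Suc (fst q))}"
      have iff: "(\<forall>k\<le>n. walk y \<omega> k = x k) \<longleftrightarrow> (\<forall>k<n. \<omega> (k, x k) = x (Suc k))" for \<omega>
      proof (induction n)
        case 0
        then show ?case using True by simp
      next
        case (Suc n)
        then show ?case by (auto simp: le_Suc_eq less_Suc_eq)
      qed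
      have "{\<omega> \<in> space ?P. \<forall>k\<le>n. walk y \<omega> k = x k} = prod_emb UNIV ?S ?J (Pi\<^sub>E ?J ?A)"
        unfolding iff by (auto simp: prod_emb_def space_PiM PiE_def Pi_def)
      then have "emeasure ?P {\<omega> \<in> space ?P. \<forall>k\<le>n. walk y \<omega> k = x k} = (\<Prod>q\<in>?J. emeasure (?S q) (?A q))"
        using x by (simp only:) (rule S.emeasure_PiM_emb, auto simp: step_def)
      also have "\<dots> = (\<Prod>k<n. emeasure (step y (x k)) {x (Suc k)})"
        by (subst prod.reindex) (auto simp: inj_on_def)
      also have "\<dots> = (\<Prod>k<n. ennreal (p (x k) (x (Suc k))))"
        using x by (intro prod.cong refl step_point) auto
      also have "\<dots> = ennreal (\<Prod>k<n. p (x k) (x (Suc k)))"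
        using x p_nonneg by (intro prod_ennreal) auto
      finally have e: "emeasure ?P {\<omega> \<in> space ?P. \<forall>k\<le>n. walk y \<omega> k = x k} = ennreal (\<Prod>k<n. p (x k) (x (Suc k)))" .
      have "0 \<le> (\<Prod>k<n. p (x k) (x (Suc k)))" using x p_nonneg by (intro prod_nonneg) auto
      then show ?thesis unfolding measure_def e using True by simp
    qed
    finally show "measure L {X \<in> space L. \<forall>k\<le>n. X k = x k}
       = (if x 0 = y then \<Prod>k<n. p (x k) (x (Suc k)) else 0)" .
  qed
  then show ?thesis by blast
qed

context
  fixes y M assumes M: "is_chain y M"
begin

lemma M_prob: "prob_space M" and M_sets: "sets M = sets PT"
  using M by (auto simp: is_chain_def)

lemma M_space: "space M = space PT" by (rule sets_eq_imp_space_eq[OF M_sets])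

lemma M_T: "X \<in> space M \<Longrightarrow> X k \<in> T" by (auto simp: M_space space_PiM PiE_def Pi_def)

lemma M_cyl: "(\<And>k. k \<le> n \<Longrightarrow> x k \<in> T) \<Longrightarrow>
    emeasure M {X \<in> space M. \<forall>k\<le>n. X k = x k} = ennreal (if x 0 = y then \<Prod>k<n. p (x k) (x (Suc k)) else 0)"
  using M prob_space.finite_measure[OF M_prob]
  by (simp add: is_chain_def finite_measure.emeasure_eq_measure)

lemma coord [measurable]: "(\<lambda>X. X k) \<in> measurable M (count_space T)"
  using measurable_component_singleton[of k UNIV "\<lambda>_. count_space T"] by (simp add: measurable_cong_sets[OF M_sets refl])

lemma ev_sets: "{X \<in> space M. X k \<in> B} \<in> sets M"
proof -
  have "(\<lambda>X. X k) -` (B \<inter> T) \<inter> space M \<in> sets M" by (rule measurable_sets[OF coord]) auto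
  also have "(\<lambda>X. X k) -` (B \<inter> T) \<inter> space M = {X \<in> space M. X k \<in> B}" using M_T by auto
  finally show ?thesis .
qed

lemma cyl_sets: "{X \<in> space M. \<forall>k\<le>n. X k = x k} \<in> sets M"
proof -
  have "{X \<in> space M. \<forall>k\<in>{..n}. X k \<in> {x k}} \<in> sets M"
    by (intro sets.sets_Collect_finite_All ev_sets) simp
  then show ?thesis by simp
qed

end

fun pw :: "nat \<Rightarrow> ('v \<Rightarrow> real) \<Rightarrow> 'v \<Rightarrow> real" where
  "pw 0 g i = g i"
| "pw (Suc k) g i = (\<Sum>j\<in>N i. p i j * pw k g j)"

lemma pw_mono: "i \<in> T \<Longrightarrow> (\<And>j. j \<in> T \<Longrightarrow> g j \<le> h j) \<Longrightarrow> pw k g i \<le> pw k h i"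
proof (induction k arbitrary: i)
  case (Suc k)
  then show ?case using N_T p_nonneg by (auto intro!: sum_mono mult_left_mono)
qed simp

lemma pw_const: "i \<in> T \<Longrightarrow> pw k (\<lambda>_. c) i = c"
proof (induction k arbitrary: i)
  case (Suc k)
  then have "pw (Suc k) (\<lambda>_. c) i = (\<Sum>j\<in>N i. p i j * c)"
    using N_T[OF Suc.prems] by (auto simp: subset_iff intro!: sum.cong)
  also have "\<dots> = c" using p_sum Suc.prems by (simp add: sum_distrib_right[symmetric])
  finally show ?case .
qed simp

lemma pw_nonneg: "i \<in> T \<Longrightarrow> (\<And>j. j \<in> T \<Longrightarrow> 0 \<le> g j) \<Longrightarrow> 0 \<le> pw k g i"
  using pw_mono[of i "\<lambda>_. 0" g k] pw_const[of i k 0] by simp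

text \<open>The Markov property for the event that the chain is in \<open>B\<close> after \<open>k\<close> more steps, by
  induction on \<open>k\<close>: the event is split according to the next vertex.\<close>

lemma chain_markov:
  assumes M: "is_chain y M" and x: "\<And>k. k \<le> n \<Longrightarrow> x k \<in> T"
  shows "emeasure M {X \<in> space M. (\<forall>i\<le>n. X i = x i) \<and> X (n + k) \<in> B}
    = ennreal ((if x 0 = y then \<Prod>k<n. p (x k) (x (Suc k)) else 0) * pw k (indicator B) (x n))"
  using x
proof (induction k arbitrary: n x)
  case 0
  show ?case
  proof (cases "x n \<in> B")
    case True
    then have "{X \<in> space M. (\<forall>i\<le>n. X i = x i) \<and> X (n + 0) \<in> B} = {X \<in> space M. \<forall>i\<le>n. X i = x i}" by auto
    then show ?thesis using M_cyl[OF M 0] True by simp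
  next
    case False
    then have "{X \<in> space M. (\<forall>i\<le>n. X i = x i) \<and> X (n + 0) \<in> B} = {}" by auto
    then show ?thesis using False by (simp only: emeasure_empty) simp
  qed
next
  case (Suc k)
  let ?c = "if x 0 = y then \<Prod>k<n. p (x k) (x (Suc k)) else 0"
  let ?x = "\<lambda>j. x(Suc n := j)"
  let ?E = "\<lambda>j. {X \<in> space M. (\<forall>i\<le>Suc n. X i = ?x j i) \<and> X (Suc n + k) \<in> B}"
  have xn: "x n \<in> T" using Suc.prems by simp
  have c0: "0 \<le> ?c" using p_nonneg Suc.prems by (auto intro!: prod_nonneg)
  have b0: "0 \<le> pw k (indicator B) j" if "j \<in> T" for j using that by (intro pw_nonneg) auto
  have E: "emeasure M (?E j) = ennreal (?c * (p (x n) j * pw k (indicator B) j))" if "j \<in> T" for j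
  proof -
    have "(\<Prod>k<n. p (?x j k) (?x j (Suc k))) = (\<Prod>k<n. p (x k) (x (Suc k)))" by (intro prod.cong) auto
    then have "(\<Prod>k<Suc n. p (?x j k) (?x j (Suc k))) = (\<Prod>k<n. p (x k) (x (Suc k))) * p (x n) j" by simp
    moreover have "emeasure M (?E j) = ennreal ((if ?x j 0 = y then \<Prod>k<Suc n. p (?x j k) (?x j (Suc k)) else 0)
        * pw k (indicator B) (?x j (Suc n)))"
      using Suc.prems that by (intro Suc.IH) (auto simp: le_Suc_eq)
    ultimately show ?thesis by (simp only: fun_upd_same) (simp add: mult.assoc)
  qed
  have "{X \<in> space M. (\<forall>i\<le>n. X i = x i) \<and> X (n + Suc k) \<in> B} = (\<Union>j\<in>T. ?E j)"
  proof (intro subset_antisym subsetI)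
    fix X assume X: "X \<in> {X \<in> space M. (\<forall>i\<le>n. X i = x i) \<and> X (n + Suc k) \<in> B}"
    then have "X \<in> ?E (X (Suc n))" by (auto simp: le_Suc_eq)
    then show "X \<in> (\<Union>j\<in>T. ?E j)" using M_T[OF M, of X "Suc n"] X by blast
  qed (auto simp: le_Suc_eq split: if_splits)
  also have "emeasure M (\<Union>j\<in>T. ?E j) = (\<integral>\<^sup>+j. emeasure M (?E j) \<partial>count_space T)"
  proof (rule emeasure_UN_countable)
    fix j
    have "?E j = {X \<in> space M. \<forall>i\<le>Suc n. X i = ?x j i} \<inter> {X \<in> space M. X (Suc n + k) \<in> B}" by blast
    then show "?E j \<in> sets M" using sets.Int[OF cyl_sets[OF M, of "Suc n" "?x j"] ev_sets[OF M, of "Suc n + k" B]]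
      by (simp only:)
  next
    show "disjoint_family_on ?E T"
      unfolding disjoint_family_on_def by (auto simp: le_Suc_eq)
  qed (rule cT)
  also have "\<dots> = (\<integral>\<^sup>+j. ennreal (?c * (p (x n) j * pw k (indicator B) j)) \<partial>count_space T)"
    by (intro nn_integral_cong E) simp
  also have "\<dots> = (\<Sum>j\<in>N (x n). ennreal (?c * (p (x n) j * pw k (indicator B) j)))"
    using N_fin[OF xn] N_T[OF xn] p_out[OF xn] by (intro nn_integral_count_space') auto
  also have "\<dots> = ennreal (\<Sum>j\<in>N (x n). ?c * (p (x n) j * pw k (indicator B) j))"
    using c0 b0 p_nonneg[OF xn] N_T[OF xn] by (intro sum_ennreal mult_nonneg_nonneg) auto
  also have "(\<Sum>j\<in>N (x n). ?c * (p (x n) j * pw k (indicator B) j)) = ?c * pw (Suc k) (indicator B) (x n)"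
    by (simp only: pw.simps sum_distrib_left)
  finally show ?case .
qed

lemma chain_at:
  assumes M: "is_chain y M" and y: "y \<in> T"
  shows "measure M {X \<in> space M. X k \<in> B} = pw k (indicator B) y"
proof -
  interpret prob_space M by (rule M_prob[OF M])
  have b0: "0 \<le> pw k (indicator B) y" using y by (intro pw_nonneg) auto
  have "emeasure M {X \<in> space M. \<forall>i\<le>0. X i = y} = 1" using M_cyl[OF M, of 0 "\<lambda>_. y"] y by simp
  then have "AE X in M. X \<in> {X \<in> space M. \<forall>i\<le>0. X i = y}"
    by (intro AE_prob_1) (simp add: emeasure_eq_measure)
  then have "AE X in M. X \<in> {X \<in> space M. X k \<in> B} \<longleftrightarrow> X \<in> {X \<in> space M. (\<forall>i\<le>0. X i = y) \<and> X (0 + k) \<in> B}"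
    by eventually_elim auto
  then have "emeasure M {X \<in> space M. X k \<in> B} = emeasure M {X \<in> space M. (\<forall>i\<le>0. X i = y) \<and> X (0 + k) \<in> B}"
  proof (rule emeasure_eq_AE)
    show "{X \<in> space M. X k \<in> B} \<in> sets M" by (rule ev_sets[OF M])
    show "{X \<in> space M. (\<forall>i\<le>0. X i = y) \<and> X (0 + k) \<in> B} \<in> sets M"
    proof -
      have "{X \<in> space M. (\<forall>i\<le>0. X i = y) \<and> X (0 + k) \<in> B}
        = {X \<in> space M. X 0 \<in> {y}} \<inter> {X \<in> space M. X k \<in> B}" by auto
      then show ?thesis using sets.Int[OF ev_sets[OF M, of 0 "{y}"] ev_sets[OF M, of k B]] by (simp only:)
    qed
  qed
  also have "\<dots> = ennreal (pw k (indicator B) y)" using chain_markov[OF M, of 0 "\<lambda>_. y" k B] y by simp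
  finally show ?thesis using b0 by (simp add: measure_def)
qed

lemma chain_edges:
  assumes M: "is_chain y M"
  shows "AE X in M. \<forall>k. X (Suc k) \<in> N (X k)"
proof -
  have "AE X in M. X (Suc k) \<in> N (X k)" for k
  proof -
    let ?D = "{x \<in> {..Suc k} \<rightarrow>\<^sub>E T. x (Suc k) \<notin> N (x k)}"
    have cD: "countable ?D"
      by (rule countable_subset[OF _ countable_PiE[of "{..Suc k}" "\<lambda>_. T"]]) (use cT in auto)
    have null: "{X \<in> space M. \<forall>i\<le>Suc k. X i = x i} \<in> null_sets M" if x: "x \<in> ?D" for x
    proof -
      have xT: "x i \<in> T" if "i \<le> Suc k" for i using x that by (auto simp: PiE_def Pi_def)
      have p0: "p (x k) (x (Suc k)) = 0" using x by (intro p_out xT) auto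
      have "emeasure M {X \<in> space M. \<forall>i\<le>Suc k. X i = x i}
        = ennreal (if x 0 = y then \<Prod>k<Suc k. p (x k) (x (Suc k)) else 0)" by (rule M_cyl[OF M xT])
      also have "\<dots> = 0" by (simp add: p0)
      finally show ?thesis using cyl_sets[OF M, of "Suc k" x] by (intro null_setsI)
    qed
    have "(\<Union>x\<in>?D. {X \<in> space M. \<forall>i\<le>Suc k. X i = x i}) \<in> null_sets M"
      by (rule null_sets_UN'[OF cD null])
    from AE_not_in[OF this] AE_space[of M] show ?thesis
    proof eventually_elim
      case (elim X)
      show ?case
      proof (rule ccontr)
        assume "X (Suc k) \<notin> N (X k)"
        then have D: "restrict X {..Suc k} \<in> ?D" using M_T[OF M elim(2)] by auto
        have "X \<in> (\<Union>x\<in>?D. {X \<in> space M. \<forall>i\<le>Suc k. X i = x i})"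
          by (rule UN_I[OF D]) (use elim(2) in simp)
        then show False using elim(1) by contradiction
      qed
    qed
  qed
  then show ?thesis by (simp add: AE_all_countable)
qed

text \<open>Finite-dimensional boxes are countable unions of cylinders on which the first
  coordinates are fixed.\<close>

lemma is_chain_unique:
  assumes M: "is_chain y M" and M': "is_chain y M'"
  shows "M = M'"
proof (rule measure_eqI_PiM_infinite[where I=UNIV and M="\<lambda>_. count_space T"])
  show "sets M = sets PT" "sets M' = sets PT" using M_sets M M' by blast+
  show "finite_measure M" by (rule prob_space.finite_measure[OF M_prob[OF M]])
  fix A :: "nat \<Rightarrow> 'v set" and J :: "nat set"
  assume J: "finite J" and A: "\<And>i. i \<in> J \<Longrightarrow> A i \<in> sets (count_space T)"
  define n where "n = Max (insert 0 J)"
  have n: "j \<le> n" if "j \<in> J" for j using J that by (simp add: n_def)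
  let ?D = "{x \<in> {..n} \<rightarrow>\<^sub>E T. \<forall>j\<in>J. x j \<in> A j}"
  have cD: "countable ?D"
    by (rule countable_subset[OF _ countable_PiE[of "{..n}" "\<lambda>_. T"]]) (use cT in auto)
  have "emeasure K (prod_emb UNIV (\<lambda>_. count_space T) J (Pi\<^sub>E J A))
     = (\<integral>\<^sup>+x. ennreal (if x 0 = y then \<Prod>k<n. p (x k) (x (Suc k)) else 0) \<partial>count_space ?D)" if K: "is_chain y K" for K
  proof -
    have "prod_emb UNIV (\<lambda>_. count_space T) J (Pi\<^sub>E J A) = (\<Union>x\<in>?D. {X \<in> space K. \<forall>i\<le>n. X i = x i})"
    proof (intro subset_antisym subsetI)
      fix X assume "X \<in> prod_emb UNIV (\<lambda>_. count_space T) J (Pi\<^sub>E J A)"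
      then have X: "X \<in> space K" "\<And>j. j \<in> J \<Longrightarrow> X j \<in> A j"
        by (auto simp: prod_emb_def M_space[OF K] space_PiM PiE_def Pi_def)
      then have "restrict X {..n} \<in> ?D" using n M_T[OF K X(1)] by auto
      then show "X \<in> (\<Union>x\<in>?D. {X \<in> space K. \<forall>i\<le>n. X i = x i})" using X(1)
        by (intro UN_I[of "restrict X {..n}"]) auto
    next
      fix X assume "X \<in> (\<Union>x\<in>?D. {X \<in> space K. \<forall>i\<le>n. X i = x i})"
      then show "X \<in> prod_emb UNIV (\<lambda>_. count_space T) J (Pi\<^sub>E J A)"
        using n by (fastforce simp: prod_emb_def M_space[OF K] space_PiM PiE_def)
    qed
    also have "emeasure K \<dots> = (\<integral>\<^sup>+x. emeasure K {X \<in> space K. \<forall>i\<le>n. X i = x i} \<partial>count_space ?D)"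
    proof (rule emeasure_UN_countable)
      show "disjoint_family_on (\<lambda>x. {X \<in> space K. \<forall>i\<le>n. X i = x i}) ?D"
        unfolding disjoint_family_on_def
      proof (intro ballI impI)
        fix x x' assume "x \<in> ?D" "x' \<in> ?D" "x \<noteq> x'"
        then obtain i where "i \<le> n" "x i \<noteq> x' i" using PiE_ext[of x "{..n}" "\<lambda>_. T" x'] by auto
        then show "{X \<in> space K. \<forall>i\<le>n. X i = x i} \<inter> {X \<in> space K. \<forall>i\<le>n. X i = x' i} = {}" by auto
      qed
    qed (rule cyl_sets[OF K] cD)+
    also have "\<dots> = (\<integral>\<^sup>+x. ennreal (if x 0 = y then \<Prod>k<n. p (x k) (x (Suc k)) else 0) \<partial>count_space ?D)"
      by (intro nn_integral_cong M_cyl[OF K]) auto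
    finally show ?thesis .
  qed
  from this[OF M] this[OF M']
  show "emeasure M (prod_emb UNIV (\<lambda>_. count_space T) J (Pi\<^sub>E J A)) = emeasure M' (prod_emb UNIV (\<lambda>_. count_space T) J (Pi\<^sub>E J A))"
    by simp
qed

lemma is_chain_chain_law:
  assumes "y \<in> T"
  shows "is_chain y (chain_law T p y)"
proof -
  have eq: "chain_law T p y = (THE M. is_chain y M)"
    unfolding chain_law_def is_chain_def ..
  obtain M where "is_chain y M" using is_chain_exists[OF assms] by blast
  then show ?thesis unfolding eq by (rule theI) (rule is_chain_unique[OF _ \<open>is_chain y M\<close>])
qed

text \<open>A vertex carrying a superharmonic function that is strictly superharmonic there is
  visited finitely often: the expected number of visits is bounded by the function.\<close>

lemma potential_bounds_visits:
  assumes x: "x \<in> T" and c: "0 < c" and g0: "\<And>i. i \<in> T \<Longrightarrow> 0 \<le> g i"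
    and g: "\<And>i. i \<in> T \<Longrightarrow> g i = (\<Sum>j\<in>N i. p i j * g j) + (if i = x then c else 0)" and i: "i \<in> T"
  shows "(\<Sum>k<K. pw k (indicator {x}) i) \<le> g i / c"
  using i
proof (induction K arbitrary: i)
  case 0
  then show ?case using g0 c by simp
next
  case (Suc K)
  have "(\<Sum>k<Suc K. pw k (indicator {x}) i) = indicator {x} i + (\<Sum>k<K. \<Sum>j\<in>N i. p i j * pw k (indicator {x}) j)"
    by (subst sum.lessThan_Suc_shift) simp
  also have "(\<Sum>k<K. \<Sum>j\<in>N i. p i j * pw k (indicator {x}) j) = (\<Sum>j\<in>N i. p i j * (\<Sum>k<K. pw k (indicator {x}) j))"
    by (simp add: sum_distrib_left) (rule sum.swap)
  also have "\<dots> \<le> (\<Sum>j\<in>N i. p i j * (g j / c))"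
    using Suc N_T p_nonneg by (intro sum_mono mult_left_mono) auto
  also have "\<dots> = (\<Sum>j\<in>N i. p i j * g j) / c" by (simp add: sum_divide_distrib)
  finally show ?case using g[OF Suc.prems] c by (simp add: field_simps indicator_def split: if_splits)
qed

text \<open>The first Borel-Cantelli lemma.\<close>

lemma finite_visits:
  assumes M: "is_chain y M" and y: "y \<in> T" and K: "\<And>K. (\<Sum>k<K. pw k (indicator {x}) y) \<le> (C::real)"
  shows "AE X in M. finite {k. X k = x}"
proof -
  interpret prob_space M by (rule M_prob[OF M])
  let ?A = "\<lambda>k. {X \<in> space M. X k \<in> {x}}"
  have "summable (\<lambda>k. measure M (?A k))"
    unfolding chain_at[OF M y] using y by (intro bounded_imp_summable[of _ C])
      (auto intro!: pw_nonneg order_trans[OF _ K] simp: lessThan_Suc_atMost[symmetric] simp del: sum.lessThan_Suc)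
  from borel_cantelli_AE1[OF ev_sets[OF M] _ this]
  have "AE X in M. \<forall>\<^sub>F k in sequentially. X \<in> space M - ?A k" by (simp add: emeasure_eq_measure)
  then show ?thesis
  proof eventually_elim
    case (elim X)
    then obtain n where "\<And>k. n \<le> k \<Longrightarrow> X k \<noteq> x" by (auto simp: eventually_sequentially)
    then have "{k. X k = x} \<subseteq> {..<n}" using not_le_imp_less by blast
    then show ?case by (rule finite_subset) simp
  qed
qed

end

section \<open>Exit laws\<close>

context wtree
begin

abbreviation "EB \<equiv> end_borel T E r"
abbreviation "Om \<equiv> ends_through E r"

lemma Om_ends: "Om u \<subseteq> ends E r"
  by (auto simp: ends_through_def)

lemma Om_root: "Om r = ends E r"
  using ends_through_iff[OF root] by (auto simp: ends_def)

lemma end_topspace: "topspace (end_topology T E r) = ends E r"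
proof -
  have "topspace (end_topology T E r) = (\<Union>u\<in>T. Om u)" by (simp add: end_topology_def)
  also have "\<dots> = ends E r" using Om_ends Om_root root by blast
  finally show ?thesis .
qed

lemma space_EB: "space EB = ends E r"
  unfolding end_borel_def by (rule space_measure_of) (use openin_subset end_topspace in blast)

lemma sets_EB: "sets EB = sigma_sets (ends E r) {A. openin (end_topology T E r) A}"
  unfolding end_borel_def by (rule sets_measure_of) (use openin_subset end_topspace in blast)

lemma Om_EB: "u \<in> T \<Longrightarrow> Om u \<in> sets EB"
  unfolding sets_EB by (rule sigma_sets.Basic) (auto simp: end_topology_def intro: topology_generated_by_Basis)

text \<open>The sets of ends through a vertex are a base of the end topology: two of them are nested
  or disjoint.\<close>

lemma open_base:
  assumes "openin (end_topology T E r) A" "\<omega> \<in> A"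
  shows "\<exists>n. Om (\<omega> n) \<subseteq> A"
proof -
  have "generate_topology_on (Om ` T) A" using assms(1) by (simp add: end_topology_def openin_topology_generated_by_iff)
  then show ?thesis using assms(2)
  proof (induction arbitrary: \<omega>)
    case (Int a b)
    then obtain m n where mn: "Om (\<omega> m) \<subseteq> a" "Om (\<omega> n) \<subseteq> b" by blast
    have w: "\<omega> \<in> ends E r"
    proof -
      have "openin (end_topology T E r) a"
        using Int.hyps(1) by (simp add: end_topology_def openin_topology_generated_by_iff)
      then show ?thesis using Int.prems openin_subset end_topspace by blast
    qed
    have mono: "Om (\<omega> (max m n)) \<subseteq> Om (\<omega> k)" if "k \<le> max m n" for k
    proof
      fix \<tau> assume t: "\<tau> \<in> Om (\<omega> (max m n))"
      have te: "\<tau> \<in> ends E r" and tm: "\<tau> (max m n) = \<omega> (max m n)"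
        using t ends_through_iff[OF endsD(1)[OF w]] endsD(2)[OF w] by auto
      have "\<tau> (max m n) \<in> sub (\<tau> k)" "\<tau> (max m n) \<in> sub (\<omega> k)"
        using ends_sub[OF te that] ends_sub[OF w that] tm by auto
      then have "\<tau> k = \<omega> k" using sub_disjoint[of "\<tau> k" "\<omega> k"] endsD(2)[OF te] endsD(2)[OF w] by auto
      then show "\<tau> \<in> Om (\<omega> k)" using te ends_through_iff[OF endsD(1)[OF w]] endsD(2)[OF w] by simp
    qed
    have "Om (\<omega> (max m n)) \<subseteq> a \<inter> b" using mn mono[of m] mono[of n] by auto
    then show ?case by blast
  next
    case (UN K)
    then obtain k where "k \<in> K" "\<omega> \<in> k" by blast
    then show ?case using UN.IH[of k \<omega>] by blast
  next
    case (Basis s)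
    then obtain u where u: "u \<in> T" "s = Om u" by blast
    then have "\<omega> (lev u) = u" using Basis ends_through_iff by auto
    then show ?case using u by (intro exI[of _ "lev u"]) simp
  qed simp
qed

text \<open>As the tree has countably many vertices, every open set of ends is a countable union of the
  sets \<open>Om u\<close>, so these generate the Borel sets.\<close>

lemma measurable_EB:
  assumes f: "f \<in> space M \<rightarrow> ends E r" and Om: "\<And>u. u \<in> T \<Longrightarrow> f -` Om u \<inter> space M \<in> sets M"
  shows "f \<in> measurable M EB"
  unfolding end_borel_def
proof (rule measurable_measure_of)
  show "{A. openin (end_topology T E r) A} \<subseteq> Pow (ends E r)" using openin_subset end_topspace by blast
  fix A assume "A \<in> {A. openin (end_topology T E r) A}"
  then have A: "openin (end_topology T E r) A" by simp
  have Ae: "A \<subseteq> ends E r" using openin_subset[OF A] end_topspace by blast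
  have "A = (\<Union>u\<in>{u \<in> T. Om u \<subseteq> A}. Om u)"
  proof (intro subset_antisym subsetI)
    fix \<omega> assume w: "\<omega> \<in> A"
    then obtain n where n: "Om (\<omega> n) \<subseteq> A" using open_base[OF A] by blast
    have we: "\<omega> \<in> ends E r" using w Ae by blast
    have "\<omega> \<in> Om (\<omega> n)" using we ends_through_iff[OF endsD(1)[OF we]] endsD(2)[OF we] by simp
    then show "\<omega> \<in> (\<Union>u\<in>{u \<in> T. Om u \<subseteq> A}. Om u)" using n endsD(1)[OF we] by blast
  qed blast
  then have "f -` A \<inter> space M = (\<Union>u\<in>{u \<in> T. Om u \<subseteq> A}. f -` Om u \<inter> space M)" by blast
  also have "\<dots> \<in> sets M"
    using countable_T Om by (intro sets.countable_UN') (auto intro: countable_subset)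
  finally show "f -` A \<inter> space M \<in> sets M" .
qed (rule f)

lemma Om_partition: "(\<Union>u\<in>level T E r m. Om u) = ends E r"
  using Om_ends endsD ends_through_iff by (fastforce simp: level_iff)

lemma sets_ev: "(\<And>k. {X \<in> space M. X k \<in> B} \<in> sets M) \<Longrightarrow> {X \<in> space M. \<forall>\<^sub>F k in sequentially. X k \<in> B} \<in> sets M"
  unfolding eventually_sequentially
proof (intro sets.sets_Collect_countable_Ex sets.sets_Collect_countable_All)
  fix N k assume "\<And>k. {X \<in> space M. X k \<in> B} \<in> sets M"
  then show "{X \<in> space M. N \<le> k \<longrightarrow> X k \<in> B} \<in> sets M" by (cases "N \<le> k") auto
qed

context
  fixes \<beta> :: "'v \<Rightarrow> real"
  assumes good: "good \<beta>"
begin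

abbreviation "p \<equiv> walk_step E w (ps \<beta>)"

lemma cv: "conv \<beta>" and ps_pos: "i \<in> T \<Longrightarrow> 0 < ps \<beta> i"
  using good by (auto simp: good_def)

lemma nbr_ne: "i \<in> T \<Longrightarrow> nbr i \<noteq> {}"
  using nbr_card[of i] d3 by (metis card.empty not_numeral_le_zero)

lemma sum_ps: "i \<in> T \<Longrightarrow> w * (\<Sum>j\<in>nbr i. ps \<beta> j) = 2 * \<beta> i * ps \<beta> i"
  using ps_Hop[OF cv, of i] by (simp add: Hop_eq)

lemma sum_ps_pos: "i \<in> T \<Longrightarrow> 0 < (\<Sum>j\<in>nbr i. ps \<beta> j)"
  using nbr_ne nbr_finite edgeD(2) ps_pos by (intro sum_pos) auto

lemma beta_pos: "i \<in> T \<Longrightarrow> 0 < \<beta> i"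
  using sum_ps[of i] sum_ps_pos[of i] ps_pos[of i] w_pos by (metis mult_pos_pos zero_less_mult_pos2 mult.commute mult.assoc zero_less_numeral zero_less_mult_pos)

lemma p_eq: "i \<in> T \<Longrightarrow> p i j = (if j \<in> nbr i then w * ps \<beta> j / (2 * \<beta> i * ps \<beta> i) else 0)"
proof -
  assume i: "i \<in> T"
  have "(\<Sum>k | {i, k} \<in> E. walk_conductance E w (ps \<beta>) i k) = ps \<beta> i * (w * (\<Sum>k\<in>nbr i. ps \<beta> k))"
    by (simp add: walk_conductance_def edge_weight_def sum_distrib_left mult_ac)
  then show ?thesis using ps_pos[OF i] unfolding walk_step_def sum_ps[OF i]
    by (simp add: walk_conductance_def edge_weight_def)
qed

text \<open>The ground state transform: \<open>g\<close> is harmonic for the walk where \<open>\<psi> g\<close> is a solution.\<close>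

lemma p_harm: "i \<in> T \<Longrightarrow> Hop E w \<beta> (\<lambda>j. ps \<beta> j * g j) i = 2 * \<beta> i * ps \<beta> i * (g i - (\<Sum>j\<in>nbr i. p i j * g j))"
proof -
  assume i: "i \<in> T"
  have b: "2 * \<beta> i * ps \<beta> i \<noteq> 0" using beta_pos[OF i] ps_pos[OF i] by simp
  have "2 * \<beta> i * ps \<beta> i * (\<Sum>j\<in>nbr i. p i j * g j) = (\<Sum>j\<in>nbr i. w * (ps \<beta> j * g j))"
    unfolding sum_distrib_left
  proof (intro sum.cong refl)
    fix j assume "j \<in> nbr i"
    then have "p i j = w * ps \<beta> j / (2 * \<beta> i * ps \<beta> i)" using p_eq[OF i] by simp
    then show "2 * \<beta> i * ps \<beta> i * (p i j * g j) = w * (ps \<beta> j * g j)" using b by (simp add: field_simps)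
  qed
  then show ?thesis unfolding Hop_eq by (simp add: sum_distrib_left[symmetric] algebra_simps)
qed

interpretation C: mchain T "\<lambda>i. nbr i" p
proof
  fix i j assume i: "i \<in> T"
  show "finite (nbr i)" by (rule nbr_finite[OF i])
  show "nbr i \<subseteq> T" using edgeD(2) by blast
  show "0 \<le> p i j" using i p_eq[OF i, of j] w_pos beta_pos[OF i] ps_pos[OF i] ps_pos[of j] edgeD(2)
    by (auto intro!: divide_nonneg_pos mult_nonneg_nonneg less_imp_le)
  show "p i j = 0" if "j \<notin> nbr i" using p_eq[OF i, of j] that by simp
  have "Hop E w \<beta> (\<lambda>j. ps \<beta> j * 1) i = 0" using ps_Hop[OF cv i] by simp
  then show "(\<Sum>j\<in>nbr i. p i j) = 1" using p_harm[OF i, of "\<lambda>_. 1"] beta_pos[OF i] ps_pos[OF i] by simp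
qed (rule countable_T)

abbreviation "PW \<equiv> mchain.pw (\<lambda>i. nbr i) p"

lemma PW_0: "PW 0 g i = g i" and PW_Suc: "PW (Suc k) g i = (\<Sum>j\<in>nbr i. p i j * PW k g j)"
  by simp_all

text \<open>By the ground state transform, \<open>G(\<sqdot>, x) / \<psi>\<close> is superharmonic for the walk, with
  defect \<open>1 / (2 \<beta>\<^sub>x \<psi>(x))\<close> at \<open>x\<close> and none elsewhere.\<close>

lemma visits:
  assumes x: "x \<in> T" and y: "y \<in> T"
  shows "(\<Sum>k<K. PW k (indicator {x}) y) \<le> (Gh \<beta> y x / ps \<beta> y) * (2 * \<beta> x * ps \<beta> x)"
proof -
  let ?c = "1 / (2 * \<beta> x * ps \<beta> x)" and ?g = "\<lambda>i. Gh \<beta> i x / ps \<beta> i"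
  have aux: "b * a = c \<Longrightarrow> b \<noteq> 0 \<Longrightarrow> a = c / b" for a b c :: real by (simp add: field_simps)
  have "(\<Sum>k<K. PW k (indicator {x}) y) \<le> ?g y / ?c"
  proof (rule C.potential_bounds_visits[OF x _ _ _ y])
    show "0 < ?c" using beta_pos[OF x] ps_pos[OF x] by simp
    fix i assume i: "i \<in> T"
    show "0 \<le> ?g i" using Gh_nonneg[OF cv i x] ps_pos[OF i] by simp
    have "Hop E w \<beta> (\<lambda>j. ps \<beta> j * ?g j) i = Hop E w \<beta> (\<lambda>j. Gh \<beta> j x) i"
    proof -
      have e: "ps \<beta> j * ?g j = Gh \<beta> j x" if "j \<in> T" for j using ps_pos[OF that] by simp
      have "(\<Sum>j\<in>nbr i. ps \<beta> j * ?g j) = (\<Sum>j\<in>nbr i. Gh \<beta> j x)"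
        using edgeD(2) by (intro sum.cong refl e) blast
      then show ?thesis unfolding Hop_eq by (simp only: e[OF i])
    qed
    then have "2 * \<beta> i * ps \<beta> i * (?g i - (\<Sum>j\<in>nbr i. p i j * ?g j)) = (if i = x then 1 else 0)"
      unfolding p_harm[OF i] Gh_Hop[OF cv i x] by simp
    moreover have "2 * \<beta> i * ps \<beta> i \<noteq> 0" using beta_pos[OF i] ps_pos[OF i] by simp
    ultimately have "?g i - (\<Sum>j\<in>nbr i. p i j * ?g j) = (if i = x then 1 else 0) / (2 * \<beta> i * ps \<beta> i)"
      by (rule aux)
    then show "?g i = (\<Sum>j\<in>nbr i. p i j * ?g j) + (if i = x then ?c else 0)"
      by (cases "i = x") (simp_all add: diff_eq_eq)
  qed
  then show ?thesis by simp
qed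

abbreviation "Lw \<equiv> chain_law T p"

lemma Lw: "y \<in> T \<Longrightarrow> C.is_chain y (Lw y)"
  by (rule C.is_chain_chain_law)

lemma Lw_tends:
  assumes y: "y \<in> T"
  shows "AE X in Lw y. \<exists>\<omega>. tends_to_end E r X \<omega>"
proof -
  have "AE X in Lw y. finite {k. X k = v}" if "v \<in> T" for v
    by (rule C.finite_visits[OF Lw[OF y] y visits[OF that y]])
  then have "AE X in Lw y. \<forall>v\<in>T. finite {k. X k = v}" by (simp add: AE_ball_countable[OF countable_T])
  then show ?thesis using C.chain_edges[OF Lw[OF y]]
  proof eventually_elim
    case (elim X)
    then have "\<exists>u\<in>level T E r n. \<forall>\<^sub>F k in sequentially. X k \<in> sub u" for n
      by (intro transient_branches) auto
    then show ?case unfolding tends_iff by blast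
  qed
qed

text \<open>The map to the limiting end is unspecified on the null set of walks without a limit, so
  it need not take values in the space of ends there. It is compared with a measurable map \<open>g\<close>
  that differs from it on this null set. The walk is finally in one subtree of each level;
  dominated convergence then gives the mass of the ends through \<open>u\<close> as the limit of the
  probabilities to be below \<open>u\<close> at time \<open>k\<close>.\<close>

lemma exit_law_facts:
  assumes y: "y \<in> T"
  shows "prob_space (exit_law T E r w (ps \<beta>) y)" "sets (exit_law T E r w (ps \<beta>) y) = sets EB"
    "u \<in> T \<Longrightarrow> (\<lambda>k. PW k (indicator (sub u)) y) \<longlonglongrightarrow> measure (exit_law T E r w (ps \<beta>) y) (Om u)"
proof -
  let ?M = "Lw y"
  note L = Lw[OF y]
  interpret prob_space ?M by (rule C.M_prob[OF L])
  let ?t = "\<lambda>X. \<exists>\<omega>. tends_to_end E r X \<omega>"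
  define Cv where "Cv = {X \<in> space ?M. ?t X}"
  have evs: "{X \<in> space ?M. \<forall>\<^sub>F k in sequentially. X k \<in> sub u} \<in> sets ?M" for u
    by (rule sets_ev[OF C.ev_sets[OF L]])
  have Cvs: "X \<in> Cv \<Longrightarrow> X \<in> space ?M" for X by (simp add: Cv_def)
  have Cv: "Cv \<in> sets ?M" unfolding Cv_def tends_iff
    by (intro sets.sets_Collect_countable_All sets.sets_Collect_finite_Ex evs level_finite)
  have AECv: "AE X in ?M. X \<in> Cv" using Lw_tends[OF y] AE_space[of ?M] by eventually_elim (simp add: Cv_def)
  have "Cv \<noteq> {}"
  proof
    assume "Cv = {}"
    then have "AE X in ?M. False" using AECv by simp
    then show False by simp
  qed
  then obtain X0 where X0: "X0 \<in> Cv" by blast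
  define f where "f X = (THE \<omega>. tends_to_end E r X \<omega>)" for X
  define g where "g X = (if X \<in> Cv then f X else f X0)" for X
  have fe: "f X \<in> ends E r" if X: "X \<in> Cv" for X
  proof -
    obtain \<omega> where "tends_to_end E r X \<omega>" using X by (auto simp: Cv_def)
    moreover from this have "f X = \<omega>" unfolding f_def using tends_unique by blast
    ultimately show ?thesis by (simp add: tends_to_end_def)
  qed
  have fOm: "f X \<in> Om u \<longleftrightarrow> (\<forall>\<^sub>F k in sequentially. X k \<in> sub u)" if "X \<in> Cv" "u \<in> T" for X u
    unfolding f_def using that by (intro the_end_through_iff) (auto simp: Cv_def)
  have gm: "g \<in> measurable ?M EB"
  proof (rule measurable_EB)
    show "g \<in> space ?M \<rightarrow> ends E r" using fe X0 by (auto simp: g_def)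
    fix u assume u: "u \<in> T"
    have "g -` Om u \<inter> space ?M = (Cv \<inter> {X \<in> space ?M. \<forall>\<^sub>F k in sequentially. X k \<in> sub u})
      \<union> (if f X0 \<in> Om u then space ?M - Cv else {})"
    proof (intro set_eqI)
      fix X
      show "X \<in> g -` Om u \<inter> space ?M \<longleftrightarrow> X \<in> (Cv \<inter> {X \<in> space ?M. \<forall>\<^sub>F k in sequentially. X k \<in> sub u})
        \<union> (if f X0 \<in> Om u then space ?M - Cv else {})"
        using fOm[OF _ u, of X] Cvs by (cases "X \<in> Cv") (auto simp: g_def)
    qed
    also have "\<dots> \<in> sets ?M" using Cv evs[of u] by auto
    finally show "g -` Om u \<inter> space ?M \<in> sets ?M" .
  qed
  have same: "emeasure ?M (f -` A \<inter> space ?M) = emeasure ?M (g -` A \<inter> space ?M)" if A: "A \<in> sets EB" for A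
  proof (rule emeasure_eq_AE)
    have ga: "g -` A \<inter> space ?M \<in> sets ?M" by (rule measurable_sets[OF gm A])
    then show "g -` A \<inter> space ?M \<in> sets ?M" .
    \<comment> \<open>For a walk without a limit the definite description is a fixed value, which may or may not
      lie in \<open>A\<close>.\<close>
    let ?c = "THE \<omega> :: nat \<Rightarrow> 'v. False"
    have f0: "f X = ?c" if "X \<in> space ?M - Cv" for X
    proof -
      have "tends_to_end E r X = (\<lambda>_. False)" using that by (auto simp: Cv_def fun_eq_iff)
      then show ?thesis by (simp add: f_def)
    qed
    have "f -` A \<inter> space ?M = (g -` A \<inter> space ?M \<inter> Cv) \<union> (if ?c \<in> A then space ?M - Cv else {})"
    proof (intro set_eqI)
      fix X
      show "X \<in> f -` A \<inter> space ?M \<longleftrightarrow> X \<in> (g -` A \<inter> space ?M \<inter> Cv) \<union> (if ?c \<in> A then space ?M - Cv else {})"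
        using f0[of X] by (cases "X \<in> Cv") (auto simp: g_def)
    qed
    also have "\<dots> \<in> sets ?M" using ga Cv by auto
    finally show "f -` A \<inter> space ?M \<in> sets ?M" .
    show "AE X in ?M. X \<in> f -` A \<inter> space ?M \<longleftrightarrow> X \<in> g -` A \<inter> space ?M"
      using AECv by eventually_elim (simp add: g_def)
  qed
  have el: "exit_law T E r w (ps \<beta>) y = distr ?M EB g"
  proof -
    have "exit_law T E r w (ps \<beta>) y = distr ?M EB f" by (simp add: exit_law_def f_def[abs_def])
    also have "\<dots> = distr ?M EB g" unfolding distr_def
      by (rule measure_of_eq) (use sets.space_closed same in \<open>auto simp: sets.sigma_sets_eq\<close>)
    finally show ?thesis .
  qed
  show "prob_space (exit_law T E r w (ps \<beta>) y)" unfolding el by (rule prob_space_distr[OF gm])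
  show "sets (exit_law T E r w (ps \<beta>) y) = sets EB" unfolding el by simp
  assume u: "u \<in> T"
  let ?I = "\<lambda>k X. indicator {X \<in> space ?M. X k \<in> sub u} X :: real"
  let ?E = "{X \<in> space ?M. \<forall>\<^sub>F k in sequentially. X k \<in> sub u}"
  have "(\<lambda>k. \<integral>X. ?I k X \<partial>?M) \<longlonglongrightarrow> (\<integral>X. indicator ?E X \<partial>?M)"
  proof (rule integral_dominated_convergence[where w="\<lambda>_. 1"])
    show "AE X in ?M. (\<lambda>k. ?I k X) \<longlonglongrightarrow> indicator ?E X"
      using AECv
    proof eventually_elim
      case (elim X)
      then have X: "X \<in> space ?M" by (simp add: Cv_def)
      obtain v where v: "v \<in> level T E r (lev u)" "\<forall>\<^sub>F k in sequentially. X k \<in> sub v"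
        using elim unfolding Cv_def tends_iff by auto
      show ?case
      proof (cases "v = u")
        case True
        then have "\<forall>\<^sub>F k in sequentially. ?I k X = indicator ?E X"
          using v(2) X by (auto elim: eventually_mono)
        then show ?thesis by (rule tendsto_eventually)
      next
        case False
        then have disj: "sub v \<inter> sub u = {}" using v(1) by (intro sub_disjoint) (auto simp: level_iff)
        have ev: "\<forall>\<^sub>F k in sequentially. X k \<notin> sub u" using v(2) by eventually_elim (use disj in auto)
        have "\<not> (\<forall>\<^sub>F k in sequentially. X k \<in> sub u)"
        proof
          assume "\<forall>\<^sub>F k in sequentially. X k \<in> sub u"
          then have "\<forall>\<^sub>F k in sequentially. False" using ev by eventually_elim simp
          then show False by simp
        qed
        then have "\<forall>\<^sub>F k in sequentially. ?I k X = indicator ?E X"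
          using ev by (auto elim: eventually_mono)
        then show ?thesis by (rule tendsto_eventually)
      qed
    qed
    show "?I k \<in> borel_measurable ?M" for k using C.ev_sets[OF L] by (intro borel_measurable_indicator)
    show "indicator ?E \<in> borel_measurable ?M" using evs by (intro borel_measurable_indicator)
  qed (auto simp: indicator_def)
  moreover have "(\<integral>X. ?I k X \<partial>?M) = PW k (indicator (sub u)) y" for k
    using C.chain_at[OF L y, of k "sub u"] C.ev_sets[OF L, of k "sub u"] by simp
  moreover have "(\<integral>X. indicator ?E X \<partial>?M) = measure (exit_law T E r w (ps \<beta>) y) (Om u)"
  proof -
    have "measure (exit_law T E r w (ps \<beta>) y) (Om u) = prob (g -` Om u \<inter> space ?M)"
      unfolding el by (rule measure_distr[OF gm Om_EB[OF u]])
    also have "\<dots> = prob ?E"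
    proof (rule finite_measure_eq_AE)
      show "AE X in ?M. X \<in> g -` Om u \<inter> space ?M \<longleftrightarrow> X \<in> ?E"
        using AECv by eventually_elim (use fOm[OF _ u] in \<open>auto simp: g_def Cv_def\<close>)
    qed (use measurable_sets[OF gm Om_EB[OF u]] evs in auto)
    finally show ?thesis using evs by simp
  qed
  ultimately show "(\<lambda>k. PW k (indicator (sub u)) y) \<longlonglongrightarrow> measure (exit_law T E r w (ps \<beta>) y) (Om u)" by simp
qed

definition exit_mass :: "'v \<Rightarrow> 'v \<Rightarrow> real" where "exit_mass u y = measure (chi T E r w \<beta> y) (Om u)"

lemma chi_sets: "y \<in> T \<Longrightarrow> sets (chi T E r w \<beta> y) = sets EB"
  using exit_law_facts(2) by (simp add: chi_def)

lemma chi_space: "y \<in> T \<Longrightarrow> space (chi T E r w \<beta> y) = ends E r"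
  using sets_eq_imp_space_eq[OF chi_sets] space_EB by simp

lemma chi_measure: "y \<in> T \<Longrightarrow> measure (chi T E r w \<beta> y) A = ps \<beta> y * measure (exit_law T E r w (ps \<beta>) y) A"
  using ps_pos[of y] by (simp add: chi_def measure_def enn2real_mult)

lemma chi_finite: "y \<in> T \<Longrightarrow> finite_measure (chi T E r w \<beta> y)"
proof
  assume y: "y \<in> T"
  interpret X: prob_space "exit_law T E r w (ps \<beta>) y" by (rule exit_law_facts(1)[OF y])
  show "emeasure (chi T E r w \<beta> y) (space (chi T E r w \<beta> y)) \<noteq> \<infinity>"
    by (simp add: chi_def X.emeasure_eq_measure ennreal_mult'[symmetric] ennreal_mult_eq_top_iff)
qed

lemma exit_mass_lim: "u \<in> T \<Longrightarrow> y \<in> T \<Longrightarrow> (\<lambda>k. ps \<beta> y * PW k (indicator (sub u)) y) \<longlonglongrightarrow> exit_mass u y"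
  unfolding exit_mass_def chi_measure by (intro tendsto_intros exit_law_facts(3))

lemma exit_mass_nonneg: "0 \<le> exit_mass u y" by (simp add: exit_mass_def)

text \<open>The ground state transform, applied to the \<open>k\<close>-step probabilities of being below \<open>u\<close>, whose
  one-step average is the \<open>(k + 1)\<close>-step probability.\<close>

lemma exit_mass_Hop:
  assumes u: "u \<in> T" and i: "i \<in> T"
  shows "Hop E w \<beta> (exit_mass u) i = 0"
proof (rule LIMSEQ_unique)
  show "(\<lambda>k. Hop E w \<beta> (\<lambda>j. ps \<beta> j * PW k (indicator (sub u)) j) i) \<longlonglongrightarrow> Hop E w \<beta> (exit_mass u) i"
    by (rule Hop_lim[OF cv i]) (rule exit_mass_lim[OF u])
  have "Hop E w \<beta> (\<lambda>j. ps \<beta> j * PW k (indicator (sub u)) j) i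
     = 2 * \<beta> i * (ps \<beta> i * PW k (indicator (sub u)) i - ps \<beta> i * PW (Suc k) (indicator (sub u)) i)" for k
    unfolding p_harm[OF i] by (simp add: algebra_simps)
  moreover have "(\<lambda>k. 2 * \<beta> i * (ps \<beta> i * PW k (indicator (sub u)) i - ps \<beta> i * PW (Suc k) (indicator (sub u)) i))
     \<longlonglongrightarrow> 2 * \<beta> i * (exit_mass u i - exit_mass u i)"
    by (intro tendsto_intros exit_mass_lim[OF u i] LIMSEQ_Suc[OF exit_mass_lim[OF u i]])
  ultimately show "(\<lambda>k. Hop E w \<beta> (\<lambda>j. ps \<beta> j * PW k (indicator (sub u)) j) i) \<longlonglongrightarrow> 0" by simp
qed

lemma exit_mass_total:
  assumes y: "y \<in> T"
  shows "(\<Sum>u\<in>level T E r m. exit_mass u y) = ps \<beta> y"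
proof -
  interpret X: prob_space "exit_law T E r w (ps \<beta>) y" by (rule exit_law_facts(1)[OF y])
  interpret F: finite_measure "chi T E r w \<beta> y" by (rule chi_finite[OF y])
  have "measure (chi T E r w \<beta> y) (\<Union>u\<in>level T E r m. Om u) = (\<Sum>u\<in>level T E r m. measure (chi T E r w \<beta> y) (Om u))"
  proof (rule F.finite_measure_finite_Union[OF level_finite])
    show "Om ` level T E r m \<subseteq> sets (chi T E r w \<beta> y)" using Om_EB chi_sets[OF y] by (auto simp: level_iff)
    show "disjoint_family_on Om (level T E r m)"
      unfolding disjoint_family_on_def using ends_through_disjoint by (auto simp: level_iff)
  qed
  moreover have "space (exit_law T E r w (ps \<beta>) y) = ends E r"
    using sets_eq_imp_space_eq[OF exit_law_facts(2)[OF y]] space_EB by simp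
  ultimately show ?thesis
    unfolding Om_partition chi_measure[OF y] exit_mass_def using X.prob_space chi_measure[OF y] by simp
qed

text \<open>From inside the subtree of \<open>y\<close> the walk reaches a disjoint subtree only through the
  parent of \<open>y\<close>. This bounds the exit probability by the Green's function, hence it is a
  potential in that subtree.\<close>

lemma exit_mass_subtree:
  assumes y: "y \<in> T" "y \<noteq> r" and u: "u \<in> T" and disj: "sub u \<inter> sub y = {}"
  shows "exit_mass u y = w * green y \<beta> * exit_mass u (par y)"
proof (rule potential_subtree[OF cv y])
  let ?x = "par y"
  have x: "?x \<in> T" using par_T y by blast
  fix z assume z: "z \<in> sub y"
  then have zT: "z \<in> T" using sub_T by blast
  show "Hop E w \<beta> (exit_mass u) z = 0" by (rule exit_mass_Hop[OF u zT])
  have PW0: "0 \<le> PW k (indicator B) v" if "v \<in> T" for k B v using that by (intro C.pw_nonneg) auto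
  have PW1: "PW k (indicator B) v \<le> 1" if "v \<in> T" for k B v
    using C.pw_mono[OF that, of "indicator B" "\<lambda>_. 1" k] C.pw_const[OF that, of k 1] by (simp add: indicator_def)
  \<comment> \<open>To be below \<open>u\<close> at time \<open>k\<close> the walk must have visited the parent of \<open>y\<close>.\<close>
  have hit: "PW k (indicator (sub u)) v \<le> (\<Sum>j\<le>k. PW j (indicator {?x}) v)" if "v \<in> sub y" for k v
    using that
  proof (induction k arbitrary: v)
    case 0
    then have "v \<notin> sub u" using disj by blast
    then show ?case using PW0[of v 0] sub_T[OF 0] by simp
  next
    case (Suc k)
    have vT: "v \<in> T" using sub_T[OF Suc.prems] by simp
    have "PW (Suc k) (indicator (sub u)) v = (\<Sum>j\<in>nbr v. p v j * PW k (indicator (sub u)) j)" by simp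
    also have "\<dots> \<le> (\<Sum>j\<in>nbr v. p v j * (\<Sum>l\<le>k. PW l (indicator {?x}) j))"
    proof (intro sum_mono mult_left_mono)
      fix j assume j: "j \<in> nbr v"
      then have jT: "j \<in> T" using edgeD(2) by blast
      show "PW k (indicator (sub u)) j \<le> (\<Sum>l\<le>k. PW l (indicator {?x}) j)"
      proof (cases "j \<in> sub y")
        case True then show ?thesis by (rule Suc.IH)
      next
        case False
        then have "j = ?x" using sub_boundary[of v j y] j Suc.prems by simp
        have "PW k (indicator (sub u)) j \<le> 1" by (rule PW1[OF jT])
        also have "\<dots> = PW 0 (indicator {?x}) j" using \<open>j = ?x\<close> by simp
        also have "\<dots> \<le> (\<Sum>l\<le>k. PW l (indicator {?x}) j)"
          by (rule member_le_sum) (use PW0[OF jT] in auto)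
        finally show ?thesis .
      qed
      show "0 \<le> p v j" by (rule C.p_nonneg[OF vT])
    qed
    also have "\<dots> = (\<Sum>l\<le>k. PW (Suc l) (indicator {?x}) v)"
      by (simp add: sum_distrib_left) (rule sum.swap)
    also have "\<dots> \<le> (\<Sum>l\<le>Suc k. PW l (indicator {?x}) v)"
      unfolding sum.atMost_Suc_shift using PW0[OF vT, of 0 "{?x}"] by linarith
    finally show ?case .
  qed
  have "exit_mass u z \<le> (2 * \<beta> ?x * ps \<beta> ?x) * Gh \<beta> z ?x"
  proof (rule LIMSEQ_le_const2[OF exit_mass_lim[OF u zT]], intro exI allI impI)
    fix k
    have "PW k (indicator (sub u)) z \<le> (Gh \<beta> z ?x / ps \<beta> z) * (2 * \<beta> ?x * ps \<beta> ?x)"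
      using order_trans[OF hit[OF z, of k] visits[OF x zT, of "Suc k", unfolded lessThan_Suc_atMost]] .
    then have "ps \<beta> z * PW k (indicator (sub u)) z \<le> ps \<beta> z * ((Gh \<beta> z ?x / ps \<beta> z) * (2 * \<beta> ?x * ps \<beta> ?x))"
      using ps_pos[OF zT] by (intro mult_left_mono) auto
    then show "ps \<beta> z * PW k (indicator (sub u)) z \<le> (2 * \<beta> ?x * ps \<beta> ?x) * Gh \<beta> z ?x"
      using ps_pos[OF zT] by (simp add: mult_ac)
  qed
  then show "\<bar>exit_mass u z\<bar> \<le> (2 * \<beta> ?x * ps \<beta> ?x) * Gh \<beta> z ?x" using exit_mass_nonneg[of u z] by simp
qed

text \<open>The boundary Green's function depends on the two ends only through the vertices of level
  \<open>m\<close> on them, so the integral is a finite sum over pairs of such vertices.\<close>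

lemma Gm_eq:
  assumes i: "i \<in> T" and j: "j \<in> T"
  shows "Gm T E r w m \<beta> \<rho> i j = Gh \<beta> i j
    + (\<Sum>u\<in>level T E r m. \<Sum>v\<in>level T E r m. exit_mass u i * exit_mass v j * Gcheck T E r w m \<beta> \<rho> u v)"
proof -
  let ?L = "level T E r m" and ?G = "Gcheck T E r w m \<beta> \<rho>"
  let ?ci = "chi T E r w \<beta> i" and ?cj = "chi T E r w \<beta> j"
  interpret I: finite_measure ?ci by (rule chi_finite[OF i])
  interpret J: finite_measure ?cj by (rule chi_finite[OF j])
  interpret P: finite_measure "?ci \<Otimes>\<^sub>M ?cj" by (rule finite_measure_pair_measure) unfold_locales
  have OmL: "u \<in> ?L \<Longrightarrow> Om u \<in> sets ?ci \<and> Om u \<in> sets ?cj" for u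
    using Om_EB chi_sets i j by (auto simp: level_iff)
  have pt: "gcheck T E r w m \<beta> \<rho> \<omega> \<tau> = (\<Sum>u\<in>?L. \<Sum>v\<in>?L. ?G u v * indicator (Om u \<times> Om v) (\<omega>, \<tau>))"
    if "\<omega> \<in> ends E r" "\<tau> \<in> ends E r" for \<omega> \<tau>
  proof -
    have L: "\<omega> m \<in> ?L" "\<tau> m \<in> ?L" using endsD[OF that(1)] endsD[OF that(2)] by (auto simp: level_iff)
    have "(\<Sum>u\<in>?L. \<Sum>v\<in>?L. ?G u v * indicator (Om u \<times> Om v) (\<omega>, \<tau>))
      = (\<Sum>u\<in>?L. \<Sum>v\<in>?L. if v = \<tau> m then (if u = \<omega> m then ?G u v else 0) else 0)"
      using that ends_through_iff by (intro sum.cong refl) (auto simp: level_iff indicator_def)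
    also have "\<dots> = ?G (\<omega> m) (\<tau> m)" using L level_finite by simp
    finally show ?thesis by (simp add: gcheck_def)
  qed
  have "(\<integral>(\<omega>, \<tau>). gcheck T E r w m \<beta> \<rho> \<omega> \<tau> \<partial>(?ci \<Otimes>\<^sub>M ?cj))
    = (\<integral>z. (\<Sum>u\<in>?L. \<Sum>v\<in>?L. ?G u v * indicator (Om u \<times> Om v) z) \<partial>(?ci \<Otimes>\<^sub>M ?cj))"
    by (rule Bochner_Integration.integral_cong) (auto simp: space_pair_measure chi_space i j pt)
  also have "\<dots> = (\<Sum>u\<in>?L. \<Sum>v\<in>?L. ?G u v * measure (?ci \<Otimes>\<^sub>M ?cj) (Om u \<times> Om v))"
  proof -
    have int: "integrable (?ci \<Otimes>\<^sub>M ?cj) (\<lambda>z. ?G u v * indicator (Om u \<times> Om v) z)" if "u \<in> ?L" "v \<in> ?L" for u v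
      using OmL that by (intro integrable_mult_right) (simp add: P.emeasure_eq_measure)
    have "(\<integral>z. (\<Sum>u\<in>?L. \<Sum>v\<in>?L. ?G u v * indicator (Om u \<times> Om v) z) \<partial>(?ci \<Otimes>\<^sub>M ?cj))
      = (\<Sum>u\<in>?L. \<Sum>v\<in>?L. (\<integral>z. ?G u v * indicator (Om u \<times> Om v) z \<partial>(?ci \<Otimes>\<^sub>M ?cj)))"
      using int by (simp add: Bochner_Integration.integral_sum Bochner_Integration.integrable_sum)
    also have "\<dots> = (\<Sum>u\<in>?L. \<Sum>v\<in>?L. ?G u v * measure (?ci \<Otimes>\<^sub>M ?cj) (Om u \<times> Om v))"
      using OmL by (intro sum.cong refl) simp
    finally show ?thesis .
  qed
  also have "\<dots> = (\<Sum>u\<in>?L. \<Sum>v\<in>?L. exit_mass u i * exit_mass v j * ?G u v)"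
  proof (intro sum.cong refl)
    fix u v assume "u \<in> ?L" "v \<in> ?L"
    then have "measure (?ci \<Otimes>\<^sub>M ?cj) (Om u \<times> Om v) = measure ?ci (Om u) * measure ?cj (Om v)"
      using OmL J.emeasure_pair_measure_Times[of "Om u" ?ci "Om v"]
      by (simp add: measure_def enn2real_mult)
    then show "?G u v * measure (?ci \<Otimes>\<^sub>M ?cj) (Om u \<times> Om v) = exit_mass u i * exit_mass v j * ?G u v"
      by (simp add: exit_mass_def)
  qed
  finally show ?thesis by (simp add: Gm_def)
qed

end

end

section \<open>A bilinear form of the inverse is almost surely nonzero\<close>

lemma AE_lborel_interval:
  assumes "AE y in lborel. P (y::real)" "a < b"
  shows "\<exists>y. a < y \<and> y < b \<and> P y"
proof (rule ccontr)
  assume n: "\<nexists>y. a < y \<and> y < b \<and> P y"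
  from assms(1) have "AE y in lborel. y \<notin> {a<..<b}" by eventually_elim (use n in auto)
  then have "emeasure lborel {a<..<b} = 0" by (subst (asm) AE_iff_measurable[of "{a<..<b}"]) auto
  then show False using assms(2) by simp
qed

text \<open>Removing one vertex \<open>v\<close> turns the bilinear form into \<open>A + B / s\<close> where \<open>A\<close> is the form
  of the remaining vertices, \<open>s\<close> is the Schur complement, an affine function of \<open>\<rho> v\<close>, and
  \<open>A\<close>, \<open>B\<close> do not depend on \<open>\<rho> v\<close>. If it vanishes for almost every \<open>\<rho> v\<close>, then
  \<open>A = B = 0\<close>. For \<open>v \<noteq> u\<close> the induction hypothesis applies to \<open>A\<close>; if \<open>u\<close> is the only vertex,
  then \<open>B = l u q u\<close>.\<close>

lemma bilinear_inverse_vanishes: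
  assumes "finite U" "weights_on U C"
    and "AE \<rho> in PiM U (\<lambda>_. lborel). posdef_on U (Hmat C \<rho>) \<longrightarrow>
      (\<Sum>i\<in>U. \<Sum>j\<in>U. l i * inv_on U (Hmat C \<rho>) i j * q j) = 0"
    and "u \<in> U"
  shows "l u * q u = (0::real)"
  using assms
proof (induction "card U" arbitrary: U u rule: less_induct)
  case less
  note fin = less.prems(1) and C = less.prems(2) and AE = less.prems(3) and u = less.prems(4)
  obtain v where v: "v \<in> U" "(\<exists>u'\<in>U. u' \<noteq> u) \<longrightarrow> v \<noteq> u" using u by blast
  define V where "V = U - {v}"
  have V: "finite V" "v \<notin> V" "U = insert v V" using fin v(1) by (auto simp: V_def)
  have CV: "weights_on V C" by (rule weights_on_subset[OF C]) (auto simp: V_def)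
  interpret product_sigma_finite "\<lambda>_::'a. lborel :: real measure" by unfold_locales
  let ?F = "\<lambda>\<rho>. \<Sum>i\<in>U. \<Sum>j\<in>U. l i * inv_on U (Hmat C \<rho>) i j * q j"
  let ?FV = "\<lambda>\<rho>. \<Sum>i\<in>V. \<Sum>j\<in>V. l i * inv_on V (Hmat C \<rho>) i j * q j"
  let ?P = "PiM U (\<lambda>_. lborel :: real measure)"
  define I where "I \<rho> i j = (if posdef_on U (Hmat C \<rho>) then inv_on U (Hmat C \<rho>) i j else 0)" for \<rho> i j
  note m = Hmat_inv_measurable[where W="\<lambda>_. C" and b="\<lambda>\<rho>. \<rho>" and N="?P", OF fin _ _ C]
  have mI[measurable]: "(\<lambda>\<rho>. I \<rho> i j) \<in> borel_measurable ?P" for i j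
    unfolding I_def by (intro m) auto
  have mp: "{\<rho> \<in> space ?P. posdef_on U (Hmat C \<rho>)} \<in> sets ?P" by (intro m) auto
  define Z where "Z = {\<rho> \<in> space ?P. posdef_on U (Hmat C \<rho>)} \<inter> {\<rho> \<in> space ?P. (\<Sum>i\<in>U. \<Sum>j\<in>U. l i * I \<rho> i j * q j) \<noteq> 0}"
  have Z[measurable]: "Z \<in> sets ?P" unfolding Z_def by (intro sets.Int mp) measurable
  have Zi: "\<rho> \<in> Z \<longleftrightarrow> \<rho> \<in> space ?P \<and> posdef_on U (Hmat C \<rho>) \<and> ?F \<rho> \<noteq> 0" for \<rho>
    by (auto simp: Z_def I_def)
  have "AE \<rho> in ?P. \<rho> \<notin> Z" using AE by eventually_elim (auto simp: Zi)
  then have "Z \<in> null_sets ?P" by (simp add: AE_iff_null_sets[OF Z])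
  then have "(\<integral>\<^sup>+\<rho>. indicator Z \<rho> \<partial>?P) = 0" using Z by (simp add: null_setsD1)
  then have "(\<integral>\<^sup>+x. (\<integral>\<^sup>+y. indicator Z (x(v := y)) \<partial>lborel) \<partial>PiM V (\<lambda>_. lborel)) = 0"
    using product_nn_integral_insert[OF V(1,2), of "indicator Z"] Z unfolding V(3) by simp
  moreover have mZ: "indicator Z \<in> borel_measurable (PiM (insert v V) (\<lambda>_. lborel :: real measure))" for Z' :: "real set"
    using Z unfolding V(3) by simp
  have mi: "(\<lambda>x. \<integral>\<^sup>+y. indicator Z (x(v := y)) \<partial>lborel) \<in> borel_measurable (PiM V (\<lambda>_. lborel))"
  proof -
    have "(\<lambda>(x, y). x(v := y)) \<in> measurable (PiM V (\<lambda>_. lborel :: real measure) \<Otimes>\<^sub>M lborel) (PiM (insert v V) (\<lambda>_. lborel))"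
      by (rule measurable_add_dim)
    from measurable_compose[OF this, of "indicator Z" borel] show ?thesis
      using Z unfolding V(3)
      by (intro sigma_finite_measure.borel_measurable_nn_integral_fst[OF sigma_finite_lborel, of "\<lambda>z. indicator Z ((fst z)(v := snd z))", simplified])
        (auto simp: case_prod_beta' borel_measurable_indicator)
  qed
  ultimately have "AE x in PiM V (\<lambda>_. lborel). (\<integral>\<^sup>+y. indicator Z (x(v := y)) \<partial>lborel) = 0"
    using nn_integral_0_iff_AE by blast
  then have AE2: "AE x in PiM V (\<lambda>_. lborel). posdef_on V (Hmat C x) \<longrightarrow>
      ?FV x = 0 \<and> (V = {} \<longrightarrow> l v * q v = 0)"
    using AE_space
  proof eventually_elim
    case (elim x)
    have mx: "(\<lambda>y. x(v := y)) \<in> measurable lborel ?P"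
      unfolding V(3) by (rule measurable_component_update[OF elim(2) V(2)])
    then have my: "(\<lambda>y. indicator Z (x(v := y)) :: ennreal) \<in> borel_measurable lborel"
      by (rule measurable_compose) (use Z in simp)
    have AEy: "AE y in lborel. x(v := y) \<notin> Z"
      using elim(1) nn_integral_0_iff_AE[OF my] by (auto simp: indicator_def)
    show ?case
    proof
      assume pdV: "posdef_on V (Hmat C x)"
      define G where "G = inv_on V (Hmat C x)"
      define e where "e i = (if i = v then 1 else 0) + (\<Sum>j\<in>V. G i j * C j v)" for i
      define c where "c = (\<Sum>i\<in>V. \<Sum>j\<in>V. C v i * G i j * C j v)"
      have Cv: "C v v = 0" using weights_onD(3)[OF C v(1) v(1)] .
      have HV: "Hmat C (x(v := y)) i j = Hmat C x i j" if "i \<in> V" for i j y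
        using that V(2) by (intro Hmat_cong) auto
      have iV: "inv_on V (Hmat C (x(v := y))) = G" for y unfolding G_def by (rule inv_on_cong) (rule HV)
      have pdV': "posdef_on V (Hmat C (x(v := y)))" for y
        using pdV posdef_on_cong[of V "Hmat C (x(v := y))" "Hmat C x"] HV by blast
      have Hik: "Hmat C (x(v := y)) i v = - C i v" "Hmat C (x(v := y)) v i = - C v i" if "i \<in> V" for i y
        using that V(2) by (auto simp: Hmat_def)
      have sch: "schur V (Hmat C (x(v := y))) v = 2 * y - c" for y
        unfolding schur_def iV c_def using Cv Hik by (simp add: Hmat_def cong: sum.cong)
      have pv: "pivot V (Hmat C (x(v := y))) v i = e i" for y i
        unfolding pivot_def iV e_def using Hik by (simp add: sum_negf cong: sum.cong)
      have sy: "symm_on (insert v V) (Hmat C (x(v := y)))" for y using Hmat_symm[OF C] unfolding V(3) .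
      define B where "B = (\<Sum>i\<in>U. e i * l i) * (\<Sum>j\<in>U. e j * q j)"
      have F: "?F (x(v := y)) = ?FV x + B / (2 * y - c)" if y: "c < 2 * y" for y
      proof -
        have pdU: "posdef_on (insert v V) (Hmat C (x(v := y)))"
          unfolding posdef_insert[OF V(1,2) sy] sch using pdV' y by simp
        have "?F (x(v := y)) = (\<Sum>i\<in>U. \<Sum>j\<in>U. l i * G i j * q j + (e i * l i) * (e j * q j) / (2 * y - c))"
          unfolding V(3) using inv_insert[OF V(1,2) sy pdU] by (simp add: iV sch pv algebra_simps)
        also have "\<dots> = (\<Sum>i\<in>U. \<Sum>j\<in>U. l i * G i j * q j) + B / (2 * y - c)"
          by (simp only: sum.distrib B_def sum_product sum_divide_distrib)
        also have "(\<Sum>i\<in>U. \<Sum>j\<in>U. l i * G i j * q j) = ?FV x"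
          unfolding V(3) using V(1,2) inv_outside[OF V(1) Hmat_symm[OF CV] pdV] by (simp add: G_def)
        finally show ?thesis .
      qed
      have zero: "\<exists>y. a < y \<and> y < b \<and> ?FV x + B / (2 * y - c) = 0" if "a < b" "c \<le> 2 * a" for a b
      proof -
        obtain y where y: "a < y" "y < b" "x(v := y) \<notin> Z" using AE_lborel_interval[OF AEy \<open>a < b\<close>] by blast
        have cy: "c < 2 * y" using y(1) that by simp
        have "x(v := y) \<in> space ?P" using measurable_space[OF mx, of y] by simp
        moreover have "posdef_on U (Hmat C (x(v := y)))"
          unfolding V(3) posdef_insert[OF V(1,2) sy] sch using pdV' cy by simp
        ultimately have "?F (x(v := y)) = 0" using y(3) Zi by blast
        then show ?thesis using F[OF cy] y by auto
      qed
      \<comment> \<open>Two zeros of \<open>A + B / s\<close> at different values of \<open>s\<close> force \<open>A = B = 0\<close>.\<close>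
      obtain y1 where y1: "c / 2 < y1" "y1 < c / 2 + 1" "?FV x + B / (2 * y1 - c) = 0" using zero[of "c / 2" "c / 2 + 1"] by auto
      obtain y2 where y2: "c / 2 + 1 < y2" "?FV x + B / (2 * y2 - c) = 0" using zero[of "c / 2 + 1" "c / 2 + 2"] by auto
      have "?FV x * (2 * y1 - c) + B = 0" "?FV x * (2 * y2 - c) + B = 0"
        using y1 y2 by (simp_all add: field_simps)
      moreover have "F * (2 * (y2 - y1)) = 0" if "F * (2 * y1 - c) + B = 0" "F * (2 * y2 - c) + B = 0" for F
      proof -
        have "F * (2 * (y2 - y1)) = (F * (2 * y2 - c) + B) - (F * (2 * y1 - c) + B)" by (simp add: algebra_simps)
        then show ?thesis using that by simp
      qed
      ultimately have "?FV x * (2 * (y2 - y1)) = 0" by blast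
      then have FV0: "?FV x = 0" using y1 y2 by simp
      then have "B = 0" using y1 by simp
      moreover have "B = l v * q v" if "V = {}" using that V(3) by (simp add: B_def e_def)
      ultimately show "?FV x = 0 \<and> (V = {} \<longrightarrow> l v * q v = 0)" using FV0 by auto
    qed
  qed
  show ?case
  proof (cases "V = {}")
    case True
    then have "U = {u}" using V(3) u by auto
    then have uv: "u = v" using v(1) by simp
    have "AE x in PiM V (\<lambda>_. lborel :: real measure). l v * q v = 0"
      using AE2 by eventually_elim (use True in \<open>simp add: posdef_on_def\<close>)
    then show ?thesis unfolding True PiM_empty AE_count_space uv by blast
  next
    case False
    then have "v \<noteq> u" using v(2) V by auto
    then have uV: "u \<in> V" using u V(3) by auto
    have "card V < card U" unfolding V_def using fin v(1) by (rule card_Diff1_less)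
    moreover have "AE \<rho> in PiM V (\<lambda>_. lborel). posdef_on V (Hmat C \<rho>) \<longrightarrow> ?FV \<rho> = 0"
      using AE2 by eventually_elim blast
    ultimately show ?thesis using less.hyps[OF _ V(1) CV _ uV] by blast
  qed
qed

section \<open>The joint law and the measurability of the jump rates\<close>

text \<open>Needed because the jump rates are measurable only after they are modified on a null set.\<close>

lemma measurable_completion_AE:
  assumes h: "h \<in> borel_measurable M" and AE: "AE x in M. f x = (h x :: real)"
  shows "f \<in> borel_measurable (completion M)"
proof (rule measurableI)
  fix S :: "real set" assume S: "S \<in> sets borel"
  let ?D = "{x \<in> space M. f x \<noteq> h x}"
  have sub: "{x \<in> space M. f x \<noteq> h x \<and> P x} \<in> sets (completion M)" for P
  proof -
    have "AE x in M. \<not> (f x \<noteq> h x \<and> P x)" using AE by eventually_elim simp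
    from sets_completion_AE[OF this] show ?thesis by (simp add: pred_def)
  qed
  have "f -` S \<inter> space (completion M)
     = ((h -` S \<inter> space M) - {x \<in> space M. f x \<noteq> h x \<and> True}) \<union> {x \<in> space M. f x \<noteq> h x \<and> f x \<in> S}"
    by auto
  also have "\<dots> \<in> sets (completion M)"
    using measurable_sets[OF h S] sub[of "\<lambda>_. True"] sub by (intro sets.Un sets.Diff) auto
  finally show "f -` S \<inter> space (completion M) \<in> sets (completion M)" .
qed simp

context wtree
begin

abbreviation "Lv m \<equiv> level T E r m"
abbreviation "Cc \<equiv> Ccheck T E r w"
abbreviation "PLv m \<equiv> PiM (Lv m) (\<lambda>_. lborel :: real measure)"

lemma good_space_measurable_cong: "(\<And>\<beta>. good \<beta> \<Longrightarrow> f \<beta> = g \<beta>) \<Longrightarrow> f \<in> borel_measurable good_space \<longleftrightarrow> g \<in> borel_measurable good_space"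
  by (intro measurable_cong) (auto dest: good_space_good)

lemma p_measurable: "(\<lambda>\<beta>. walk_step E w (ps \<beta>) i j) \<in> borel_measurable good_space"
  unfolding walk_step_def walk_conductance_def
  by (intro borel_measurable_divide borel_measurable_sum borel_measurable_times ps_measurable borel_measurable_const)

lemma PW_measurable: "(\<lambda>\<beta>. mchain.pw (\<lambda>i. nbr i) (walk_step E w (ps \<beta>)) k g i) \<in> borel_measurable good_space"
proof (induction k arbitrary: i)
  case 0
  have "(\<lambda>\<beta>. g i) \<in> borel_measurable good_space" by simp
  then show ?case by (rule good_space_measurable_cong[THEN iffD1, rotated]) (simp add: PW_0)
next
  case (Suc k)
  have "(\<lambda>\<beta>. \<Sum>j\<in>nbr i. walk_step E w (ps \<beta>) i j * mchain.pw (\<lambda>i. nbr i) (walk_step E w (ps \<beta>)) k g j) \<in> borel_measurable good_space"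
    using Suc p_measurable by (intro borel_measurable_sum borel_measurable_times)
  then show ?case by (rule good_space_measurable_cong[THEN iffD1, rotated]) (simp add: PW_Suc)
qed

lemma exit_mass_measurable:
  assumes "u \<in> T" "y \<in> T"
  shows "(\<lambda>\<beta>. exit_mass \<beta> u y) \<in> borel_measurable good_space"
proof -
  have "(\<lambda>\<beta>. lim (\<lambda>k. ps \<beta> y * mchain.pw (\<lambda>i. nbr i) (walk_step E w (ps \<beta>)) k (indicator (sub u)) y)) \<in> borel_measurable good_space"
    by (intro borel_measurable_lim_metric borel_measurable_times ps_measurable PW_measurable)
  then show ?thesis
    by (rule good_space_measurable_cong[THEN iffD1, rotated]) (rule limI[OF exit_mass_lim[OF _ assms]])
qed

lemma Cc_eq: "good \<beta> \<Longrightarrow> Cc \<beta> x x' = (if x = x' then 0 else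
    exit_mass \<beta> x (meet E r x x') * exit_mass \<beta> x' (meet E r x x') / Gh \<beta> (meet E r x x') (meet E r x x'))"
  by (simp add: Ccheck_def Let_def exit_mass_def)

lemma Cc_measurable: "x \<in> T \<Longrightarrow> x' \<in> T \<Longrightarrow> (\<lambda>\<beta>. Cc \<beta> x x') \<in> borel_measurable good_space"
proof -
  assume x: "x \<in> T" "x' \<in> T"
  have "(\<lambda>\<beta>. if x = x' then 0 else
    exit_mass \<beta> x (meet E r x x') * exit_mass \<beta> x' (meet E r x x') / Gh \<beta> (meet E r x x') (meet E r x x')) \<in> borel_measurable good_space"
    using x by (cases "x = x'") (auto intro!: borel_measurable_divide borel_measurable_times exit_mass_measurable Gh_measurable meet_T)
  then show ?thesis by (rule good_space_measurable_cong[THEN iffD1, rotated]) (simp add: Cc_eq)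
qed

lemma Cc_weights: "good \<beta> \<Longrightarrow> U \<subseteq> T \<Longrightarrow> weights_on U (Cc \<beta>)"
  unfolding weights_on_def
proof (intro conjI ballI)
  assume g: "good \<beta>" and U: "U \<subseteq> T"
  fix i j assume "i \<in> U" "j \<in> U"
  then have z: "meet E r i j \<in> T" using U meet_T by blast
  show "Cc \<beta> i j = Cc \<beta> j i" using meet_commute[of i j] by (simp add: Cc_eq[OF g])
  show "0 \<le> Cc \<beta> i j" using exit_mass_nonneg[OF g] Gh_nonneg[OF good_conv[OF g] z z] by (simp add: Cc_eq[OF g])
qed (simp add: Ccheck_def)

lemma level_T: "Lv m \<subseteq> T" by (auto simp: level_iff)

definition good_set :: "('v \<Rightarrow> real) set" where "good_set = {\<beta> \<in> space nu. good \<beta>}"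

lemma AE_good_set:
  assumes "AE \<beta> in nu. \<forall>i\<in>T. 0 < ps \<beta> i"
  shows "AE \<beta> in nu. \<beta> \<in> good_set"
  using assms AE_conv AE_space[of nu] by eventually_elim (simp add: good_set_def good_def)

definition good_joint :: "nat \<Rightarrow> (('v \<Rightarrow> real) \<times> ('v \<Rightarrow> real)) measure" where
  "good_joint m = restrict_space (nu \<Otimes>\<^sub>M PLv m) (good_set \<times> space (PLv m))"

lemma good_set_times: "good_set \<times> space (PLv m) \<in> sets (nu \<Otimes>\<^sub>M PLv m)"
  using good_sets by (simp add: good_set_def)

lemma space_good_joint: "space (good_joint m) = good_set \<times> space (PLv m)"
  unfolding good_joint_def space_restrict_space space_pair_measure by (auto simp: good_set_def)

lemma fst_good_joint: "f \<in> borel_measurable good_space \<Longrightarrow> (\<lambda>x. f (fst x)) \<in> borel_measurable (good_joint m)"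
proof -
  assume f: "f \<in> borel_measurable good_space"
  have "fst \<in> measurable (good_joint m) good_space"
    unfolding good_space_def
  proof (rule measurable_restrict_space2)
    show "fst \<in> space (good_joint m) \<rightarrow> {\<beta> \<in> space nu. good \<beta>}" by (auto simp: space_good_joint good_set_def)
    show "fst \<in> measurable (good_joint m) nu" unfolding good_joint_def by (rule measurable_restrict_space1) simp
  qed
  from measurable_compose[OF this f] show ?thesis .
qed

lemma snd_good_joint: "i \<in> Lv m \<Longrightarrow> (\<lambda>x. snd x i) \<in> borel_measurable (good_joint m)"
proof -
  assume i: "i \<in> Lv m"
  have "(\<lambda>x. snd x i) \<in> borel_measurable (nu \<Otimes>\<^sub>M PLv m)"
    using measurable_compose[OF measurable_snd measurable_component_singleton[OF i, of "\<lambda>_. lborel"], of nu] by simp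
  then show ?thesis unfolding good_joint_def by (rule measurable_restrict_space1)
qed

lemma good_joint_good_set: "x \<in> space (good_joint m) \<Longrightarrow> good (fst x)"
  by (auto simp: space_good_joint good_set_def)

text \<open>The joint law has a density with respect to \<open>nu\<close> and Lebesgue measure on the boundary
  potential; it is set to \<open>0\<close> on the null set of potentials that are not
  good, where it need not be measurable.\<close>

definition joint_dens :: "nat \<Rightarrow> ('v \<Rightarrow> real) \<times> ('v \<Rightarrow> real) \<Rightarrow> real" where
  "joint_dens m x = indicator (good_set \<times> space (PLv m)) x * nu_dens (Lv m) (Cc (fst x)) (\<lambda>_. 0) (snd x)"

lemma joint_dens_measurable: "joint_dens m \<in> borel_measurable (nu \<Otimes>\<^sub>M PLv m)"
proof -
  have "(\<lambda>x. nu_dens (Lv m) (Cc (fst x)) (\<lambda>_. 0) (snd x)) \<in> borel_measurable (good_joint m)"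
    using Cc_measurable level_T
    by (intro nu_dens_measurable level_finite snd_good_joint fst_good_joint Cc_weights good_joint_good_set) auto
  then have "(\<lambda>x. indicator (good_set \<times> space (PLv m)) x *\<^sub>R nu_dens (Lv m) (Cc (fst x)) (\<lambda>_. 0) (snd x)) \<in> borel_measurable (nu \<Otimes>\<^sub>M PLv m)"
    unfolding good_joint_def by (rule borel_measurable_restrict_space_iff[THEN iffD1, rotated]) (simp add: good_set_times sets.Int_space_eq2)
  then show ?thesis by (simp add: joint_dens_def[abs_def])
qed

text \<open>The set function in the definition of \<^const>\<open>nu_joint\<close> agrees with the measure with
  density \<open>joint_dens\<close> on measurable sets; this also shows that it is a measure.\<close>

lemma nu_joint_density:
  assumes G: "AE \<beta> in nu. \<beta> \<in> good_set"
  shows "nu_joint T E r w m = density (nu \<Otimes>\<^sub>M PLv m) (\<lambda>x. ennreal (joint_dens m x))"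
proof -
  let ?P = "nu \<Otimes>\<^sub>M PiM (Lv m) (\<lambda>_. borel :: real measure)"
  let ?J = "density (nu \<Otimes>\<^sub>M PLv m) (\<lambda>x. ennreal (joint_dens m x))"
  let ?mu = "\<lambda>A. \<integral>\<^sup>+ \<beta>. emeasure (nu_fin (Lv m) (Cc \<beta>) (\<lambda>_. 0)) {\<rho>. (\<beta>, \<rho>) \<in> A} \<partial>nu"
  interpret product_sigma_finite "\<lambda>_::'v. lborel :: real measure" by unfold_locales
  interpret S: sigma_finite_measure "PLv m" by (rule sigma_finite[OF level_finite])
  have sJ: "sets ?J = sets ?P"
    unfolding sets_density by (intro sets_pair_measure_cong sets_PiM_cong refl) simp
  have spJ: "space ?J = space ?P" using sets_eq_imp_space_eq[OF sJ] .
  note [measurable] = joint_dens_measurable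
  have em: "emeasure ?J A = ?mu A" if A: "A \<in> sets ?P" for A
  proof -
    have A'[measurable]: "A \<in> sets (nu \<Otimes>\<^sub>M PLv m)" using A sJ by simp
    have "emeasure ?J A = (\<integral>\<^sup>+ x. ennreal (joint_dens m x) * indicator A x \<partial>(nu \<Otimes>\<^sub>M PLv m))"
      by (rule emeasure_density) measurable
    also have "\<dots> = (\<integral>\<^sup>+ \<beta>. \<integral>\<^sup>+ \<rho>. ennreal (joint_dens m (\<beta>, \<rho>)) * indicator A (\<beta>, \<rho>) \<partial>PLv m \<partial>nu)"
      by (rule S.nn_integral_fst[symmetric]) measurable
    also have "\<dots> = ?mu A"
    proof (rule nn_integral_cong_AE)
      show "AE \<beta> in nu. (\<integral>\<^sup>+ \<rho>. ennreal (joint_dens m (\<beta>, \<rho>)) * indicator A (\<beta>, \<rho>) \<partial>PLv m)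
          = emeasure (nu_fin (Lv m) (Cc \<beta>) (\<lambda>_. 0)) {\<rho>. (\<beta>, \<rho>) \<in> A}"
        using G
      proof eventually_elim
        case (elim \<beta>)
        have g: "good \<beta>" using elim by (simp add: good_set_def)
        have s: "{\<rho>. (\<beta>, \<rho>) \<in> A} \<in> sets (PLv m)" using sets_Pair1[OF A', of \<beta>] by (simp add: vimage_def)
        have "emeasure (nu_fin (Lv m) (Cc \<beta>) (\<lambda>_. 0)) {\<rho>. (\<beta>, \<rho>) \<in> A}
          = (\<integral>\<^sup>+ \<rho>. ennreal (nu_dens (Lv m) (Cc \<beta>) (\<lambda>_. 0) \<rho>) * indicator {\<rho>. (\<beta>, \<rho>) \<in> A} \<rho> \<partial>PLv m)"
          unfolding nu_fin_dens
          by (intro emeasure_density s measurable_compose[OF nu_dens_measurable'[OF level_finite Cc_weights[OF g level_T]] measurable_ennreal])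
        also have "\<dots> = (\<integral>\<^sup>+ \<rho>. ennreal (joint_dens m (\<beta>, \<rho>)) * indicator A (\<beta>, \<rho>) \<partial>PLv m)"
          using elim by (intro nn_integral_cong) (auto simp: joint_dens_def indicator_def)
        finally show ?case by simp
      qed
    qed
    finally show ?thesis .
  qed
  have "nu_joint T E r w m = measure_of (space ?P) (sets ?P) ?mu"
    by (simp add: nu_joint_def Let_def)
  also have "\<dots> = measure_of (space ?J) (sets ?J) (emeasure ?J)"
    unfolding spJ sJ by (rule measure_of_eq) (use sets.space_closed em in \<open>auto simp: sets.sigma_sets_eq\<close>)
  also have "\<dots> = ?J" by (rule measure_of_of_measure)
  finally show ?thesis .
qed

text \<open>The set where the joint density is positive. Almost sure statements about the joint law
  thus become statements about almost every point of this set with respect to a product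
  measure.\<close>

definition good_pair :: "nat \<Rightarrow> ('v \<Rightarrow> real) \<times> ('v \<Rightarrow> real) \<Rightarrow> bool" where
  "good_pair m x \<longleftrightarrow> x \<in> good_set \<times> space (PLv m) \<and> posdef_on (Lv m) (Hmat (Cc (fst x)) (snd x))"

lemma joint_dens_pos_good_pair: "0 < joint_dens m x \<longleftrightarrow> good_pair m x"
proof -
  have "0 < nu_dens (Lv m) (Cc (fst x)) (\<lambda>_. 0) (snd x) \<longleftrightarrow> posdef_on (Lv m) (Hmat (Cc (fst x)) (snd x))" if "fst x \<in> good_set"
  proof -
    have "weights_on (Lv m) (Cc (fst x))" using that by (intro Cc_weights level_T) (simp add: good_set_def)
    from det_pos[OF level_finite Hmat_symm[OF this]] show ?thesis by (auto simp: nu_dens_def dom_fin_def indicator_def)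
  qed
  then show ?thesis by (auto simp: joint_dens_def good_pair_def indicator_def)
qed

lemma AE_joint:
  assumes G: "AE \<beta> in nu. \<beta> \<in> good_set"
  shows "(AE x in nu_joint T E r w m. P x) \<longleftrightarrow> (AE x in nu \<Otimes>\<^sub>M PLv m. good_pair m x \<longrightarrow> P x)"
  unfolding nu_joint_density[OF G]
  by (subst AE_density) (use joint_dens_measurable in \<open>auto simp: joint_dens_pos_good_pair\<close>)

lemma space_joint: "AE \<beta> in nu. \<beta> \<in> good_set \<Longrightarrow> space (nu_joint T E r w m) = space (nu \<Otimes>\<^sub>M PLv m)"
  and sets_joint: "AE \<beta> in nu. \<beta> \<in> good_set \<Longrightarrow> sets (nu_joint T E r w m) = sets (nu \<Otimes>\<^sub>M PLv m)"
  by (simp_all add: nu_joint_density)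

text \<open>Away from \<open>i0\<close>, the function \<open>Gfrom m i0\<close> is the solution with value \<open>bdry m i0 v\<close>, relative
  to \<open>\<psi>\<close>, on the ends below \<open>v\<close>, for each \<open>v\<close> of level \<open>m\<close>, plus the potential \<open>G(i0, \<sqdot>)\<close>.\<close>

definition Gfrom :: "nat \<Rightarrow> 'v \<Rightarrow> ('v \<Rightarrow> real) \<times> ('v \<Rightarrow> real) \<Rightarrow> 'v \<Rightarrow> real" where
  "Gfrom m i0 x i = Gm T E r w m (fst x) (snd x) i0 i"

definition bdry :: "nat \<Rightarrow> 'v \<Rightarrow> ('v \<Rightarrow> real) \<times> ('v \<Rightarrow> real) \<Rightarrow> 'v \<Rightarrow> real" where
  "bdry m i0 x v = (\<Sum>u\<in>Lv m. exit_mass (fst x) u i0 * inv_on (Lv m) (Hmat (Cc (fst x)) (snd x)) u v)"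

lemma Gfrom_eq: "good (fst x) \<Longrightarrow> i0 \<in> T \<Longrightarrow> i \<in> T \<Longrightarrow>
    Gfrom m i0 x i = Gh (fst x) i0 i + (\<Sum>v\<in>Lv m. exit_mass (fst x) v i * bdry m i0 x v)"
proof -
  assume g: "good (fst x)" "i0 \<in> T" "i \<in> T"
  have "Gfrom m i0 x i = Gh (fst x) i0 i + (\<Sum>u\<in>Lv m. \<Sum>v\<in>Lv m. exit_mass (fst x) u i0 * exit_mass (fst x) v i
      * inv_on (Lv m) (Hmat (Cc (fst x)) (snd x)) u v)"
    unfolding Gfrom_def Gm_eq[OF g] Gcheck_def ..
  also have "(\<Sum>u\<in>Lv m. \<Sum>v\<in>Lv m. exit_mass (fst x) u i0 * exit_mass (fst x) v i * inv_on (Lv m) (Hmat (Cc (fst x)) (snd x)) u v)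
    = (\<Sum>v\<in>Lv m. exit_mass (fst x) v i * bdry m i0 x v)"
    by (subst sum.swap) (simp add: bdry_def sum_distrib_left mult_ac)
  finally show ?thesis .
qed

lemma bdry_nonneg: "good_pair m x \<Longrightarrow> 0 \<le> bdry m i0 x v"
proof -
  assume x: "good_pair m x"
  then have g: "good (fst x)" by (auto simp: good_pair_def good_set_def)
  have W: "weights_on (Lv m) (Cc (fst x))" by (rule Cc_weights[OF g level_T])
  show ?thesis unfolding bdry_def
    using x exit_mass_nonneg[OF g] inv_nonneg[OF level_finite Hmat_symm[OF W] _ Hmat_Zmat[OF W]]
    by (intro sum_nonneg mult_nonneg_nonneg) (auto simp: good_pair_def)
qed

lemma Gfrom_pos: "good_pair m x \<Longrightarrow> i0 \<in> T \<Longrightarrow> i \<in> T \<Longrightarrow> 0 < Gfrom m i0 x i"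
proof -
  assume x: "good_pair m x" and i: "i0 \<in> T" "i \<in> T"
  then have g: "good (fst x)" by (auto simp: good_pair_def good_set_def)
  have "0 \<le> (\<Sum>v\<in>Lv m. exit_mass (fst x) v i * bdry m i0 x v)"
    using exit_mass_nonneg[OF g] bdry_nonneg[OF x] by (intro sum_nonneg mult_nonneg_nonneg) auto
  then show ?thesis using Gh_pos[OF good_conv[OF g] i] by (simp add: Gfrom_eq[OF g i])
qed

lemma Gfrom_Hop:
  assumes g: "good (fst x)" and i: "i0 \<in> T" "i \<in> T" "i \<noteq> i0"
  shows "2 * fst x i * Gfrom m i0 x i = w * (\<Sum>j\<in>nbr i. Gfrom m i0 x j)"
proof -
  let ?b = "fst x"
  have nT: "j \<in> T" if "j \<in> nbr i" for j using that edgeD(2) by blast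
  have "Hop E w ?b (\<lambda>k. Gh ?b k i0) i = 0" using Gh_Hop[OF good_conv[OF g] i(2,1)] i(3) by simp
  then have 1: "2 * ?b i * Gh ?b i0 i = w * (\<Sum>j\<in>nbr i. Gh ?b i0 j)"
    unfolding Hop_eq using Gh_sym[OF good_conv[OF g], of i0] by simp
  have 2: "2 * ?b i * exit_mass ?b v i = w * (\<Sum>j\<in>nbr i. exit_mass ?b v j)" if "v \<in> Lv m" for v
    using exit_mass_Hop[OF g _ i(2), of v] that by (simp add: Hop_eq level_iff)
  have "w * (\<Sum>j\<in>nbr i. Gfrom m i0 x j)
    = w * (\<Sum>j\<in>nbr i. Gh ?b i0 j) + w * (\<Sum>j\<in>nbr i. \<Sum>v\<in>Lv m. exit_mass ?b v j * bdry m i0 x v)"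
    using Gfrom_eq[OF g i(1) nT] by (simp add: sum.distrib distrib_left)
  also have "w * (\<Sum>j\<in>nbr i. \<Sum>v\<in>Lv m. exit_mass ?b v j * bdry m i0 x v)
    = (\<Sum>v\<in>Lv m. (w * (\<Sum>j\<in>nbr i. exit_mass ?b v j)) * bdry m i0 x v)"
    by (subst sum.swap) (simp add: sum_distrib_left sum_distrib_right mult.assoc)
  also have "\<dots> = (\<Sum>v\<in>Lv m. 2 * ?b i * exit_mass ?b v i * bdry m i0 x v)"
    using 2 by (intro sum.cong refl) simp
  finally show ?thesis unfolding Gfrom_eq[OF g i(1,2)] 1[symmetric]
    by (simp add: distrib_left sum_distrib_left mult.assoc)
qed

text \<open>In a subtree that does not contain \<open>i0\<close> the term \<open>G(i0, \<sqdot>)\<close> has no inflow and cancels.\<close>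

lemma Gfrom_branch:
  assumes g: "good (fst x)" and i0: "i0 \<in> T" and y: "y \<in> T" "y \<noteq> r" "i0 \<notin> sub y"
  shows "Gfrom m i0 x y - w * green y (fst x) * Gfrom m i0 x (par y)
    = (\<Sum>v\<in>Lv m. (exit_mass (fst x) v y - w * green y (fst x) * exit_mass (fst x) v (par y)) * bdry m i0 x v)"
proof -
  have p: "par y \<in> T" using par_T y by blast
  have "Gh (fst x) i0 y = w * green y (fst x) * Gh (fst x) i0 (par y)"
    using Gh_subtree[OF good_conv[OF g] y(1,2) i0 y(3)] Gh_sym[OF good_conv[OF g]] by metis
  then show ?thesis unfolding Gfrom_eq[OF g i0 y(1)] Gfrom_eq[OF g i0 p]
    by (simp add: algebra_simps sum_subtractf sum_distrib_left)
qed

lemma jump_rates_eq: "(i, j) \<in> dir_edges E \<Longrightarrow> jump_rates T E r w m i0 x (i, j) = 1/2 * w * (Gfrom m i0 x j / Gfrom m i0 x i)"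
  by (simp add: jump_rates_def case_prod_beta Gfrom_def dir_edges_def edge_weight_def)

text \<open>With \<open>h = Gfrom m i0 x\<close>, divide \<open>2 \<beta>\<^sub>i h(i) = w \<Sum>\<^sub>j h(j)\<close> by \<open>2 h(i)\<close>. At \<open>i0\<close> the equation for \<open>h\<close> has a source.\<close>

lemma jump_rates_sum:
  assumes x: "good_pair m x" and i: "i0 \<in> T" "i \<in> T" "i \<noteq> i0"
  shows "(\<Sum>j\<in>nbr i. jump_rates T E r w m i0 x (i, j)) = fst x i"
proof -
  have g: "good (fst x)" using x by (auto simp: good_pair_def good_set_def)
  have "(\<Sum>j\<in>nbr i. jump_rates T E r w m i0 x (i, j)) = (\<Sum>j\<in>nbr i. 1/2 * w * (Gfrom m i0 x j / Gfrom m i0 x i))"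
    by (intro sum.cong refl jump_rates_eq) (simp add: dir_edges_def)
  also have "\<dots> = (w * (\<Sum>j\<in>nbr i. Gfrom m i0 x j)) / (2 * Gfrom m i0 x i)"
    by (simp add: sum_distrib_left sum_divide_distrib)
  also have "\<dots> = fst x i" unfolding Gfrom_Hop[OF g i, symmetric] using Gfrom_pos[OF x i(1,2)] by simp
  finally show ?thesis .
qed

lemma jump_rates_measurable:
  assumes G: "AE \<beta> in nu. \<beta> \<in> good_set" and i0: "i0 \<in> T"
  shows "jump_rates T E r w m i0 \<in> measurable (completion (nu_joint T E r w m)) (PiM (dir_edges E) (\<lambda>_. borel))"
proof -
  let ?J = "nu_joint T E r w m"
  let ?jr = "jump_rates T E r w m i0"
  define I where "I x u v = (if posdef_on (Lv m) (Hmat (Cc (fst x)) (snd x)) then inv_on (Lv m) (Hmat (Cc (fst x)) (snd x)) u v else 0)" for x u v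
  have I: "(\<lambda>x. I x u v) \<in> borel_measurable (good_joint m)" for u v
    unfolding I_def using Cc_measurable level_T
    by (intro Hmat_inv_measurable(2) level_finite snd_good_joint fst_good_joint Cc_weights good_joint_good_set) auto
  define h where "h x i = Gh (fst x) i0 i + (\<Sum>v\<in>Lv m. exit_mass (fst x) v i * (\<Sum>u\<in>Lv m. exit_mass (fst x) u i0 * I x u v))" for x i
  have hm: "(\<lambda>x. h x i) \<in> borel_measurable (good_joint m)" if "i \<in> T" for i
    unfolding h_def using level_T that i0
    by (intro borel_measurable_add borel_measurable_sum borel_measurable_times I fst_good_joint Gh_measurable exit_mass_measurable) auto
  have Gfrom: "Gfrom m i0 x i = h x i" if "good_pair m x" "i \<in> T" for x i
    using that Gfrom_eq[of x i0 i m] i0 by (auto simp: good_pair_def good_set_def h_def bdry_def I_def)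
  have comp: "(\<lambda>x. ?jr x (i, j)) \<in> borel_measurable (completion ?J)" if e: "(i, j) \<in> dir_edges E" for i j
  proof (rule measurable_completion_AE)
    let ?f = "\<lambda>x. 1/2 * w * (h x j / h x i)"
    have ij: "i \<in> T" "j \<in> T" using e edgeD by (auto simp: dir_edges_def)
    have "?f \<in> borel_measurable (good_joint m)" using hm ij by (intro borel_measurable_times borel_measurable_divide borel_measurable_const) auto
    then have "(\<lambda>x. indicator (good_set \<times> space (PLv m)) x *\<^sub>R ?f x) \<in> borel_measurable (nu \<Otimes>\<^sub>M PLv m)"
      unfolding good_joint_def by (rule borel_measurable_restrict_space_iff[THEN iffD1, rotated]) (simp add: good_set_times sets.Int_space_eq2)
    then show "(\<lambda>x. indicator (good_set \<times> space (PLv m)) x *\<^sub>R ?f x) \<in> borel_measurable ?J"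
      by (simp add: measurable_cong_sets[OF sets_joint[OF G] refl])
    show "AE x in ?J. ?jr x (i, j) = indicator (good_set \<times> space (PLv m)) x *\<^sub>R ?f x"
      unfolding AE_joint[OF G]
    proof (rule AE_I2, rule impI)
      fix x assume x: "good_pair m x"
      then have "x \<in> good_set \<times> space (PLv m)" by (simp add: good_pair_def)
      then show "?jr x (i, j) = indicator (good_set \<times> space (PLv m)) x *\<^sub>R ?f x"
        using jump_rates_eq[OF e] Gfrom[OF x] ij by simp
    qed
  qed
  show ?thesis
  proof (rule measurable_PiM_single')
    show "?jr \<in> space (completion ?J) \<rightarrow> dir_edges E \<rightarrow>\<^sub>E space borel"
      by (auto simp: jump_rates_def case_prod_beta)
    fix q assume q: "q \<in> dir_edges E"
    then show "(\<lambda>x. ?jr x q) \<in> borel_measurable (completion ?J)" using comp[of "fst q" "snd q"] by simp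
  qed
qed

text \<open>Two laws that are equal have the same null sets. The theorem is proved by an event that is
  null for one law and not for the other, and this lemma expresses such an event on the
  underlying space.\<close>

lemma law_null_iff:
  assumes G: "AE \<beta> in nu. \<beta> \<in> good_set" and i0: "i0 \<in> T" and A: "A \<in> sets (PiM (dir_edges E) (\<lambda>_. borel))"
  shows "A \<in> null_sets (jump_rates_law T E r w m i0) \<longleftrightarrow> (AE x in nu_joint T E r w m. jump_rates T E r w m i0 x \<notin> A)"
proof -
  let ?J = "nu_joint T E r w m" and ?jr = "jump_rates T E r w m i0"
  have "A \<in> null_sets (jump_rates_law T E r w m i0) \<longleftrightarrow> (AE y in jump_rates_law T E r w m i0. y \<notin> A)"
    using A by (intro AE_iff_null_sets) (simp add: jump_rates_law_def)
  also have "\<dots> \<longleftrightarrow> (AE x in completion ?J. ?jr x \<notin> A)"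
    unfolding jump_rates_law_def using A by (intro AE_distr_iff jump_rates_measurable[OF G i0]) auto
  finally show ?thesis by (simp add: AE_completion_iff)
qed

end

section \<open>Independence of disconnected vertex sets\<close>

lemma posdef_nonneg:
  assumes "posdef_on U A"
  shows "0 \<le> (\<Sum>i\<in>U. \<Sum>j\<in>U. f i * A i j * f j)"
proof (cases "\<exists>i\<in>U. f i \<noteq> 0")
  case True
  then obtain i where "i \<in> U" "f i \<noteq> 0" by blast
  from posdef_onD[of U A i f, OF assms this] show ?thesis by simp
qed simp

locale two_blocks =
  fixes S1 S2 :: "'a set" and A :: "'a \<Rightarrow> 'a \<Rightarrow> real"
  assumes fin: "finite S1" "finite S2" and disj: "S1 \<inter> S2 = {}" and sym: "symm_on (S1 \<union> S2) A"
    and cross: "\<And>i j. i \<in> S1 \<Longrightarrow> j \<in> S2 \<Longrightarrow> A i j = 0"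
begin

lemma cross': "i \<in> S1 \<Longrightarrow> j \<in> S2 \<Longrightarrow> A j i = 0"
  using cross[of i j] sym unfolding symm_on_def by fastforce

lemma double_sum:
  "(\<Sum>i\<in>S1 \<union> S2. \<Sum>j\<in>S1 \<union> S2. f i * A i j * g j)
   = (\<Sum>i\<in>S1. \<Sum>j\<in>S1. f i * A i j * g j) + (\<Sum>i\<in>S2. \<Sum>j\<in>S2. f i * A i j * g j)"
proof -
  have 1: "(\<Sum>j\<in>S1 \<union> S2. f i * A i j * g j) = (\<Sum>j\<in>S1. f i * A i j * g j)" if "i \<in> S1" for i
    using cross[OF that] fin by (intro sum.mono_neutral_right) auto
  have 2: "(\<Sum>j\<in>S1 \<union> S2. f i * A i j * g j) = (\<Sum>j\<in>S2. f i * A i j * g j)" if "i \<in> S2" for i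
    using cross'[OF _ that] fin by (intro sum.mono_neutral_right) auto
  show ?thesis unfolding sum.union_disjoint[OF fin disj, of "\<lambda>i. \<Sum>j\<in>S1 \<union> S2. f i * A i j * g j"]
    by (intro arg_cong2[where f="(+)"] sum.cong[OF refl] 1 2)
qed

lemma posdef_blocks: "posdef_on (S1 \<union> S2) A \<longleftrightarrow> posdef_on S1 A \<and> posdef_on S2 A"
proof
  assume "posdef_on (S1 \<union> S2) A"
  then show "posdef_on S1 A \<and> posdef_on S2 A" using fin by (auto intro: posdef_on_subset)
next
  assume p: "posdef_on S1 A \<and> posdef_on S2 A"
  show "posdef_on (S1 \<union> S2) A" unfolding posdef_on_def double_sum
  proof (intro allI impI)
    fix f :: "'a \<Rightarrow> real" assume "\<exists>i\<in>S1 \<union> S2. f i \<noteq> 0"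
    then obtain i where i: "i \<in> S1 \<or> i \<in> S2" "f i \<noteq> 0" by auto
    have nn: "0 \<le> (\<Sum>i\<in>S1. \<Sum>j\<in>S1. f i * A i j * f j)" "0 \<le> (\<Sum>i\<in>S2. \<Sum>j\<in>S2. f i * A i j * f j)"
      using posdef_nonneg p by auto
    from i(1) show "0 < (\<Sum>i\<in>S1. \<Sum>j\<in>S1. f i * A i j * f j) + (\<Sum>i\<in>S2. \<Sum>j\<in>S2. f i * A i j * f j)"
    proof
      assume "i \<in> S1"
      from posdef_onD[of S1 A i f, OF _ this i(2)] p nn(2) show ?thesis by simp
    next
      assume "i \<in> S2"
      from posdef_onD[of S2 A i f, OF _ this i(2)] p nn(1) show ?thesis by simp
    qed
  qed
qed

lemma inv_blocks:
  assumes p: "posdef_on S1 A" "posdef_on S2 A"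
  shows "inv_on (S1 \<union> S2) A = (\<lambda>i j. inv_on S1 A i j + inv_on S2 A i j)"
proof (rule inv_on_eqI)
  let ?B = "\<lambda>i j. inv_on S1 A i j + inv_on S2 A i j"
  have s: "symm_on S1 A" "symm_on S2 A" using symm_on_subset[OF sym] by auto
  note o1 = inv_outside[OF fin(1) s(1) p(1)] and o2 = inv_outside[OF fin(2) s(2) p(2)]
  have AB: "(\<Sum>k\<in>S1 \<union> S2. A i k * ?B k j) = (if i = j then 1 else 0)" if ij: "i \<in> S1 \<union> S2" "j \<in> S1 \<union> S2" for i j
  proof -
    have "(\<Sum>k\<in>S1 \<union> S2. A i k * ?B k j) = (\<Sum>k\<in>S1. A i k * inv_on S1 A k j) + (\<Sum>k\<in>S2. A i k * inv_on S2 A k j)"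
    proof -
      have "(\<Sum>k\<in>S1. A i k * ?B k j) = (\<Sum>k\<in>S1. A i k * inv_on S1 A k j)"
        using o2 disj by (intro sum.cong refl) auto
      moreover have "(\<Sum>k\<in>S2. A i k * ?B k j) = (\<Sum>k\<in>S2. A i k * inv_on S2 A k j)"
        using o1 disj by (intro sum.cong refl) auto
      ultimately show ?thesis by (simp add: sum.union_disjoint[OF fin disj])
    qed
    also have "\<dots> = (if i = j then 1 else 0)"
    proof (cases "i \<in> S1")
      case True
      then have z: "(\<Sum>k\<in>S2. A i k * inv_on S2 A k j) = 0" using cross by simp
      show ?thesis
      proof (cases "j \<in> S1")
        case True
        then show ?thesis using inv_right[OF fin(1) s(1) p(1) \<open>i \<in> S1\<close>] z by simp
      next
        case False
        then show ?thesis using \<open>i \<in> S1\<close> z o1 by auto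
      qed
    next
      case False
      then have i2: "i \<in> S2" using ij by auto
      then have z: "(\<Sum>k\<in>S1. A i k * inv_on S1 A k j) = 0" using cross' by simp
      show ?thesis
      proof (cases "j \<in> S2")
        case True
        then show ?thesis using inv_right[OF fin(2) s(2) p(2) i2] z by simp
      next
        case False
        then show ?thesis using i2 z o2 by auto
      qed
    qed
    finally show ?thesis .
  qed
  have sB: "?B i j = ?B j i" for i j
    using inv_sym[OF fin(1) s(1) p(1), of i j] inv_sym[OF fin(2) s(2) p(2), of i j] by simp
  have BA: "(\<Sum>k\<in>S1 \<union> S2. ?B i k * A k j) = (if i = j then 1 else 0)" if ij: "i \<in> S1 \<union> S2" "j \<in> S1 \<union> S2" for i j
  proof -
    have "(\<Sum>k\<in>S1 \<union> S2. ?B i k * A k j) = (\<Sum>k\<in>S1 \<union> S2. A j k * ?B k i)"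
    proof (rule sum.cong[OF refl])
      fix k assume "k \<in> S1 \<union> S2"
      then have "A k j = A j k" using sym ij unfolding symm_on_def by blast
      then show "?B i k * A k j = A j k * ?B k i" by (simp only: sB[of i] mult.commute)
    qed
    then show ?thesis using AB[OF ij(2,1)] by auto
  qed
  show "is_inv_on (S1 \<union> S2) A ?B" unfolding is_inv_on_def using AB BA o1 o2 by simp
qed (use fin in simp)

end

text \<open>Vertices of the second block are added one at a time; the Schur complement of such a
  vertex does not see the first block.\<close>

lemma det_blocks:
  assumes "finite S2" "finite S1" "S1 \<inter> S2 = {}" "symm_on (S1 \<union> S2) A"
    "\<And>i j. i \<in> S1 \<Longrightarrow> j \<in> S2 \<Longrightarrow> A i j = 0" "posdef_on (S1 \<union> S2) A"
  shows "det_on (S1 \<union> S2) A = det_on S1 A * det_on S2 A"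
  using assms
proof (induction S2 rule: finite_induct)
  case empty
  then show ?case by (simp add: det_on_def)
next
  case (insert k V)
  let ?U = "S1 \<union> V"
  have k: "k \<notin> ?U" "finite ?U" using insert by auto
  have eq: "S1 \<union> insert k V = insert k ?U" by auto
  have sy: "symm_on (insert k ?U) A" and pdk: "posdef_on (insert k ?U) A"
    using insert.prems unfolding eq by auto
  have pdU: "posdef_on ?U A" using posdef_on_subset[OF pdk] k by auto
  have syU: "symm_on ?U A" by (rule symm_on_subset[OF sy]) auto
  have IH: "det_on ?U A = det_on S1 A * det_on V A"
    using insert.prems syU pdU by (intro insert.IH) auto
  interpret two_blocks S1 V A using insert.hyps insert.prems syU by unfold_locales auto
  have pd: "posdef_on S1 A" "posdef_on V A" using posdef_blocks pdU by auto
  have Ak: "A k i = 0" "A i k = 0" if "i \<in> S1" for i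
  proof -
    show 0: "A i k = 0" using insert.prems(4)[of i k] that by simp
    have "A k i = A i k" using sy that unfolding symm_on_def by blast
    then show "A k i = 0" using 0 by simp
  qed
  have o: "inv_on S1 A i j = 0" if "i \<notin> S1 \<or> j \<notin> S1" for i j
    using inv_outside[OF fin(1) symm_on_subset[OF syU] pd(1)] that by auto
  have "(\<Sum>i\<in>?U. \<Sum>j\<in>?U. A k i * inv_on ?U A i j * A j k) = (\<Sum>i\<in>V. \<Sum>j\<in>V. A k i * inv_on V A i j * A j k)"
  proof -
    have "(\<Sum>i\<in>?U. \<Sum>j\<in>?U. A k i * inv_on ?U A i j * A j k) = (\<Sum>i\<in>V. \<Sum>j\<in>?U. A k i * inv_on ?U A i j * A j k)"
      using Ak fin by (intro sum.mono_neutral_right) auto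
    also have "\<dots> = (\<Sum>i\<in>V. \<Sum>j\<in>V. A k i * inv_on ?U A i j * A j k)"
      using Ak fin by (intro sum.cong refl sum.mono_neutral_right) auto
    also have "\<dots> = (\<Sum>i\<in>V. \<Sum>j\<in>V. A k i * inv_on V A i j * A j k)"
      unfolding inv_blocks[OF pd] using o disj by (intro sum.cong refl) auto
    finally show ?thesis .
  qed
  then have "schur ?U A k = schur V A k" by (simp add: schur_def)
  moreover have "det_on (insert k ?U) A = det_on ?U A * schur ?U A k" by (rule det_insert[OF k(2,1) sy pdU])
  moreover have "det_on (insert k V) A = det_on V A * schur V A k"
    by (rule det_insert[OF fin(2) insert.hyps(2) symm_on_subset[OF sy] pd(2)]) auto
  ultimately show ?case unfolding eq using IH by simp
qed

lemma nu_dens_blocks: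
  assumes fin: "finite S1" "finite S2" and disj: "S1 \<inter> S2 = {}" and W: "weights_on (S1 \<union> S2) W"
    and cross: "\<And>i j. i \<in> S1 \<Longrightarrow> j \<in> S2 \<Longrightarrow> W i j = 0"
  shows "nu_dens (S1 \<union> S2) W \<eta> \<beta> = nu_dens S1 W \<eta> \<beta> * nu_dens S2 W \<eta> \<beta>"
proof -
  let ?A = "Hmat W \<beta>"
  have cr: "?A i j = 0" if "i \<in> S1" "j \<in> S2" for i j
    using cross[OF that] that disj by (auto simp: Hmat_def)
  interpret two_blocks S1 S2 ?A
    by unfold_locales (use fin disj cr Hmat_symm[OF W] in auto)
  show ?thesis
  proof (cases "posdef_on S1 ?A \<and> posdef_on S2 ?A")
    case False
    then show ?thesis using posdef_blocks by (auto simp: nu_dens_def dom_fin_def)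
  next
    case True
    then have p: "posdef_on S1 ?A" "posdef_on S2 ?A" "posdef_on (S1 \<union> S2) ?A" using posdef_blocks by auto
    have s: "symm_on S1 ?A" "symm_on S2 ?A" using symm_on_subset[OF sym] by auto
    note o1 = inv_outside[OF fin(1) s(1) p(1)] and o2 = inv_outside[OF fin(2) s(2) p(2)]
    have sH: "(\<Sum>i\<in>S1 \<union> S2. \<Sum>j\<in>S1 \<union> S2. ?A i j) = (\<Sum>i\<in>S1. \<Sum>j\<in>S1. ?A i j) + (\<Sum>i\<in>S2. \<Sum>j\<in>S2. ?A i j)"
      using double_sum[of "\<lambda>_. 1" "\<lambda>_. 1"] by simp
    have quad: "(\<Sum>i\<in>S1 \<union> S2. \<Sum>j\<in>S1 \<union> S2. \<eta> i * inv_on (S1 \<union> S2) ?A i j * \<eta> j)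
      = (\<Sum>i\<in>S1. \<Sum>j\<in>S1. \<eta> i * inv_on S1 ?A i j * \<eta> j) + (\<Sum>i\<in>S2. \<Sum>j\<in>S2. \<eta> i * inv_on S2 ?A i j * \<eta> j)"
    proof -
      have a: "(\<Sum>i\<in>S1 \<union> S2. \<Sum>j\<in>S1 \<union> S2. \<eta> i * inv_on S ?A i j * \<eta> j) = (\<Sum>i\<in>S. \<Sum>j\<in>S. \<eta> i * inv_on S ?A i j * \<eta> j)"
        if "S \<subseteq> S1 \<union> S2" "\<And>i j. i \<notin> S \<or> j \<notin> S \<Longrightarrow> inv_on S ?A i j = 0" for S
      proof -
        have "(\<Sum>i\<in>S1 \<union> S2. \<Sum>j\<in>S1 \<union> S2. \<eta> i * inv_on S ?A i j * \<eta> j) = (\<Sum>i\<in>S. \<Sum>j\<in>S1 \<union> S2. \<eta> i * inv_on S ?A i j * \<eta> j)"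
          using that fin by (intro sum.mono_neutral_right) auto
        also have "\<dots> = (\<Sum>i\<in>S. \<Sum>j\<in>S. \<eta> i * inv_on S ?A i j * \<eta> j)"
          using that fin by (intro sum.cong refl sum.mono_neutral_right) auto
        finally show ?thesis .
      qed
      have "(\<Sum>i\<in>S1 \<union> S2. \<Sum>j\<in>S1 \<union> S2. \<eta> i * inv_on (S1 \<union> S2) ?A i j * \<eta> j)
        = (\<Sum>i\<in>S1 \<union> S2. \<Sum>j\<in>S1 \<union> S2. \<eta> i * inv_on S1 ?A i j * \<eta> j) + (\<Sum>i\<in>S1 \<union> S2. \<Sum>j\<in>S1 \<union> S2. \<eta> i * inv_on S2 ?A i j * \<eta> j)"
        unfolding inv_blocks[OF p(1,2)] sum.distrib[symmetric] by (intro sum.cong refl) (simp add: algebra_simps)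
      then show ?thesis using a[of S1] a[of S2] o1 o2 by simp
    qed
    have det: "det_on (S1 \<union> S2) ?A = det_on S1 ?A * det_on S2 ?A"
      by (rule det_blocks[OF fin(2,1) disj sym cr p(3)])
    have c: "(2 / pi) powr (real (card (S1 \<union> S2)) / 2) = (2 / pi) powr (real (card S1) / 2) * (2 / pi) powr (real (card S2) / 2)"
      using card_Un_disjoint[OF fin disj] by (simp add: powr_add add_divide_distrib)
    have se: "sum \<eta> (S1 \<union> S2) = sum \<eta> S1 + sum \<eta> S2" by (rule sum.union_disjoint[OF fin disj])
    have e: "exp (- (1/2) * ((a + b) + (a' + b'))) = exp (- (1/2) * (a + a')) * exp (- (1/2) * (b + b'))" for a b a' b' :: real
      unfolding exp_add[symmetric] by (simp add: field_simps)
    show ?thesis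
      unfolding nu_dens_def sH quad det c e se exp_add real_sqrt_mult
      using p by (simp add: dom_fin_def)
  qed
qed

text \<open>The density is a product, and the boundary weights \<open>\<eta>\<close> act on the blocks separately.\<close>

lemma nu_fin_independent:
  assumes fin: "finite S1" "finite S2" and disj: "S1 \<inter> S2 = {}" and W: "weights_on (S1 \<union> S2) W"
    and cross: "\<And>i j. i \<in> S1 \<Longrightarrow> j \<in> S2 \<Longrightarrow> W i j = 0"
    and F1: "F1 \<in> borel_measurable (PiM S1 (\<lambda>_. borel))" and F2: "F2 \<in> borel_measurable (PiM S2 (\<lambda>_. borel))"
  shows "(\<integral>\<^sup>+\<beta>. (F1 (restrict \<beta> S1) * F2 (restrict \<beta> S2) :: ennreal) \<partial>nu_fin (S1 \<union> S2) W \<eta>)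
    = (\<integral>\<^sup>+\<beta>. F1 \<beta> \<partial>nu_fin S1 W \<eta>) * (\<integral>\<^sup>+\<beta>. F2 \<beta> \<partial>nu_fin S2 W \<eta>)"
proof -
  interpret product_sigma_finite "\<lambda>_::'a. lborel :: real measure" by unfold_locales
  have W1: "weights_on S1 W" and W2: "weights_on S2 W" using weights_on_subset[OF W] by auto
  note d = nu_dens_measurable'[OF _ W] nu_dens_measurable'[OF fin(1) W1] nu_dens_measurable'[OF fin(2) W2]
  have [measurable]: "nu_dens (S1 \<union> S2) W \<eta> \<in> borel_measurable (PiM (S1 \<union> S2) (\<lambda>_. lborel))" using d(1) fin by blast
  have [measurable]: "nu_dens S1 W \<eta> \<in> borel_measurable (PiM S1 (\<lambda>_. lborel))" by (rule d(2))
  have [measurable]: "nu_dens S2 W \<eta> \<in> borel_measurable (PiM S2 (\<lambda>_. lborel))" by (rule d(3))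
  have lb: "sets (PiM S (\<lambda>_. borel :: real measure)) = sets (PiM S (\<lambda>_. lborel))" for S :: "'a set"
    by (intro sets_PiM_cong) auto
  have [measurable]: "F1 \<in> borel_measurable (PiM S1 (\<lambda>_. lborel))" "F2 \<in> borel_measurable (PiM S2 (\<lambda>_. lborel))"
    using F1 F2 by (simp_all add: measurable_cong_sets[OF lb refl])
  have r1: "(\<lambda>\<beta>. restrict \<beta> S1) \<in> measurable (PiM (S1 \<union> S2) (\<lambda>_. lborel :: real measure)) (PiM S1 (\<lambda>_. lborel))"
    and r2: "(\<lambda>\<beta>. restrict \<beta> S2) \<in> measurable (PiM (S1 \<union> S2) (\<lambda>_. lborel :: real measure)) (PiM S2 (\<lambda>_. lborel))"
    by (rule measurable_restrict_subset; auto)+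
  have [measurable]: "(\<lambda>\<beta>. F1 (restrict \<beta> S1)) \<in> borel_measurable (PiM (S1 \<union> S2) (\<lambda>_. lborel))"
    by (rule measurable_compose[OF r1]) measurable
  have [measurable]: "(\<lambda>\<beta>. F2 (restrict \<beta> S2)) \<in> borel_measurable (PiM (S1 \<union> S2) (\<lambda>_. lborel))"
    by (rule measurable_compose[OF r2]) measurable
  have n1: "0 \<le> nu_dens S1 W \<eta> b" for b by (rule nu_dens_nonneg[OF fin(1) W1])
  have "(\<integral>\<^sup>+\<beta>. (F1 (restrict \<beta> S1) * F2 (restrict \<beta> S2)) \<partial>nu_fin (S1 \<union> S2) W \<eta>)
    = (\<integral>\<^sup>+\<beta>. ennreal (nu_dens (S1 \<union> S2) W \<eta> \<beta>) * (F1 (restrict \<beta> S1) * F2 (restrict \<beta> S2)) \<partial>PiM (S1 \<union> S2) (\<lambda>_. lborel))"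
    unfolding nu_fin_dens by (rule nn_integral_density) measurable
  also have "\<dots> = (\<integral>\<^sup>+x. (\<integral>\<^sup>+y. ennreal (nu_dens (S1 \<union> S2) W \<eta> (merge S1 S2 (x, y)))
      * (F1 (restrict (merge S1 S2 (x, y)) S1) * F2 (restrict (merge S1 S2 (x, y)) S2)) \<partial>PiM S2 (\<lambda>_. lborel)) \<partial>PiM S1 (\<lambda>_. lborel))"
    by (rule product_nn_integral_fold[OF disj fin]) measurable
  also have "\<dots> = (\<integral>\<^sup>+x. (\<integral>\<^sup>+y. (ennreal (nu_dens S1 W \<eta> x) * F1 x) * (ennreal (nu_dens S2 W \<eta> y) * F2 y) \<partial>PiM S2 (\<lambda>_. lborel)) \<partial>PiM S1 (\<lambda>_. lborel))"
  proof (intro nn_integral_cong)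
    fix x y assume x: "x \<in> space (PiM S1 (\<lambda>_. lborel :: real measure))" and y: "y \<in> space (PiM S2 (\<lambda>_. lborel :: real measure))"
    let ?m = "merge S1 S2 (x, y)"
    have e1: "restrict ?m S1 = x" and e2: "restrict ?m S2 = y"
      using x y disj by (auto simp: space_PiM PiE_def merge_def extensional_def fun_eq_iff)
    have "nu_dens S1 W \<eta> ?m = nu_dens S1 W \<eta> x" by (rule nu_dens_cong) (auto simp: merge_def)
    moreover have "nu_dens S2 W \<eta> ?m = nu_dens S2 W \<eta> y" using disj by (intro nu_dens_cong) (auto simp: merge_def)
    ultimately have "ennreal (nu_dens (S1 \<union> S2) W \<eta> ?m) = ennreal (nu_dens S1 W \<eta> x) * ennreal (nu_dens S2 W \<eta> y)"
      using n1[of x] nu_dens_blocks[OF fin disj W cross, of \<eta> ?m] by (simp add: ennreal_mult')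
    then show "ennreal (nu_dens (S1 \<union> S2) W \<eta> ?m) * (F1 (restrict ?m S1) * F2 (restrict ?m S2))
      = (ennreal (nu_dens S1 W \<eta> x) * F1 x) * (ennreal (nu_dens S2 W \<eta> y) * F2 y)"
      unfolding e1 e2 by (simp add: mult_ac)
  qed
  also have "\<dots> = (\<integral>\<^sup>+x. (ennreal (nu_dens S1 W \<eta> x) * F1 x) * (\<integral>\<^sup>+y. ennreal (nu_dens S2 W \<eta> y) * F2 y \<partial>PiM S2 (\<lambda>_. lborel)) \<partial>PiM S1 (\<lambda>_. lborel))"
    by (intro nn_integral_cong nn_integral_cmult) measurable
  also have "\<dots> = (\<integral>\<^sup>+x. ennreal (nu_dens S1 W \<eta> x) * F1 x \<partial>PiM S1 (\<lambda>_. lborel)) * (\<integral>\<^sup>+y. ennreal (nu_dens S2 W \<eta> y) * F2 y \<partial>PiM S2 (\<lambda>_. lborel))"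
    by (rule nn_integral_multc) measurable
  also have "\<dots> = (\<integral>\<^sup>+\<beta>. F1 \<beta> \<partial>nu_fin S1 W \<eta>) * (\<integral>\<^sup>+\<beta>. F2 \<beta> \<partial>nu_fin S2 W \<eta>)"
    unfolding nu_fin_dens by (intro arg_cong2[where f="(*)"] nn_integral_density[symmetric]) measurable
  finally show ?thesis .
qed

section \<open>Invariance under relabelling\<close>

locale relabel =
  fixes S S' :: "'a set" and \<phi> :: "'a \<Rightarrow> 'a" and A A' :: "'a \<Rightarrow> 'a \<Rightarrow> real"
  assumes fin: "finite S" and bij: "bij_betw \<phi> S S'"
    and A: "\<And>i j. i \<in> S \<Longrightarrow> j \<in> S \<Longrightarrow> A' (\<phi> i) (\<phi> j) = A i j"
begin

lemma sum_re: "(\<Sum>i\<in>S'. f i) = (\<Sum>i\<in>S. f (\<phi> i))"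
  using sum.reindex_bij_betw[OF bij, of f] by simp

lemma in_S': "i \<in> S \<Longrightarrow> \<phi> i \<in> S'" using bij by (auto simp: bij_betw_def)

lemma phi_eq: "i \<in> S \<Longrightarrow> j \<in> S \<Longrightarrow> \<phi> i = \<phi> j \<longleftrightarrow> i = j"
  using bij by (auto simp: bij_betw_def inj_on_def)

lemma fin': "finite S'" using fin bij bij_betw_finite by blast

lemma symm_re: "symm_on S' A' \<Longrightarrow> symm_on S A"
  unfolding symm_on_def
proof (intro ballI)
  fix i j assume h: "\<forall>i\<in>S'. \<forall>j\<in>S'. A' i j = A' j i" and ij: "i \<in> S" "j \<in> S"
  have "A' (\<phi> i) (\<phi> j) = A' (\<phi> j) (\<phi> i)" using h in_S' ij by blast
  then show "A i j = A j i" using A ij by simp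
qed

lemma posdef_re: "posdef_on S' A' \<longleftrightarrow> posdef_on S A"
proof
  assume p: "posdef_on S' A'"
  show "posdef_on S A" unfolding posdef_on_def
  proof (intro allI impI)
    fix f :: "'a \<Rightarrow> real" assume "\<exists>i\<in>S. f i \<noteq> 0"
    then obtain i where i: "i \<in> S" "f i \<noteq> 0" by blast
    let ?f = "\<lambda>x. f (inv_into S \<phi> x)"
    have f: "?f (\<phi> j) = f j" if "j \<in> S" for j using bij_betw_inv_into_left[OF bij that] by simp
    have "0 < (\<Sum>i\<in>S'. \<Sum>j\<in>S'. ?f i * A' i j * ?f j)"
      using i f by (intro posdef_onD[OF p in_S'[OF i(1)]]) simp
    also have "\<dots> = (\<Sum>i\<in>S. \<Sum>j\<in>S. f i * A i j * f j)"
      unfolding sum_re using f A by (intro sum.cong refl) simp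
    finally show "0 < (\<Sum>i\<in>S. \<Sum>j\<in>S. f i * A i j * f j)" .
  qed
next
  assume p: "posdef_on S A"
  show "posdef_on S' A'" unfolding posdef_on_def
  proof (intro allI impI)
    fix f :: "'a \<Rightarrow> real" assume "\<exists>i\<in>S'. f i \<noteq> 0"
    then obtain i where i: "i \<in> S" "f (\<phi> i) \<noteq> 0" using bij by (auto simp: bij_betw_def)
    have "0 < (\<Sum>i\<in>S. \<Sum>j\<in>S. f (\<phi> i) * A i j * f (\<phi> j))"
      by (rule posdef_onD[of S A i "\<lambda>i. f (\<phi> i)", OF p i])
    also have "\<dots> = (\<Sum>i\<in>S'. \<Sum>j\<in>S'. f i * A' i j * f j)"
      unfolding sum_re using A by (intro sum.cong refl) simp
    finally show "0 < (\<Sum>i\<in>S'. \<Sum>j\<in>S'. f i * A' i j * f j)" .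
  qed
qed

lemma inv_re:
  assumes s: "symm_on S' A'" and p: "posdef_on S' A'" and ij: "i \<in> S" "j \<in> S"
  shows "inv_on S' A' (\<phi> i) (\<phi> j) = inv_on S A i j"
proof -
  let ?B = "\<lambda>i j. if i \<in> S \<and> j \<in> S then inv_on S' A' (\<phi> i) (\<phi> j) else 0"
  have "is_inv_on S A ?B"
    unfolding is_inv_on_def
  proof (intro conjI ballI allI impI)
    fix i j assume ij: "i \<in> S" "j \<in> S"
    have "(\<Sum>k\<in>S. A i k * ?B k j) = (\<Sum>k\<in>S'. A' (\<phi> i) k * inv_on S' A' k (\<phi> j))"
      unfolding sum_re using ij A by (intro sum.cong refl) simp
    then show "(\<Sum>k\<in>S. A i k * ?B k j) = (if i = j then 1 else 0)"
      using inv_right[OF fin' s p in_S'[OF ij(1)] in_S'[OF ij(2)]] phi_eq[OF ij] by simp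
    have "(\<Sum>k\<in>S. ?B i k * A k j) = (\<Sum>k\<in>S'. inv_on S' A' (\<phi> i) k * A' k (\<phi> j))"
      unfolding sum_re using ij A by (intro sum.cong refl) simp
    then show "(\<Sum>k\<in>S. ?B i k * A k j) = (if i = j then 1 else 0)"
      using inv_left[OF fin' s p in_S'[OF ij(1)] in_S'[OF ij(2)]] phi_eq[OF ij] by simp
  qed auto
  from inv_on_eqI[OF fin this] show ?thesis using ij by simp
qed

end

text \<open>Again by adding the vertices one at a time.\<close>

lemma det_re:
  fixes S :: "'a set" and \<phi> :: "'a \<Rightarrow> 'a"
  assumes "finite S" "inj_on \<phi> S" "\<And>i j. i \<in> S \<Longrightarrow> j \<in> S \<Longrightarrow> A' (\<phi> i) (\<phi> j) = A i j"
    and "symm_on (\<phi> ` S) A'" "posdef_on (\<phi> ` S) A'"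
  shows "det_on (\<phi> ` S) A' = det_on S A"
  using assms
proof (induction S rule: finite_induct)
  case empty
  then show ?case by (simp add: det_on_def)
next
  case (insert k V)
  have eq: "\<phi> ` insert k V = insert (\<phi> k) (\<phi> ` V)" by simp
  have k: "\<phi> k \<notin> \<phi> ` V" using insert.hyps(2) insert.prems(1) by auto
  have s': "symm_on (insert (\<phi> k) (\<phi> ` V)) A'" and p': "posdef_on (insert (\<phi> k) (\<phi> ` V)) A'"
    using insert.prems unfolding eq by auto
  have fV: "finite (\<phi> ` V)" using insert.hyps by simp
  have sV: "symm_on (\<phi> ` V) A'" by (rule symm_on_subset[OF s']) auto
  have pV: "posdef_on (\<phi> ` V) A'" by (rule posdef_on_subset[OF p']) (use fV in auto)
  interpret V: relabel V "\<phi> ` V" \<phi> A A'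
    using insert by unfold_locales (auto simp: bij_betw_def inj_on_insert)
  interpret U: relabel "insert k V" "insert (\<phi> k) (\<phi> ` V)" \<phi> A A'
    using insert by unfold_locales (auto simp: bij_betw_def)
  have IH: "det_on (\<phi> ` V) A' = det_on V A"
    using insert.prems sV pV by (intro insert.IH) (auto simp: inj_on_insert)
  have "schur (\<phi> ` V) A' (\<phi> k) = schur V A k"
    unfolding schur_def V.sum_re using V.inv_re[OF sV pV] insert.prems(2) by simp
  then show ?case
    unfolding eq using det_insert[OF fV k s' pV] det_insert[OF insert.hyps U.symm_re[OF s']] V.posdef_re pV IH by simp
qed

lemma nu_dens_re:
  assumes fin: "finite S" and bij: "bij_betw \<phi> S S'" and W': "weights_on S' W"
    and W: "\<And>i j. i \<in> S \<Longrightarrow> j \<in> S \<Longrightarrow> W (\<phi> i) (\<phi> j) = W i j" and \<eta>: "\<And>i. i \<in> S \<Longrightarrow> \<eta>' (\<phi> i) = \<eta> i"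
  shows "nu_dens S' W \<eta>' x = nu_dens S W \<eta> (\<lambda>i\<in>S. x (\<phi> i))"
proof -
  let ?b = "\<lambda>i\<in>S. x (\<phi> i)"
  interpret relabel S S' \<phi> "Hmat W ?b" "Hmat W x"
  proof
    fix i j assume ij: "i \<in> S" "j \<in> S"
    have "\<phi> i = \<phi> j \<longleftrightarrow> i = j" using bij ij by (auto simp: bij_betw_def inj_on_def)
    then show "Hmat W x (\<phi> i) (\<phi> j) = Hmat W ?b i j" using W[OF ij] ij by (simp add: Hmat_def)
  qed (use fin bij in auto)
  have S': "S' = \<phi> ` S" using bij by (simp add: bij_betw_def)
  show ?thesis
  proof (cases "posdef_on S' (Hmat W x)")
    case False
    then show ?thesis using posdef_re by (simp add: nu_dens_def dom_fin_def)
  next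
    case True
    note s = Hmat_symm[OF W', of x]
    have det: "det_on S' (Hmat W x) = det_on S (Hmat W ?b)"
      unfolding S' using s True bij A by (intro det_re fin) (auto simp: S' bij_betw_def)
    have c: "card S' = card S" using bij_betw_same_card[OF bij] by simp
    have h: "(\<Sum>i\<in>S'. \<Sum>j\<in>S'. Hmat W x i j) = (\<Sum>i\<in>S. \<Sum>j\<in>S. Hmat W ?b i j)"
      unfolding sum_re using A by (intro sum.cong refl) simp
    have q: "(\<Sum>i\<in>S'. \<Sum>j\<in>S'. \<eta>' i * inv_on S' (Hmat W x) i j * \<eta>' j) = (\<Sum>i\<in>S. \<Sum>j\<in>S. \<eta> i * inv_on S (Hmat W ?b) i j * \<eta> j)"
      unfolding sum_re using inv_re[OF s True] \<eta> by (intro sum.cong refl) simp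
    have e: "(\<Sum>i\<in>S'. \<eta>' i) = (\<Sum>i\<in>S. \<eta> i)" unfolding sum_re using \<eta> by simp
    show ?thesis unfolding nu_dens_def det c h q e using True posdef_re by (simp add: dom_fin_def)
  qed
qed

lemma PiM_lborel_re:
  fixes S S' :: "'a set" and \<phi> :: "'a \<Rightarrow> 'a"
  assumes fin: "finite S" and bij: "bij_betw \<phi> S S'"
  shows "distr (PiM S' (\<lambda>_. lborel)) (PiM S (\<lambda>_. lborel :: real measure)) (\<lambda>x. \<lambda>i\<in>S. x (\<phi> i)) = PiM S (\<lambda>_. lborel)"
    and "(\<lambda>x. \<lambda>i\<in>S. x (\<phi> i)) \<in> measurable (PiM S' (\<lambda>_. lborel :: real measure)) (PiM S (\<lambda>_. lborel))"
proof -
  interpret product_sigma_finite "\<lambda>_::'a. lborel :: real measure" by unfold_locales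
  have fin': "finite S'" using fin bij bij_betw_finite by blast
  have in': "i \<in> S \<Longrightarrow> \<phi> i \<in> S'" for i using bij by (auto simp: bij_betw_def)
  show m: "(\<lambda>x. \<lambda>i\<in>S. x (\<phi> i)) \<in> measurable (PiM S' (\<lambda>_. lborel :: real measure)) (PiM S (\<lambda>_. lborel))"
    using in' by (intro measurable_restrict measurable_component_singleton)
  show "distr (PiM S' (\<lambda>_. lborel)) (PiM S (\<lambda>_. lborel :: real measure)) (\<lambda>x. \<lambda>i\<in>S. x (\<phi> i)) = PiM S (\<lambda>_. lborel)"
  proof (rule PiM_eqI[OF fin])
    fix B :: "'a \<Rightarrow> real set" assume B: "\<And>i. i \<in> S \<Longrightarrow> B i \<in> sets lborel"
    let ?B' = "\<lambda>j. B (inv_into S \<phi> j)"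
    have iv: "inv_into S \<phi> (\<phi> i) = i" if "i \<in> S" for i using bij_betw_inv_into_left[OF bij that] .
    have ii: "inv_into S \<phi> j \<in> S \<and> \<phi> (inv_into S \<phi> j) = j" if "j \<in> S'" for j
      using that bij by (auto simp: bij_betw_def inv_into_into f_inv_into_f)
    have "emeasure (distr (PiM S' (\<lambda>_. lborel)) (PiM S (\<lambda>_. lborel)) (\<lambda>x. \<lambda>i\<in>S. x (\<phi> i))) (Pi\<^sub>E S B)
      = emeasure (PiM S' (\<lambda>_. lborel)) ((\<lambda>x. \<lambda>i\<in>S. x (\<phi> i)) -` Pi\<^sub>E S B \<inter> space (PiM S' (\<lambda>_. lborel)))"
      using m B fin by (intro emeasure_distr) (auto intro!: sets_PiM_I_finite)
    also have "(\<lambda>x. \<lambda>i\<in>S. x (\<phi> i)) -` Pi\<^sub>E S B \<inter> space (PiM S' (\<lambda>_. lborel)) = Pi\<^sub>E S' ?B'"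
    proof (intro set_eqI iffI)
      fix x assume "x \<in> (\<lambda>x. \<lambda>i\<in>S. x (\<phi> i)) -` Pi\<^sub>E S B \<inter> space (PiM S' (\<lambda>_. lborel))"
      then have x: "x \<in> extensional S'" "\<And>i. i \<in> S \<Longrightarrow> x (\<phi> i) \<in> B i" by (auto simp: space_PiM PiE_def Pi_def)
      show "x \<in> Pi\<^sub>E S' ?B'"
      proof (rule PiE_I)
        fix j assume "j \<in> S'"
        then have j: "inv_into S \<phi> j \<in> S" "\<phi> (inv_into S \<phi> j) = j" using ii by auto
        from x(2)[OF j(1)] show "x j \<in> ?B' j" unfolding j(2) .
      next
        fix j assume "j \<notin> S'"
        then show "x j = undefined" using x(1) by (rule extensional_arb[rotated])
      qed
    next
      fix x assume x: "x \<in> Pi\<^sub>E S' ?B'"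
      have "x (\<phi> i) \<in> B i" if "i \<in> S" for i using x in'[OF that] iv[OF that] by (auto simp: PiE_def Pi_def)
      then show "x \<in> (\<lambda>x. \<lambda>i\<in>S. x (\<phi> i)) -` Pi\<^sub>E S B \<inter> space (PiM S' (\<lambda>_. lborel))"
        using x by (auto simp: space_PiM PiE_def)
    qed
    also have "emeasure (PiM S' (\<lambda>_. lborel)) (Pi\<^sub>E S' ?B') = (\<Prod>j\<in>S'. emeasure lborel (?B' j))"
      by (rule emeasure_PiM[OF fin']) (use B ii in blast)
    also have "\<dots> = (\<Prod>i\<in>S. emeasure lborel (B i))"
      using prod.reindex_bij_betw[OF bij, of "\<lambda>j. emeasure lborel (?B' j)"] iv by (simp cong: prod.cong)
    finally show "emeasure (distr (PiM S' (\<lambda>_. lborel)) (PiM S (\<lambda>_. lborel)) (\<lambda>x. \<lambda>i\<in>S. x (\<phi> i))) (Pi\<^sub>E S B)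
      = (\<Prod>i\<in>S. emeasure lborel (B i))" .
  qed simp
qed

lemma nu_fin_re:
  assumes fin: "finite S" and bij: "bij_betw \<phi> S S'" and W': "weights_on S' W" and WS: "weights_on S W"
    and W: "\<And>i j. i \<in> S \<Longrightarrow> j \<in> S \<Longrightarrow> W (\<phi> i) (\<phi> j) = W i j" and \<eta>: "\<And>i. i \<in> S \<Longrightarrow> \<eta>' (\<phi> i) = \<eta> i"
    and F: "F \<in> borel_measurable (PiM S (\<lambda>_. borel))"
  shows "(\<integral>\<^sup>+x. F (\<lambda>i\<in>S. x (\<phi> i)) \<partial>nu_fin S' W \<eta>') = (\<integral>\<^sup>+x. F x \<partial>nu_fin S W \<eta>)"
proof -
  let ?t = "\<lambda>x. \<lambda>i\<in>S. x (\<phi> i)"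
  have fin': "finite S'" using fin bij bij_betw_finite by blast
  have lb: "sets (PiM S (\<lambda>_. borel :: real measure)) = sets (PiM S (\<lambda>_. lborel))"
    by (intro sets_PiM_cong) auto
  have F'[measurable]: "F \<in> borel_measurable (PiM S (\<lambda>_. lborel))"
    using F by (simp add: measurable_cong_sets[OF lb refl])
  note t[measurable] = PiM_lborel_re(2)[OF fin bij]
  have de: "nu_dens S' W \<eta>' x = nu_dens S W \<eta> (?t x)" for x
    by (rule nu_dens_re[where S'=S' and S=S and \<phi>=\<phi> and \<eta>=\<eta> and \<eta>'=\<eta>' and W=W]) (fact fin bij W' W \<eta>)+
  note [measurable] = nu_dens_measurable'[OF fin' W'] nu_dens_measurable'[OF fin WS]
  have "(\<integral>\<^sup>+x. F (?t x) \<partial>nu_fin S' W \<eta>') = (\<integral>\<^sup>+x. ennreal (nu_dens S' W \<eta>' x) * F (?t x) \<partial>PiM S' (\<lambda>_. lborel))"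
    unfolding nu_fin_dens by (rule nn_integral_density) measurable
  also have "\<dots> = (\<integral>\<^sup>+x. ennreal (nu_dens S W \<eta> (?t x)) * F (?t x) \<partial>PiM S' (\<lambda>_. lborel))"
    unfolding de ..
  also have "\<dots> = (\<integral>\<^sup>+x. ennreal (nu_dens S W \<eta> x) * F x \<partial>distr (PiM S' (\<lambda>_. lborel)) (PiM S (\<lambda>_. lborel)) ?t)"
    by (rule nn_integral_distr[symmetric]) measurable
  also have "\<dots> = (\<integral>\<^sup>+x. F x \<partial>nu_fin S W \<eta>)"
    unfolding PiM_lborel_re(1)[OF fin bij] nu_fin_dens by (rule nn_integral_density[symmetric]) measurable
  finally show ?thesis .
qed

section \<open>Escape through two branches\<close>

context wtree
begin

text \<open>Versions of \<open>green\<close> and \<open>inflow\<close> that are measurable on the whole space of potentials,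
  because the inverse is replaced by \<open>0\<close> where the matrix is not positive definite. They are
  evaluated at the sums of the jump rates, which may differ from the potential at \<open>i0\<close>.\<close>

definition green0_n :: "'v \<Rightarrow> nat \<Rightarrow> ('v \<Rightarrow> real) \<Rightarrow> real" where
  "green0_n y n b = (if posdef_on (Sb y n) (Hmat W b) then green_n y n b else 0)"

definition inflow0_n :: "'v \<Rightarrow> nat \<Rightarrow> ('v \<Rightarrow> real) \<Rightarrow> real" where
  "inflow0_n y n b = (if posdef_on (Sb y n) (Hmat W b) then inflow_n y n b else 0)"

definition green0 :: "'v \<Rightarrow> ('v \<Rightarrow> real) \<Rightarrow> real" where "green0 y b = lim (\<lambda>n. green0_n y n b)"
definition inflow0 :: "'v \<Rightarrow> ('v \<Rightarrow> real) \<Rightarrow> real" where "inflow0 y b = lim (\<lambda>n. inflow0_n y n b)"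

lemma branch_cong:
  assumes "\<And>i. i \<in> Sb y n \<Longrightarrow> b i = b' i"
  shows "green0_n y n b = green0_n y n b'" "inflow0_n y n b = inflow0_n y n b'"
proof -
  have "Hmat W b i j = Hmat W b' i j" if "i \<in> Sb y n" for i j using assms[OF that] by (rule Hmat_cong)
  then have "posdef_on (Sb y n) (Hmat W b) = posdef_on (Sb y n) (Hmat W b')"
    "inv_on (Sb y n) (Hmat W b) = inv_on (Sb y n) (Hmat W b')"
    by (intro posdef_on_cong inv_on_cong; simp)+
  then show "green0_n y n b = green0_n y n b'" "inflow0_n y n b = inflow0_n y n b'"
    by (simp_all add: green0_n_def inflow0_n_def green_n_def inflow_n_def)
qed

lemma branch_eq:
  assumes "\<beta> \<in> Dm" "\<And>i. i \<in> sub y \<Longrightarrow> b i = \<beta> i"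
  shows "green0_n y n b = green_n y n \<beta>" "inflow0_n y n b = inflow_n y n \<beta>"
proof -
  have c: "\<And>i. i \<in> Sb y n \<Longrightarrow> b i = \<beta> i" using assms(2) by (simp add: Sb_def)
  show "green0_n y n b = green_n y n \<beta>" "inflow0_n y n b = inflow_n y n \<beta>"
    using branch_cong[of y n b \<beta>] c pd[OF assms(1) Sb_finite Sb_T, of y n] by (simp_all add: green0_n_def inflow0_n_def)
qed

lemma M_eq:
  assumes "conv \<beta>" "\<And>i. i \<in> sub y \<Longrightarrow> b i = \<beta> i"
  shows "green0 y b = green y \<beta>" "inflow0 y b = inflow y \<beta>"
  unfolding green0_def inflow0_def green_def inflow_def using branch_eq[OF dm[OF assms(1)] assms(2)] by simp_all

lemma green0_n_bnM_measurable:
  assumes b: "\<And>j. j \<in> Sb y n \<Longrightarrow> (\<lambda>x. b x j) \<in> borel_measurable N"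
  shows "(\<lambda>x. green0_n y n (b x)) \<in> borel_measurable N" "(\<lambda>x. inflow0_n y n (b x)) \<in> borel_measurable N"
proof -
  define I where "I x i j = (if posdef_on (Sb y n) (Hmat W (b x)) then inv_on (Sb y n) (Hmat W (b x)) i j else 0)" for x i j
  have [measurable]: "(\<lambda>x. I x i j) \<in> borel_measurable N" for i j
    unfolding I_def by (rule Hmat_inv_measurable(2)[where W="\<lambda>_. W", OF Sb_finite _ b weights_U[OF Sb_T]]) auto
  have a: "green0_n y n (b x) = I x y y" for x by (simp add: green0_n_def green_n_def I_def)
  have c: "inflow0_n y n (b x) = (\<Sum>z\<in>Sb y n. I x y z * eta (Sb y n) z) - w * I x y y" for x
    by (simp add: inflow0_n_def inflow_n_def green_n_def I_def)
  show "(\<lambda>x. green0_n y n (b x)) \<in> borel_measurable N" unfolding a by measurable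
  show "(\<lambda>x. inflow0_n y n (b x)) \<in> borel_measurable N" unfolding c by measurable
qed

lemma green0_bM_measurable:
  assumes b: "\<And>j. j \<in> T \<Longrightarrow> (\<lambda>x. b x j) \<in> borel_measurable N"
  shows "(\<lambda>x. green0 y (b x)) \<in> borel_measurable N" "(\<lambda>x. inflow0 y (b x)) \<in> borel_measurable N"
proof -
  have b': "\<And>n j. j \<in> Sb y n \<Longrightarrow> (\<lambda>x. b x j) \<in> borel_measurable N" using b Sb_T by blast
  show "(\<lambda>x. green0 y (b x)) \<in> borel_measurable N" "(\<lambda>x. inflow0 y (b x)) \<in> borel_measurable N"
    unfolding green0_def inflow0_def by (intro borel_measurable_lim_metric green0_n_bnM_measurable b'; assumption)+
qed

text \<open>Any two subtrees below the root are isomorphic to any finite depth, because every vertex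
  other than the root has \<open>d - 1\<close> children.\<close>

lemma branch_iso:
  assumes y: "y \<in> T" "y \<noteq> r" and y': "y' \<in> T" "y' \<noteq> r"
  shows "\<exists>\<phi>. bij_betw \<phi> (Sb y (lev y + k)) (Sb y' (lev y' + k)) \<and> \<phi> y = y'
    \<and> (\<forall>z\<in>Sb y (lev y + k) - {y}. par (\<phi> z) = \<phi> (par z))
    \<and> (\<forall>z\<in>Sb y (lev y + k). lev (\<phi> z) + lev y = lev z + lev y')"
proof (induction k)
  case 0
  have "Sb x (lev x + 0) = {x}" if "x \<in> T" for x
    using sub_self[OF that] sub_level_eq[of _ x] sub_T[of _ x] that by (fastforce simp: Sb_def tball_iff)
  then show ?case using y y' by (intro exI[of _ "\<lambda>_. y'"]) auto
next
  case (Suc k)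
  let ?N = "lev y + k" and ?N' = "lev y' + k"
  let ?S = "Sb y ?N" and ?S' = "Sb y' ?N'" and ?R = "Sb y (Suc ?N)" and ?R' = "Sb y' (Suc ?N')"
  obtain \<phi> where bij: "bij_betw \<phi> ?S ?S'" and py: "\<phi> y = y'"
    and pp: "\<And>z. z \<in> ?S \<Longrightarrow> z \<noteq> y \<Longrightarrow> par (\<phi> z) = \<phi> (par z)"
    and pl: "\<And>z. z \<in> ?S \<Longrightarrow> lev (\<phi> z) + lev y = lev z + lev y'"
    using Suc.IH by auto
  have yS: "y \<in> ?S" using Sb_self[OF y(1)] by simp
  have \<phi>S: "z \<in> ?S \<Longrightarrow> \<phi> z \<in> ?S'" for z using bij by (auto simp: bij_betw_def)
  have nr: "z \<noteq> r" if "z \<in> Sb x n" "x \<in> T" "x \<noteq> r" for z x n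
  proof -
    have "lev x \<le> lev z" using that(1) sub_T by (auto simp: Sb_def)
    then show ?thesis using lev_0_iff[OF that(2)] that(3) by auto
  qed
  have STT: "z \<in> Sb x n \<Longrightarrow> z \<in> T" for z x n using Sb_T by blast
  have "\<exists>\<sigma>. bij_betw \<sigma> (ch z) (ch (\<phi> z))" if z: "z \<in> ?S" for z
    using card_ch[OF STT[OF z]] card_ch[OF STT[OF \<phi>S[OF z]]] nr[OF z y] nr[OF \<phi>S[OF z] y']
      ch_finite[OF STT[OF z]] ch_finite[OF STT[OF \<phi>S[OF z]]] by (intro finite_same_card_bij) auto
  then have "\<forall>z. \<exists>\<sigma>. z \<in> ?S \<longrightarrow> bij_betw \<sigma> (ch z) (ch (\<phi> z))" by blast
  then obtain \<sigma> where \<sigma>: "\<And>z. z \<in> ?S \<Longrightarrow> bij_betw (\<sigma> z) (ch z) (ch (\<phi> z))"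
    using choice[of "\<lambda>z \<sigma>. z \<in> ?S \<longrightarrow> bij_betw \<sigma> (ch z) (ch (\<phi> z))"] by blast
  define \<psi> where "\<psi> c = (if lev c = Suc ?N then \<sigma> (par c) c else \<phi> c)" for c
  have R_cases: "c \<in> ?R \<longleftrightarrow> c \<in> ?S \<or> (\<exists>z\<in>?S. lev z = ?N \<and> c \<in> ch z)" for c
  proof
    assume c: "c \<in> ?R"
    show "c \<in> ?S \<or> (\<exists>z\<in>?S. lev z = ?N \<and> c \<in> ch z)"
    proof (cases "lev c = Suc ?N")
      case True
      then have cy: "c \<noteq> y" by auto
      have cs: "c \<in> sub y" "c \<in> T" using c STT by (auto simp: Sb_def)
      note p = sub_par[OF cs(1) cy]
      have "lev (par c) = ?N" using par(2)[OF cs(2) p(2)] True by simp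
      then have "par c \<in> ?S" using p(1) par_T[OF cs(2) p(2)] by (simp add: Sb_def tball_iff)
      moreover have "c \<in> ch (par c)" using cs p by (simp add: ch_def)
      ultimately show ?thesis using \<open>lev (par c) = ?N\<close> by blast
    next
      case False
      then show ?thesis using c by (auto simp: Sb_def tball_iff)
    qed
  next
    assume "c \<in> ?S \<or> (\<exists>z\<in>?S. lev z = ?N \<and> c \<in> ch z)"
    then show "c \<in> ?R"
    proof
      assume "\<exists>z\<in>?S. lev z = ?N \<and> c \<in> ch z"
      then obtain z where z: "z \<in> ?S" "lev z = ?N" "c \<in> ch z" by blast
      then have "c \<in> sub y" using sub_ch by (auto simp: Sb_def)
      then show ?thesis using chD[OF z(3)] z(2) by (simp add: Sb_def tball_iff)
    qed (auto simp: Sb_def tball_iff)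
  qed
  have R'_cases: "c \<in> ?R' \<Longrightarrow> c \<in> ?S' \<or> (\<exists>z\<in>?S'. lev z = ?N' \<and> c \<in> ch z)" for c
  proof (cases "lev c = Suc ?N'")
    case True
    assume c: "c \<in> ?R'"
    have cy: "c \<noteq> y'" using True by auto
    have cs: "c \<in> sub y'" "c \<in> T" using c STT by (auto simp: Sb_def)
    note p = sub_par[OF cs(1) cy]
    have "lev (par c) = ?N'" using par(2)[OF cs(2) p(2)] True by simp
    then have "par c \<in> ?S'" using p(1) par_T[OF cs(2) p(2)] by (simp add: Sb_def tball_iff)
    moreover have "c \<in> ch (par c)" using cs p by (simp add: ch_def)
    ultimately show ?thesis using \<open>lev (par c) = ?N'\<close> by blast
  next
    case False
    assume "c \<in> ?R'"
    then show ?thesis using False by (auto simp: Sb_def tball_iff)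
  qed
  have lS: "lev z \<le> ?N" if "z \<in> ?S" for z using that by (simp add: Sb_def tball_iff)
  have lS': "lev z \<le> ?N'" if "z \<in> ?S'" for z using that by (simp add: Sb_def tball_iff)
  have \<psi>S: "\<psi> c = \<phi> c" if "c \<in> ?S" for c using lS[OF that] by (simp add: \<psi>_def)
  have \<psi>C: "\<psi> c = \<sigma> z c \<and> \<psi> c \<in> ch (\<phi> z)" if z: "z \<in> ?S" "lev z = ?N" "c \<in> ch z" for z c
  proof -
    have "\<psi> c = \<sigma> z c" using chD[OF z(3)] z(2) by (simp add: \<psi>_def)
    then show ?thesis using \<sigma>[OF z(1)] z(3) by (auto simp: bij_betw_def)
  qed
  have l\<phi>: "lev (\<phi> z) = ?N'" if "z \<in> ?S" "lev z = ?N" for z using pl[OF that(1)] that(2) by simp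
  have "bij_betw \<psi> ?R ?R'"
    unfolding bij_betw_def
  proof
    show "inj_on \<psi> ?R"
    proof (rule inj_onI)
      fix c c' assume cc: "c \<in> ?R" "c' \<in> ?R" "\<psi> c = \<psi> c'"
      have mixed: False if "a \<in> ?S" "z \<in> ?S" "lev z = ?N" "b \<in> ch z" "\<psi> a = \<psi> b" for a b z
      proof -
        have "\<psi> b \<in> ch (\<phi> z)" using \<psi>C[OF that(2-4)] by blast
        then have "lev (\<psi> b) = Suc ?N'" using chD[of "\<psi> b" "\<phi> z"] l\<phi>[OF that(2,3)] by simp
        moreover have "lev (\<psi> a) \<le> ?N'" using lS'[OF \<phi>S[OF that(1)]] \<psi>S[OF that(1)] by simp
        ultimately show False using that(5) by simp
      qed
      from cc(1)[unfolded R_cases] cc(2)[unfolded R_cases] show "c = c'"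
      proof (elim disjE bexE conjE)
        assume "c \<in> ?S" "c' \<in> ?S"
        then show ?thesis using cc(3) \<psi>S bij by (auto simp: bij_betw_def inj_on_def)
      next
        fix z assume "c \<in> ?S" "z \<in> ?S" "lev z = ?N" "c' \<in> ch z"
        then show ?thesis using mixed cc(3) by blast
      next
        fix z assume "c' \<in> ?S" "z \<in> ?S" "lev z = ?N" "c \<in> ch z"
        then show ?thesis using mixed[of c' z c] cc(3) by simp
      next
        fix z z' assume z: "z \<in> ?S" "lev z = ?N" "c \<in> ch z" and z': "z' \<in> ?S" "lev z' = ?N" "c' \<in> ch z'"
        have "\<psi> c \<in> ch (\<phi> z)" "\<psi> c \<in> ch (\<phi> z')" using \<psi>C[OF z] \<psi>C[OF z'] cc(3) by auto
        then have "\<phi> z = \<phi> z'" using chD[of "\<psi> c" "\<phi> z"] chD[of "\<psi> c" "\<phi> z'"] by simp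
        then have "z = z'" using bij z(1) z'(1) by (auto simp: bij_betw_def inj_on_def)
        then have "\<sigma> z c = \<sigma> z c'" using \<psi>C[OF z] \<psi>C[OF z'] cc(3) by simp
        then show ?thesis using \<sigma>[OF z(1)] z(3) z'(3) \<open>z = z'\<close> by (auto simp: bij_betw_def inj_on_def)
      qed
    qed
    show "\<psi> ` ?R = ?R'"
    proof (intro subset_antisym subsetI)
      fix v assume "v \<in> \<psi> ` ?R"
      then obtain c where c: "c \<in> ?R" "v = \<psi> c" by blast
      from c(1)[unfolded R_cases] show "v \<in> ?R'"
      proof (elim disjE bexE conjE)
        assume "c \<in> ?S"
        then have "v \<in> ?S'" using c(2) \<psi>S \<phi>S by simp
        then show ?thesis by (auto simp: Sb_def tball_iff)
      next
        fix z assume z: "z \<in> ?S" "lev z = ?N" "c \<in> ch z"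
        have vc: "v \<in> ch (\<phi> z)" unfolding c(2) using \<psi>C[OF z] by blast
        then have "v \<in> sub y'" using sub_ch[of "\<phi> z" y' v] \<phi>S[OF z(1)] by (auto simp: Sb_def)
        then show ?thesis using chD[OF vc] l\<phi>[OF z(1,2)] by (simp add: Sb_def tball_iff)
      qed
    next
      fix v assume "v \<in> ?R'"
      from R'_cases[OF this] show "v \<in> \<psi> ` ?R"
      proof (elim disjE bexE conjE)
        assume "v \<in> ?S'"
        then obtain c where "c \<in> ?S" "v = \<phi> c" using bij by (auto simp: bij_betw_def)
        then show ?thesis using \<psi>S R_cases by (intro image_eqI[of _ _ c]) auto
      next
        fix u assume u: "u \<in> ?S'" "lev u = ?N'" "v \<in> ch u"
        then obtain z where z: "z \<in> ?S" "u = \<phi> z" using bij by (auto simp: bij_betw_def)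
        have lz: "lev z = ?N" using pl[OF z(1)] z(2) u(2) by simp
        obtain c where c: "c \<in> ch z" "v = \<sigma> z c" using \<sigma>[OF z(1)] u(3) z(2) by (auto simp: bij_betw_def)
        then have "v = \<psi> c" using \<psi>C[OF z(1) lz c(1)] by simp
        then show ?thesis using R_cases[of c] z(1) lz c(1) by (intro image_eqI[of _ _ c]) auto
      qed
    qed
  qed
  moreover have "\<psi> y = y'" using \<psi>S[OF yS] py by simp
  moreover have "par (\<psi> c) = \<psi> (par c) \<and> lev (\<psi> c) + lev y = lev c + lev y'" if c: "c \<in> ?R" "c \<noteq> y" for c
    using c(1)[unfolded R_cases]
  proof (elim disjE bexE conjE)
    assume cS: "c \<in> ?S"
    have "par c \<in> ?S" using sub_par[of c y] cS c(2) par[of c] par_T[of c] STT[OF cS] by (auto simp: Sb_def tball_iff)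
    then show ?thesis using \<psi>S cS pp[OF cS c(2)] pl[OF cS] by simp
  next
    fix z assume z: "z \<in> ?S" "lev z = ?N" "c \<in> ch z"
    have "\<psi> c \<in> ch (\<phi> z)" using \<psi>C[OF z] by blast
    then show ?thesis using chD[of "\<psi> c" "\<phi> z"] chD[OF z(3)] \<psi>S[OF z(1)] l\<phi>[OF z(1,2)] z(2) by simp
  qed
  moreover have "lev (\<psi> y) + lev y = lev y + lev y'" using \<open>\<psi> y = y'\<close> by simp
  ultimately have "bij_betw \<psi> ?R ?R' \<and> \<psi> y = y' \<and> (\<forall>z\<in>?R - {y}. par (\<psi> z) = \<psi> (par z))
    \<and> (\<forall>z\<in>?R. lev (\<psi> z) + lev y = lev z + lev y')" by blast
  then show ?case unfolding add_Suc_right by blast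
qed

text \<open>A bounded continuous function that vanishes only at \<open>0\<close>. Composed with it, the
  inflow is integrable, and bounded convergence applies.\<close>

definition clip :: "real \<Rightarrow> real" where "clip b = 1 - exp (- \<bar>b\<bar>)"

lemma clip: "0 \<le> clip b" "clip b \<le> 1" "clip b = 0 \<longleftrightarrow> b = 0"
  by (auto simp: clip_def)

lemma clip_measurable [measurable]: "clip \<in> borel_measurable borel"
  unfolding clip_def[abs_def] by measurable

lemma clip_cont: "X \<longlonglongrightarrow> x \<Longrightarrow> (\<lambda>n. clip (X n)) \<longlonglongrightarrow> clip x"
  unfolding clip_def by (intro tendsto_intros)

lemma inflow0_n_PiM: "(\<lambda>x. ennreal (clip (inflow0_n y n x))) \<in> borel_measurable (PiM (Sb y n) (\<lambda>_. borel))"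
  using green0_n_bnM_measurable(2)[of y n "\<lambda>x. x", OF component_borel] by measurable

lemma inflow0_n_nu: "inflow0_n y n \<in> borel_measurable nu" and inflow0_nu: "inflow0 y \<in> borel_measurable nu"
proof -
  show "inflow0_n y n \<in> borel_measurable nu"
    using green0_n_bnM_measurable(2)[of y n "\<lambda>x. x", OF component_nu] Sb_T by blast
  show "inflow0 y \<in> borel_measurable nu"
    using green0_bM_measurable(2)[of "\<lambda>x. x", OF component_nu] by blast
qed

lemma inflow0_n_law:
  "(\<integral>\<^sup>+\<beta>. ennreal (clip (inflow0_n y n \<beta>)) \<partial>nu) = (\<integral>\<^sup>+x. ennreal (clip (inflow0_n y n x)) \<partial>nu_fin (Sb y n) W (eta (Sb y n)))"
proof -
  let ?S = "Sb y n"
  have "(\<integral>\<^sup>+x. ennreal (clip (inflow0_n y n x)) \<partial>nu_fin ?S W (eta ?S))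
    = (\<integral>\<^sup>+x. ennreal (clip (inflow0_n y n x)) \<partial>distr nu (PiM ?S (\<lambda>_. borel)) (\<lambda>\<beta>. restrict \<beta> ?S))"
    using nu_restrict[OF Sb_finite Sb_T, of y n] by simp
  also have "\<dots> = (\<integral>\<^sup>+\<beta>. ennreal (clip (inflow0_n y n (restrict \<beta> ?S))) \<partial>nu)"
    by (rule nn_integral_distr[OF restrict_nu[OF Sb_T]]) (simp add: inflow0_n_PiM)
  also have "\<dots> = (\<integral>\<^sup>+\<beta>. ennreal (clip (inflow0_n y n \<beta>)) \<partial>nu)"
    by (intro nn_integral_cong arg_cong[where f="\<lambda>b. ennreal (clip b)"] branch_cong(2)) simp
  finally show ?thesis by simp
qed

text \<open>The inflow at depth \<open>k\<close> is a function of the potential in the subtree to depth \<open>k\<close>,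
  whose law is the finite-volume measure. The isomorphism carries it to the other subtree.\<close>

lemma inflow0_n_symmetric:
  assumes y: "y \<in> T" "y \<noteq> r" and y': "y' \<in> T" "y' \<noteq> r"
  shows "(\<integral>\<^sup>+\<beta>. ennreal (clip (inflow0_n y (lev y + k) \<beta>)) \<partial>nu) = (\<integral>\<^sup>+\<beta>. ennreal (clip (inflow0_n y' (lev y' + k) \<beta>)) \<partial>nu)"
proof -
  let ?S = "Sb y (lev y + k)" and ?S' = "Sb y' (lev y' + k)"
  obtain \<phi> where bij: "bij_betw \<phi> ?S ?S'" and py: "\<phi> y = y'"
    and pp: "\<And>z. z \<in> ?S \<Longrightarrow> z \<noteq> y \<Longrightarrow> par (\<phi> z) = \<phi> (par z)"
    using branch_iso[OF y y', of k] by auto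
  have inS': "z \<in> ?S \<Longrightarrow> \<phi> z \<in> ?S'" for z using bij by (auto simp: bij_betw_def)
  have inj: "u \<in> ?S \<Longrightarrow> v \<in> ?S \<Longrightarrow> \<phi> u = \<phi> v \<longleftrightarrow> u = v" for u v using bij by (auto simp: bij_betw_def inj_on_def)
  have yS: "y \<in> ?S" using Sb_self[OF y(1)] by simp
  have nr: "z \<noteq> r" if "z \<in> Sb x n" "x \<in> T" "x \<noteq> r" for z x n
  proof -
    have "lev x \<le> lev z" using that(1) sub_T by (auto simp: Sb_def)
    then show ?thesis using lev_0_iff[OF that(2)] that(3) by auto
  qed
  have parS: "par u \<in> ?S" if "u \<in> ?S" "u \<noteq> y" for u
    using that sub_par[of u y] par[of u] par_T[of u] Sb_T by (auto simp: Sb_def tball_iff)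
  have pnot: "par x \<notin> Sb x n" if "x \<in> T" "x \<noteq> r" for x n using par_not_sub[OF that] by (simp add: Sb_def)
  have pe: "v = par u \<longleftrightarrow> \<phi> v = par (\<phi> u)" if uv: "u \<in> ?S" "v \<in> ?S" for u v
  proof (cases "u = y")
    case True
    have "v \<noteq> par u" using uv pnot[OF y] True by auto
    moreover have "\<phi> v \<noteq> par (\<phi> u)" using inS'[OF uv(2)] pnot[OF y'] True py by auto
    ultimately show ?thesis by simp
  next
    case False
    then show ?thesis using pp[OF uv(1)] inj[OF uv(2) parS[OF uv(1)]] by simp
  qed
  have edges: "{\<phi> u, \<phi> v} \<in> E \<longleftrightarrow> {u, v} \<in> E" if uv: "u \<in> ?S" "v \<in> ?S" for u v
  proof -
    have iff: "{a, b} \<in> E \<longleftrightarrow> b = par a \<or> a = par b" if "a \<in> T" "b \<in> T" "a \<noteq> r" "b \<noteq> r" for a b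
      using edge_par[of a b] par(1)[of a] par(1)[of b] edge_sym[of a b] that by auto
    have "u \<in> T" "v \<in> T" "\<phi> u \<in> T" "\<phi> v \<in> T" using uv inS' Sb_T by blast+
    then show ?thesis using pe[OF uv] pe[OF uv(2,1)] iff nr[OF uv(1) y] nr[OF uv(2) y]
        nr[OF inS'[OF uv(1)] y'] nr[OF inS'[OF uv(2)] y'] by simp
  qed
  have W: "W (\<phi> i) (\<phi> j) = W i j" if "i \<in> ?S" "j \<in> ?S" for i j
    using edges[OF that] by (simp add: edge_weight_def)
  have et: "eta ?S' (\<phi> i) = eta ?S i" if i: "i \<in> ?S" for i
  proof -
    have T: "i \<in> T" "\<phi> i \<in> T" using i inS' Sb_T by blast+
    have "bij_betw \<phi> (nbr i \<inter> ?S) (nbr (\<phi> i) \<inter> ?S')"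
      unfolding bij_betw_def
    proof
      show "inj_on \<phi> (nbr i \<inter> ?S)" using bij by (auto simp: bij_betw_def inj_on_def)
      show "\<phi> ` (nbr i \<inter> ?S) = nbr (\<phi> i) \<inter> ?S'"
      proof (intro subset_antisym subsetI)
        fix v assume "v \<in> nbr (\<phi> i) \<inter> ?S'"
        moreover then obtain u where "u \<in> ?S" "v = \<phi> u" using bij by (auto simp: bij_betw_def)
        ultimately show "v \<in> \<phi> ` (nbr i \<inter> ?S)" using edges[OF i] by auto
      qed (use edges[OF i] inS' in auto)
    qed
    then have "card (nbr i \<inter> ?S) = card (nbr (\<phi> i) \<inter> ?S')" by (rule bij_betw_same_card)
    moreover have "card (nbr v - U) = d - card (nbr v \<inter> U)" if "v \<in> T" for v U
      using nbr_finite[OF that] nbr_card[OF that] by (simp add: card_Diff_subset_Int)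
    ultimately show ?thesis using T by (simp add: eta_eq)
  qed
  have bre: "inflow0_n y' (lev y' + k) x = inflow0_n y (lev y + k) (\<lambda>i\<in>?S. x (\<phi> i))" for x
  proof -
    let ?b = "\<lambda>i\<in>?S. x (\<phi> i)"
    interpret relabel ?S ?S' \<phi> "Hmat W ?b" "Hmat W x"
    proof
      fix i j assume ij: "i \<in> ?S" "j \<in> ?S"
      then show "Hmat W x (\<phi> i) (\<phi> j) = Hmat W ?b i j" using W[OF ij] inj[OF ij] by (simp add: Hmat_def)
    qed (use Sb_finite bij in auto)
    show ?thesis
    proof (cases "posdef_on ?S' (Hmat W x)")
      case False
      then show ?thesis using posdef_re by (simp add: inflow0_n_def)
    next
      case True
      note i = inv_re[OF Hmat_symm[OF weights_U[OF Sb_T]] True]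
      have "(\<Sum>z\<in>?S'. inv_on ?S' (Hmat W x) y' z * eta ?S' z) = (\<Sum>z\<in>?S. inv_on ?S (Hmat W ?b) y z * eta ?S z)"
        unfolding sum_re using i[OF yS] et py by (intro sum.cong refl) simp
      moreover have "inv_on ?S' (Hmat W x) y' y' = inv_on ?S (Hmat W ?b) y y" using i[OF yS yS] py by simp
      ultimately show ?thesis using True posdef_re by (simp add: inflow0_n_def inflow_n_def green_n_def)
    qed
  qed
  have "(\<integral>\<^sup>+\<beta>. ennreal (clip (inflow0_n y' (lev y' + k) \<beta>)) \<partial>nu)
    = (\<integral>\<^sup>+x. ennreal (clip (inflow0_n y (lev y + k) (\<lambda>i\<in>?S. x (\<phi> i)))) \<partial>nu_fin ?S' W (eta ?S'))"
    by (subst inflow0_n_law) (simp only: bre)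
  also have "\<dots> = (\<integral>\<^sup>+x. ennreal (clip (inflow0_n y (lev y + k) x)) \<partial>nu_fin ?S W (eta ?S))"
    by (rule nu_fin_re[where F="\<lambda>x. ennreal (clip (inflow0_n y (lev y + k) x))" and S="?S" and S'="?S'" and \<phi>=\<phi> and W=W and \<eta>="eta ?S" and \<eta>'="eta ?S'"])
      (fact Sb_finite bij weights_U[OF Sb_T] W et inflow0_n_PiM)+
  finally show ?thesis unfolding inflow0_n_law by simp
qed

text \<open>The law of the potential on the union of the two truncated subtrees is a
  finite-volume measure without weights between the blocks, as both are connected to the rest
  of the tree through \<open>x\<close> and through the level below \<open>n\<close> only.\<close>

lemma inflow0_n_independent:
  assumes x: "y1 \<in> ch x" "y2 \<in> ch x" "y1 \<noteq> y2"
  shows "(\<integral>\<^sup>+\<beta>. ennreal (clip (inflow0_n y1 n \<beta>)) * ennreal (clip (inflow0_n y2 n \<beta>)) \<partial>nu)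
    = (\<integral>\<^sup>+\<beta>. ennreal (clip (inflow0_n y1 n \<beta>)) \<partial>nu) * (\<integral>\<^sup>+\<beta>. ennreal (clip (inflow0_n y2 n \<beta>)) \<partial>nu)"
proof -
  let ?S1 = "Sb y1 n" and ?S2 = "Sb y2 n"
  let ?U = "?S1 \<union> ?S2"
  note c1 = chD[OF x(1)] and c2 = chD[OF x(2)]
  have sd: "sub y1 \<inter> sub y2 = {}" using c1 c2 x(3) by (intro sub_disjoint) auto
  have disj: "?S1 \<inter> ?S2 = {}" using sd by (auto simp: Sb_def)
  have xs: "x \<notin> sub y1" "x \<notin> sub y2" using par_not_sub[of y1] par_not_sub[of y2] c1 c2 by auto
  have noE: "{i, j} \<notin> E" if "i \<in> sub y1" "j \<in> sub y2" for i j
  proof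
    assume e: "{i, j} \<in> E"
    have "j \<notin> sub y1" using that sd by auto
    from sub_boundary[OF e that(1) this] have "j = x" using c1 by simp
    then show False using that xs by simp
  qed
  have cross: "W i j = 0" if "i \<in> ?S1" "j \<in> ?S2" for i j
    using noE[of i j] that by (simp add: edge_weight_def Sb_def)
  have U: "finite ?U" "?U \<subseteq> T" using Sb_finite Sb_T by auto
  have et1: "eta ?U i = eta ?S1 i" if "i \<in> ?S1" for i
  proof -
    have "nbr i - ?U = nbr i - ?S1" using noE[of i] that by (auto simp: Sb_def)
    moreover have "i \<in> T" using that Sb_T by blast
    ultimately show ?thesis by (simp add: eta_eq)
  qed
  have et2: "eta ?U i = eta ?S2 i" if "i \<in> ?S2" for i
  proof -
    have "nbr i - ?U = nbr i - ?S2" using noE[of _ i] that edge_sym[of i] by (auto simp: Sb_def)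
    moreover have "i \<in> T" using that Sb_T by blast
    ultimately show ?thesis by (simp add: eta_eq)
  qed
  let ?F1 = "\<lambda>x. ennreal (clip (inflow0_n y1 n x))" and ?F2 = "\<lambda>x. ennreal (clip (inflow0_n y2 n x))"
  have r1: "(\<lambda>\<beta>. restrict \<beta> ?S1) \<in> measurable (PiM ?U (\<lambda>_. borel :: real measure)) (PiM ?S1 (\<lambda>_. borel))"
    and r2: "(\<lambda>\<beta>. restrict \<beta> ?S2) \<in> measurable (PiM ?U (\<lambda>_. borel :: real measure)) (PiM ?S2 (\<lambda>_. borel))"
    by (rule measurable_restrict_subset; auto)+
  have mm: "(\<lambda>\<beta>. ?F1 (restrict \<beta> ?S1) * ?F2 (restrict \<beta> ?S2)) \<in> borel_measurable (PiM ?U (\<lambda>_. borel))"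
    by (intro borel_measurable_times_ennreal measurable_compose[OF r1 inflow0_n_PiM] measurable_compose[OF r2 inflow0_n_PiM])
  have "(\<integral>\<^sup>+\<beta>. ?F1 \<beta> * ?F2 \<beta> \<partial>nu) = (\<integral>\<^sup>+\<beta>. ?F1 (restrict (restrict \<beta> ?U) ?S1) * ?F2 (restrict (restrict \<beta> ?U) ?S2) \<partial>nu)"
  proof (intro nn_integral_cong)
    fix \<beta> :: "'v \<Rightarrow> real"
    have "inflow0_n y1 n \<beta> = inflow0_n y1 n (restrict (restrict \<beta> ?U) ?S1)" "inflow0_n y2 n \<beta> = inflow0_n y2 n (restrict (restrict \<beta> ?U) ?S2)"
      by (rule branch_cong(2); simp)+
    then show "?F1 \<beta> * ?F2 \<beta> = ?F1 (restrict (restrict \<beta> ?U) ?S1) * ?F2 (restrict (restrict \<beta> ?U) ?S2)" by simp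
  qed
  also have "\<dots> = (\<integral>\<^sup>+\<beta>. ?F1 (restrict \<beta> ?S1) * ?F2 (restrict \<beta> ?S2) \<partial>distr nu (PiM ?U (\<lambda>_. borel)) (\<lambda>\<beta>. restrict \<beta> ?U))"
    by (rule nn_integral_distr[symmetric, OF restrict_nu[OF U(2)]]) (use mm in simp)
  also have "\<dots> = (\<integral>\<^sup>+\<beta>. ?F1 (restrict \<beta> ?S1) * ?F2 (restrict \<beta> ?S2) \<partial>nu_fin ?U W (eta ?U))"
    unfolding nu_restrict[OF U] ..
  also have "\<dots> = (\<integral>\<^sup>+\<beta>. ?F1 \<beta> \<partial>nu_fin ?S1 W (eta ?U)) * (\<integral>\<^sup>+\<beta>. ?F2 \<beta> \<partial>nu_fin ?S2 W (eta ?U))"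
    by (rule nu_fin_independent[OF Sb_finite Sb_finite disj weights_U[OF U(2)] cross inflow0_n_PiM inflow0_n_PiM])
  also have "nu_fin ?S1 W (eta ?U) = nu_fin ?S1 W (eta ?S1)" by (rule nu_fin_cong[OF et1])
  also have "nu_fin ?S2 W (eta ?U) = nu_fin ?S2 W (eta ?S2)" by (rule nu_fin_cong[OF et2])
  finally show ?thesis unfolding inflow0_n_law .
qed

definition mean_clip :: "'v \<Rightarrow> real" where "mean_clip y = (\<integral>\<beta>. clip (inflow0 y \<beta>) \<partial>nu)"

lemma inflow0_n_lim: "y \<in> T \<Longrightarrow> y \<noteq> r \<Longrightarrow> AE \<beta> in nu. (\<lambda>n. inflow0_n y n \<beta>) \<longlonglongrightarrow> inflow0 y \<beta>"
  using AE_conv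
proof eventually_elim
  case (elim \<beta>)
  then show ?case using inflow_n_lim[OF elim(3,1,2)] branch_eq(2)[OF dm[OF elim(3)], of y \<beta>] M_eq(2)[OF elim(3), of y \<beta>] by simp
qed

lemma clip_integral:
  assumes "f \<in> borel_measurable nu"
  shows "(\<integral>\<beta>. clip (f \<beta>) \<partial>nu) = enn2real (\<integral>\<^sup>+\<beta>. ennreal (clip (f \<beta>)) \<partial>nu)"
  using assms clip(1) by (intro integral_eq_nn_integral) auto

lemma mean_clip_lim:
  assumes "y \<in> T" "y \<noteq> r"
  shows "(\<lambda>n. \<integral>\<beta>. clip (inflow0_n y n \<beta>) \<partial>nu) \<longlonglongrightarrow> mean_clip y"
  unfolding mean_clip_def
proof (rule integral_dominated_convergence[where w="\<lambda>_. 1"])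
  interpret prob_space nu by (rule nu_prob)
  show "integrable nu (\<lambda>_. 1 :: real)" by simp
  show "AE \<beta> in nu. (\<lambda>n. clip (inflow0_n y n \<beta>)) \<longlonglongrightarrow> clip (inflow0 y \<beta>)"
    using inflow0_n_lim[OF assms] by eventually_elim (rule clip_cont)
qed (use clip inflow0_n_nu inflow0_nu in \<open>auto intro!: measurable_compose[OF _ clip_measurable]\<close>)

lemma mean_clip_symmetric:
  assumes y: "y \<in> T" "y \<noteq> r" and y': "y' \<in> T" "y' \<noteq> r"
  shows "mean_clip y = mean_clip y'"
proof (rule LIMSEQ_unique)
  show "(\<lambda>k. \<integral>\<beta>. clip (inflow0_n y (k + lev y) \<beta>) \<partial>nu) \<longlonglongrightarrow> mean_clip y"
    by (rule LIMSEQ_ignore_initial_segment[OF mean_clip_lim[OF y]])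
  have "(\<integral>\<beta>. clip (inflow0_n y (k + lev y) \<beta>) \<partial>nu) = (\<integral>\<beta>. clip (inflow0_n y' (k + lev y') \<beta>) \<partial>nu)" for k
    using inflow0_n_symmetric[OF y y', of k] by (simp add: clip_integral[OF inflow0_n_nu] add.commute)
  then show "(\<lambda>k. \<integral>\<beta>. clip (inflow0_n y (k + lev y) \<beta>) \<partial>nu) \<longlonglongrightarrow> mean_clip y'"
    using LIMSEQ_ignore_initial_segment[OF mean_clip_lim[OF y'], of "lev y'"] by simp
qed

lemma mean_clip_independent:
  assumes x: "y1 \<in> ch x" "y2 \<in> ch x" "y1 \<noteq> y2"
  shows "(\<integral>\<beta>. clip (inflow0 y1 \<beta>) * clip (inflow0 y2 \<beta>) \<partial>nu) = mean_clip y1 * mean_clip y2"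
proof (rule LIMSEQ_unique)
  interpret prob_space nu by (rule nu_prob)
  note [measurable] = inflow0_n_nu inflow0_nu
  have y: "y1 \<in> T" "y1 \<noteq> r" "y2 \<in> T" "y2 \<noteq> r" using chD[OF x(1)] chD[OF x(2)] by auto
  show "(\<lambda>n. \<integral>\<beta>. clip (inflow0_n y1 n \<beta>) * clip (inflow0_n y2 n \<beta>) \<partial>nu) \<longlonglongrightarrow> (\<integral>\<beta>. clip (inflow0 y1 \<beta>) * clip (inflow0 y2 \<beta>) \<partial>nu)"
  proof (rule integral_dominated_convergence[where w="\<lambda>_. 1"])
    show "AE \<beta> in nu. (\<lambda>n. clip (inflow0_n y1 n \<beta>) * clip (inflow0_n y2 n \<beta>)) \<longlonglongrightarrow> clip (inflow0 y1 \<beta>) * clip (inflow0 y2 \<beta>)"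
      using inflow0_n_lim[OF y(1,2)] inflow0_n_lim[OF y(3,4)] by eventually_elim (intro tendsto_mult clip_cont)
    show "AE \<beta> in nu. norm (clip (inflow0_n y1 n \<beta>) * clip (inflow0_n y2 n \<beta>)) \<le> 1" for n
      using clip(1,2) by (intro AE_I2) (simp add: abs_mult mult_le_one)
  qed auto
  have "(\<integral>\<beta>. clip (inflow0_n y1 n \<beta>) * clip (inflow0_n y2 n \<beta>) \<partial>nu) = (\<integral>\<beta>. clip (inflow0_n y1 n \<beta>) \<partial>nu) * (\<integral>\<beta>. clip (inflow0_n y2 n \<beta>) \<partial>nu)" for n
  proof -
    have "(\<integral>\<beta>. clip (inflow0_n y1 n \<beta>) * clip (inflow0_n y2 n \<beta>) \<partial>nu) = enn2real (\<integral>\<^sup>+\<beta>. ennreal (clip (inflow0_n y1 n \<beta>) * clip (inflow0_n y2 n \<beta>)) \<partial>nu)"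
      using clip(1) by (intro integral_eq_nn_integral) auto
    also have "\<dots> = enn2real (\<integral>\<^sup>+\<beta>. ennreal (clip (inflow0_n y1 n \<beta>)) * ennreal (clip (inflow0_n y2 n \<beta>)) \<partial>nu)"
      using clip(1) by (simp add: ennreal_mult')
    finally show ?thesis unfolding inflow0_n_independent[OF x] by (simp add: clip_integral[OF inflow0_n_nu] enn2real_mult)
  qed
  then show "(\<lambda>n. \<integral>\<beta>. clip (inflow0_n y1 n \<beta>) * clip (inflow0_n y2 n \<beta>) \<partial>nu) \<longlonglongrightarrow> mean_clip y1 * mean_clip y2"
    using tendsto_mult[OF mean_clip_lim[OF y(1,2)] mean_clip_lim[OF y(3,4)]] by simp
qed

lemma clip_integral_zero:
  assumes [measurable]: "f \<in> borel_measurable nu" and zero: "(\<integral>\<beta>. clip (f \<beta>) \<partial>nu) = 0"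
  shows "AE \<beta> in nu. f \<beta> = 0"
proof -
  interpret prob_space nu by (rule nu_prob)
  have "integrable nu (\<lambda>\<beta>. clip (f \<beta>))" using clip by (intro integrable_const_bound[of _ 1]) auto
  then have "AE \<beta> in nu. clip (f \<beta>) = 0"
    using integral_nonneg_eq_0_iff_AE[of nu "\<lambda>\<beta>. clip (f \<beta>)"] clip(1) zero by simp
  then show ?thesis by (simp add: clip(3))
qed

text \<open>If the inflow vanished for one vertex, it would vanish for all children \<open>c\<close> of the root, by
  symmetry. Then \<open>\<psi>(c) = w a\<^sub>c \<psi>(r)\<close> and \<open>G(c, r) = w a\<^sub>c G(r, r)\<close> have the same form, but
  \<open>H \<psi> = 0\<close> and \<open>H G(\<sqdot>, r) = 1\<close> at \<open>r\<close>.\<close>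

lemma mean_clip_pos:
  assumes G: "AE \<beta> in nu. \<beta> \<in> good_set" and y: "y \<in> T" "y \<noteq> r"
  shows "0 < mean_clip y"
proof (rule ccontr)
  interpret prob_space nu by (rule nu_prob)
  assume "\<not> 0 < mean_clip y"
  moreover have "0 \<le> mean_clip y" unfolding mean_clip_def using clip(1) by simp
  ultimately have "mean_clip c = 0" if "c \<in> ch r" for c using mean_clip_symmetric[of c y] y chD[OF that] by simp
  then have "AE \<beta> in nu. inflow0 c \<beta> = 0" if "c \<in> ch r" for c
    using clip_integral_zero[OF inflow0_nu, of c] that by (simp add: mean_clip_def)
  then have "AE \<beta> in nu. \<forall>c\<in>ch r. inflow0 c \<beta> = 0"
    using ch_finite[OF root] by (simp add: AE_finite_all)
  then have "AE \<beta> in nu. False" using G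
  proof eventually_elim
    case (elim \<beta>)
    then have g: "good \<beta>" by (simp add: good_set_def)
    note cv = good_conv[OF g]
    have b0: "ps \<beta> c = w * green c \<beta> * ps \<beta> r" if "c \<in> ch r" for c
      using inflow_eq[OF cv, of c] chD[OF that] elim(1) that M_eq(2)[OF cv, of c \<beta>] by auto
    have g0: "Gh \<beta> c r = w * green c \<beta> * Gh \<beta> r r" if "c \<in> ch r" for c
      using Gh_green[OF cv, of c] chD[OF that] by auto
    have "2 * \<beta> r * ps \<beta> r = w * (\<Sum>c\<in>ch r. w * green c \<beta> * ps \<beta> r)"
      using ps_Hop[OF cv root] b0 by (simp add: Hop_eq nbr_root)
    then have "(2 * \<beta> r - w * (\<Sum>c\<in>ch r. w * green c \<beta>)) * ps \<beta> r = 0"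
      by (simp add: algebra_simps sum_distrib_left)
    then have z: "2 * \<beta> r - w * (\<Sum>c\<in>ch r. w * green c \<beta>) = 0" using ps_pos[OF g root] by simp
    have "2 * \<beta> r * Gh \<beta> r r - w * (\<Sum>c\<in>ch r. w * green c \<beta> * Gh \<beta> r r) = 1"
      using Gh_Hop[OF cv root root] g0 by (simp add: Hop_eq nbr_root)
    then have "(2 * \<beta> r - w * (\<Sum>c\<in>ch r. w * green c \<beta>)) * Gh \<beta> r r = 1"
      by (simp add: algebra_simps sum_distrib_left)
    then show False using z by simp
  qed
  then show False by simp
qed

lemma not_AE_one_branch:
  assumes G: "AE \<beta> in nu. \<beta> \<in> good_set" and x: "y1 \<in> ch x" "y2 \<in> ch x" "y1 \<noteq> y2"
  shows "\<not> (AE \<beta> in nu. inflow y1 \<beta> * inflow y2 \<beta> = 0)"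
proof
  assume h: "AE \<beta> in nu. inflow y1 \<beta> * inflow y2 \<beta> = 0"
  have "AE \<beta> in nu. clip (inflow0 y1 \<beta>) * clip (inflow0 y2 \<beta>) = 0"
    using h AE_conv
  proof eventually_elim
    case (elim \<beta>)
    then show ?case using M_eq(2)[OF elim(2), of y1 \<beta>] M_eq(2)[OF elim(2), of y2 \<beta>] clip(3) by auto
  qed
  then have "(\<integral>\<beta>. clip (inflow0 y1 \<beta>) * clip (inflow0 y2 \<beta>) \<partial>nu) = 0" by (rule integral_eq_zero_AE)
  then show False unfolding mean_clip_independent[OF x] using mean_clip_pos[OF G, of y1] mean_clip_pos[OF G, of y2] chD[OF x(1)] chD[OF x(2)] by auto
qed

section \<open>The distinguishing event\<close>

text \<open>The potential reconstructed from the jump rates, up to its value at the source \<open>i0\<close>.\<close>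

definition rate_sum :: "('v \<times> 'v \<Rightarrow> real) \<Rightarrow> 'v \<Rightarrow> real" where
  "rate_sum J i = (\<Sum>j\<in>nbr i. J (i, j))"

text \<open>With \<open>J (x, y) = w h(y) / (2 h(x))\<close>, the expression \<open>J (x, y) - w\<^sup>2 / 2 a\<^sub>y\<close> is
  \<open>w / (2 h(x))\<close> times the inflow \<open>h(y) - w a\<^sub>y h(x)\<close> of \<open>h\<close>. The event is that the inflows of
  \<open>h\<close> at \<open>y1\<close> and \<open>y2\<close> are not in the ratio of the inflows of \<open>\<psi>\<close>.\<close>

definition mismatch :: "'v \<Rightarrow> 'v \<Rightarrow> 'v \<Rightarrow> ('v \<times> 'v \<Rightarrow> real) set" where
  "mismatch x y1 y2 = {J \<in> space (PiM (dir_edges E) (\<lambda>_. borel)).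
     inflow0 y2 (rate_sum J) * (J (x, y1) - w\<^sup>2 / 2 * green0 y1 (rate_sum J)) \<noteq> inflow0 y1 (rate_sum J) * (J (x, y2) - w\<^sup>2 / 2 * green0 y2 (rate_sum J))}"

lemma mismatch_sets:
  assumes "y1 \<in> ch x" "y2 \<in> ch x"
  shows "mismatch x y1 y2 \<in> sets (PiM (dir_edges E) (\<lambda>_. borel))"
proof -
  have [measurable]: "(\<lambda>J. J e) \<in> borel_measurable (PiM (dir_edges E) (\<lambda>_. borel :: real measure))" if "e \<in> dir_edges E" for e
    using that by (rule measurable_component_singleton)
  have p: "(\<lambda>J. rate_sum J i) \<in> borel_measurable (PiM (dir_edges E) (\<lambda>_. borel))" for i
    unfolding rate_sum_def by (intro borel_measurable_sum) (simp add: dir_edges_def)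
  note [measurable] = green0_bM_measurable[of rate_sum, OF p]
  have [measurable]: "(x, y1) \<in> dir_edges E" "(x, y2) \<in> dir_edges E"
    using chD[OF assms(1)] chD[OF assms(2)] by (auto simp: dir_edges_def)
  have "(\<lambda>J. inflow0 y2 (rate_sum J) * (J (x, y1) - w\<^sup>2 / 2 * green0 y1 (rate_sum J))) \<in> borel_measurable (PiM (dir_edges E) (\<lambda>_. borel))"
    "(\<lambda>J. inflow0 y1 (rate_sum J) * (J (x, y2) - w\<^sup>2 / 2 * green0 y2 (rate_sum J))) \<in> borel_measurable (PiM (dir_edges E) (\<lambda>_. borel))"
    by measurable
  from borel_measurable_neq[OF this] show ?thesis unfolding mismatch_def .
qed

lemma mismatch_iff:
  assumes z: "good_pair m z" and i0: "i0 \<in> T" and y: "y1 \<in> ch x" "y2 \<in> ch x" and i: "i0 \<notin> sub y1" "i0 \<notin> sub y2"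
  shows "jump_rates T E r w m i0 z \<in> mismatch x y1 y2 \<longleftrightarrow>
    inflow y2 (fst z) * (Gfrom m i0 z y1 - w * green y1 (fst z) * Gfrom m i0 z x) \<noteq>
    inflow y1 (fst z) * (Gfrom m i0 z y2 - w * green y2 (fst z) * Gfrom m i0 z x)"
proof -
  let ?J = "jump_rates T E r w m i0 z" and ?b = "fst z" and ?h = "Gfrom m i0 z"
  have g: "good ?b" using z by (auto simp: good_pair_def good_set_def)
  have sp: "?J \<in> space (PiM (dir_edges E) (\<lambda>_. borel))"
    by (auto simp: space_PiM jump_rates_def case_prod_beta)
  have M: "green0 y (rate_sum ?J) = green y ?b \<and> inflow0 y (rate_sum ?J) = inflow y ?b" if "y \<in> ch x" "i0 \<notin> sub y" for y
  proof -
    have "rate_sum ?J i = ?b i" if "i \<in> sub y" for i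
      unfolding rate_sum_def using that \<open>i0 \<notin> sub y\<close> sub_T[of i y] by (intro jump_rates_sum[OF z i0]) auto
    from M_eq[OF good_conv[OF g] this] show ?thesis by simp
  qed
  have hx: "0 < ?h x" using Gfrom_pos[OF z i0] chD[OF y(1)] by blast
  have J: "?J (x, y) - w\<^sup>2 / 2 * green y ?b = w / (2 * ?h x) * (?h y - w * green y ?b * ?h x)" if "y \<in> ch x" for y
    using jump_rates_eq[of x y m i0 z] chD[OF that] hx by (simp add: dir_edges_def field_simps power2_eq_square)
  have "?J \<in> mismatch x y1 y2 \<longleftrightarrow> inflow y2 ?b * (w / (2 * ?h x) * (?h y1 - w * green y1 ?b * ?h x)) \<noteq> inflow y1 ?b * (w / (2 * ?h x) * (?h y2 - w * green y2 ?b * ?h x))"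
    using sp M[OF y(1) i(1)] M[OF y(2) i(2)] J[OF y(1)] J[OF y(2)] by (simp add: mismatch_def)
  also have "\<dots> \<longleftrightarrow> (w / (2 * ?h x)) * (inflow y2 ?b * (?h y1 - w * green y1 ?b * ?h x)) \<noteq> (w / (2 * ?h x)) * (inflow y1 ?b * (?h y2 - w * green y2 ?b * ?h x))"
    by (simp only: mult.left_commute)
  also have "\<dots> \<longleftrightarrow> inflow y2 ?b * (?h y1 - w * green y1 ?b * ?h x) \<noteq> inflow y1 ?b * (?h y2 - w * green y2 ?b * ?h x)"
    using w_pos hx by (subst mult_cancel_left) simp
  finally show ?thesis .
qed

text \<open>The inflow at \<open>y\<close> of the exit mass of \<open>v\<close>.\<close>

definition own_exit :: "('v \<Rightarrow> real) \<Rightarrow> 'v \<Rightarrow> 'v \<Rightarrow> real" where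
  "own_exit \<beta> v y = exit_mass \<beta> v y - w * green y \<beta> * exit_mass \<beta> v (par y)"

lemma own_exit_zero: "good \<beta> \<Longrightarrow> y \<in> T \<Longrightarrow> y \<noteq> r \<Longrightarrow> v \<in> T \<Longrightarrow> sub v \<inter> sub y = {} \<Longrightarrow> own_exit \<beta> v y = 0"
  using exit_mass_subtree[of \<beta> y v] by (simp add: own_exit_def)

lemma own_exit_sum: "good \<beta> \<Longrightarrow> y \<in> T \<Longrightarrow> y \<noteq> r \<Longrightarrow> (\<Sum>v\<in>Lv m. own_exit \<beta> v y) = inflow y \<beta>"
  unfolding own_exit_def using exit_mass_total[of \<beta>] par_T[of y] inflow_eq[OF good_conv, of \<beta> y]
  by (simp add: sum_subtractf sum_distrib_left[symmetric])

text \<open>Among the vertices of level \<open>m\<close>, only \<open>x\<close> has ends below \<open>y\<close>; it carries the whole inflow,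
  and the boundary value at \<open>x\<close> is the same for all children of \<open>x\<close>.\<close>

lemma level_identity:
  assumes z: "good_pair m z" and i0: "i0 \<in> T" and x: "x \<in> Lv m" and y: "y \<in> ch x" "i0 \<notin> sub y"
  shows "Gfrom m i0 z y - w * green y (fst z) * Gfrom m i0 z x = inflow y (fst z) * bdry m i0 z x"
proof -
  have g: "good (fst z)" using z by (auto simp: good_pair_def good_set_def)
  note c = chD[OF y(1)]
  have y': "y \<in> T" "y \<noteq> r" using c by auto
  have zero: "own_exit (fst z) v y = 0" if "v \<in> Lv m" "v \<noteq> x" for v
  proof (rule own_exit_zero[OF g y'])
    show "v \<in> T" using that by (simp add: level_iff)
    have "sub v \<inter> sub x = {}" using that x by (intro sub_disjoint) (auto simp: level_iff)
    then show "sub v \<inter> sub y = {}" using sub_trans[OF ch_sub[OF y(1)]] by blast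
  qed
  have "Gfrom m i0 z y - w * green y (fst z) * Gfrom m i0 z (par y) = (\<Sum>v\<in>Lv m. own_exit (fst z) v y * bdry m i0 z v)"
    unfolding own_exit_def by (rule Gfrom_branch[OF g i0 y' y(2)])
  also have "\<dots> = own_exit (fst z) x y * bdry m i0 z x"
    using sum.remove[OF level_finite x, of "\<lambda>v. own_exit (fst z) v y * bdry m i0 z v"] zero by simp
  also have "own_exit (fst z) x y = inflow y (fst z)"
    using sum.remove[OF level_finite x, of "\<lambda>v. own_exit (fst z) v y"] zero own_exit_sum[OF g y', of m] by simp
  finally show ?thesis using c by simp
qed

text \<open>At most one child of each vertex has \<open>i0\<close> in its subtree. For \<open>m = 0\<close> the root has at
  least two other children; for \<open>m > 0\<close> take any vertex of level \<open>m\<close> below a child of the root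
  whose subtree avoids \<open>i0\<close>.\<close>

lemma choose_branches:
  assumes i0: "i0 \<in> T"
  shows "\<exists>x\<in>Lv m. \<exists>y1\<in>ch x. \<exists>y2\<in>ch x. y1 \<noteq> y2 \<and> i0 \<notin> sub y1 \<and> i0 \<notin> sub y2"
proof -
  have two: "\<exists>a\<in>S. \<exists>b\<in>S. a \<noteq> b" if "finite S" "2 \<le> card S" for S :: "'v set"
    using that card_le_Suc0_iff_eq[of S] by auto
  let ?S = "{y \<in> ch r. i0 \<notin> sub y}"
  have "card (ch r - ?S) \<le> Suc 0"
  proof (subst card_le_Suc0_iff_eq)
    show "finite (ch r - ?S)" using ch_finite[OF root] by simp
    show "\<forall>a\<in>ch r - ?S. \<forall>b\<in>ch r - ?S. a = b"
    proof (intro ballI)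
      fix a b assume ab: "a \<in> ch r - ?S" "b \<in> ch r - ?S"
      then have "i0 \<in> sub a \<inter> sub b" by auto
      then show "a = b" using sub_disjoint[of a b] chD[of a r] chD[of b r] ab by auto
    qed
  qed
  moreover have "card (ch r) = card ?S + card (ch r - ?S)"
  proof -
    have "ch r = ?S \<union> (ch r - ?S)" by auto
    then show ?thesis using card_Un_disjoint[of ?S "ch r - ?S"] ch_finite[OF root] by auto
  qed
  ultimately have S2: "2 \<le> card ?S" using card_ch[OF root] d3 by simp
  have Sf: "finite ?S" using ch_finite[OF root] by simp
  show ?thesis
  proof (cases "m = 0")
    case True
    obtain a b where "a \<in> ?S" "b \<in> ?S" "a \<noteq> b" using two[OF Sf S2] by blast
    moreover have "r \<in> Lv m" using True root by (simp add: level_iff)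
    ultimately show ?thesis by blast
  next
    case False
    obtain c where c: "c \<in> ch r" "i0 \<notin> sub c" using two[OF Sf S2] by blast
    have "lev c \<le> m" using chD[OF c(1)] False by simp
    then obtain x where x: "x \<in> sub c" "lev x = m" using descendant_at_level[of c m] chD[OF c(1)] by blast
    have xT: "x \<in> T" using sub_T[OF x(1)] by simp
    obtain a b where ab: "a \<in> ch x" "b \<in> ch x" "a \<noteq> b" using two[OF ch_finite[OF xT] card_ch_ge[OF xT]] by blast
    have "i0 \<notin> sub y" if "y \<in> ch x" for y using sub_trans[OF sub_ch[OF x(1) that]] c(2) by blast
    moreover have "x \<in> Lv m" using x xT by (simp add: level_iff)
    ultimately show ?thesis using ab by blast
  qed
qed

text \<open>The event \<open>mismatch\<close> is null for level \<open>m\<close>. If it were null for level \<open>m'\<close>, then for almost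
  every \<open>\<beta>\<close> the difference of the two sides, a bilinear form of the inverse with coefficients
  \<open>exit_mass v i0\<close> on the left and \<open>l v\<close> on the right, would vanish for almost every \<open>\<rho>\<close>.\<close>

lemma laws_differ:
  assumes pos: "AE \<beta> in nu. \<forall>i\<in>T. 0 < ps \<beta> i" and m: "m < m'" and i0: "i0 \<in> T"
  shows "jump_rates_law T E r w m i0 \<noteq> jump_rates_law T E r w m' i0"
proof
  assume eq: "jump_rates_law T E r w m i0 = jump_rates_law T E r w m' i0"
  note G = AE_good_set[OF pos]
  obtain x y1 y2 where x: "x \<in> Lv m" and y: "y1 \<in> ch x" "y2 \<in> ch x" "y1 \<noteq> y2"
    and i: "i0 \<notin> sub y1" "i0 \<notin> sub y2" using choose_branches[OF i0, of m] by blast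
  note c1 = chD[OF y(1)] and c2 = chD[OF y(2)]
  have yT: "y1 \<in> T" "y1 \<noteq> r" "y2 \<in> T" "y2 \<noteq> r" using c1 c2 by auto
  have ly: "lev y1 \<le> m'" "lev y2 \<le> m'" using c1 c2 x m by (auto simp: level_iff)
  note BS = mismatch_sets[OF y(1,2)]
  have "AE z in nu_joint T E r w m. jump_rates T E r w m i0 z \<notin> mismatch x y1 y2"
    unfolding AE_joint[OF G]
  proof (rule AE_I2, rule impI)
    fix z assume z: "good_pair m z"
    show "jump_rates T E r w m i0 z \<notin> mismatch x y1 y2"
      unfolding mismatch_iff[OF z i0 y(1,2) i] level_identity[OF z i0 x y(1) i(1)] level_identity[OF z i0 x y(2) i(2)] by simp
  qed
  then have "mismatch x y1 y2 \<in> null_sets (jump_rates_law T E r w m' i0)"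
    unfolding eq[symmetric] law_null_iff[OF G i0 BS] .
  then have "AE z in nu_joint T E r w m'. jump_rates T E r w m' i0 z \<notin> mismatch x y1 y2"
    unfolding law_null_iff[OF G i0 BS] .
  then have AEp: "AE z in nu \<Otimes>\<^sub>M PLv m'. good_pair m' z \<longrightarrow> jump_rates T E r w m' i0 z \<notin> mismatch x y1 y2"
    unfolding AE_joint[OF G] .
  interpret nu: prob_space nu by (rule nu_prob)
  interpret product_sigma_finite "\<lambda>_::'v. lborel :: real measure" by unfold_locales
  interpret PL: sigma_finite_measure "PLv m'" by (rule sigma_finite[OF level_finite])
  interpret PP: pair_sigma_finite nu "PLv m'" by unfold_locales
  have "AE \<beta> in nu. AE \<rho> in PLv m'. good_pair m' (\<beta>, \<rho>) \<longrightarrow> jump_rates T E r w m' i0 (\<beta>, \<rho>) \<notin> mismatch x y1 y2"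
    by (rule PP.AE_pair[OF AEp])
  then have "AE \<beta> in nu. inflow y1 \<beta> * inflow y2 \<beta> = 0" using G
  proof eventually_elim
    case (elim \<beta>)
    have g: "good \<beta>" using elim(2) by (simp add: good_set_def)
    define l where "l v = inflow y2 \<beta> * own_exit \<beta> v y1 - inflow y1 \<beta> * own_exit \<beta> v y2" for v
    have lin: "AE \<rho> in PLv m'. posdef_on (Lv m') (Hmat (Cc \<beta>) \<rho>) \<longrightarrow>
      (\<Sum>u\<in>Lv m'. \<Sum>v\<in>Lv m'. exit_mass \<beta> u i0 * inv_on (Lv m') (Hmat (Cc \<beta>) \<rho>) u v * l v) = 0"
      using elim(1) AE_space
    proof eventually_elim
      case el: (elim \<rho>)
      show ?case
      proof
        assume p: "posdef_on (Lv m') (Hmat (Cc \<beta>) \<rho>)"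
        then have z: "good_pair m' (\<beta>, \<rho>)" using elim(2) el(2) by (simp add: good_pair_def)
        let ?z = "(\<beta>, \<rho>)"
        have px: "par y1 = x" "par y2 = x" using c1 c2 by auto
        have g': "good (fst ?z)" using g by simp
        have b1: "Gfrom m' i0 ?z y1 - w * green y1 \<beta> * Gfrom m' i0 ?z x = (\<Sum>v\<in>Lv m'. own_exit \<beta> v y1 * bdry m' i0 ?z v)"
          using Gfrom_branch[OF g' i0 yT(1,2) i(1)] px by (simp add: own_exit_def)
        have b2: "Gfrom m' i0 ?z y2 - w * green y2 \<beta> * Gfrom m' i0 ?z x = (\<Sum>v\<in>Lv m'. own_exit \<beta> v y2 * bdry m' i0 ?z v)"
          using Gfrom_branch[OF g' i0 yT(3,4) i(2)] px by (simp add: own_exit_def)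
        have "inflow y2 \<beta> * (\<Sum>v\<in>Lv m'. own_exit \<beta> v y1 * bdry m' i0 ?z v) = inflow y1 \<beta> * (\<Sum>v\<in>Lv m'. own_exit \<beta> v y2 * bdry m' i0 ?z v)"
          using el(1) z mismatch_iff[OF z i0 y(1,2) i] b1 b2 by simp
        then have "(\<Sum>v\<in>Lv m'. l v * bdry m' i0 ?z v) = 0"
          by (simp add: l_def left_diff_distrib sum_subtractf sum_distrib_left mult.assoc)
        moreover have "(\<Sum>v\<in>Lv m'. l v * bdry m' i0 ?z v)
          = (\<Sum>u\<in>Lv m'. \<Sum>v\<in>Lv m'. exit_mass \<beta> u i0 * inv_on (Lv m') (Hmat (Cc \<beta>) \<rho>) u v * l v)"
          by (subst sum.swap) (simp add: bdry_def sum_distrib_left mult_ac)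
        ultimately show "(\<Sum>u\<in>Lv m'. \<Sum>v\<in>Lv m'. exit_mass \<beta> u i0 * inv_on (Lv m') (Hmat (Cc \<beta>) \<rho>) u v * l v) = 0" by simp
      qed
    qed
    have fl: "exit_mass \<beta> v i0 * l v = 0" if "v \<in> Lv m'" for v
      by (rule bilinear_inverse_vanishes[OF level_finite Cc_weights[OF g level_T] lin that])
    show ?case
    proof (cases "inflow y1 \<beta> = 0")
      case False
      then have "(\<Sum>v\<in>Lv m'. own_exit \<beta> v y1) \<noteq> 0" using own_exit_sum[OF g yT(1,2), of m'] by simp
      \<comment> \<open>Some boundary point \<open>v\<close> has inflow at \<open>y1\<close>. It lies below \<open>y1\<close>, hence not below \<open>y2\<close>, and
      \<open>l v\<close> is reduced to its first term.\<close>
      then obtain v where v: "v \<in> Lv m'" "own_exit \<beta> v y1 \<noteq> 0" by (rule sum.not_neutral_contains_not_neutral)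
      have vT: "v \<in> T" "lev v = m'" using v(1) by (auto simp: level_iff)
      have vy: "v \<in> sub y1"
      proof (rule ccontr)
        assume n: "v \<notin> sub y1"
        have "sub v \<inter> sub y1 = {}"
        proof (rule ccontr)
          assume "sub v \<inter> sub y1 \<noteq> {}"
          then obtain t where "t \<in> sub y1" "t \<in> sub v" by blast
          then show False using sub_comparable[of t y1 v] ly(1) vT(2) n by simp
        qed
        then show False using own_exit_zero[OF g yT(1,2) vT(1)] v(2) by simp
      qed
      have "sub y1 \<inter> sub y2 = {}" using c1 c2 y(3) by (intro sub_disjoint) auto
      then have "sub v \<inter> sub y2 = {}" using sub_trans[OF vy] by blast
      then have "own_exit \<beta> v y2 = 0" by (rule own_exit_zero[OF g yT(3,4) vT(1)])
      moreover have "exit_mass \<beta> v i0 \<noteq> 0"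
      proof
        assume f0: "exit_mass \<beta> v i0 = 0"
        have "exit_mass \<beta> v u = 0" if "u \<in> T" for u
          by (rule zero_propagates[of \<beta> "exit_mass \<beta> v", OF dm[OF good_conv[OF g]] _ _ i0 f0 that])
            (auto simp: exit_mass_nonneg[OF g] exit_mass_Hop[OF g vT(1)])
        then show False using v(2) yT par_T[OF yT(1,2)] by (simp add: own_exit_def)
      qed
      ultimately have "inflow y2 \<beta> * own_exit \<beta> v y1 = 0" using fl[OF v(1)] by (simp add: l_def)
      then show ?thesis using v(2) by simp
    qed simp
  qed
  then show False using not_AE_one_branch[OF G y] by blast
qed

end

theorem proposition2p8:
  fixes T :: "'v set" and E :: "'v set set" and r :: 'v and w :: real and d :: nat
  assumes "is_tree T E" and "r \<in> T" and "3 \<le> d" and "regular T E d"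
    and "0 < w"
    and "AE \<beta> in nu_inf T (edge_weight E w). \<forall>i\<in>T. 0 < psi T E r w \<beta> i"
  shows "\<forall>m m'. m \<noteq> m' \<longrightarrow>
           (\<forall>i0\<in>T. jump_rates_law T E r w m i0 \<noteq> jump_rates_law T E r w m' i0)"
proof -
  interpret wtree T E r d w using assms(1-5) by unfold_locales
  show ?thesis
  proof (intro allI impI ballI)
    fix m m' :: nat and i0 assume ne: "m \<noteq> m'" and i0: "i0 \<in> T"
    show "jump_rates_law T E r w m i0 \<noteq> jump_rates_law T E r w m' i0"
    proof (cases "m < m'")
      case True
      then show ?thesis by (rule laws_differ[OF assms(6) _ i0])
    next
      case False
      then have "m' < m" using ne by simp
      from laws_differ[OF assms(6) this i0] show ?thesis by (rule not_sym)
    qed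
  qed
qed

end
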